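(* Let $M$ be a filtered manifold equipped with a Riemannian metric $g_{TM}$. Let $d_0:=\Phi^{-1}\circ d_{\mathfrak gM}\circ\Phi$ and $\delta_0:=d_0^t$. Let $\Pi:=(\mathrm I-b)^{-1}d_0^{-1}d+d(\mathrm I-b)^{-1}d_0^{-1}$ with $b:=d_0^{-1}d_0-d_0^{-1}d$, and let $P:=\frac1{2\pi i}\oint_{|z|=\varepsilon}(z-\Box)^{-1}dz$ with $\Box=dd_0^t+d_0^td$. Then the projections $\Pi$ and $P$ coincide.
   Context: **Filtered manifold.** $M$ is a smooth $n$-dimensional manifold with a filtration of $TM$ by vector subbundles $M\times\{0\}=H^0\subseteq H^1\subseteq\dots\subseteq H^s=TM$ such that $[\Gamma(H^i),\Gamma(H^j)]\subseteq\Gamma(H^{i+j})$ (with $H^i=TM$ for $i>s$); $g_{TM}$ is a Riemannian metric; $d$ is the de Rham differential. **Graded bundles.** $\mathrm{gr}(TM)=\oplus_i H^i/H^{i-1}$, and $\mathrm{gr}(T^*M)=\oplus_{i=1}^s (H^{i-1})^\perp/(H^i)^\perp\cong\mathrm{gr}(TM)^*$ where $(H^i)^\perp\subset T^*M$ is the annihilator of $H^i$. Let $G^i$ be the $g_{TM}$-orthogonal complement of $H^{i-1}$ in $H^i$, so $TM=\oplus_i G^i$. The isomorphisms $G^i\cong H^i/H^{i-1}$ give an isomorphism $TM\cong\mathrm{gr}(TM)$, hence by duality an isomorphism $T^*M\cong\mathrm{gr}(T^*M)$, extended multiplicatively to an isomorphism of $C^\infty(M)$-modules $\Phi:\Omega^\bullet(M)\to\Gamma(\wedge^\bullet\mathrm{gr}(T^*M))$.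 The metric on $\mathrm{gr}(TM)$ is the one making $TM\cong \mathrm{gr}(TM)$ isometric; it induces a metric on $\wedge^\bullet \mathrm{gr}(T^*M)$ (different degrees orthogonal, determinant formula), and similarly for $\wedge^\bullet T^*M$. **Osculating objects.** The Lie bracket of vector fields induces a Lie bracket on each $\mathrm{gr}(T_xM)$, giving a graded nilpotent Lie algebra $\mathfrak g_xM$. $d_{\mathfrak gM}$ is the map on $\Gamma(\wedge^\bullet\mathrm{gr}(T^*M))$ equal at each $x$ to the Chevalley–Eilenberg differential of $\mathfrak g_xM$: $d_{\mathfrak g_xM}\alpha(V_0,\dots,V_k)=\sum_{i<j}(-1)^{i+j}\alpha([V_i,V_j],V_0,\dots,\hat V_i,\dots,\hat V_j,\dots,V_k)$ (zero in degree $0$). $d^t_{\mathfrak gM}$ is the pointwise transpose. The partial inverse $d_{\mathfrak gM}^{-1}$ is defined pointwise as the orthogonal projection onto $\mathrm{Im}\,d_{\mathfrak g_xM}$ followed by the inverse of the bijection $d_{\mathfrak g_xM}:(\ker d_{\mathfrak g_xM})^{\perp}\to\mathrm{Im}\,d_{\mathfrak g_xM}$. **Operators on $\Omega^\bullet(M)$.** $d_0=\Phi^{-1}d_{\mathfrak gM}\Phi$, $d_0^{-1}:=\Phi^{-1}d_{\mathfrak gM}^{-1}\Phi$ (a partial inverse), and $d_0^t=\Phi^{-1}d_{\mathfrak gM}^t\Phi$ is the pointwise transpose of $d_0$. The operator $b$ is nilpotent, so $(\mathrm I-b)^{-1}$ is a well-defined differential operator. In the definition of $P$, $\varepsilon>0$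 is taken small enough.
   Formalization: As written Π = P fails: on functions Π is 0 and P is the identity. Proved instead: P = I − Π, on each open set where ε is small enough (such sets cover M), assuming that d_0^{-1} maps smooth forms to smooth forms, so that Π is defined; dim M ≥ 1. *)

theory Defs
  imports
    "HOL-Complex_Analysis.Complex_Analysis"
    "Jordan_Normal_Form.Determinant"
begin

section \<open>Smooth functions on open subsets of a Euclidean space\<close>

primrec Ck_on :: "nat \<Rightarrow> 'a::euclidean_space set \<Rightarrow> ('a \<Rightarrow> 'b::real_normed_vector) \<Rightarrow> bool" where
  "Ck_on 0 S f \<longleftrightarrow> continuous_on S f"
| "Ck_on (Suc k) S f \<longleftrightarrow>
     (\<forall>x\<in>S. f differentiable (at x)) \<and> (\<forall>v. Ck_on k S (\<lambda>x. frechet_derivative f (at x) v))"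

definition smooth_on :: "'a::euclidean_space set \<Rightarrow> ('a \<Rightarrow> 'b::real_normed_vector) \<Rightarrow> bool" where
  "smooth_on S f \<longleftrightarrow> (\<forall>k. Ck_on k S f)"


section \<open>Filtered Riemannian manifolds\<close>

text \<open>
  The manifold is the whole type \<open>'m\<close>; \<open>'e\<close> is the model space, so that the dimension is
  \<open>DIM('e)\<close>. A chart is a pair \<open>(U, \<phi>)\<close> of a domain and a coordinate map, which is
  meaningful on the domain only.

  Every tangent space \<open>T\<^sub>pM\<close> is identified with \<open>'e\<close>: the vector \<open>v :: 'e\<close> stands for the
  tangent vector at \<open>p\<close> whose components in the reference chart \<open>chart_at M p\<close> are \<open>v\<close>.
  Thus vector fields are functions \<open>'m \<Rightarrow> 'e\<close> and a Riemannian metric has type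
  \<open>'m \<Rightarrow> 'e \<Rightarrow> 'e \<Rightarrow> real\<close>. The reference chart varies with \<open>p\<close> without any
  continuity, so smoothness always has to be expressed in a chart of the atlas,
  through \<open>tang_to\<close> and \<open>tang_from\<close>.
\<close>

type_synonym ('m, 'e) chart = "'m set \<times> ('m \<Rightarrow> 'e)"

record ('m, 'e) filtered_space =
  atlas :: "('m, 'e) chart set"
  depth :: nat
  filt :: "nat \<Rightarrow> 'm \<Rightarrow> 'e set"
  gTM :: "'m \<Rightarrow> 'e \<Rightarrow> 'e \<Rightarrow> real"

definition chart_inv :: "('m, 'e) chart \<Rightarrow> 'e \<Rightarrow> 'm" where
  "chart_inv c = inv_into (fst c) (snd c)"

definition smooth_atlas ::
  "('m::{t2_space, second_countable_topology}, 'e::euclidean_space) chart set \<Rightarrow> bool" where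
  "smooth_atlas A \<longleftrightarrow>
     (\<forall>(U, \<phi>)\<in>A. open U \<and> open (\<phi> ` U) \<and> homeomorphism U (\<phi> ` U) \<phi> (chart_inv (U, \<phi>))) \<and>
     (\<Union>(fst ` A)) = UNIV \<and>
     (\<forall>(U, \<phi>)\<in>A. \<forall>(V, \<psi>)\<in>A. smooth_on (\<phi> ` (U \<inter> V)) (\<psi> \<circ> chart_inv (U, \<phi>)))"

definition chart_at :: "('m, 'e) filtered_space \<Rightarrow> 'm \<Rightarrow> ('m, 'e) chart" where
  "chart_at M p = (SOME c. c \<in> atlas M \<and> p \<in> fst c)"

text \<open>\<open>tang_to M c p v\<close>: the components in the chart \<open>c\<close> of \<open>v \<in> T\<^sub>pM\<close>;
  \<open>tang_from M c p\<close> is the inverse map.\<close>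

definition tang_to ::
  "('m, 'e::euclidean_space) filtered_space \<Rightarrow> ('m, 'e) chart \<Rightarrow> 'm \<Rightarrow> 'e \<Rightarrow> 'e" where
  "tang_to M c p =
     frechet_derivative (snd c \<circ> chart_inv (chart_at M p)) (at (snd (chart_at M p) p))"

definition tang_from ::
  "('m, 'e::euclidean_space) filtered_space \<Rightarrow> ('m, 'e) chart \<Rightarrow> 'm \<Rightarrow> 'e \<Rightarrow> 'e" where
  "tang_from M c p = frechet_derivative (snd (chart_at M p) \<circ> chart_inv c) (at (snd c p))"

definition vf_rep ::
  "('m, 'e::euclidean_space) filtered_space \<Rightarrow> ('m, 'e) chart \<Rightarrow> ('m \<Rightarrow> 'e) \<Rightarrow> 'e \<Rightarrow> 'e" where
  "vf_rep M c X y = tang_to M c (chart_inv c y) (X (chart_inv c y))"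

definition smooth_vf_on ::
  "('m, 'e::euclidean_space) filtered_space \<Rightarrow> 'm set \<Rightarrow> ('m \<Rightarrow> 'e) \<Rightarrow> bool" where
  "smooth_vf_on M W X \<longleftrightarrow> (\<forall>c\<in>atlas M. smooth_on (snd c ` (fst c \<inter> W)) (vf_rep M c X))"

text \<open>The Lie bracket, by its usual coordinate formula evaluated in the reference chart of the
  point, in which the components of \<open>X x\<close> and \<open>Y x\<close> are these vectors themselves.\<close>

definition lie_bracket ::
  "('m, 'e::euclidean_space) filtered_space \<Rightarrow> ('m \<Rightarrow> 'e) \<Rightarrow> ('m \<Rightarrow> 'e) \<Rightarrow> 'm \<Rightarrow> 'e" where
  "lie_bracket M X Y x =
     (let c = chart_at M x; y = snd c x in
        frechet_derivative (vf_rep M c Y) (at y) (X x)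
      - frechet_derivative (vf_rep M c X) (at y) (Y x))"

definition vector_subbundle ::
  "('m::topological_space, 'e::euclidean_space) filtered_space \<Rightarrow> ('m \<Rightarrow> 'e set) \<Rightarrow> bool" where
  "vector_subbundle M E \<longleftrightarrow>
     (\<forall>p. \<exists>W (r::nat) X. open W \<and> p \<in> W \<and> (\<forall>j<r. smooth_vf_on M W (X j)) \<and>
        (\<forall>q\<in>W. inj_on (\<lambda>j. X j q) {..<r} \<and> independent ((\<lambda>j. X j q) ` {..<r}) \<and>
               span ((\<lambda>j. X j q) ` {..<r}) = E q))"

definition sections ::
  "('m, 'e::euclidean_space) filtered_space \<Rightarrow> ('m \<Rightarrow> 'e set) \<Rightarrow> ('m \<Rightarrow> 'e) set" where
  "sections M E = {X. smooth_vf_on M UNIV X \<and> (\<forall>p. X p \<in> E p)}"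

definition riemannian_metric :: "('m, 'e::euclidean_space) filtered_space \<Rightarrow> bool" where
  "riemannian_metric M \<longleftrightarrow>
     (\<forall>p. bilinear (gTM M p) \<and> (\<forall>u v. gTM M p u v = gTM M p v u) \<and>
          (\<forall>v. v \<noteq> 0 \<longrightarrow> gTM M p v v > 0)) \<and>
     (\<forall>c\<in>atlas M. \<forall>u v. smooth_on (snd c ` fst c)
        (\<lambda>y. gTM M (chart_inv c y)
               (tang_from M c (chart_inv c y) u) (tang_from M c (chart_inv c y) v)))"

definition filtered_riemannian_manifold ::
  "('m::{t2_space, second_countable_topology}, 'e::euclidean_space) filtered_space \<Rightarrow> bool" where
  "filtered_riemannian_manifold M \<longleftrightarrow>
     smooth_atlas (atlas M) \<and>
     (\<forall>i. vector_subbundle M (filt M i)) \<and>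
     (\<forall>p. filt M 0 p = {0}) \<and>
     (\<forall>i j p. i \<le> j \<longrightarrow> filt M i p \<subseteq> filt M j p) \<and>
     (\<forall>i p. depth M \<le> i \<longrightarrow> filt M i p = UNIV) \<and>
     (\<forall>i j. \<forall>X\<in>sections M (filt M i). \<forall>Y\<in>sections M (filt M j).
        lie_bracket M X Y \<in> sections M (filt M (i + j))) \<and>
     riemannian_metric M"


section \<open>Exterior algebra of the dual\<close>

text \<open>
  For a real vector space with carrier \<open>V\<close>, addition \<open>ad\<close> and scalar multiplication
  \<open>sc\<close>, elements of the full exterior algebra of \<open>V\<^sup>*\<close> are functions on lists of
  vectors: the restriction to lists of length \<open>k\<close> is the homogeneous component of degree
  \<open>k\<close>, an alternating \<open>k\<close>-linear form. Components of degree above the dimension vanish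
  automatically, so this is a finite direct sum.
\<close>

definition ext_alg ::
  "'v set \<Rightarrow> ('v \<Rightarrow> 'v \<Rightarrow> 'v) \<Rightarrow> (real \<Rightarrow> 'v \<Rightarrow> 'v) \<Rightarrow> ('v list \<Rightarrow> real) set" where
  "ext_alg V ad sc = {a.
     (\<forall>vs. \<not> set vs \<subseteq> V \<longrightarrow> a vs = 0) \<and>
     (\<forall>us vs. \<forall>x\<in>V. \<forall>y\<in>V. set us \<subseteq> V \<longrightarrow> set vs \<subseteq> V \<longrightarrow>
        a (us @ ad x y # vs) = a (us @ x # vs) + a (us @ y # vs)) \<and>
     (\<forall>us vs r. \<forall>x\<in>V. set us \<subseteq> V \<longrightarrow> set vs \<subseteq> V \<longrightarrow>
        a (us @ sc r x # vs) = r * a (us @ x # vs)) \<and>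
     (\<forall>vs. set vs \<subseteq> V \<longrightarrow> \<not> distinct vs \<longrightarrow> a vs = 0)}"

text \<open>\<open>gram_wedge V g [u\<^sub>1, \<dots>, u\<^sub>k]\<close> is \<open>u\<^sub>1\<^sup>\<flat> \<and> \<dots> \<and> u\<^sub>k\<^sup>\<flat>\<close>
  with \<open>u\<^sup>\<flat> = g(u, _)\<close>; its value on \<open>k\<close> vectors is \<open>det (g(u\<^sub>i, v\<^sub>j))\<close>.\<close>

definition gram_wedge :: "'v set \<Rightarrow> ('v \<Rightarrow> 'v \<Rightarrow> real) \<Rightarrow> 'v list \<Rightarrow> 'v list \<Rightarrow> real" where
  "gram_wedge V g us vs =
     (if set vs \<subseteq> V \<and> length us = length vs
      then Determinant.det
             (Matrix.mat (length us) (length us) (\<lambda>(i, j). g (us ! i) (vs ! j)))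
      else 0)"

text \<open>
  The inner product induced by \<open>g\<close>, determined by bilinearity, orthogonality of different
  degrees and the determinant formula
  \<open>\<langle>u\<^sub>1\<^sup>\<flat> \<and> \<dots> \<and> u\<^sub>k\<^sup>\<flat>, w\<^sub>1\<^sup>\<flat> \<and> \<dots> \<and> w\<^sub>k\<^sup>\<flat>\<rangle> = det \<langle>u\<^sub>i\<^sup>\<flat>, w\<^sub>j\<^sup>\<flat>\<rangle> = det (g(u\<^sub>i, w\<^sub>j))\<close>.
  As every covector is some \<open>u\<^sup>\<flat>\<close>, the last equation of the definition covers all
  decomposable elements; its right-hand side is this determinant, and is \<open>0\<close> for lists of
  different lengths.
\<close>

definition ext_inner ::
  "'v set \<Rightarrow> ('v \<Rightarrow> 'v \<Rightarrow> 'v) \<Rightarrow> (real \<Rightarrow> 'v \<Rightarrow> 'v) \<Rightarrow> ('v \<Rightarrow> 'v \<Rightarrow> real) \<Rightarrow>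
   ('v list \<Rightarrow> real) \<Rightarrow> ('v list \<Rightarrow> real) \<Rightarrow> real" where
  "ext_inner V ad sc g = (THE B. let L = ext_alg V ad sc in
     (\<forall>a\<in>L. \<forall>b\<in>L. \<forall>c\<in>L. B (\<lambda>vs. a vs + b vs) c = B a c + B b c) \<and>
     (\<forall>a\<in>L. \<forall>b\<in>L. \<forall>c\<in>L. B c (\<lambda>vs. a vs + b vs) = B c a + B c b) \<and>
     (\<forall>r. \<forall>a\<in>L. \<forall>c\<in>L. B (\<lambda>vs. r * a vs) c = r * B a c) \<and>
     (\<forall>r. \<forall>a\<in>L. \<forall>c\<in>L. B c (\<lambda>vs. r * a vs) = r * B c a) \<and>
     (\<forall>a b. a \<notin> L \<or> b \<notin> L \<longrightarrow> B a b = 0) \<and>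
     (\<forall>us ws. set us \<subseteq> V \<longrightarrow> set ws \<subseteq> V \<longrightarrow>
        B (gram_wedge V g us) (gram_wedge V g ws) = gram_wedge V g us ws))"

text \<open>The following three notions are for a linear map \<open>T\<close> of a space \<open>L\<close> of functions to
  itself, where \<open>L\<close> carries the inner product \<open>B\<close>.\<close>

definition transpose_on ::
  "('w \<Rightarrow> real) set \<Rightarrow> (('w \<Rightarrow> real) \<Rightarrow> ('w \<Rightarrow> real) \<Rightarrow> real) \<Rightarrow>
   (('w \<Rightarrow> real) \<Rightarrow> ('w \<Rightarrow> real)) \<Rightarrow> ('w \<Rightarrow> real) \<Rightarrow> ('w \<Rightarrow> real)" where
  "transpose_on L B T b = (THE c. c \<in> L \<and> (\<forall>a\<in>L. B (T a) b = B a c))"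

definition orth_proj ::
  "('w \<Rightarrow> real) set \<Rightarrow> (('w \<Rightarrow> real) \<Rightarrow> ('w \<Rightarrow> real) \<Rightarrow> real) \<Rightarrow>
   ('w \<Rightarrow> real) \<Rightarrow> ('w \<Rightarrow> real)" where
  "orth_proj W B b = (THE p. p \<in> W \<and> (\<forall>w\<in>W. B p w = B b w))"

definition partial_inverse ::
  "('w \<Rightarrow> real) set \<Rightarrow> (('w \<Rightarrow> real) \<Rightarrow> ('w \<Rightarrow> real) \<Rightarrow> real) \<Rightarrow>
   (('w \<Rightarrow> real) \<Rightarrow> ('w \<Rightarrow> real)) \<Rightarrow> ('w \<Rightarrow> real) \<Rightarrow> ('w \<Rightarrow> real)" where
  "partial_inverse L B T b =
     (THE a. a \<in> L \<and> (\<forall>k\<in>L. T k = (\<lambda>_. 0) \<longrightarrow> B a k = 0) \<and> T a = orth_proj (T ` L) B b)"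


section \<open>The osculating Lie algebras\<close>

text \<open>
  An element of \<open>gr(T\<^sub>xM)\<close> is the family, indexed by \<open>i = 1, \<dots>, s\<close>, of its components in
  \<open>H\<^sup>i / H\<^sup>i\<^sup>-\<^sup>1\<close>, which are cosets \<open>v + H\<^sup>i\<^sup>-\<^sup>1\<close> with \<open>v \<in> H\<^sup>i\<close>.
\<close>

definition gr :: "('m, 'e::euclidean_space) filtered_space \<Rightarrow> 'm \<Rightarrow> (nat \<Rightarrow> 'e set) set" where
  "gr M x =
     (\<Pi>\<^sub>E i\<in>{1..depth M}. (\<lambda>v. (\<lambda>h. v + h) ` filt M (i - 1) x) ` filt M i x)"

definition gr_add :: "('m, 'e::euclidean_space) filtered_space \<Rightarrow> 'm \<Rightarrow>
    (nat \<Rightarrow> 'e set) \<Rightarrow> (nat \<Rightarrow> 'e set) \<Rightarrow> (nat \<Rightarrow> 'e set)" where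
  "gr_add M x w w' = (\<lambda>i\<in>{1..depth M}. {u + v | u v. u \<in> w i \<and> v \<in> w' i})"

definition gr_scale :: "('m, 'e::euclidean_space) filtered_space \<Rightarrow> 'm \<Rightarrow>
    real \<Rightarrow> (nat \<Rightarrow> 'e set) \<Rightarrow> (nat \<Rightarrow> 'e set)" where
  "gr_scale M x r w =
     (\<lambda>i\<in>{1..depth M}. {r *\<^sub>R u + h | u h. u \<in> w i \<and> h \<in> filt M (i - 1) x})"

text \<open>\<open>bracket_rep M x i j A B\<close> is a representative in \<open>H\<^sup>i\<^sup>+\<^sup>j\<close> of the bracket of
  \<open>A \<in> H\<^sup>i / H\<^sup>i\<^sup>-\<^sup>1\<close> and \<open>B \<in> H\<^sup>j / H\<^sup>j\<^sup>-\<^sup>1\<close>; it is determined modulo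
  \<open>H\<^sup>i\<^sup>+\<^sup>j\<^sup>-\<^sup>1\<close>.\<close>

definition bracket_rep :: "('m, 'e::euclidean_space) filtered_space \<Rightarrow> 'm \<Rightarrow> nat \<Rightarrow> nat \<Rightarrow>
    'e set \<Rightarrow> 'e set \<Rightarrow> 'e" where
  "bracket_rep M x i j A B =
     (SOME u. \<exists>X\<in>sections M (filt M i). \<exists>Y\<in>sections M (filt M j).
        X x \<in> A \<and> Y x \<in> B \<and> u = lie_bracket M X Y x)"

definition gr_bracket :: "('m, 'e::euclidean_space) filtered_space \<Rightarrow> 'm \<Rightarrow>
    (nat \<Rightarrow> 'e set) \<Rightarrow> (nat \<Rightarrow> 'e set) \<Rightarrow> (nat \<Rightarrow> 'e set)" where
  "gr_bracket M x w w' =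
     (\<lambda>k\<in>{1..depth M}.
        (\<lambda>h. (\<Sum>i\<in>{1..<k}. bracket_rep M x i (k - i) (w i) (w' (k - i))) + h) ` filt M (k - 1) x)"

definition orth_compl :: "('m, 'e::euclidean_space) filtered_space \<Rightarrow> nat \<Rightarrow> 'm \<Rightarrow> 'e set" where
  "orth_compl M i x = {v \<in> filt M i x. \<forall>w\<in>filt M (i - 1) x. gTM M x v w = 0}"

text \<open>The isomorphism \<open>gr(T\<^sub>xM) \<cong> T\<^sub>xM\<close>, and the metric making it isometric.\<close>

definition gr_to_T :: "('m, 'e::euclidean_space) filtered_space \<Rightarrow> 'm \<Rightarrow> (nat \<Rightarrow> 'e set) \<Rightarrow> 'e" where
  "gr_to_T M x w = (\<Sum>i\<in>{1..depth M}. (THE v. v \<in> orth_compl M i x \<and> v \<in> w i))"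

definition gr_metric :: "('m, 'e::euclidean_space) filtered_space \<Rightarrow> 'm \<Rightarrow>
    (nat \<Rightarrow> 'e set) \<Rightarrow> (nat \<Rightarrow> 'e set) \<Rightarrow> real" where
  "gr_metric M x w w' = gTM M x (gr_to_T M x w) (gr_to_T M x w')"

text \<open>The exterior algebras of \<open>T\<^sub>x\<^sup>*M\<close> and of \<open>gr(T\<^sub>x\<^sup>*M) \<cong> gr(T\<^sub>xM)\<^sup>*\<close>.\<close>

definition ext_T :: "('e::euclidean_space list \<Rightarrow> real) set" where
  "ext_T = ext_alg UNIV (+) (*\<^sub>R)"

definition ext_gr :: "('m, 'e::euclidean_space) filtered_space \<Rightarrow> 'm \<Rightarrow>
    ((nat \<Rightarrow> 'e set) list \<Rightarrow> real) set" where
  "ext_gr M x = ext_alg (gr M x) (gr_add M x) (gr_scale M x)"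

definition ext_gr_inner :: "('m, 'e::euclidean_space) filtered_space \<Rightarrow> 'm \<Rightarrow>
    ((nat \<Rightarrow> 'e set) list \<Rightarrow> real) \<Rightarrow> ((nat \<Rightarrow> 'e set) list \<Rightarrow> real) \<Rightarrow> real" where
  "ext_gr_inner M x = ext_inner (gr M x) (gr_add M x) (gr_scale M x) (gr_metric M x)"

definition chevalley_eilenberg :: "('m, 'e::euclidean_space) filtered_space \<Rightarrow> 'm \<Rightarrow>
    ((nat \<Rightarrow> 'e set) list \<Rightarrow> real) \<Rightarrow> ((nat \<Rightarrow> 'e set) list \<Rightarrow> real)" where
  "chevalley_eilenberg M x a = (\<lambda>ws.
     if set ws \<subseteq> gr M x
     then \<Sum>j<length ws. \<Sum>i<j.
            (-1) ^ (i + j) * a (gr_bracket M x (ws ! i) (ws ! j) # nths ws (- {i, j}))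
     else 0)"

definition Phi :: "('m, 'e::euclidean_space) filtered_space \<Rightarrow> 'm \<Rightarrow>
    ('e list \<Rightarrow> real) \<Rightarrow> ((nat \<Rightarrow> 'e set) list \<Rightarrow> real)" where
  "Phi M x a = (\<lambda>ws. if set ws \<subseteq> gr M x then a (map (gr_to_T M x) ws) else 0)"

definition Phi_inv :: "('m, 'e::euclidean_space) filtered_space \<Rightarrow> 'm \<Rightarrow>
    ((nat \<Rightarrow> 'e set) list \<Rightarrow> real) \<Rightarrow> ('e list \<Rightarrow> real)" where
  "Phi_inv M x = inv_into ext_T (Phi M x)"


section \<open>Differential forms and operators on them\<close>

text \<open>A (not necessarily homogeneous) form assigns to each point an element of \<open>ext_T\<close>.\<close>

type_synonym ('m, 'e) form = "'m \<Rightarrow> 'e list \<Rightarrow> real"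
type_synonym ('m, 'e) cform = "'m \<Rightarrow> 'e list \<Rightarrow> complex"

definition form_rep :: "('m, 'e::euclidean_space) filtered_space \<Rightarrow> ('m, 'e) chart \<Rightarrow>
    ('m, 'e) form \<Rightarrow> 'e \<Rightarrow> 'e list \<Rightarrow> real" where
  "form_rep M c \<omega> y us = \<omega> (chart_inv c y) (map (tang_from M c (chart_inv c y)) us)"

text \<open>Smooth forms on the open set \<open>U\<close>, set to \<open>0\<close> outside \<open>U\<close> so that they are
  determined by their values on \<open>U\<close>.\<close>

definition forms_on ::
  "('m, 'e::euclidean_space) filtered_space \<Rightarrow> 'm set \<Rightarrow> ('m, 'e) form set" where
  "forms_on M U = {\<omega>.
     (\<forall>x\<in>U. \<omega> x \<in> ext_T) \<and> (\<forall>x. x \<notin> U \<longrightarrow> \<omega> x = (\<lambda>_. 0)) \<and>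
     (\<forall>c\<in>atlas M. \<forall>us. smooth_on (snd c ` (fst c \<inter> U)) (\<lambda>y. form_rep M c \<omega> y us))}"

text \<open>The de Rham differential, by the coordinate formula
  \<open>(d\<omega>)(v\<^sub>0, \<dots>, v\<^sub>k) = \<Sum>\<^sub>i (-1)\<^sup>i \<partial>\<^bsub>v\<^sub>i\<^esub> \<omega>(v\<^sub>0, \<dots>, [omit v\<^sub>i], \<dots>, v\<^sub>k)\<close> with constant
  \<open>v\<^sub>i\<close>, evaluated in the reference chart of the point.\<close>

definition de_rham ::
  "('m, 'e::euclidean_space) filtered_space \<Rightarrow> ('m, 'e) form \<Rightarrow> ('m, 'e) form" where
  "de_rham M \<omega> x vs =
     (let c = chart_at M x in
      \<Sum>i<length vs. (-1) ^ i *
        frechet_derivative (\<lambda>y. form_rep M c \<omega> y (nths vs (- {i}))) (at (snd c x)) (vs ! i))"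

definition d0 ::
  "('m, 'e::euclidean_space) filtered_space \<Rightarrow> ('m, 'e) form \<Rightarrow> ('m, 'e) form" where
  "d0 M \<omega> x = Phi_inv M x (chevalley_eilenberg M x (Phi M x (\<omega> x)))"

definition d0_inv ::
  "('m, 'e::euclidean_space) filtered_space \<Rightarrow> ('m, 'e) form \<Rightarrow> ('m, 'e) form" where
  "d0_inv M \<omega> x = Phi_inv M x
     (partial_inverse (ext_gr M x) (ext_gr_inner M x) (chevalley_eilenberg M x) (Phi M x (\<omega> x)))"

definition d0_t ::
  "('m, 'e::euclidean_space) filtered_space \<Rightarrow> ('m, 'e) form \<Rightarrow> ('m, 'e) form" where
  "d0_t M \<omega> x = Phi_inv M x
     (transpose_on (ext_gr M x) (ext_gr_inner M x) (chevalley_eilenberg M x) (Phi M x (\<omega> x)))"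

definition b_op ::
  "('m, 'e::euclidean_space) filtered_space \<Rightarrow> ('m, 'e) form \<Rightarrow> ('m, 'e) form" where
  "b_op M \<omega> = (\<lambda>x vs. d0_inv M (d0 M \<omega>) x vs - d0_inv M (de_rham M \<omega>) x vs)"

definition I_minus_b_inv ::
  "('m, 'e::euclidean_space) filtered_space \<Rightarrow> ('m, 'e) form \<Rightarrow> ('m, 'e) form" where
  "I_minus_b_inv M = inv_into (forms_on M UNIV) (\<lambda>\<omega> x vs. \<omega> x vs - b_op M \<omega> x vs)"

text \<open>
  \<open>Pi_op\<close> projects onto \<open>im d\<^sub>0\<^sup>-\<^sup>1 + d (im d\<^sub>0\<^sup>-\<^sup>1)\<close>; in particular it is \<open>0\<close> on functions.
  The spectral projection \<open>P_op\<close> below projects onto the generalised kernel of \<open>\<box>\<close>, which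
  contains all functions. So the two describe the same splitting of the forms, but as
  complementary projections: the projection to compare with \<open>P_op\<close> is
  \<open>I - \<Pi>\<close>.
\<close>

definition Pi_op ::
  "('m, 'e::euclidean_space) filtered_space \<Rightarrow> ('m, 'e) form \<Rightarrow> ('m, 'e) form" where
  "Pi_op M \<omega> = (\<lambda>x vs. I_minus_b_inv M (d0_inv M (de_rham M \<omega>)) x vs
                     + de_rham M (I_minus_b_inv M (d0_inv M \<omega>)) x vs)"

definition Box ::
  "('m, 'e::euclidean_space) filtered_space \<Rightarrow> ('m, 'e) form \<Rightarrow> ('m, 'e) form" where
  "Box M \<omega> = (\<lambda>x vs. de_rham M (d0_t M \<omega>) x vs + d0_t M (de_rham M \<omega>) x vs)"


section \<open>Complexification and the spectral projection\<close>

definition cforms_on ::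
  "('m, 'e::euclidean_space) filtered_space \<Rightarrow> 'm set \<Rightarrow> ('m, 'e) cform set" where
  "cforms_on M U = {\<omega>. (\<lambda>x vs. Re (\<omega> x vs)) \<in> forms_on M U \<and> (\<lambda>x vs. Im (\<omega> x vs)) \<in> forms_on M U}"

definition cplx ::
  "(('m, 'e) form \<Rightarrow> ('m, 'e) form) \<Rightarrow> ('m, 'e) cform \<Rightarrow> ('m, 'e) cform" where
  "cplx T \<omega> x vs =
     Complex (T (\<lambda>x vs. Re (\<omega> x vs)) x vs) (T (\<lambda>x vs. Im (\<omega> x vs)) x vs)"

definition solves_resolvent :: "('m, 'e::euclidean_space) filtered_space \<Rightarrow> 'm set \<Rightarrow> complex \<Rightarrow>
    ('m, 'e) cform \<Rightarrow> ('m, 'e) cform \<Rightarrow> bool" where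
  "solves_resolvent M U z \<eta> \<zeta> \<longleftrightarrow>
     \<zeta> \<in> cforms_on M U \<and> (\<forall>x\<in>U. \<forall>vs. z * \<zeta> x vs - cplx (Box M) \<zeta> x vs = \<eta> x vs)"

text \<open>\<open>(z - \<box>)\<^sup>-\<^sup>1\<close> on forms over \<open>U\<close>; it depends on the restriction of the argument to \<open>U\<close> only.\<close>

definition resolvent :: "('m, 'e::euclidean_space) filtered_space \<Rightarrow> 'm set \<Rightarrow> complex \<Rightarrow>
    ('m, 'e) cform \<Rightarrow> ('m, 'e) cform" where
  "resolvent M U z \<eta> = (THE \<zeta>. solves_resolvent M U z \<eta> \<zeta>)"

text \<open>
  What it means for \<open>\<epsilon>\<close> to be small enough: \<open>0\<close> is the only possible point of the spectrum
  of \<open>\<box>\<close> on forms over \<open>U\<close> in the closed disc of radius \<open>\<epsilon>\<close>. The eigenvalues of the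
  zeroth order part of \<open>\<box>\<close> are functions on \<open>M\<close>, so for noncompact \<open>M\<close> such an
  \<open>\<epsilon>\<close> need not exist for \<open>U = UNIV\<close>, but only locally. All operators involved being local,
  this is what defines the spectral projection in general.
\<close>

definition small_enough ::
  "('m, 'e::euclidean_space) filtered_space \<Rightarrow> 'm set \<Rightarrow> real \<Rightarrow> bool" where
  "small_enough M U \<epsilon> \<longleftrightarrow> 0 < \<epsilon> \<and>
     (\<forall>z. 0 < cmod z \<and> cmod z \<le> \<epsilon> \<longrightarrow>
        (\<forall>\<eta>\<in>cforms_on M U. \<exists>!\<zeta>. solves_resolvent M U z \<eta> \<zeta>))"

definition P_op :: "('m, 'e::euclidean_space) filtered_space \<Rightarrow> 'm set \<Rightarrow> real \<Rightarrow>
    ('m, 'e) cform \<Rightarrow> ('m, 'e) cform" where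
  "P_op M U \<epsilon> \<omega> x vs =
     1 / (2 * complex_of_real pi * \<i>) *
       contour_integral (circlepath 0 \<epsilon>) (\<lambda>z. resolvent M U z \<omega> x vs)"

end

theory Submission
  imports Defs
begin

text \<open>
  Let \<open>h = d\<^sub>0\<^sup>-\<^sup>1\<close>, \<open>t = d\<^sub>0\<^sup>t\<close> and \<open>Q = I - \<Pi>\<close>. The weights of an adapted orthonormal frame filter the
  forms, \<open>d\<^sub>0\<close>, \<open>h\<close> and \<open>t\<close> preserve weights, and \<open>d - d\<^sub>0\<close> raises them; so \<open>\<box>\<close> is the pointwise operator
  \<open>box0 = d\<^sub>0t + td\<^sub>0\<close> plus a nilpotent perturbation, and locally its resolvent is a finite sum of
  compositions of differential operators with the resolvent of a matrix.

  Since \<open>h d = I - b\<close> on the image of \<open>h\<close>, one gets \<open>hQ = hdQ = 0\<close>; as \<open>h\<close> and \<open>t\<close> have the same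
  kernel, \<open>\<box>Q = 0\<close> and \<open>(z - \<box>)\<^sup>-\<^sup>1Q = Q/z\<close>. On the other hand \<open>\<Pi>\<omega> = h \<alpha>\<^sub>1 + d h \<alpha>\<^sub>2\<close>. On the image of
  \<open>h\<close> the operator \<open>\<box>\<close> is \<open>td\<close>, whose leading part \<open>td\<^sub>0\<close> is invertible there, so
  \<open>(z - td) v\<^sub>i(z) = h \<alpha>\<^sub>i\<close> has solutions holomorphic near \<open>z = 0\<close>, and \<open>v\<^sub>1(z) + d v\<^sub>2(z)\<close> is
  \<open>(z - \<box>)\<^sup>-\<^sup>1\<Pi>\<omega>\<close>. The contour integral therefore only sees the residue \<open>Q\<omega>\<close>.
\<close>

subsection \<open>Calculus of smooth functions\<close>

text \<open>The obstacle is that \<open>small_enough\<close> only asserts unique solvability of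
  \<open>(z - \<box>)\<zeta> = \<eta>\<close> over \<open>U\<close> and says nothing about the
  dependence on \<open>z\<close>, which a contour integral needs. So on a small frame neighbourhood
  a solution with visible holomorphic dependence is built and identified with the resolvent by local
  uniqueness. That requires the pointwise statement that \<open>box0\<close> has no eigenvalue
  \<open>z\<close>, which has to be recovered from solvability over \<open>U\<close>. At
  \<open>z = 0\<close> the operator \<open>box0\<close> is singular. The decomposition of
  \<open>\<Pi>\<omega>\<close> only asks for solutions in the image of \<open>h\<close>, and there
  \<open>t d0\<close> agrees with an auxiliary operator that is invertible at 0 too. Each nilpotency
  argument is an induction on the weight that ends at \<open>top_weight\<close>. The same filtration
  yields \<open>d0 d0 = 0\<close>, as the leading part of \<open>d d = 0\<close>. The matrices of
  \<open>d0\<close> and \<open>t\<close> in an adapted frame come from smooth structure functions,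
  whereas the projections inside \<open>h\<close> may jump with the rank of \<open>d0\<close>; this
  is where the smoothness hypothesis on \<open>h\<close> enters.\<close>

lemma frechet_derivative_eq:
  "(f has_derivative f') (at x) \<Longrightarrow> frechet_derivative f (at x) = f'"
  by (metis frechet_derivative_at)

lemma differentiable_cong_open:
  assumes "open S" "x \<in> S" "\<And>y. y \<in> S \<Longrightarrow> f y = g y"
  shows "f differentiable (at x) \<longleftrightarrow> g differentiable (at x)"
proof -
  have "(f has_derivative f') (at x) \<longleftrightarrow> (g has_derivative f') (at x)" for f'
    using assms by (metis has_derivative_transform_within_open)
  then show ?thesis by (simp add: differentiable_def)
qed

lemma frechet_derivative_cong_open:
  fixes f g :: "'a::real_normed_vector \<Rightarrow> 'b::real_normed_vector"
  assumes "open S" "x \<in> S" "\<And>y. y \<in> S \<Longrightarrow> f y = g y"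
  shows "frechet_derivative f (at x) = frechet_derivative g (at x)"
proof -
  have "(f has_derivative f') (at x) \<longleftrightarrow> (g has_derivative f') (at x)" for f'
    using assms by (metis has_derivative_transform_within_open)
  then show ?thesis by (simp add: frechet_derivative_def)
qed

text \<open>Openness matters because derivatives are taken \<open>at x\<close> in the whole space:
  functions that agree only on a set that is not open may have different derivatives there.\<close>

lemma Ck_on_cong:
  assumes "open S" "\<And>x. x \<in> S \<Longrightarrow> f x = g x"
  shows "Ck_on k S f \<longleftrightarrow> Ck_on k S g"
  using assms(2)
proof (induction k arbitrary: f g)
  case 0 then show ?case by simp
next
  case (Suc k)
  have "Ck_on k S (\<lambda>x. frechet_derivative f (at x) v)
      \<longleftrightarrow> Ck_on k S (\<lambda>x. frechet_derivative g (at x) v)" for v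
    by (intro Suc.IH) (use frechet_derivative_cong_open[OF assms(1)] Suc.prems in metis)
  moreover have "f differentiable (at x) \<longleftrightarrow> g differentiable (at x)" if "x \<in> S" for x
    using differentiable_cong_open[OF assms(1) that] Suc.prems by blast
  ultimately show ?case by simp
qed

lemma Ck_on_pred: "Ck_on (Suc k) S f \<Longrightarrow> Ck_on k S f"
proof (induction k arbitrary: f)
  case 0 then show ?case
    by (auto intro!: continuous_at_imp_continuous_on differentiable_imp_continuous_within)
next
  case (Suc k)
  then show ?case by (metis Ck_on.simps(2))
qed

lemma Ck_on_subset: "Ck_on k S f \<Longrightarrow> T \<subseteq> S \<Longrightarrow> Ck_on k T f"
  by (induction k arbitrary: f) (auto intro: continuous_on_subset)

lemma Ck_on_local:
  assumes "\<And>x. x \<in> S \<Longrightarrow> \<exists>T. open T \<and> x \<in> T \<and> Ck_on k T f"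
  shows "Ck_on k S f"
  using assms
proof (induction k arbitrary: f)
  case 0
  show ?case
    unfolding Ck_on.simps
  proof (rule continuous_at_imp_continuous_on, rule ballI)
    fix x assume "x \<in> S"
    then obtain T where "open T" "x \<in> T" "continuous_on T f" using 0 by auto
    then show "isCont f x" using continuous_on_eq_continuous_at by blast
  qed
next
  case (Suc k)
  have "Ck_on k S (\<lambda>x. frechet_derivative f (at x) v)" for v
  proof (rule Suc.IH)
    fix x assume "x \<in> S"
    then obtain T where "open T" "x \<in> T" "Ck_on (Suc k) T f" using Suc.prems by blast
    then show "\<exists>T. open T \<and> x \<in> T \<and> Ck_on k T (\<lambda>x. frechet_derivative f (at x) v)"
      by (intro exI[of _ T]) simp
  qed
  moreover have "f differentiable (at x)" if "x \<in> S" for x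
  proof -
    obtain T where "open T" "x \<in> T" "Ck_on (Suc k) T f" using Suc.prems \<open>x \<in> S\<close> by blast
    then show ?thesis unfolding Ck_on.simps by blast
  qed
  ultimately show ?case unfolding Ck_on.simps by blast
qed

lemma smooth_on_iff:
  "smooth_on S f \<longleftrightarrow>
    (\<forall>x\<in>S. f differentiable (at x)) \<and> (\<forall>v. smooth_on S (\<lambda>x. frechet_derivative f (at x) v))"
proof
  assume "smooth_on S f"
  then have *: "Ck_on (Suc k) S f" for k by (simp add: smooth_on_def del: Ck_on.simps)
  show "(\<forall>x\<in>S. f differentiable (at x)) \<and> (\<forall>v. smooth_on S (\<lambda>x. frechet_derivative f (at x) v))"
    using * by (auto simp: smooth_on_def)
next
  assume *: "(\<forall>x\<in>S. f differentiable (at x)) \<and> (\<forall>v. smooth_on S (\<lambda>x. frechet_derivative f (at x) v))"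
  then have "Ck_on (Suc k) S f" for k by (simp add: smooth_on_def)
  then show "smooth_on S f" using Ck_on_pred unfolding smooth_on_def by blast
qed

lemma smooth_on_cong:
  "open S \<Longrightarrow> (\<And>x. x \<in> S \<Longrightarrow> f x = g x) \<Longrightarrow> smooth_on S f \<longleftrightarrow> smooth_on S g"
  unfolding smooth_on_def using Ck_on_cong by blast

lemma smooth_on_subset: "smooth_on S f \<Longrightarrow> T \<subseteq> S \<Longrightarrow> smooth_on T f"
  unfolding smooth_on_def using Ck_on_subset by blast

lemma smooth_on_local:
  "(\<And>x. x \<in> S \<Longrightarrow> \<exists>T. open T \<and> x \<in> T \<and> smooth_on T f) \<Longrightarrow> smooth_on S f"
  unfolding smooth_on_def by (meson Ck_on_local)

lemma smooth_on_empty [simp]: "smooth_on {} f"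
  by (rule smooth_on_local) auto

lemma smooth_on_differentiable: "smooth_on S f \<Longrightarrow> x \<in> S \<Longrightarrow> f differentiable (at x)"
  using smooth_on_iff[of S f] by blast

lemma smooth_on_has_derivative:
  "smooth_on S f \<Longrightarrow> x \<in> S \<Longrightarrow> (f has_derivative frechet_derivative f (at x)) (at x)"
  using smooth_on_differentiable frechet_derivative_works by blast

lemma smooth_on_derivative: "smooth_on S f \<Longrightarrow> smooth_on S (\<lambda>x. frechet_derivative f (at x) v)"
  using smooth_on_iff[of S f] by blast

lemma smooth_on_continuous_on: "smooth_on S f \<Longrightarrow> continuous_on S f"
  unfolding smooth_on_def by (drule spec[of _ 0]) simp

text \<open>Smoothness without a formula for higher derivatives: it suffices to find a family that
  contains \<open>f\<close> and is closed under directional derivatives, up to equality on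
  \<open>S\<close>. Powers, flat exponentials and the families with a holomorphic parameter are
  treated in this way.\<close>

lemma smooth_on_coinduct:
  fixes F :: "('a::euclidean_space \<Rightarrow> 'b::real_normed_vector) set"
  assumes "open S" and "f \<in> F"
    and diff: "\<And>f x. f \<in> F \<Longrightarrow> x \<in> S \<Longrightarrow> f differentiable (at x)"
    and der: "\<And>f v. f \<in> F \<Longrightarrow> \<exists>g\<in>F. \<forall>x\<in>S. frechet_derivative f (at x) v = g x"
  shows "smooth_on S f"
proof -
  have "\<forall>f\<in>F. Ck_on k S f" for k
  proof (induction k)
    case 0 then show ?case
      by (auto intro!: continuous_at_imp_continuous_on differentiable_imp_continuous_within diff)
  next
    case (Suc k)
    show ?case
    proof
      fix f assume f: "f \<in> F"
      have "Ck_on k S (\<lambda>x. frechet_derivative f (at x) v)" for v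
      proof -
        obtain g where "g \<in> F" "\<forall>x\<in>S. frechet_derivative f (at x) v = g x" using der f by blast
        then have "Ck_on k S (\<lambda>x. frechet_derivative f (at x) v) \<longleftrightarrow> Ck_on k S g"
          by (intro Ck_on_cong[OF assms(1)]) blast
        then show ?thesis using Suc.IH \<open>g \<in> F\<close> by blast
      qed
      then show "Ck_on (Suc k) S f" using diff f by auto
    qed
  qed
  then show ?thesis using assms(2) smooth_on_def by blast
qed

lemma smooth_on_const [simp]: "smooth_on S (\<lambda>x. c)"
proof -
  have "Ck_on k S (\<lambda>x. c)" for k
    by (induction k arbitrary: c) (auto simp: frechet_derivative_const)
  then show ?thesis by (simp add: smooth_on_def)
qed

lemma smooth_on_bounded_linear:
  assumes "bounded_linear L" shows "smooth_on S L"
proof (subst smooth_on_iff, intro conjI ballI allI)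
  fix x show "L differentiable at x"
    using assms bounded_linear_imp_differentiable by blast
next
  fix v
  have "frechet_derivative L (at x) v = L v" for x
    using frechet_derivative_eq bounded_linear_imp_has_derivative assms by metis
  then show "smooth_on S (\<lambda>x. frechet_derivative L (at x) v)" by simp
qed

section \<open>Smoothness of sums, bilinear expressions, compositions and powers\<close>

lemma Ck_on_add:
  assumes "open S"
  shows "Ck_on k S f \<Longrightarrow> Ck_on k S g \<Longrightarrow> Ck_on k S (\<lambda>x. f x + g x)"
proof (induction k arbitrary: f g)
  case 0 then show ?case by (auto intro: continuous_on_add)
next
  case (Suc k)
  have D: "frechet_derivative (\<lambda>x. f x + g x) (at x) v
      = frechet_derivative f (at x) v + frechet_derivative g (at x) v" if "x \<in> S" for x v
    using Suc.prems that
    by (subst frechet_derivative_eq[OF has_derivative_add[of f "frechet_derivative f (at x)" _ g "frechet_derivative g (at x)"]])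
       (auto simp: frechet_derivative_works[symmetric])
  have "Ck_on k S (\<lambda>x. frechet_derivative (\<lambda>x. f x + g x) (at x) v)" for v
    by (subst Ck_on_cong[OF assms D]) (use Suc in auto)
  then show ?case using Suc.prems by (auto intro: differentiable_add)
qed

lemma Ck_on_bilinear:
  assumes "open S" and "bounded_bilinear B"
  shows "Ck_on k S f \<Longrightarrow> Ck_on k S g \<Longrightarrow> Ck_on k S (\<lambda>x. B (f x) (g x))"
proof (induction k arbitrary: f g)
  case 0 then show ?case using bounded_bilinear.continuous_on[OF assms(2)] by auto
next
  case (Suc k)
  have H: "((\<lambda>x. B (f x) (g x)) has_derivative
      (\<lambda>v. B (f x) (frechet_derivative g (at x) v) + B (frechet_derivative f (at x) v) (g x))) (at x)"
    if "x \<in> S" for x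
    using Suc.prems that
    by (intro bounded_bilinear.FDERIV[OF assms(2)]) (auto simp: frechet_derivative_works[symmetric])
  have "Ck_on k S (\<lambda>x. frechet_derivative (\<lambda>x. B (f x) (g x)) (at x) v)" for v
  proof (subst Ck_on_cong[OF assms(1)])
    show "frechet_derivative (\<lambda>x. B (f x) (g x)) (at x) v =
      B (f x) (frechet_derivative g (at x) v) + B (frechet_derivative f (at x) v) (g x)" if "x \<in> S" for x
      using frechet_derivative_eq[OF H[OF that]] by simp
    show "Ck_on k S (\<lambda>x. B (f x) (frechet_derivative g (at x) v) + B (frechet_derivative f (at x) v) (g x))"
    proof (intro Ck_on_add[OF assms(1)] Suc.IH)
      show "Ck_on k S f" "Ck_on k S g" using Suc.prems Ck_on_pred by blast+
    qed (use Suc.prems in auto)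
  qed
  then show ?case using H by (auto simp: differentiable_def)
qed

lemma smooth_on_add: "open S \<Longrightarrow> smooth_on S f \<Longrightarrow> smooth_on S g \<Longrightarrow> smooth_on S (\<lambda>x. f x + g x)"
  by (simp add: smooth_on_def Ck_on_add)

lemma smooth_on_bilinear:
  "open S \<Longrightarrow> bounded_bilinear B \<Longrightarrow> smooth_on S f \<Longrightarrow> smooth_on S g \<Longrightarrow> smooth_on S (\<lambda>x. B (f x) (g x))"
  by (simp add: smooth_on_def Ck_on_bilinear)

lemma smooth_on_mult:
  fixes f g :: "_ \<Rightarrow> 'b::real_normed_algebra"
  shows "open S \<Longrightarrow> smooth_on S f \<Longrightarrow> smooth_on S g \<Longrightarrow> smooth_on S (\<lambda>x. f x * g x)"
  by (rule smooth_on_bilinear[OF _ bounded_bilinear_mult])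

lemma smooth_on_scaleR: "open S \<Longrightarrow> smooth_on S f \<Longrightarrow> smooth_on S g \<Longrightarrow> smooth_on S (\<lambda>x. f x *\<^sub>R g x)"
  by (rule smooth_on_bilinear[OF _ bounded_bilinear_scaleR])

lemma smooth_on_inner: "open S \<Longrightarrow> smooth_on S f \<Longrightarrow> smooth_on S g \<Longrightarrow> smooth_on S (\<lambda>x. f x \<bullet> g x)"
  by (rule smooth_on_bilinear[OF _ bounded_bilinear_inner])

lemma smooth_on_uminus: "open S \<Longrightarrow> smooth_on S f \<Longrightarrow> smooth_on S (\<lambda>x. - f x)"
  using smooth_on_scaleR[of S "\<lambda>_. -1" f] by simp

lemma smooth_on_diff: "open S \<Longrightarrow> smooth_on S f \<Longrightarrow> smooth_on S g \<Longrightarrow> smooth_on S (\<lambda>x. f x - g x)"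
  using smooth_on_add[of S f "\<lambda>x. - g x"] smooth_on_uminus by fastforce

lemma smooth_on_sum:
  "open S \<Longrightarrow> (\<And>i. i \<in> I \<Longrightarrow> smooth_on S (f i)) \<Longrightarrow> smooth_on S (\<lambda>x. \<Sum>i\<in>I. f i x)"
  by (induction I rule: infinite_finite_induct) (auto intro: smooth_on_add)

text \<open>\<open>Ck_on\<close> only controls derivatives in fixed directions. This expansion
  reduces a direction that moves with the point to the fixed basis directions, with its components
  as extra coefficients.\<close>

lemma frechet_derivative_expand:
  fixes g :: "'a::euclidean_space \<Rightarrow> 'b::real_normed_vector"
  assumes "g differentiable (at y)"
  shows "frechet_derivative g (at y) u = (\<Sum>b\<in>Basis. (u \<bullet> b) *\<^sub>R frechet_derivative g (at y) b)"
proof -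
  interpret linear "frechet_derivative g (at y)" using assms linear_frechet_derivative by blast
  have "frechet_derivative g (at y) u = frechet_derivative g (at y) (\<Sum>b\<in>Basis. (u \<bullet> b) *\<^sub>R b)"
    by (simp add: euclidean_representation)
  also have "\<dots> = (\<Sum>b\<in>Basis. (u \<bullet> b) *\<^sub>R frechet_derivative g (at y) b)"
    by (simp add: sum scaleR)
  finally show ?thesis .
qed

lemma Ck_on_sum:
  fixes f :: "'i \<Rightarrow> 'a::euclidean_space \<Rightarrow> 'b::real_normed_vector"
  assumes "open S" "Ck_on k S (\<lambda>x. 0::'b)"
  shows "(\<And>i. i \<in> I \<Longrightarrow> Ck_on k S (f i)) \<Longrightarrow> Ck_on k S (\<lambda>x. \<Sum>i\<in>I. f i x)"
  by (induction I rule: infinite_finite_induct) (auto simp: assms(2) intro: Ck_on_add[OF assms(1)])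

lemma Ck_on_compose:
  fixes f :: "'a::euclidean_space \<Rightarrow> 'b::euclidean_space" and g :: "'b \<Rightarrow> 'c::real_normed_vector"
  assumes "open S" "open T" "f ` S \<subseteq> T"
  shows "Ck_on k T g \<Longrightarrow> Ck_on k S f \<Longrightarrow> Ck_on k S (\<lambda>x. g (f x))"
proof (induction k arbitrary: g)
  case 0 then show ?case using continuous_on_compose2 assms by (metis Ck_on.simps(1))
next
  case (Suc k)
  have H: "((\<lambda>x. g (f x)) has_derivative
      (\<lambda>v. frechet_derivative g (at (f x)) (frechet_derivative f (at x) v))) (at x)" if "x \<in> S" for x
  proof -
    have "f differentiable (at x)" "g differentiable (at (f x))" using Suc.prems that assms(3) by auto
    then have "(f has_derivative frechet_derivative f (at x)) (at x)"
      "(g has_derivative frechet_derivative g (at (f x))) (at (f x))"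
      by (simp_all add: frechet_derivative_works)
    then show ?thesis by (rule has_derivative_compose)
  qed
  have "Ck_on k S (\<lambda>x. frechet_derivative (\<lambda>x. g (f x)) (at x) v)" for v
  proof (subst Ck_on_cong[OF assms(1)])
    \<comment> \<open>The chain rule differentiates \<open>g\<close> in a direction that moves with
      \<open>x\<close>; the basis expansion leaves fixed directions only, to which the induction
      hypothesis applies.\<close>
    show "frechet_derivative (\<lambda>x. g (f x)) (at x) v =
      (\<Sum>b\<in>Basis. (frechet_derivative f (at x) v \<bullet> b) *\<^sub>R frechet_derivative g (at (f x)) b)" if "x \<in> S" for x
      unfolding frechet_derivative_eq[OF H[OF that]]
      by (rule frechet_derivative_expand) (use Suc.prems that assms(3) in auto)
    have 0: "Ck_on k S (\<lambda>x. 0 :: 'c)" using smooth_on_const unfolding smooth_on_def by blast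
    have c: "Ck_on k S (\<lambda>x. b)" for b :: 'b using smooth_on_const unfolding smooth_on_def by blast
    have "Ck_on k S f" using Suc.prems Ck_on_pred by blast
    then show "Ck_on k S (\<lambda>x. \<Sum>b\<in>Basis. (frechet_derivative f (at x) v \<bullet> b) *\<^sub>R frechet_derivative g (at (f x)) b)"
      using Suc.prems by (intro Ck_on_sum[OF assms(1)] 0 Ck_on_bilinear[OF assms(1) bounded_bilinear_scaleR]
          Ck_on_bilinear[OF assms(1) bounded_bilinear_inner] c Suc.IH) simp_all
  qed
  then show ?case using H by (auto simp: differentiable_def)
qed

lemma smooth_on_compose:
  fixes f :: "'a::euclidean_space \<Rightarrow> 'b::euclidean_space" and g :: "'b \<Rightarrow> 'c::real_normed_vector"
  shows "open S \<Longrightarrow> open T \<Longrightarrow> f ` S \<subseteq> T \<Longrightarrow> smooth_on T g \<Longrightarrow> smooth_on S f \<Longrightarrow> smooth_on S (\<lambda>x. g (f x))"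
  by (simp add: smooth_on_def Ck_on_compose)

text \<open>The functions \<open>c * t powr a\<close> with all \<open>c\<close> and \<open>a\<close>
  are closed under differentiation. Exponent \<open>-1/2\<close> normalises vectors later, exponent
  \<open>-1\<close> gives reciprocals.\<close>

lemma smooth_on_powr:
  "smooth_on {0<..} (\<lambda>t::real. t powr a)"
proof (rule smooth_on_coinduct[where F = "range (\<lambda>(c, a) (t::real). c * t powr a)"])
  show "(\<lambda>t. t powr a) \<in> range (\<lambda>(c, a) (t::real). c * t powr a)"
    by (rule image_eqI[of _ _ "(1, a)"]) auto
next
  fix f :: "real \<Rightarrow> real" assume "f \<in> range (\<lambda>(c, a) (t::real). c * t powr a)"
  then obtain c a where f: "f = (\<lambda>t. c * t powr a)" by auto
  have D: "(f has_field_derivative c * (a * x powr (a - 1))) (at x)" if "x \<in> {0<..}" for x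
    unfolding f using that by (auto intro!: derivative_eq_intros)
  show "f differentiable at x" if "x \<in> {0<..}" for x
    using D[OF that] by (meson differentiable_def has_field_derivative_imp_has_derivative)
  show "\<exists>g\<in>range (\<lambda>(c, a) (t::real). c * t powr a). \<forall>x\<in>{0<..}. frechet_derivative f (at x) v = g x" for v
  proof (rule bexI[of _ "\<lambda>t. (c * a * v) * t powr (a - 1)"], intro ballI)
    fix x :: real assume "x \<in> {0<..}"
    from frechet_derivative_eq[OF D[OF this, unfolded has_field_derivative_def]]
    show "frechet_derivative f (at x) v = (c * a * v) * x powr (a - 1)" by simp
  qed auto
qed simp

lemma smooth_on_powr_fun:
  fixes f :: "'a::euclidean_space \<Rightarrow> real"
  assumes "open S" "smooth_on S f" "\<And>x. x \<in> S \<Longrightarrow> f x > 0"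
  shows "smooth_on S (\<lambda>x. f x powr a)"
  using assms by (intro smooth_on_compose[OF _ _ _ smooth_on_powr, of S f a]) auto

lemma smooth_on_inverse_pos:
  fixes f :: "'a::euclidean_space \<Rightarrow> real"
  assumes "open S" "smooth_on S f" "\<And>x. x \<in> S \<Longrightarrow> f x > 0"
  shows "smooth_on S (\<lambda>x. inverse (f x))"
  using smooth_on_powr_fun[OF assms, of "-1"]
  by (subst smooth_on_cong[OF assms(1), of _ "\<lambda>x. f x powr -1"]) (auto simp: powr_minus dest: assms(3))

section \<open>Symmetry of second derivatives\<close>

lemma real_second_difference:
  fixes f :: "'a::euclidean_space \<Rightarrow> real"
  assumes S: "open S" and f: "smooth_on S f" and h: "0 < h"
    and sub: "\<And>s t. 0 \<le> s \<Longrightarrow> s \<le> h \<Longrightarrow> 0 \<le> t \<Longrightarrow> t \<le> h \<Longrightarrow> x + s *\<^sub>R u + t *\<^sub>R v \<in> S"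
  shows "\<exists>s t. 0 < s \<and> s < h \<and> 0 < t \<and> t < h \<and>
    f (x + h *\<^sub>R u + h *\<^sub>R v) - f (x + h *\<^sub>R u) - f (x + h *\<^sub>R v) + f x
    = h * h * frechet_derivative (\<lambda>y. frechet_derivative f (at y) u) (at (x + s *\<^sub>R u + t *\<^sub>R v)) v"
proof -
  define f1 where "f1 = (\<lambda>y. frechet_derivative f (at y) u)"
  have f1: "smooth_on S f1" unfolding f1_def by (rule smooth_on_derivative[OF f])
  have line: "((\<lambda>t. g (p + t *\<^sub>R w)) has_field_derivative frechet_derivative g (at (p + t *\<^sub>R w)) w) (at t)"
    if g: "smooth_on S g" and p: "p + t *\<^sub>R w \<in> S" for g :: "'a \<Rightarrow> real" and p w t
  proof -
    have a: "((\<lambda>t. p + t *\<^sub>R w) has_derivative (\<lambda>r. r *\<^sub>R w)) (at t)"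
      by (auto intro!: derivative_eq_intros)
    have "linear (frechet_derivative g (at (p + t *\<^sub>R w)))"
      using linear_frechet_derivative smooth_on_differentiable[OF g p] by blast
    then have "frechet_derivative g (at (p + t *\<^sub>R w)) (r *\<^sub>R w) = frechet_derivative g (at (p + t *\<^sub>R w)) w * r" for r
      by (simp add: linear_scale)
    then show ?thesis
      using has_derivative_compose[OF a smooth_on_has_derivative[OF g p]]
      by (simp add: has_field_derivative_def)
  qed
  \<comment> \<open>The mean value theorem is applied first along \<open>u\<close>, to the
    difference of \<open>f\<close> at two points that differ by \<open>h v\<close>, and then along
    \<open>v\<close> to the derivative; this fixes the order of differentiation in the
    result.\<close>
  have "\<exists>s>0. s < h \<and> (f (x + h *\<^sub>R v + h *\<^sub>R u) - f (x + h *\<^sub>R u)) - (f (x + h *\<^sub>R v + 0 *\<^sub>R u) - f (x + 0 *\<^sub>R u)) =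
      (h - 0) * (f1 (x + h *\<^sub>R v + s *\<^sub>R u) - f1 (x + s *\<^sub>R u))"
  proof (rule MVT2[OF h])
    fix s assume "0 \<le> s" "s \<le> h"
    then show "((\<lambda>s. f (x + h *\<^sub>R v + s *\<^sub>R u) - f (x + s *\<^sub>R u)) has_real_derivative
      (f1 (x + h *\<^sub>R v + s *\<^sub>R u) - f1 (x + s *\<^sub>R u))) (at s)"
      unfolding f1_def using sub[of s h] sub[of s 0] h by (intro DERIV_diff line[OF f]) (auto simp: algebra_simps)
  qed
  then obtain s where s: "0 < s" "s < h"
    and e1: "(f (x + h *\<^sub>R v + h *\<^sub>R u) - f (x + h *\<^sub>R u)) - (f (x + h *\<^sub>R v) - f x) =
      h * (f1 (x + h *\<^sub>R v + s *\<^sub>R u) - f1 (x + s *\<^sub>R u))" by auto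
  have "\<exists>t>0. t < h \<and> f1 (x + s *\<^sub>R u + h *\<^sub>R v) - f1 (x + s *\<^sub>R u + 0 *\<^sub>R v) =
      (h - 0) * frechet_derivative f1 (at (x + s *\<^sub>R u + t *\<^sub>R v)) v"
  proof (rule MVT2[OF h])
    fix t assume "0 \<le> t" "t \<le> h"
    then show "((\<lambda>t. f1 (x + s *\<^sub>R u + t *\<^sub>R v)) has_real_derivative
      frechet_derivative f1 (at (x + s *\<^sub>R u + t *\<^sub>R v)) v) (at t)"
      using sub[of s t] s by (intro line[OF f1]) auto
  qed
  then obtain t where t: "0 < t" "t < h"
    and e2: "f1 (x + s *\<^sub>R u + h *\<^sub>R v) - f1 (x + s *\<^sub>R u) = h * frechet_derivative f1 (at (x + s *\<^sub>R u + t *\<^sub>R v)) v" by auto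
  have "f (x + h *\<^sub>R u + h *\<^sub>R v) - f (x + h *\<^sub>R u) - f (x + h *\<^sub>R v) + f x =
     h * (f1 (x + s *\<^sub>R u + h *\<^sub>R v) - f1 (x + s *\<^sub>R u))" using e1 by (simp add: algebra_simps)
  also have "\<dots> = h * h * frechet_derivative f1 (at (x + s *\<^sub>R u + t *\<^sub>R v)) v" using e2 by simp
  finally show ?thesis using s t unfolding f1_def by blast
qed

text \<open>The second difference of \<open>f\<close> over a small parallelogram is symmetric in
  \<open>u\<close> and \<open>v\<close>, and the mean value theorem writes it through either mixed
  derivative at some nearby point. Continuity of both forces them to agree at
  \<open>x\<close>.\<close>

lemma real_second_derivative_symmetric:
  fixes f :: "'a::euclidean_space \<Rightarrow> real"
  assumes S: "open S" and f: "smooth_on S f" and x: "x \<in> S"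
  shows "frechet_derivative (\<lambda>y. frechet_derivative f (at y) u) (at x) v =
         frechet_derivative (\<lambda>y. frechet_derivative f (at y) v) (at x) u" (is "?A x = ?B x")
proof (rule ccontr)
  assume ne: "?A x \<noteq> ?B x"
  define e where "e = \<bar>?A x - ?B x\<bar> / 2"
  have e: "e > 0" using ne by (simp add: e_def)
  have "continuous_on S ?A" "continuous_on S ?B"
    by (intro smooth_on_continuous_on smooth_on_derivative f)+
  then have "isCont ?A x" "isCont ?B x" using S x continuous_on_eq_continuous_at by blast+
  then obtain d1 d2 where d1: "d1 > 0" "\<And>y. dist y x < d1 \<Longrightarrow> dist (?A y) (?A x) < e"
    and d2: "d2 > 0" "\<And>y. dist y x < d2 \<Longrightarrow> dist (?B y) (?B x) < e"
    using e unfolding continuous_at_eps_delta dist_norm by metis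
  obtain d3 where d3: "d3 > 0" "ball x d3 \<subseteq> S" using S x open_contains_ball by blast
  define d where "d = min d1 (min d2 d3)"
  have d: "d > 0" using d1 d2 d3 by (simp add: d_def)
  \<comment> \<open>Small enough for the parallelogram with sides \<open>h u\<close> and
    \<open>h v\<close> to stay within distance \<open>d\<close> of \<open>x\<close>; the summand 1
    keeps the denominator positive when both vectors vanish.\<close>
  define h where "h = d / (2 * (norm u + norm v + 1))"
  have np: "norm u + norm v + 1 > 0" using norm_ge_zero[of u] norm_ge_zero[of v] by linarith
  have h: "h > 0" using d np by (simp add: h_def)
  have hb: "h * (norm u + norm v) < d"
  proof -
    have "h * (norm u + norm v) < h * (2 * (norm u + norm v + 1))"
    proof (rule mult_strict_left_mono[OF _ h])
      show "norm u + norm v < 2 * (norm u + norm v + 1)" using np unfolding distrib_left by linarith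
    qed
    also have "\<dots> = d" using np by (simp add: h_def)
    finally show ?thesis .
  qed
  have near: "dist (x + s *\<^sub>R u + t *\<^sub>R v) x < d" if "0 \<le> s" "s \<le> h" "0 \<le> t" "t \<le> h" for s t
  proof -
    have "dist (x + s *\<^sub>R u + t *\<^sub>R v) x = norm (s *\<^sub>R u + t *\<^sub>R v)" by (simp add: dist_norm)
    also have "\<dots> \<le> s * norm u + t * norm v" using norm_triangle_ineq[of "s *\<^sub>R u" "t *\<^sub>R v"] that by simp
    also have "\<dots> \<le> h * norm u + h * norm v" using that by (intro add_mono mult_right_mono) auto
    also have "\<dots> < d" using hb by (simp add: algebra_simps)
    finally show ?thesis .
  qed
  have sub: "x + s *\<^sub>R u + t *\<^sub>R v \<in> S" if "0 \<le> s" "s \<le> h" "0 \<le> t" "t \<le> h" for s t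
    using near[OF that] d3 by (auto simp: d_def dist_commute)
  obtain s t where st: "0 < s" "s < h" "0 < t" "t < h"
    and e1: "f (x + h *\<^sub>R u + h *\<^sub>R v) - f (x + h *\<^sub>R u) - f (x + h *\<^sub>R v) + f x = h * h * ?A (x + s *\<^sub>R u + t *\<^sub>R v)"
    using real_second_difference[OF S f h sub] by blast
  have sub': "x + s *\<^sub>R v + t *\<^sub>R u \<in> S" if "0 \<le> s" "s \<le> h" "0 \<le> t" "t \<le> h" for s t
    using sub[of t s] that by (simp add: algebra_simps)
  obtain s' t' where st': "0 < s'" "s' < h" "0 < t'" "t' < h"
    and e2: "f (x + h *\<^sub>R v + h *\<^sub>R u) - f (x + h *\<^sub>R v) - f (x + h *\<^sub>R u) + f x = h * h * ?B (x + s' *\<^sub>R v + t' *\<^sub>R u)"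
    using real_second_difference[OF S f h sub'] by blast
  have "h * h * ?A (x + s *\<^sub>R u + t *\<^sub>R v) = h * h * ?B (x + s' *\<^sub>R v + t' *\<^sub>R u)"
    using e1 e2 by (simp add: algebra_simps)
  then have eq: "?A (x + s *\<^sub>R u + t *\<^sub>R v) = ?B (x + t' *\<^sub>R u + s' *\<^sub>R v)" using h by (simp add: algebra_simps)
  have "dist (?A (x + s *\<^sub>R u + t *\<^sub>R v)) (?A x) < e" using near[of s t] st d1 by (auto simp: d_def)
  moreover have "dist (?B (x + t' *\<^sub>R u + s' *\<^sub>R v)) (?B x) < e" using near[of t' s'] st' d2 by (auto simp: d_def)
  ultimately have "\<bar>?A x - ?B x\<bar> < 2 * e" using eq unfolding dist_real_def by linarith
  then show False by (simp add: e_def)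
qed

lemma second_derivative_symmetric:
  fixes f :: "'a::euclidean_space \<Rightarrow> 'b::euclidean_space"
  assumes S: "open S" and f: "smooth_on S f" and x: "x \<in> S"
  shows "frechet_derivative (\<lambda>y. frechet_derivative f (at y) u) (at x) v =
         frechet_derivative (\<lambda>y. frechet_derivative f (at y) v) (at x) u"
proof (rule euclidean_eqI)
  fix b :: 'b assume b: "b \<in> Basis"
  have inner: "frechet_derivative (\<lambda>y. g y \<bullet> b) (at y) w = frechet_derivative g (at y) w \<bullet> b"
    if "smooth_on S g" "y \<in> S" for g :: "'a \<Rightarrow> 'b" and y w
    using frechet_derivative_eq[OF has_derivative_inner_left[OF smooth_on_has_derivative[OF that]]] by metis
  have *: "frechet_derivative (\<lambda>y. frechet_derivative f (at y) u) (at x) v \<bullet> b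
      = frechet_derivative (\<lambda>y. frechet_derivative (\<lambda>y. f y \<bullet> b) (at y) u) (at x) v" for u v
    unfolding inner[OF smooth_on_derivative[OF f] x, symmetric]
    by (rule fun_cong[OF frechet_derivative_cong_open[OF S x]]) (simp add: inner[OF f])
  show "frechet_derivative (\<lambda>y. frechet_derivative f (at y) u) (at x) v \<bullet> b =
        frechet_derivative (\<lambda>y. frechet_derivative f (at y) v) (at x) u \<bullet> b"
    unfolding * by (rule real_second_derivative_symmetric[OF S _ x]) (intro smooth_on_inner S f smooth_on_const)
qed

section \<open>A smooth bump function\<close>

definition flat_exp :: "real poly \<Rightarrow> real \<Rightarrow> real" where
  "flat_exp p t = (if t \<le> 0 then 0 else poly p (1 / t) * exp (- (1 / t)))"

lemma flat_exp_tendsto_0: "(flat_exp p \<longlongrightarrow> 0) (at_right 0)"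
proof -
  have "((\<lambda>s::real. s ^ i / exp s) \<longlongrightarrow> 0) at_top" for i by (rule tendsto_power_div_exp_0)
  then have "((\<lambda>s. \<Sum>i\<le>degree p. coeff p i * (s ^ i / exp s)) \<longlongrightarrow> (\<Sum>i\<le>degree p. coeff p i * 0)) at_top"
    by (intro tendsto_sum tendsto_mult tendsto_const)
  moreover have "(\<lambda>s. \<Sum>i\<le>degree p. coeff p i * (s ^ i / exp s)) = (\<lambda>s. poly p s * exp (- s))"
    by (simp add: poly_altdef sum_distrib_right exp_minus divide_inverse mult.assoc)
  ultimately have "((\<lambda>s. poly p s * exp (- s)) \<longlongrightarrow> 0) at_top" by simp
  then have "((\<lambda>t. poly p (1 / t) * exp (- (1 / t))) \<longlongrightarrow> 0) (at_right 0)"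
    using filterlim_compose[OF _ filterlim_inverse_at_top_right, of "\<lambda>s. poly p s * exp (- s)"]
    by (simp add: divide_inverse)
  then show ?thesis
    by (rule Lim_transform_eventually) (auto simp: flat_exp_def eventually_at_right_field intro!: exI[of _ 1])
qed

text \<open>With \<open>s = 1 / t\<close> the derivative of \<open>p(s) exp(-s)\<close> in
  \<open>t\<close> is \<open>s^2 (p(s) - p'(s)) exp(-s)\<close>, of the same shape again; this is
  why \<open>flat_exp\<close> carries a polynomial. At \<open>t = 0\<close> the difference quotient
  from the right is \<open>flat_exp\<close> for the polynomial \<open>X p\<close>, which tends to
  0.\<close>

lemma flat_exp_deriv:
  "(flat_exp p has_real_derivative flat_exp ([:0, 0, 1:] * (p - pderiv p)) t) (at t)"
proof (cases "t = 0")
  case False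
  then consider "t < 0" | "t > 0" by linarith
  then show ?thesis
  proof cases
    case 1
    have "((\<lambda>_. 0) has_real_derivative 0) (at t)" by simp
    then have "(flat_exp p has_real_derivative 0) (at t)"
      by (rule DERIV_cong_ev[THEN iffD1, rotated 3])
        (use 1 in \<open>auto simp: flat_exp_def eventually_nhds intro!: exI[of _ "{..<0}"]\<close>)
    then show ?thesis using 1 by (simp add: flat_exp_def)
  next
    case 2
    have "((\<lambda>t. poly p (1 / t) * exp (- (1 / t))) has_real_derivative
       flat_exp ([:0, 0, 1:] * (p - pderiv p)) t) (at t)"
      using 2 by (auto intro!: derivative_eq_intros simp: flat_exp_def field_simps power2_eq_square)
    then show ?thesis
      by (rule DERIV_cong_ev[THEN iffD1, rotated 3])
        (use 2 in \<open>auto simp: flat_exp_def eventually_nhds intro!: exI[of _ "{0<..}"]\<close>)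
  qed
next
  case True
  have a: "((\<lambda>h. flat_exp p h / h) \<longlongrightarrow> 0) (at_right 0)"
    by (rule Lim_transform_eventually[OF flat_exp_tendsto_0[of "[:0, 1:] * p"]])
      (auto simp: flat_exp_def eventually_at_right_field intro!: exI[of _ 1])
  have b: "((\<lambda>h. flat_exp p h / h) \<longlongrightarrow> 0) (at_left 0)"
    by (rule Lim_transform_eventually[OF tendsto_const])
      (auto simp: flat_exp_def eventually_at_left_field intro!: exI[of _ "-1"])
  have "((\<lambda>h. (flat_exp p (0 + h) - flat_exp p 0) / h) \<longlongrightarrow> 0) (at 0)"
    using filterlim_split_at[OF b a] by (simp add: flat_exp_def)
  then show ?thesis using True by (simp add: DERIV_def flat_exp_def)
qed

lemma smooth_on_flat_exp: "smooth_on UNIV (flat_exp p)"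
proof (rule smooth_on_coinduct[where F = "range (\<lambda>(c, p) t. c * flat_exp p t)"])
  show "flat_exp p \<in> range (\<lambda>(c, p) t. c * flat_exp p t)"
    by (auto simp: image_iff intro!: exI[of _ 1] exI[of _ p])
next
  fix f assume "f \<in> range (\<lambda>(c, p) t. c * flat_exp p t)"
  then obtain c p where f: "f = (\<lambda>t. c * flat_exp p t)" by auto
  have D: "(f has_field_derivative c * flat_exp ([:0, 0, 1:] * (p - pderiv p)) x) (at x)" for x
    unfolding f by (rule DERIV_cmult[OF flat_exp_deriv])
  show "f differentiable at x" for x
    using D by (meson differentiable_def has_field_derivative_imp_has_derivative)
  show "\<exists>g\<in>range (\<lambda>(c, p) t. c * flat_exp p t). \<forall>x\<in>UNIV. frechet_derivative f (at x) v = g x" for v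
  proof (rule bexI[of _ "\<lambda>t. (c * v) * flat_exp ([:0, 0, 1:] * (p - pderiv p)) t"], intro ballI)
    fix x
    from frechet_derivative_eq[OF D[unfolded has_field_derivative_def]]
    show "frechet_derivative f (at x) v = (c * v) * flat_exp ([:0, 0, 1:] * (p - pderiv p)) x" by simp
  qed auto
qed simp

text \<open>The quotient \<open>A / (A + B)\<close>, where \<open>A\<close> is positive exactly
  inside radius \<open>r\<close> and \<open>B\<close> exactly outside radius \<open>r / 2\<close>,
  so that the denominator never vanishes.\<close>

lemma bump_function:
  fixes y0 :: "'a::euclidean_space"
  assumes "r > 0"
  obtains f :: "'a \<Rightarrow> real" where "smooth_on UNIV f" "\<And>y. dist y y0 < r / 2 \<Longrightarrow> f y = 1"
    "\<And>y. dist y y0 \<ge> r \<Longrightarrow> f y = 0"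
proof -
  define e where "e = flat_exp 1"
  have e: "e t \<ge> 0" "t > 0 \<Longrightarrow> e t > 0" "t \<le> 0 \<Longrightarrow> e t = 0" for t by (auto simp: e_def flat_exp_def)
  define q where "q y = (y - y0) \<bullet> (y - y0)" for y :: 'a
  have qd: "q y = (dist y y0)\<^sup>2" for y by (simp add: q_def dist_norm power2_norm_eq_inner)
  have "smooth_on UNIV (\<lambda>y::'a. y)" by (rule smooth_on_bounded_linear[OF bounded_linear_ident])
  then have q: "smooth_on UNIV q" unfolding q_def by (intro smooth_on_inner smooth_on_diff smooth_on_const) auto
  have comp: "smooth_on UNIV (\<lambda>y. e (g y))" if "smooth_on UNIV g" for g :: "'a \<Rightarrow> real"
    unfolding e_def by (rule smooth_on_compose[OF _ _ _ smooth_on_flat_exp that]) auto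
  define A where "A y = e (r\<^sup>2 - q y)" for y
  define B where "B y = e (q y - (r / 2)\<^sup>2)" for y
  have A: "smooth_on UNIV A" and B: "smooth_on UNIV B"
    unfolding A_def B_def by (intro comp smooth_on_diff smooth_on_const q open_UNIV)+
  have pos: "A y + B y > 0" for y
  proof (cases "q y < r\<^sup>2")
    case True then show ?thesis using e by (simp add: A_def B_def add_pos_nonneg)
  next
    case False
    moreover have "(r / 2)\<^sup>2 < r\<^sup>2" using assms by (simp add: power_divide)
    ultimately have "q y > (r / 2)\<^sup>2" by linarith
    then show ?thesis using e by (simp add: A_def B_def add_nonneg_pos)
  qed
  show thesis
  proof (rule that[of "\<lambda>y. A y * inverse (A y + B y)"])
    show "smooth_on UNIV (\<lambda>y. A y * inverse (A y + B y))"
      by (intro smooth_on_mult smooth_on_inverse_pos smooth_on_add A B pos) auto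
    fix y
    show "A y * inverse (A y + B y) = 1" if "dist y y0 < r / 2"
    proof -
      have "q y \<le> (r / 2)\<^sup>2" unfolding qd using that by (intro power_mono) auto
      then have "B y = 0" by (simp add: B_def e)
      then show ?thesis using pos[of y] by simp
    qed
    show "A y * inverse (A y + B y) = 0" if "dist y y0 \<ge> r"
    proof -
      have "q y \<ge> r\<^sup>2" unfolding qd using that assms by (intro power_mono) auto
      then show ?thesis by (simp add: A_def e)
    qed
  qed
qed

subsection \<open>Alternating forms in an orthonormal frame\<close>

lemma ext_T_iff: "a \<in> ext_T \<longleftrightarrow>
    (\<forall>us vs x y. a (us @ (x + y) # vs) = a (us @ x # vs) + a (us @ y # vs)) \<and>
    (\<forall>us vs r x. a (us @ (r *\<^sub>R x) # vs) = r * a (us @ x # vs)) \<and>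
    (\<forall>vs. \<not> distinct vs \<longrightarrow> a vs = 0)"
  unfolding ext_T_def ext_alg_def by auto

lemma ext_T_add: "a \<in> ext_T \<Longrightarrow> a (us @ (x + y) # vs) = a (us @ x # vs) + a (us @ y # vs)"
  and ext_T_scale: "a \<in> ext_T \<Longrightarrow> a (us @ (r *\<^sub>R x) # vs) = r * a (us @ x # vs)"
  and ext_T_alt: "a \<in> ext_T \<Longrightarrow> \<not> distinct ws \<Longrightarrow> a ws = 0"
  by (auto simp: ext_T_iff)

lemma ext_T_zero_arg: "a \<in> ext_T \<Longrightarrow> a (us @ 0 # vs) = 0"
  using ext_T_scale[of a us 0 0 vs] by simp

lemma ext_T_minus_arg: "a \<in> ext_T \<Longrightarrow> a (us @ (- x) # vs) = - a (us @ x # vs)"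
  using ext_T_scale[of a us "-1" x vs] by simp

lemma ext_T_diff_arg: "a \<in> ext_T \<Longrightarrow> a (us @ (x - y) # vs) = a (us @ x # vs) - a (us @ y # vs)"
  using ext_T_add[of a us x "- y" vs] ext_T_minus_arg[of a us y vs] by simp

lemma ext_T_sum_arg: "a \<in> ext_T \<Longrightarrow> a (us @ (\<Sum>i\<in>I. f i) # vs) = (\<Sum>i\<in>I. a (us @ f i # vs))"
  by (induction I rule: infinite_finite_induct) (auto simp: ext_T_zero_arg ext_T_add)

lemma ext_T_zero [simp]: "(\<lambda>_. 0) \<in> ext_T"
  by (simp add: ext_T_iff)

lemma ext_T_plus: "a \<in> ext_T \<Longrightarrow> b \<in> ext_T \<Longrightarrow> (\<lambda>vs. a vs + b vs) \<in> ext_T"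
  by (simp add: ext_T_iff algebra_simps)

lemma ext_T_scaled: "a \<in> ext_T \<Longrightarrow> (\<lambda>vs. r * a vs) \<in> ext_T"
  by (simp add: ext_T_iff algebra_simps)

lemma ext_T_minus: "a \<in> ext_T \<Longrightarrow> b \<in> ext_T \<Longrightarrow> (\<lambda>vs. a vs - b vs) \<in> ext_T"
  by (simp add: ext_T_iff algebra_simps)

lemma ext_T_sum: "(\<And>i. i \<in> I \<Longrightarrow> f i \<in> ext_T) \<Longrightarrow> (\<lambda>vs. \<Sum>i\<in>I. f i vs) \<in> ext_T"
  by (induction I rule: infinite_finite_induct) (auto intro: ext_T_plus)

lemma ext_T_swap:
  assumes "a \<in> ext_T"
  shows "a (us @ x # y # vs) = - a (us @ y # x # vs)"
proof -
  have "a (us @ (x + y) # (x + y) # vs) = 0" by (rule ext_T_alt[OF assms]) simp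
  moreover have "a (us @ (x + y) # (x + y) # vs)
      = a (us @ x # x # vs) + a (us @ x # y # vs) + (a (us @ y # x # vs) + a (us @ y # y # vs))"
    using ext_T_add[OF assms, of us x y "(x + y) # vs"] ext_T_add[OF assms, of "us @ [x]" x y vs]
      ext_T_add[OF assms, of "us @ [y]" x y vs] by simp
  moreover have "a (us @ x # x # vs) = 0" "a (us @ y # y # vs) = 0"
    by (rule ext_T_alt[OF assms]; simp)+
  ultimately show ?thesis by simp
qed

lemma ext_T_move:
  assumes "a \<in> ext_T"
  shows "a (us @ vs @ x # ws) = (- 1) ^ length vs * a (us @ x # vs @ ws)"
proof (induction vs arbitrary: us)
  case Nil then show ?case by simp
next
  case (Cons v vs)
  have "a (us @ (v # vs) @ x # ws) = (- 1) ^ length vs * a (us @ v # x # vs @ ws)"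
    using Cons.IH[of "us @ [v]"] by simp
  also have "\<dots> = (- 1) ^ length (v # vs) * a (us @ x # (v # vs) @ ws)"
    using ext_T_swap[OF assms, of us v x "vs @ ws"] by simp
  finally show ?case .
qed

text \<open>Serves to pass vanishing from one arrangement of the arguments to another; for that
  purpose the sign of the permutation can stay open.\<close>

lemma ext_T_permute:
  assumes "a \<in> ext_T"
  shows "mset vs = mset ws \<Longrightarrow> a (us @ vs) = a (us @ ws) \<or> a (us @ vs) = - a (us @ ws)"
proof (induction vs arbitrary: us ws)
  case Nil then show ?case by simp
next
  case (Cons x vs)
  then have "x \<in> set ws" by (metis list.set_intros(1) mset_eq_setD)
  then obtain p q where ws: "ws = p @ x # q" by (meson split_list)
  then have "mset vs = mset (p @ q)" using Cons.prems by simp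
  from Cons.IH[OF this, of "us @ [x]"]
  have "a (us @ x # vs) = a (us @ x # p @ q) \<or> a (us @ x # vs) = - a (us @ x # p @ q)" by simp
  moreover have "a (us @ ws) = (- 1) ^ length p * a (us @ x # p @ q)"
    unfolding ws by (rule ext_T_move[OF assms])
  ultimately show ?case by (cases "even (length p)") auto
qed

text \<open>Laplace expansion along column \<open>m\<close>: its cofactors delete exactly the column
  in which the three matrices differ. This is the source of the multilinearity of
  \<open>gram_wedge\<close>.\<close>

lemma det_mat_column_linear:
  fixes f g h :: "nat \<Rightarrow> nat \<Rightarrow> real"
  assumes m: "m < k"
    and eq: "\<And>i j. i < k \<Longrightarrow> j < k \<Longrightarrow> j \<noteq> m \<Longrightarrow> h i j = f i j"
    and eq': "\<And>i j. i < k \<Longrightarrow> j < k \<Longrightarrow> j \<noteq> m \<Longrightarrow> h i j = g i j"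
    and col: "\<And>i. i < k \<Longrightarrow> h i m = r * f i m + s * g i m"
  shows "Determinant.det (Matrix.mat k k (\<lambda>(i, j). h i j)) =
    r * Determinant.det (Matrix.mat k k (\<lambda>(i, j). f i j)) + s * Determinant.det (Matrix.mat k k (\<lambda>(i, j). g i j))"
proof -
  let ?M = "\<lambda>f. Matrix.mat k k (\<lambda>(i, j). f i j :: real)"
  have cof: "cofactor (?M h) i m = cofactor (?M f) i m" "cofactor (?M h) i m = cofactor (?M g) i m" if "i < k" for i
  proof -
    have "mat_delete (?M h) i m = mat_delete (?M f) i m"
      using that m by (auto simp: mat_delete_def eq intro!: eq_matI)
    moreover have "mat_delete (?M h) i m = mat_delete (?M g) i m"
      using that m by (auto simp: mat_delete_def eq' intro!: eq_matI)
    ultimately show "cofactor (?M h) i m = cofactor (?M f) i m" "cofactor (?M h) i m = cofactor (?M g) i m"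
      by (simp_all add: cofactor_def)
  qed
  have l: "Determinant.det (?M f) = (\<Sum>i<k. f i m * cofactor (?M f) i m)" for f
    by (subst laplace_expansion_column[of _ k m]) (use m in auto)
  show ?thesis unfolding l
    by (simp add: sum_distrib_left sum.distrib[symmetric] cof(1)[symmetric] cof(2)[symmetric] col algebra_simps)
qed

lemma gram_wedge_ext_T:
  assumes "bilinear g"
  shows "gram_wedge UNIV g ws \<in> ext_T"
proof -
  interpret L: linear "g x" for x using assms bilinear_def by blast
  let ?D = "\<lambda>vs. Determinant.det (Matrix.mat (length ws) (length ws) (\<lambda>(i, j). g (ws ! i) (vs ! j)))"
  have len: "gram_wedge UNIV g ws vs = (if length ws = length vs then ?D vs else 0)" for vs
    by (simp add: gram_wedge_def)
  have lin: "gram_wedge UNIV g ws (us @ z # vs) = r * gram_wedge UNIV g ws (us @ x # vs) + s * gram_wedge UNIV g ws (us @ y # vs)"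
    if "\<And>w. g w z = r * g w x + s * g w y" for us vs x y z r s
  proof (cases "length ws = length us + Suc (length vs)")
    case True
    have "?D (us @ z # vs) = r * ?D (us @ x # vs) + s * ?D (us @ y # vs)"
      by (rule det_mat_column_linear[of "length us"]) (use True that in \<open>auto simp: nth_append nth_Cons'\<close>)
    then show ?thesis using True by (simp add: len)
  qed (simp add: len)
  show ?thesis unfolding ext_T_iff
  proof (intro conjI allI impI)
    show "gram_wedge UNIV g ws (us @ (x + y) # vs) = gram_wedge UNIV g ws (us @ x # vs) + gram_wedge UNIV g ws (us @ y # vs)" for us vs x y
      using lin[of "x + y" 1 x 1 y] by (simp add: L.add)
    show "gram_wedge UNIV g ws (us @ (r *\<^sub>R x) # vs) = r * gram_wedge UNIV g ws (us @ x # vs)" for us vs r x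
      using lin[of "r *\<^sub>R x" r x 0 x] by (simp add: L.scaleR)
    show "gram_wedge UNIV g ws vs = 0" if nd: "\<not> distinct vs" for vs
    proof (cases "length ws = length vs")
      case True
      obtain i j where ij: "i < length vs" "j < length vs" "i \<noteq> j" "vs ! i = vs ! j"
        using nd by (auto simp: distinct_conv_nth)
      have "?D vs = 0"
        by (rule det_identical_columns[OF _ ij(3)]) (use True ij in \<open>auto simp: Matrix.col_def intro!: eq_vecI\<close>)
      then show ?thesis using True by (simp add: len)
    qed (simp add: len)
  qed
qed

lemma gram_wedge_sym:
  assumes "\<And>x y. g x y = g y x"
  shows "gram_wedge UNIV g us vs = gram_wedge UNIV g vs us"
proof (cases "length us = length vs")
  case True
  let ?A = "Matrix.mat (length us) (length us) (\<lambda>(i, j). g (us ! i) (vs ! j))"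
  have "transpose_mat ?A = Matrix.mat (length vs) (length vs) (\<lambda>(i, j). g (vs ! i) (us ! j))"
    using True by (auto intro!: eq_matI simp: assms)
  moreover have "Determinant.det (transpose_mat ?A) = Determinant.det ?A" by (rule det_transpose) auto
  ultimately show ?thesis using True by (simp add: gram_wedge_def)
qed (simp add: gram_wedge_def)

section \<open>Orthonormal frames and increasing multi-indices\<close>

definition idx :: "nat \<Rightarrow> nat list set" where
  "idx n = {K. sorted_wrt (<) K \<and> set K \<subseteq> {..<n}}"

lemma idx_distinct: "K \<in> idx n \<Longrightarrow> distinct K"
  by (auto simp: idx_def strict_sorted_iff)

lemma idx_set: "K \<in> idx n \<Longrightarrow> set K \<subseteq> {..<n}"
  by (auto simp: idx_def)

lemma idx_length: "K \<in> idx n \<Longrightarrow> length K \<le> n"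
  using card_mono[OF finite_lessThan idx_set] distinct_card[OF idx_distinct] by fastforce

lemma finite_idx [simp]: "finite (idx n)"
  by (rule finite_subset[OF _ finite_lists_length_le[of "{..<n}" n]]) (use idx_length idx_set in blast)+

lemma idx_sort: "distinct K \<Longrightarrow> set K \<subseteq> {..<n} \<Longrightarrow> sort K \<in> idx n"
  by (simp add: idx_def strict_sorted_iff)

lemma idx_eqI: "K \<in> idx n \<Longrightarrow> J \<in> idx n \<Longrightarrow> set K = set J \<Longrightarrow> K = J"
  by (auto simp: idx_def intro: strict_sorted_equal)

locale orthonormal_frame =
  fixes g :: "'e::euclidean_space \<Rightarrow> 'e \<Rightarrow> real" and E :: "nat \<Rightarrow> 'e" and n :: nat
  assumes g_bilinear: "bilinear g"
    and g_sym: "g x y = g y x"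
    and g_frame: "i < n \<Longrightarrow> j < n \<Longrightarrow> g (E i) (E j) = (if i = j then 1 else 0)"
    and frame_expand: "(\<Sum>i<n. g v (E i) *\<^sub>R E i) = v"
begin

text \<open>The exterior monomials of the dual coframe; the empty list gives the constant 1 in
  degree 0.\<close>

definition ebas :: "nat list \<Rightarrow> 'e list \<Rightarrow> real" where
  "ebas K = gram_wedge UNIV g (map E K)"

text \<open>The inner product in which the \<open>ebas K\<close> with increasing \<open>K\<close>
  are orthonormal. That it is the one fixed by the determinant formula is shown in
  \<open>ext_gr_inner_eq\<close>, after transport to \<open>gr\<close>.\<close>

definition ip :: "('e list \<Rightarrow> real) \<Rightarrow> ('e list \<Rightarrow> real) \<Rightarrow> real" where
  "ip a b = (\<Sum>K\<in>idx n. a (map E K) * b (map E K))"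

lemma ebas_ext_T: "ebas K \<in> ext_T"
  unfolding ebas_def by (rule gram_wedge_ext_T[OF g_bilinear])

lemma ext_T_expand_arg:
  "a \<in> ext_T \<Longrightarrow> a (us @ v # vs) = (\<Sum>i<n. g v (E i) * a (us @ E i # vs))"
  by (subst frame_expand[of v, symmetric]) (simp add: ext_T_sum_arg ext_T_scale)

lemma ebas_frame:
  assumes "K \<in> idx n" "J \<in> idx n"
  shows "ebas K (map E J) = (if K = J then 1 else 0)"
proof (cases "length K = length J")
  case False then show ?thesis by (auto simp: ebas_def gram_wedge_def)
next
  case len: True
  show ?thesis
  proof (cases "K = J")
    case True
    have "Matrix.mat (length K) (length K) (\<lambda>(i, j). g (map E K ! i) (map E K ! j)) = 1\<^sub>m (length K)"
      using g_frame idx_set[OF assms(1)] idx_distinct[OF assms(1)]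
      by (auto intro!: eq_matI simp: subset_iff nth_eq_iff_index_eq)
    then show ?thesis using True by (simp add: ebas_def gram_wedge_def)
  next
    case False
    have "set K \<noteq> set J" using False idx_eqI assms by blast
    moreover have "card (set K) = card (set J)"
      using len distinct_card idx_distinct assms by metis
    ultimately have "\<not> set K \<subseteq> set J" using card_subset_eq by blast
    \<comment> \<open>Different increasing lists of equal length have different sets, so some index
      of \<open>K\<close> is missing from \<open>J\<close>; its row in the Gram matrix is
      zero.\<close>
    then obtain i where i: "i < length K" "K ! i \<notin> set J" by (metis in_set_conv_nth subsetI)
    let ?A = "Matrix.mat (length K) (length K) (\<lambda>(i, j). g (map E K ! i) (map E J ! j))"
    have z: "?A $$ (i, j) = 0" if "j < length K" for j
    proof -
      have "K ! i < n" "J ! j < n" "K ! i \<noteq> J ! j"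
        using i that len idx_set[OF assms(1)] idx_set[OF assms(2)] by (auto simp: subset_iff in_set_conv_nth)
      then show ?thesis using i that len g_frame by simp
    qed
    have "Determinant.det ?A = (\<Sum>j<length K. ?A $$ (i, j) * cofactor ?A i j)"
      by (rule laplace_expansion_row) (use i in auto)
    also have "\<dots> = 0" using z by simp
    finally show ?thesis using False len by (simp add: ebas_def gram_wedge_def)
  qed
qed

text \<open>Multilinearity replaces the arguments one by one by frame vectors. A list of frame
  vectors either has a repetition or becomes increasing at the cost of a sign.\<close>

lemma ext_T_eq_0I:
  assumes a: "a \<in> ext_T" and z: "\<And>K. K \<in> idx n \<Longrightarrow> a (map E K) = 0"
  shows "a = (\<lambda>_. 0)"
proof
  have z': "a (map E K) = 0" if "set K \<subseteq> {..<n}" for K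
  proof (cases "distinct K")
    case True
    have "mset (map E K) = mset (map E (sort K))" by simp
    from ext_T_permute[OF a this, of "[]"] z[OF idx_sort[OF True that]] show ?thesis by auto
  next
    case False
    then show ?thesis using ext_T_alt[OF a] by (meson distinct_map)
  qed
  have "set K \<subseteq> {..<n} \<Longrightarrow> a (map E K @ vs) = 0" for K vs
  proof (induction vs arbitrary: K)
    case Nil then show ?case using z' by simp
  next
    case (Cons v vs)
    have "a (map E K @ E i # vs) = 0" if "i < n" for i
      using Cons.IH[of "K @ [i]"] Cons.prems that by simp
    then show ?case by (subst ext_T_expand_arg[OF a]) simp
  qed
  from this[of "[]"] show "a vs = 0" for vs by simp
qed

lemma ext_T_eqI:
  assumes "a \<in> ext_T" "b \<in> ext_T" "\<And>K. K \<in> idx n \<Longrightarrow> a (map E K) = b (map E K)"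
  shows "a = b"
proof -
  have "(\<lambda>vs. a vs - b vs) = (\<lambda>_. 0)"
    by (rule ext_T_eq_0I) (use assms in \<open>auto intro: ext_T_minus\<close>)
  then show ?thesis by (metis eq_iff_diff_eq_0 ext)
qed

lemma lincomb_ebas_frame:
  "J \<in> idx n \<Longrightarrow> (\<Sum>K\<in>idx n. c K * ebas K (map E J)) = c J"
  by (subst sum.cong[OF refl, where h = "\<lambda>K. if K = J then c K else 0"]) (auto simp: ebas_frame)

lemma ext_T_expand:
  assumes a: "a \<in> ext_T"
  shows "a vs = (\<Sum>K\<in>idx n. a (map E K) * ebas K vs)"
proof -
  have "a = (\<lambda>vs. \<Sum>K\<in>idx n. a (map E K) * ebas K vs)"
    by (rule ext_T_eqI[OF a]) (auto intro!: ext_T_sum ext_T_scaled ebas_ext_T simp: lincomb_ebas_frame)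
  then show ?thesis by metis
qed

lemma ext_T_lincomb: "(\<lambda>vs. \<Sum>K\<in>idx n. c K * ebas K vs) \<in> ext_T"
  by (intro ext_T_sum ext_T_scaled ebas_ext_T)

lemma ip_add: "ip (\<lambda>vs. a vs + b vs) c = ip a c + ip b c" "ip c (\<lambda>vs. a vs + b vs) = ip c a + ip c b"
  by (simp_all add: ip_def algebra_simps sum.distrib)

lemma ip_scale: "ip (\<lambda>vs. r * a vs) c = r * ip a c" "ip c (\<lambda>vs. r * a vs) = r * ip c a"
  by (simp_all add: ip_def algebra_simps sum_distrib_left)

lemma ip_sym: "ip a b = ip b a"
  by (simp add: ip_def mult.commute)

lemma ip_pos: "a \<in> ext_T \<Longrightarrow> ip a a = 0 \<Longrightarrow> a = (\<lambda>_. 0)"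
  by (rule ext_T_eq_0I) (auto simp: ip_def sum_nonneg_eq_0_iff)

text \<open>By symmetry of the Gram determinant the frame coefficients of the decomposable form are
  the values \<open>ebas K ws\<close>, so the inner product becomes the expansion of
  \<open>a\<close> evaluated at \<open>ws\<close>. When \<open>a\<close> is decomposable too, this
  is the determinant formula.\<close>

lemma ip_gram: "a \<in> ext_T \<Longrightarrow> ip a (gram_wedge UNIV g ws) = a ws"
proof -
  assume a: "a \<in> ext_T"
  have "gram_wedge UNIV g ws (map E K) = ebas K ws" for K
    unfolding ebas_def by (rule gram_wedge_sym[OF g_sym])
  then show ?thesis using ext_T_expand[OF a, of ws] by (simp add: ip_def)
qed

lemma ip_ebas: "K \<in> idx n \<Longrightarrow> ip a (ebas K) = a (map E K)" "K \<in> idx n \<Longrightarrow> ip (ebas K) a = a (map E K)"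
proof -
  assume K: "K \<in> idx n"
  have "ip a (ebas K) = (\<Sum>J\<in>idx n. if J = K then a (map E J) else 0)"
    unfolding ip_def by (rule sum.cong) (auto simp: ebas_frame K)
  then show "ip a (ebas K) = a (map E K)" using K by simp
  then show "ip (ebas K) a = a (map E K)" by (simp add: ip_sym)
qed

end

subsection \<open>Transposes and partial inverses\<close>

text \<open>The vectors are the functions in a set \<open>L\<close>, and all rules for
  \<open>B\<close> are restricted to \<open>L\<close>, as is the case for
  \<open>ext_gr_inner\<close>. Finite dimension enters only through the expansion in the finite
  family \<open>e\<close>.\<close>

locale fin_inner_space =
  fixes L :: "('w \<Rightarrow> real) set" and B :: "('w \<Rightarrow> real) \<Rightarrow> ('w \<Rightarrow> real) \<Rightarrow> real"
    and e :: "'i \<Rightarrow> 'w \<Rightarrow> real" and I :: "'i set"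
  assumes zero_in [simp]: "(\<lambda>_. 0) \<in> L"
    and add_in: "a \<in> L \<Longrightarrow> b \<in> L \<Longrightarrow> (\<lambda>w. a w + b w) \<in> L"
    and scale_in: "a \<in> L \<Longrightarrow> (\<lambda>w. r * a w) \<in> L"
    and B_add: "a \<in> L \<Longrightarrow> b \<in> L \<Longrightarrow> c \<in> L \<Longrightarrow> B (\<lambda>w. a w + b w) c = B a c + B b c"
    and B_scale: "a \<in> L \<Longrightarrow> c \<in> L \<Longrightarrow> B (\<lambda>w. r * a w) c = r * B a c"
    and B_sym: "a \<in> L \<Longrightarrow> b \<in> L \<Longrightarrow> B a b = B b a"
    and B_pos: "a \<in> L \<Longrightarrow> B a a = 0 \<Longrightarrow> a = (\<lambda>_. 0)"
    and fin: "finite I"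
    and e_in: "i \<in> I \<Longrightarrow> e i \<in> L"
    and expand: "a \<in> L \<Longrightarrow> a = (\<lambda>w. \<Sum>i\<in>I. B a (e i) * e i w)"
begin

lemma diff_in: "a \<in> L \<Longrightarrow> b \<in> L \<Longrightarrow> (\<lambda>w. a w - b w) \<in> L"
  using add_in[OF _ scale_in[of b "-1"], of a] by simp

lemma sum_in: "(\<And>j. j \<in> J \<Longrightarrow> f j \<in> L) \<Longrightarrow> (\<lambda>w. \<Sum>j\<in>J. c j * f j w) \<in> L"
  by (induction J rule: infinite_finite_induct) (simp_all add: add_in scale_in)

lemma B_zero: "c \<in> L \<Longrightarrow> B (\<lambda>_. 0) c = 0" "c \<in> L \<Longrightarrow> B c (\<lambda>_. 0) = 0"
  using B_scale[of "\<lambda>_. 0" c 0] B_sym[of c "\<lambda>_. 0"] by auto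

lemma B_add_right: "a \<in> L \<Longrightarrow> b \<in> L \<Longrightarrow> c \<in> L \<Longrightarrow> B c (\<lambda>w. a w + b w) = B c a + B c b"
  by (simp add: B_add B_sym[of c] add_in)

lemma B_scale_right: "a \<in> L \<Longrightarrow> c \<in> L \<Longrightarrow> B c (\<lambda>w. r * a w) = r * B c a"
  by (simp add: B_scale B_sym[of c] scale_in)

lemma B_diff: "a \<in> L \<Longrightarrow> b \<in> L \<Longrightarrow> c \<in> L \<Longrightarrow> B (\<lambda>w. a w - b w) c = B a c - B b c"
  using B_add[of a "\<lambda>w. -1 * b w" c] B_scale[of b c "-1"] scale_in[of b "-1"] by simp

lemma B_sum: "(\<And>j. j \<in> J \<Longrightarrow> f j \<in> L) \<Longrightarrow> c \<in> L \<Longrightarrow> B (\<lambda>w. \<Sum>j\<in>J. r j * f j w) c = (\<Sum>j\<in>J. r j * B (f j) c)"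
  by (induction J rule: infinite_finite_induct) (simp_all add: B_zero B_add scale_in sum_in B_scale)

lemma B_sum_right: "(\<And>j. j \<in> J \<Longrightarrow> f j \<in> L) \<Longrightarrow> c \<in> L \<Longrightarrow> B c (\<lambda>w. \<Sum>j\<in>J. r j * f j w) = (\<Sum>j\<in>J. r j * B c (f j))"
  using B_sum[of J f c r] by (simp add: B_sym[of c] sum_in)

lemma B_eqI:
  assumes "a \<in> L" "b \<in> L" "\<And>c. c \<in> L \<Longrightarrow> B a c = B b c"
  shows "a = b"
proof -
  have "(\<lambda>w. a w - b w) = (\<lambda>_. 0)"
    using assms by (intro B_pos diff_in) (simp_all add: B_diff diff_in)
  then show ?thesis by (metis eq_iff_diff_eq_0 ext)
qed

definition lspan :: "('j \<Rightarrow> 'w \<Rightarrow> real) \<Rightarrow> 'j set \<Rightarrow> ('w \<Rightarrow> real) set" where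
  "lspan u J = range (\<lambda>c w. \<Sum>j\<in>J. c j * u j w)"

text \<open>Gram-Schmidt by induction on the spanning family: \<open>b\<close> and the new vector
  \<open>u k\<close> are projected onto the old span, and the projection of \<open>b\<close> is then
  corrected along the residual \<open>r\<close> of \<open>u k\<close>.\<close>

lemma ex_projection:
  assumes "finite J" "\<And>j. j \<in> J \<Longrightarrow> u j \<in> L" "b \<in> L"
  shows "\<exists>p\<in>lspan u J. \<forall>j\<in>J. B (\<lambda>w. b w - p w) (u j) = 0"
  using assms
proof (induction J arbitrary: b rule: finite_induct)
  case empty then show ?case by (auto simp: lspan_def)
next
  case (insert k J)
  have uL: "u j \<in> L" if "j \<in> J" for j using insert.prems(1) that by simp
  have uk: "u k \<in> L" using insert.prems(1) by simp
  obtain c where p: "\<forall>j\<in>J. B (\<lambda>w. b w - (\<Sum>j\<in>J. c j * u j w)) (u j) = 0"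
    using insert.IH[OF uL insert.prems(2)] by (auto simp: lspan_def)
  obtain d where q: "\<forall>j\<in>J. B (\<lambda>w. u k w - (\<Sum>j\<in>J. d j * u j w)) (u j) = 0"
    using insert.IH[OF uL uk] by (auto simp: lspan_def)
  define P where "P = (\<lambda>w. \<Sum>j\<in>J. c j * u j w)"
  define Q where "Q = (\<lambda>w. \<Sum>j\<in>J. d j * u j w)"
  define r where "r = (\<lambda>w. u k w - Q w)"
  have PL: "P \<in> L" and QL: "Q \<in> L" unfolding P_def Q_def by (auto intro!: sum_in uL)
  have rL: "r \<in> L" unfolding r_def by (intro diff_in uk QL)
  have bP: "(\<lambda>w. b w - P w) \<in> L" by (intro diff_in insert.prems PL)
  have ru: "B r (u j) = 0" if "j \<in> J" for j using q that by (simp add: r_def Q_def)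
  have bu: "B (\<lambda>w. b w - P w) (u j) = 0" if "j \<in> J" for j using p that by (simp add: P_def)
  \<comment> \<open>If \<open>r\<close> has length 0, then \<open>u k\<close> already lies in the
    old span and no correction is made.\<close>
  define s where "s = (if B r r = 0 then 0 else B (\<lambda>w. b w - P w) r / B r r)"
  define c' where "c' = (\<lambda>j. if j = k then s else c j - s * d j)"
  have eq: "(\<Sum>j\<in>insert k J. c' j * u j w) = P w + s * r w" for w
  proof -
    have "(\<Sum>j\<in>J. c' j * u j w) = (\<Sum>j\<in>J. (c j - s * d j) * u j w)"
      using insert.hyps by (intro sum.cong) (auto simp: c'_def)
    then show ?thesis using insert.hyps
      by (simp add: c'_def P_def Q_def r_def algebra_simps sum_subtractf sum_distrib_left)
  qed
  have R: "(\<lambda>w. b w - (P w + s * r w)) = (\<lambda>w. (\<lambda>w. b w - P w) w - (\<lambda>w. s * r w) w)" by (simp add: fun_eq_iff)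
  have o: "B (\<lambda>w. b w - (P w + s * r w)) c = B (\<lambda>w. b w - P w) c - s * B r c" if "c \<in> L" for c
    unfolding R by (subst B_diff) (use that bP rL in \<open>auto simp: scale_in B_scale\<close>)
  have oJ: "B (\<lambda>w. b w - (P w + s * r w)) (u j) = 0" if "j \<in> J" for j
    using o[OF uL[OF that]] ru[OF that] bu[OF that] by simp
  have oL: "(\<lambda>w. b w - (P w + s * r w)) \<in> L" by (intro diff_in add_in scale_in insert.prems PL rL)
  have "B (\<lambda>w. b w - (P w + s * r w)) r = 0"
  proof (cases "B r r = 0")
    case True
    then have "r = (\<lambda>_. 0)" using B_pos rL by blast
    then show ?thesis using B_zero(2)[OF oL] by simp
  next
    case False then show ?thesis unfolding o[OF rL] by (simp add: s_def)
  qed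
  moreover have "B (\<lambda>w. b w - (P w + s * r w)) Q = 0"
    unfolding Q_def by (subst B_sum_right) (auto simp: uL oL oJ)
  moreover have "u k = (\<lambda>w. r w + Q w)" by (simp add: r_def)
  ultimately have "B (\<lambda>w. b w - (P w + s * r w)) (u k) = 0"
    using B_add_right[OF rL QL oL] by simp
  then show ?case using oJ eq
    by (intro bexI[of _ "\<lambda>w. P w + s * r w"]) (auto simp: lspan_def fun_eq_iff intro!: image_eqI[of _ _ c'])
qed

lemma lspan_orth:
  assumes "finite J" "\<And>j. j \<in> J \<Longrightarrow> u j \<in> L" "b \<in> L" "\<And>j. j \<in> J \<Longrightarrow> B b (u j) = 0" "w \<in> lspan u J"
  shows "B b w = 0"
proof -
  obtain c where "w = (\<lambda>x. \<Sum>j\<in>J. c j * u j x)" using assms(5) by (auto simp: lspan_def)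
  then show ?thesis using assms(4) by (simp add: B_sum_right[OF assms(2,3)])
qed

lemma lspan_in: "(\<And>j. j \<in> J \<Longrightarrow> u j \<in> L) \<Longrightarrow> lspan u J \<subseteq> L"
  by (auto simp: lspan_def intro: sum_in)

end

section \<open>Transpose and partial inverse of a linear map\<close>

locale fin_inner_map = fin_inner_space L B e I
  for L :: "('w \<Rightarrow> real) set" and B and e :: "'i \<Rightarrow> 'w \<Rightarrow> real" and I +
  fixes T :: "('w \<Rightarrow> real) \<Rightarrow> 'w \<Rightarrow> real"
  assumes T_in: "a \<in> L \<Longrightarrow> T a \<in> L"
    and T_add: "a \<in> L \<Longrightarrow> b \<in> L \<Longrightarrow> T (\<lambda>w. a w + b w) = (\<lambda>w. T a w + T b w)"
    and T_scale: "a \<in> L \<Longrightarrow> T (\<lambda>w. r * a w) = (\<lambda>w. r * T a w)"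
begin

abbreviation "tr \<equiv> transpose_on L B T"
abbreviation "pinv \<equiv> partial_inverse L B T"

lemma T_zero: "T (\<lambda>_. 0) = (\<lambda>_. 0)"
  using T_scale[of "\<lambda>_. 0" 0] by simp

lemma T_diff: "a \<in> L \<Longrightarrow> b \<in> L \<Longrightarrow> T (\<lambda>w. a w - b w) = (\<lambda>w. T a w - T b w)"
  using T_add[of a "\<lambda>w. -1 * b w"] T_scale[of b "-1"] scale_in[of b "-1"] by simp

lemma T_sum: "(\<And>j. j \<in> J \<Longrightarrow> f j \<in> L) \<Longrightarrow> T (\<lambda>w. \<Sum>j\<in>J. c j * f j w) = (\<lambda>w. \<Sum>j\<in>J. c j * T (f j) w)"
  by (induction J rule: infinite_finite_induct) (simp_all add: T_zero T_add scale_in sum_in T_scale)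

lemma tr_unique:
  assumes "b \<in> L" "c \<in> L" "\<And>a. a \<in> L \<Longrightarrow> B (T a) b = B a c"
  shows "tr b = c"
  unfolding transpose_on_def
proof (rule the_equality)
  show "c \<in> L \<and> (\<forall>a\<in>L. B (T a) b = B a c)" using assms by blast
  fix d assume d: "d \<in> L \<and> (\<forall>a\<in>L. B (T a) b = B a d)"
  show "d = c" by (rule B_eqI) (use d assms in \<open>auto simp: B_sym\<close>)
qed

lemma tr_formula:
  assumes b: "b \<in> L"
  shows "tr b = (\<lambda>w. \<Sum>i\<in>I. B (T (e i)) b * e i w)"
proof (rule tr_unique[OF b])
  show "(\<lambda>w. \<Sum>i\<in>I. B (T (e i)) b * e i w) \<in> L" by (intro sum_in e_in)
  fix a assume a: "a \<in> L"
  have "B (T a) b = B (T (\<lambda>w. \<Sum>i\<in>I. B a (e i) * e i w)) b" using expand[OF a] by simp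
  also have "\<dots> = (\<Sum>i\<in>I. B a (e i) * B (T (e i)) b)"
    by (simp add: T_sum e_in B_sum T_in b)
  also have "\<dots> = B a (\<lambda>w. \<Sum>i\<in>I. B (T (e i)) b * e i w)"
    by (subst B_sum_right) (auto simp: e_in a mult.commute)
  finally show "B (T a) b = B a (\<lambda>w. \<Sum>i\<in>I. B (T (e i)) b * e i w)" .
qed

lemma tr_in: "b \<in> L \<Longrightarrow> tr b \<in> L"
  by (simp add: tr_formula sum_in e_in)

lemma tr_adj: "a \<in> L \<Longrightarrow> b \<in> L \<Longrightarrow> B (T a) b = B a (tr b)"
proof -
  assume a: "a \<in> L" and b: "b \<in> L"
  have "B (T a) b = B (T (\<lambda>w. \<Sum>i\<in>I. B a (e i) * e i w)) b" using expand[OF a] by simp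
  also have "\<dots> = (\<Sum>i\<in>I. B a (e i) * B (T (e i)) b)"
    by (simp add: T_sum e_in B_sum T_in b)
  also have "\<dots> = B a (\<lambda>w. \<Sum>i\<in>I. B (T (e i)) b * e i w)"
    by (subst B_sum_right) (auto simp: e_in a mult.commute)
  finally show ?thesis using b by (simp add: tr_formula)
qed

lemma tr_add: "a \<in> L \<Longrightarrow> b \<in> L \<Longrightarrow> tr (\<lambda>w. a w + b w) = (\<lambda>w. tr a w + tr b w)"
  by (rule tr_unique) (simp_all add: add_in tr_in B_add_right tr_adj T_in)

lemma tr_scale: "a \<in> L \<Longrightarrow> tr (\<lambda>w. r * a w) = (\<lambda>w. r * tr a w)"
  by (rule tr_unique) (simp_all add: scale_in tr_in B_scale_right tr_adj T_in)

lemma image_lspan: "T ` L = lspan (\<lambda>i. T (e i)) I"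
proof safe
  fix a assume a: "a \<in> L"
  have "T a = T (\<lambda>w. \<Sum>i\<in>I. B a (e i) * e i w)" using expand[OF a] by simp
  then show "T a \<in> lspan (\<lambda>i. T (e i)) I" by (simp add: T_sum e_in lspan_def)
next
  fix b assume "b \<in> lspan (\<lambda>i. T (e i)) I"
  then obtain c where "b = (\<lambda>w. \<Sum>i\<in>I. c i * T (e i) w)" by (auto simp: lspan_def)
  then have "b = T (\<lambda>w. \<Sum>i\<in>I. c i * e i w)" by (simp add: T_sum e_in)
  then show "b \<in> T ` L" using sum_in[of I e c] e_in by auto
qed

lemma orth_proj_props:
  assumes b: "b \<in> L"
  shows "orth_proj (T ` L) B b \<in> T ` L" "\<And>a. a \<in> L \<Longrightarrow> B (orth_proj (T ` L) B b) (T a) = B b (T a)"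
proof -
  obtain p where p: "p \<in> T ` L" "\<forall>i\<in>I. B (\<lambda>w. b w - p w) (T (e i)) = 0"
    using ex_projection[OF fin, of "\<lambda>i. T (e i)" b] b T_in e_in unfolding image_lspan by auto
  then have pL: "p \<in> L" using T_in by auto
  have p2: "B p w = B b w" if "w \<in> T ` L" for w
  proof -
    have "B (\<lambda>w. b w - p w) w = 0"
      by (rule lspan_orth[OF fin, of "\<lambda>i. T (e i)"]) (use that p b pL in \<open>auto simp: image_lspan[symmetric] T_in e_in diff_in\<close>)
    moreover have "w \<in> L" using that T_in by auto
    ultimately show ?thesis using B_diff b pL by simp
  qed
  have "orth_proj (T ` L) B b = p" unfolding orth_proj_def
  proof (rule the_equality)
    show "p \<in> T ` L \<and> (\<forall>w\<in>T ` L. B p w = B b w)" using p p2 by blast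
    fix q assume q: "q \<in> T ` L \<and> (\<forall>w\<in>T ` L. B q w = B b w)"
    then obtain a c where ac: "a \<in> L" "c \<in> L" "q = T a" "p = T c" using p by auto
    then have qL: "q \<in> L" using T_in by simp
    have dT: "(\<lambda>w. q w - p w) = T (\<lambda>w. a w - c w)" using ac by (simp add: T_diff)
    then have "(\<lambda>w. q w - p w) \<in> T ` L" using ac diff_in by blast
    then have "B q (\<lambda>w. q w - p w) = B p (\<lambda>w. q w - p w)" using q p2 by metis
    then have "B (\<lambda>w. q w - p w) (\<lambda>w. q w - p w) = 0"
      using B_diff[OF qL pL] diff_in[OF qL pL] by simp
    then have "(\<lambda>w. q w - p w) = (\<lambda>_. 0)" using B_pos diff_in[OF qL pL] by blast
    then show "q = p" by (metis eq_iff_diff_eq_0 ext)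
  qed
  then show "orth_proj (T ` L) B b \<in> T ` L" "\<And>a. a \<in> L \<Longrightarrow> B (orth_proj (T ` L) B b) (T a) = B b (T a)"
    using p p2 by auto
qed

lemma pinv_ex1:
  assumes b: "b \<in> L"
  shows "\<exists>!a. a \<in> L \<and> (\<forall>k\<in>L. T k = (\<lambda>_. 0) \<longrightarrow> B a k = 0) \<and> T a = orth_proj (T ` L) B b"
proof (rule ex_ex1I)
  obtain a0 where a0: "a0 \<in> L" "T a0 = orth_proj (T ` L) B b" using orth_proj_props(1)[OF b] by auto
  \<comment> \<open>The vectors \<open>tr (e i)\<close> span the orthogonal complement of the
    kernel. Projecting the preimage \<open>a0\<close> onto this span changes it by an element of the
    kernel, because pairing the difference with \<open>tr (e i)\<close> amounts to pairing its image
    with \<open>e i\<close>.\<close>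
  obtain a where a: "a \<in> lspan (\<lambda>i. tr (e i)) I" "\<forall>i\<in>I. B (\<lambda>w. a0 w - a w) (tr (e i)) = 0"
    using ex_projection[OF fin, of "\<lambda>i. tr (e i)" a0] a0 tr_in e_in by auto
  have aL: "a \<in> L" using a(1) lspan_in[of I "\<lambda>i. tr (e i)"] tr_in e_in by auto
  have "B (T (\<lambda>w. a0 w - a w)) (e i) = 0" if "i \<in> I" for i
    using a that tr_adj[OF diff_in[OF a0(1) aL] e_in[OF that]] by simp
  then have "T (\<lambda>w. a0 w - a w) = (\<lambda>_. 0)"
    by (subst expand[OF T_in[OF diff_in[OF a0(1) aL]]]) simp
  then have "T a0 = T a" using T_diff[OF a0(1) aL] by (metis eq_iff_diff_eq_0 ext)
  moreover have "B a k = 0" if "k \<in> L" "T k = (\<lambda>_. 0)" for k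
  proof -
    have "B k a = 0"
      by (rule lspan_orth[OF fin, of "\<lambda>i. tr (e i)"])
        (use that a tr_in e_in tr_adj[of k] B_zero in \<open>auto simp: tr_adj[symmetric]\<close>)
    then show ?thesis using that aL B_sym by simp
  qed
  ultimately show "\<exists>a. a \<in> L \<and> (\<forall>k\<in>L. T k = (\<lambda>_. 0) \<longrightarrow> B a k = 0) \<and> T a = orth_proj (T ` L) B b"
    using aL a0 by auto
next
  fix a c assume a: "a \<in> L \<and> (\<forall>k\<in>L. T k = (\<lambda>_. 0) \<longrightarrow> B a k = 0) \<and> T a = orth_proj (T ` L) B b"
    and c: "c \<in> L \<and> (\<forall>k\<in>L. T k = (\<lambda>_. 0) \<longrightarrow> B c k = 0) \<and> T c = orth_proj (T ` L) B b"
  then have "T (\<lambda>w. a w - c w) = (\<lambda>_. 0)" by (simp add: T_diff)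
  then have "B (\<lambda>w. a w - c w) (\<lambda>w. a w - c w) = 0"
    using a c by (subst B_diff) (auto simp: diff_in)
  then have "(\<lambda>w. a w - c w) = (\<lambda>_. 0)" using a c B_pos diff_in by blast
  then show "a = c" by (metis eq_iff_diff_eq_0 ext)
qed

lemma pinv_props:
  assumes b: "b \<in> L"
  shows "pinv b \<in> L" "\<And>k. k \<in> L \<Longrightarrow> T k = (\<lambda>_. 0) \<Longrightarrow> B (pinv b) k = 0"
    "\<And>a. a \<in> L \<Longrightarrow> B (T (pinv b)) (T a) = B b (T a)"
  using theI'[OF pinv_ex1[OF b]] orth_proj_props[OF b] unfolding partial_inverse_def by auto

text \<open>A characterisation by inner products alone: orthogonality to the kernel and the normal
  equations. In this form linearity and preservation of weights are easy to verify, and an isometry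
  carries it over.\<close>

lemma pinv_unique:
  assumes b: "b \<in> L" and a: "a \<in> L" "\<And>k. k \<in> L \<Longrightarrow> T k = (\<lambda>_. 0) \<Longrightarrow> B a k = 0"
    "\<And>c. c \<in> L \<Longrightarrow> B (T a) (T c) = B b (T c)"
  shows "pinv b = a"
proof -
  note p = pinv_props[OF b]
  have d: "(\<lambda>w. pinv b w - a w) \<in> L" using p a diff_in by blast
  have "B (T (\<lambda>w. pinv b w - a w)) (T (\<lambda>w. pinv b w - a w)) = 0"
    using p(3)[OF d] a(3)[OF d] p(1) a(1) d by (subst T_diff) (auto simp: B_diff T_in)
  then have "T (\<lambda>w. pinv b w - a w) = (\<lambda>_. 0)" using B_pos T_in d by blast
  then have "B (\<lambda>w. pinv b w - a w) (\<lambda>w. pinv b w - a w) = 0"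
    using p(2)[OF d] a(2)[OF d] p(1) a(1) d by (simp add: B_diff)
  then have "(\<lambda>w. pinv b w - a w) = (\<lambda>_. 0)" using B_pos d by blast
  then show ?thesis by (metis eq_iff_diff_eq_0 ext)
qed

lemma pinv_add: "a \<in> L \<Longrightarrow> b \<in> L \<Longrightarrow> pinv (\<lambda>w. a w + b w) = (\<lambda>w. pinv a w + pinv b w)"
  by (rule pinv_unique) (simp_all add: add_in pinv_props B_add T_add T_in)

lemma pinv_scale: "a \<in> L \<Longrightarrow> pinv (\<lambda>w. r * a w) = (\<lambda>w. r * pinv a w)"
  by (rule pinv_unique) (simp_all add: scale_in pinv_props B_scale T_scale T_in)

text \<open>The difference of \<open>T (pinv b)\<close> and \<open>b\<close> is orthogonal to the
  image of \<open>T\<close>, hence killed by the transpose. Consequently the transpose vanishes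
  wherever the partial inverse does.\<close>

lemma tr_T_pinv: "b \<in> L \<Longrightarrow> tr (T (pinv b)) = tr b"
  by (rule tr_unique) (simp_all add: T_in pinv_props tr_in tr_adj[symmetric] B_sym[of _ "T (pinv b)"] B_sym[of _ b])

lemma T_pinv_T: "a \<in> L \<Longrightarrow> T (pinv (T a)) = T a"
proof -
  assume a: "a \<in> L"
  have p: "pinv (T a) \<in> L" by (simp add: pinv_props T_in a)
  let ?d = "\<lambda>w. pinv (T a) w - a w"
  have d: "?d \<in> L" by (intro diff_in p a)
  have "B (T ?d) (T ?d) = 0"
    using pinv_props(3)[OF T_in[OF a] d] p a d by (subst T_diff) (simp_all add: B_diff T_in)
  then have "T ?d = (\<lambda>_. 0)" using B_pos T_in d by blast
  then show ?thesis using T_diff[OF p a] by (metis eq_iff_diff_eq_0 ext)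
qed

lemma pinv_T_fixed:
  assumes a: "a \<in> L" "\<And>k. k \<in> L \<Longrightarrow> T k = (\<lambda>_. 0) \<Longrightarrow> B a k = 0"
  shows "pinv (T a) = a"
  by (rule pinv_unique) (use a in \<open>simp_all add: T_in\<close>)

lemma pinv_T_pinv: "b \<in> L \<Longrightarrow> pinv (T (pinv b)) = pinv b"
  by (rule pinv_T_fixed) (simp_all add: pinv_props)

lemma pinv_T_tr: "b \<in> L \<Longrightarrow> pinv (T (tr b)) = tr b"
proof (rule pinv_T_fixed)
  assume b: "b \<in> L"
  then show "tr b \<in> L" by (rule tr_in)
  show "B (tr b) k = 0" if "k \<in> L" "T k = (\<lambda>_. 0)" for k
    using tr_adj[OF that(1) b] that b B_zero B_sym tr_in by simp
qed

end

text \<open>If \<open>T\<close> squares to zero, its image lies in its kernel, to which all values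
  of the transpose and of the partial inverse are orthogonal; this makes the three products below
  vanish.\<close>

locale fin_inner_differential = fin_inner_map +
  assumes T_T: "a \<in> L \<Longrightarrow> T (T a) = (\<lambda>_. 0)"
begin

lemma tr_pinv: "b \<in> L \<Longrightarrow> tr (pinv b) = (\<lambda>_. 0)"
  by (rule tr_unique) (auto simp: pinv_props B_zero T_in T_T B_sym[of _ "pinv b"])

lemma tr_tr: "b \<in> L \<Longrightarrow> tr (tr b) = (\<lambda>_. 0)"
  by (rule tr_unique) (simp_all add: tr_in B_zero T_in T_T tr_adj[symmetric])

lemma pinv_pinv: "b \<in> L \<Longrightarrow> pinv (pinv b) = (\<lambda>_. 0)"
  by (rule pinv_unique) (auto simp: pinv_props B_zero T_zero T_in T_T)

end

subsection \<open>Alternating sums over sublists\<close>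

text \<open>List entries have a type of their own: they are vectors when a form is evaluated in a
  chart and indices of vector fields in Cartan's formula. \<open>v\<close> tells which vector an
  entry contributes as an argument, while \<open>A\<close> sees the entry itself.\<close>

definition altsum1 :: "('v \<Rightarrow> 'e list \<Rightarrow> real) \<Rightarrow> ('v \<Rightarrow> 'e) \<Rightarrow> 'v list \<Rightarrow> real" where
  "altsum1 A v xs = (\<Sum>i<length xs. (-1) ^ i * A (xs ! i) (map v (nths xs (- {i}))))"

definition altsum2 :: "('v \<Rightarrow> 'v \<Rightarrow> 'e) \<Rightarrow> ('e list \<Rightarrow> real) \<Rightarrow> ('v \<Rightarrow> 'e) \<Rightarrow> 'v list \<Rightarrow> real" where
  "altsum2 C a v xs = (\<Sum>j<length xs. \<Sum>i<j.
     (-1) ^ (i + j) * a (C (xs ! i) (xs ! j) # map v (nths xs (- {i, j}))))"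

definition derivsum :: "('v \<Rightarrow> 'e) \<Rightarrow> ('e list \<Rightarrow> real) \<Rightarrow> ('v \<Rightarrow> 'e) \<Rightarrow> 'v list \<Rightarrow> real" where
  "derivsum f a v xs = (\<Sum>j<length xs. a ((map v xs)[j := f (xs ! j)]))"

lemma nths_Cons_0: "nths (x # xs) (- {0}) = xs"
  by (simp add: nths_Cons nths_all)

lemma nths_Cons_Suc: "nths (x # xs) (- {Suc i}) = x # nths xs (- {i})"
proof -
  have "{k. k \<noteq> i} = - {i}" by auto
  then show ?thesis by (simp add: nths_Cons)
qed

lemma nths_Cons_0_Suc: "nths (x # xs) (- {0, Suc j}) = nths xs (- {j})"
proof -
  have "{k. k \<noteq> j} = - {j}" by auto
  then show ?thesis by (simp add: nths_Cons)
qed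

lemma nths_Cons_Suc_Suc: "nths (x # xs) (- {Suc i, Suc j}) = x # nths xs (- {i, j})"
proof -
  have "{k. k \<noteq> i \<and> k \<noteq> j} = - {i, j}" by auto
  then show ?thesis by (simp add: nths_Cons)
qed

lemma altsum1_Nil [simp]: "altsum1 A v [] = 0"
  by (simp add: altsum1_def)

text \<open>Such recursions on the list replace the handling of positions and signs; the identities
  that follow are inductions over them.\<close>

lemma altsum1_Cons: "altsum1 A v (x # xs) = A x (map v xs) - altsum1 (\<lambda>u vs. A u (v x # vs)) v xs"
  unfolding altsum1_def
  by (simp add: sum.lessThan_Suc_shift nths_Cons_0 nths_Cons_Suc sum_negf del: sum.lessThan_Suc)

lemma altsum2_Nil [simp]: "altsum2 C a v [] = 0"
  by (simp add: altsum2_def)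

lemma derivsum_Nil [simp]: "derivsum f a v [] = 0"
  by (simp add: derivsum_def)

lemma derivsum_Cons: "derivsum f a v (x # xs) = a (f x # map v xs) + derivsum f (\<lambda>vs. a (v x # vs)) v xs"
  unfolding derivsum_def by (simp add: sum.lessThan_Suc_shift del: sum.lessThan_Suc)

lemma ext_T_tail: "a \<in> ext_T \<Longrightarrow> (\<lambda>vs. a (x # vs)) \<in> ext_T"
proof -
  assume a: "a \<in> ext_T"
  show ?thesis unfolding ext_T_iff
    using ext_T_add[OF a, of "x # us" for us] ext_T_scale[OF a, of "x # us" for us] ext_T_alt[OF a] by auto
qed

lemma ext_T_swap0: "a \<in> ext_T \<Longrightarrow> a (x # y # vs) = - a (y # x # vs)"
  using ext_T_swap[of a "[]" x y vs] by (simp only: append_Nil)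

text \<open>Pairs that contain the first entry make up the first sum. In the other pairs the bracket
  stands in front of \<open>v x\<close>, and moving it behind costs the second minus sign.\<close>

lemma altsum2_Cons:
  assumes "a \<in> ext_T"
  shows "altsum2 C a v (x # xs) =
    - altsum1 (\<lambda>y vs. a (C x y # vs)) v xs - altsum2 C (\<lambda>vs. a (v x # vs)) v xs"
proof -
  have "altsum2 C a v (x # xs) = (\<Sum>j<length xs. \<Sum>i<Suc j.
     (-1) ^ (i + Suc j) * a (C ((x # xs) ! i) (xs ! j) # map v (nths (x # xs) (- {i, Suc j}))))"
    unfolding altsum2_def length_Cons
    by (subst sum.lessThan_Suc_shift) (simp del: sum.lessThan_Suc)
  also have "\<dots> = (\<Sum>j<length xs. - ((-1) ^ j * a (C x (xs ! j) # map v (nths xs (- {j})))) +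
      (\<Sum>i<j. (-1) ^ (i + j) * a (C (xs ! i) (xs ! j) # v x # map v (nths xs (- {i, j})))))"
    by (rule sum.cong) (auto simp: sum.lessThan_Suc_shift nths_Cons_0_Suc nths_Cons_Suc_Suc simp del: sum.lessThan_Suc)
  also have "\<dots> = - altsum1 (\<lambda>y vs. a (C x y # vs)) v xs - altsum2 C (\<lambda>vs. a (v x # vs)) v xs"
  proof -
    have sw: "a (C p q # v x # vs) = - a (v x # C p q # vs)" for p q vs by (rule ext_T_swap0[OF assms])
    show ?thesis unfolding altsum1_def altsum2_def by (simp add: sw sum_negf sum_subtractf)
  qed
  finally show ?thesis .
qed

lemma altsum1_add: "altsum1 (\<lambda>u vs. A u vs + B u vs) v xs = altsum1 A v xs + altsum1 B v xs"
  by (simp add: altsum1_def algebra_simps sum.distrib)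

lemma altsum1_scale: "altsum1 (\<lambda>u vs. r * A u vs) v xs = r * altsum1 A v xs"
  by (simp add: altsum1_def algebra_simps sum_distrib_left)

lemma altsum1_minus: "altsum1 (\<lambda>u vs. - A u vs) v xs = - altsum1 A v xs"
  by (simp add: altsum1_def sum_negf)

lemma altsum2_add: "altsum2 C (\<lambda>vs. a vs + b vs) v xs = altsum2 C a v xs + altsum2 C b v xs"
  by (simp add: altsum2_def algebra_simps sum.distrib)

lemma altsum2_scale: "altsum2 C (\<lambda>vs. r * a vs) v xs = r * altsum2 C a v xs"
  by (simp add: altsum2_def algebra_simps sum_distrib_left)

lemma altsum2_minus: "altsum2 C (\<lambda>vs. - a vs) v xs = - altsum2 C a v xs"
  by (simp add: altsum2_def sum_negf)

text \<open>Moving \<open>f y\<close> from the front to the place of the omitted entry costs exactly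
  the sign \<open>(-1)^i\<close> of the alternating sum.\<close>

lemma altsum1_derivsum: "a \<in> ext_T \<Longrightarrow> altsum1 (\<lambda>y vs. a (f y # vs)) v xs = derivsum f a v xs"
proof (induction xs arbitrary: a)
  case Nil then show ?case by simp
next
  case (Cons x xs)
  have "altsum1 (\<lambda>y vs. a (f y # v x # vs)) v xs = - altsum1 (\<lambda>y vs. a (v x # f y # vs)) v xs"
    unfolding altsum1_minus[symmetric] by (subst ext_T_swap0[OF Cons.prems]) (rule refl)
  then show ?case
    using Cons.IH[OF ext_T_tail[OF Cons.prems, of "v x"]] by (simp add: altsum1_Cons derivsum_Cons)
qed

text \<open>Antisymmetry under adjacent exchanges is what inductions on the list deliver; equal
  entries are brought together by such exchanges.\<close>

lemma ext_TI_swap: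
  assumes add: "\<And>us vs x y. a (us @ (x + y) # vs) = a (us @ x # vs) + a (us @ y # vs)"
    and scale: "\<And>us vs r x. a (us @ (r *\<^sub>R x) # vs) = r * a (us @ x # vs)"
    and swap: "\<And>us x y vs. a (us @ x # y # vs) = - a (us @ y # x # vs)"
  shows "a \<in> ext_T"
  unfolding ext_T_iff
proof (intro conjI allI impI add scale)
  have adj: "a (us @ x # x # vs) = 0" for us x vs using swap[of us x x vs] by simp
  have "a (us @ x # ws @ x # vs) = 0" for us x ws vs
  proof (induction ws arbitrary: us)
    case Nil then show ?case by (simp add: adj)
  next
    case (Cons y ws)
    then show ?case using swap[of us x y "ws @ x # vs"] Cons.IH[of "us @ [y]"] by simp
  qed
  then show "a vs = 0" if "\<not> distinct vs" for vs
    using not_distinct_decomp[OF that] by auto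
qed

lemma altsum1_ext_T:
  assumes A: "\<And>u. A u \<in> ext_T" and Aadd: "\<And>u v ws. A (u + v) ws = A u ws + A v ws"
    and Ascale: "\<And>r u ws. A (r *\<^sub>R u) ws = r * A u ws"
  shows "altsum1 A (\<lambda>v. v) \<in> ext_T"
proof (rule ext_TI_swap)
  note tail = ext_T_tail
  show "altsum1 A (\<lambda>v. v) (us @ (x + y) # vs) = altsum1 A (\<lambda>v. v) (us @ x # vs) + altsum1 A (\<lambda>v. v) (us @ y # vs)" for us vs x y
    using assms
  proof (induction us arbitrary: A)
    case Nil
    then show ?case using ext_T_add[OF Nil(1), where us = "[]"] by (simp add: altsum1_Cons altsum1_add)
  next
    case (Cons u us)
    have "altsum1 (\<lambda>w vs. A w (u # vs)) (\<lambda>v. v) (us @ (x + y) # vs) =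
      altsum1 (\<lambda>w vs. A w (u # vs)) (\<lambda>v. v) (us @ x # vs) + altsum1 (\<lambda>w vs. A w (u # vs)) (\<lambda>v. v) (us @ y # vs)"
      by (rule Cons.IH) (simp_all add: tail Cons.prems)
    then show ?case using ext_T_add[OF Cons.prems(1)] by (simp add: altsum1_Cons)
  qed
  show "altsum1 A (\<lambda>v. v) (us @ (r *\<^sub>R x) # vs) = r * altsum1 A (\<lambda>v. v) (us @ x # vs)" for us vs r x
    using assms
  proof (induction us arbitrary: A)
    case Nil
    then show ?case using ext_T_scale[OF Nil(1), where us = "[]"] by (simp add: altsum1_Cons altsum1_scale algebra_simps)
  next
    case (Cons u us)
    have "altsum1 (\<lambda>w vs. A w (u # vs)) (\<lambda>v. v) (us @ (r *\<^sub>R x) # vs) =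
      r * altsum1 (\<lambda>w vs. A w (u # vs)) (\<lambda>v. v) (us @ x # vs)"
      by (rule Cons.IH) (simp_all add: tail Cons.prems)
    then show ?case using ext_T_scale[OF Cons.prems(1)] by (simp add: altsum1_Cons algebra_simps)
  qed
  show "altsum1 A (\<lambda>v. v) (us @ x # y # vs) = - altsum1 A (\<lambda>v. v) (us @ y # x # vs)" for us x y vs
    using assms
  proof (induction us arbitrary: A)
    case Nil
    have "(\<lambda>u vs. A u (x # y # vs)) = (\<lambda>u vs. - A u (y # x # vs))"
      by (intro ext) (rule ext_T_swap0[OF Nil(1)])
    then have "altsum1 (\<lambda>u vs. A u (x # y # vs)) (\<lambda>v. v) vs = - altsum1 (\<lambda>u vs. A u (y # x # vs)) (\<lambda>v. v) vs"
      by (simp only: altsum1_minus)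
    then show ?case by (simp add: altsum1_Cons)
  next
    case (Cons u us)
    have "altsum1 (\<lambda>w vs. A w (u # vs)) (\<lambda>v. v) (us @ x # y # vs) = - altsum1 (\<lambda>w vs. A w (u # vs)) (\<lambda>v. v) (us @ y # x # vs)"
      by (rule Cons.IH) (simp_all add: tail Cons.prems)
    then show ?case using ext_T_swap[OF Cons.prems(1)[of u], of us x y vs] by (simp add: altsum1_Cons)
  qed
qed

lemma derivsum_ext_T:
  assumes f: "linear f" and a: "a \<in> ext_T"
  shows "derivsum f a (\<lambda>v. v) \<in> ext_T"
proof -
  have "altsum1 (\<lambda>y vs. a (f y # vs)) (\<lambda>v. v) \<in> ext_T"
    using ext_T_add[OF a, of "[]"] ext_T_scale[OF a, of "[]"] f
    by (intro altsum1_ext_T ext_T_tail a) (simp_all add: linear_add linear_scale)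
  moreover have "altsum1 (\<lambda>y vs. a (f y # vs)) (\<lambda>v. v) = derivsum f a (\<lambda>v. v)"
    by (rule ext) (rule altsum1_derivsum[OF a])
  ultimately show ?thesis by simp
qed

lemma altsum2_ext_T:
  assumes bil: "bilinear C" and anti: "\<And>x y. C x y = - C y x" and a: "a \<in> ext_T"
  shows "altsum2 C a (\<lambda>v. v) \<in> ext_T"
proof (rule ext_TI_swap)
  let ?S = "\<lambda>a. altsum2 C a (\<lambda>v. v)"
  have lin: "linear (C x)" for x using bil by (simp add: bilinear_def)
  have part: "(\<lambda>xs. altsum1 (\<lambda>y vs. a (C u y # vs)) (\<lambda>v. v) xs) \<in> ext_T" if "a \<in> ext_T" for a u
    using derivsum_ext_T[OF lin that] by (simp add: altsum1_derivsum[OF that])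
  note c = altsum2_Cons altsum1_Cons
  show "?S a (us @ (x + y) # vs) = ?S a (us @ x # vs) + ?S a (us @ y # vs)" for us vs x y
    using a
  proof (induction us arbitrary: a)
    case Nil
    have "altsum1 (\<lambda>z vs. a (C (x + y) z # vs)) (\<lambda>v. v) vs =
       altsum1 (\<lambda>z vs. a (C x z # vs)) (\<lambda>v. v) vs + altsum1 (\<lambda>z vs. a (C y z # vs)) (\<lambda>v. v) vs"
      using ext_T_add[OF Nil, of "[]"] by (simp add: bilinear_ladd[OF bil] altsum1_add)
    moreover have "?S (\<lambda>vs. a ((x + y) # vs)) vs = ?S (\<lambda>vs. a (x # vs)) vs + ?S (\<lambda>vs. a (y # vs)) vs"
      using ext_T_add[OF Nil, of "[]"] by (simp add: altsum2_add)
    ultimately show ?case by (simp add: altsum2_Cons[OF Nil])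
  next
    case (Cons u us)
    from Cons.IH[OF ext_T_tail[OF Cons.prems, of u]] ext_T_add[OF part[OF Cons.prems, of u]]
    show ?case by (simp add: altsum2_Cons[OF Cons.prems])
  qed
  show "?S a (us @ (r *\<^sub>R x) # vs) = r * ?S a (us @ x # vs)" for us vs r x
    using a
  proof (induction us arbitrary: a)
    case Nil
    have "altsum1 (\<lambda>z vs. a (C (r *\<^sub>R x) z # vs)) (\<lambda>v. v) vs = r * altsum1 (\<lambda>z vs. a (C x z # vs)) (\<lambda>v. v) vs"
      using ext_T_scale[OF Nil, of "[]"] by (simp add: bilinear_lmul[OF bil] altsum1_scale)
    moreover have "?S (\<lambda>vs. a ((r *\<^sub>R x) # vs)) vs = r * ?S (\<lambda>vs. a (x # vs)) vs"
      using ext_T_scale[OF Nil, of "[]"] by (simp add: altsum2_scale)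
    ultimately show ?case by (simp add: altsum2_Cons[OF Nil] algebra_simps)
  next
    case (Cons u us)
    from Cons.IH[OF ext_T_tail[OF Cons.prems, of u]] ext_T_scale[OF part[OF Cons.prems, of u]]
    show ?case by (simp add: altsum2_Cons[OF Cons.prems] algebra_simps)
  qed
  show "?S a (us @ x # y # vs) = - ?S a (us @ y # x # vs)" for us x y vs
    using a
  proof (induction us arbitrary: a)
    case Nil
    have 1: "a (C x y # vs) = - a (C y x # vs)"
      using ext_T_minus_arg[OF Nil, of "[]"] by (simp add: anti[of x y])
    have 2: "?S (\<lambda>vs. a (x # y # vs)) vs = - ?S (\<lambda>vs. a (y # x # vs)) vs"
    proof -
      have "(\<lambda>vs. a (x # y # vs)) = (\<lambda>vs. - a (y # x # vs))" by (intro ext) (rule ext_T_swap0[OF Nil])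
      then show ?thesis by (simp only: altsum2_minus)
    qed
    have 3: "altsum1 (\<lambda>z vs. a (C u z # v # vs)) (\<lambda>v. v) vs = - altsum1 (\<lambda>z vs. a (v # C u z # vs)) (\<lambda>v. v) vs" for u v
    proof -
      have "(\<lambda>z vs. a (C u z # v # vs)) = (\<lambda>z vs. - a (v # C u z # vs))" by (intro ext) (rule ext_T_swap0[OF Nil])
      then show ?thesis by (simp only: altsum1_minus)
    qed
    show ?case
      by (simp add: altsum2_Cons[OF Nil] altsum2_Cons[OF ext_T_tail[OF Nil]] altsum1_Cons 1 2 3)
  next
    case (Cons u us)
    from Cons.IH[OF ext_T_tail[OF Cons.prems, of u]] ext_T_swap[OF part[OF Cons.prems, of u], of us x y vs]
    show ?case by (simp add: altsum2_Cons[OF Cons.prems])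
  qed
qed

text \<open>The sign bookkeeping behind both Cartan's formula and the naturality of the exterior
  derivative: an entry of the list carries a direction \<open>u\<close>, a vector \<open>v\<close> and the derivative
  \<open>\<delta>\<close> of a vector field with value \<open>v\<close>.\<close>

lemma altsum_commutator:
  assumes "a \<in> ext_T"
  shows "(\<Sum>i<length xs. (-1) ^ i * derivsum (\<lambda>y. \<delta> y (u (xs ! i))) a v (nths xs (- {i})))
    = - altsum2 (\<lambda>x y. \<delta> y (u x) - \<delta> x (u y)) a v xs"
  using assms
proof (induction xs arbitrary: a)
    case Nil then show ?case by simp
  next
    case (Cons x xs)
    have "(\<Sum>i<length (x # xs). (-1) ^ i * derivsum (\<lambda>y. \<delta> y (u ((x # xs) ! i))) a v (nths (x # xs) (- {i})))
      = derivsum (\<lambda>y. \<delta> y (u x)) a v xs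
        - (\<Sum>i<length xs. (-1) ^ i * derivsum (\<lambda>y. \<delta> y (u (xs ! i))) a v (x # nths xs (- {i})))"
      by (simp add: sum.lessThan_Suc_shift nths_Cons_0 nths_Cons_Suc sum_negf del: sum.lessThan_Suc)
    also have "\<dots> = altsum1 (\<lambda>y vs. a (\<delta> y (u x) # vs)) v xs
        - altsum1 (\<lambda>y vs. a (\<delta> x (u y) # vs)) v xs
        - (\<Sum>i<length xs. (-1) ^ i * derivsum (\<lambda>y. \<delta> y (u (xs ! i))) (\<lambda>vs. a (v x # vs)) v (nths xs (- {i})))"
    proof -
      have "derivsum (\<lambda>y. \<delta> y (u x)) a v xs = altsum1 (\<lambda>y vs. a (\<delta> y (u x) # vs)) v xs"
        by (rule altsum1_derivsum[OF Cons.prems, symmetric])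
      moreover have "(\<Sum>i<length xs. (-1) ^ i * derivsum (\<lambda>y. \<delta> y (u (xs ! i))) a v (x # nths xs (- {i})))
        = altsum1 (\<lambda>y vs. a (\<delta> x (u y) # vs)) v xs
        + (\<Sum>i<length xs. (-1) ^ i * derivsum (\<lambda>y. \<delta> y (u (xs ! i))) (\<lambda>vs. a (v x # vs)) v (nths xs (- {i})))"
        by (simp add: derivsum_Cons distrib_left sum.distrib altsum1_def)
      ultimately show ?thesis by simp
    qed
    also have "\<dots> = altsum1 (\<lambda>y vs. a (\<delta> y (u x) # vs) + - a (\<delta> x (u y) # vs)) v xs
        + altsum2 (\<lambda>x y. \<delta> y (u x) - \<delta> x (u y)) (\<lambda>vs. a (v x # vs)) v xs"
      unfolding Cons.IH[OF ext_T_tail[OF Cons.prems, of "v x"]] altsum1_add altsum1_minus by simp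
    also have "\<dots> = - altsum2 (\<lambda>x y. \<delta> y (u x) - \<delta> x (u y)) a v (x # xs)"
      using ext_T_diff_arg[OF Cons.prems, of "[]"] by (simp add: altsum2_Cons[OF Cons.prems])
    finally show ?case .
  qed

subsection \<open>The osculating algebra in an adapted frame\<close>

text \<open>The three operators on a single fibre, which is where their algebra takes place.\<close>

definition d0_at :: "('m, 'e::euclidean_space) filtered_space \<Rightarrow> 'm \<Rightarrow> ('e list \<Rightarrow> real) \<Rightarrow> 'e list \<Rightarrow> real" where
  "d0_at M x a = Phi_inv M x (chevalley_eilenberg M x (Phi M x a))"

definition h_at :: "('m, 'e::euclidean_space) filtered_space \<Rightarrow> 'm \<Rightarrow> ('e list \<Rightarrow> real) \<Rightarrow> 'e list \<Rightarrow> real" where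
  "h_at M x a = Phi_inv M x
     (partial_inverse (ext_gr M x) (ext_gr_inner M x) (chevalley_eilenberg M x) (Phi M x a))"

definition t_at :: "('m, 'e::euclidean_space) filtered_space \<Rightarrow> 'm \<Rightarrow> ('e list \<Rightarrow> real) \<Rightarrow> 'e list \<Rightarrow> real" where
  "t_at M x a = Phi_inv M x
     (transpose_on (ext_gr M x) (ext_gr_inner M x) (chevalley_eilenberg M x) (Phi M x a))"

lemma pointwise_ops: "d0 M \<omega> x = d0_at M x (\<omega> x)" "d0_inv M \<omega> x = h_at M x (\<omega> x)" "d0_t M \<omega> x = t_at M x (\<omega> x)"
  by (simp_all add: d0_def d0_at_def d0_inv_def h_at_def d0_t_def t_at_def)

definition coset :: "('m, 'e::euclidean_space) filtered_space \<Rightarrow> 'm \<Rightarrow> nat \<Rightarrow> 'e \<Rightarrow> 'e set" where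
  "coset M x i v = (\<lambda>h. v + h) ` filt M (i - 1) x"

lemma mem_coset: "z \<in> coset M x i v \<longleftrightarrow> z - v \<in> filt M (i - 1) x"
  unfolding coset_def by (auto simp: image_iff) (metis add.commute diff_add_cancel)

text \<open>\<open>w a\<close> is the filtration degree of \<open>E a\<close>: each
  \<open>H^i\<close> is spanned by the \<open>E a\<close> with \<open>w a \<le> i\<close>, stated as
  vanishing of the components of higher degree. Since the frame is orthonormal, the vectors of
  degree exactly \<open>i\<close> span the complement \<open>G^i\<close>.\<close>

locale adapted_frame = orthonormal_frame "gTM M x" E n
  for M :: "('m, 'e::euclidean_space) filtered_space" and x :: 'm and E :: "nat \<Rightarrow> 'e" and n :: nat +
  fixes w :: "nat \<Rightarrow> nat"
  assumes filt_iff: "v \<in> filt M i x \<longleftrightarrow> (\<forall>a<n. i < w a \<longrightarrow> gTM M x v (E a) = 0)"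
    and w_range: "a < n \<Longrightarrow> 1 \<le> w a \<and> w a \<le> depth M"
begin

abbreviation "g \<equiv> gTM M x"

lemmas g_simps = bilinear_ladd[OF g_bilinear] bilinear_lmul[OF g_bilinear] bilinear_lzero[OF g_bilinear]
  bilinear_lsub[OF g_bilinear] bilinear_lneg[OF g_bilinear]

lemma g_sum: "g (\<Sum>i\<in>I. f i) v = (\<Sum>i\<in>I. g (f i) v)"
  by (induction I rule: infinite_finite_induct) (simp_all add: g_simps)

lemma vec_eqI: "(\<And>a. a < n \<Longrightarrow> g u (E a) = g v (E a)) \<Longrightarrow> u = v"
  by (metis (no_types, lifting) frame_expand lessThan_iff sum.cong)

text \<open>The orthogonal projection onto \<open>G^i\<close>.\<close>

definition pr :: "nat \<Rightarrow> 'e \<Rightarrow> 'e" where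
  "pr i v = (\<Sum>a<n. (if w a = i then g v (E a) else 0) *\<^sub>R E a)"

lemma g_lincomb: "b < n \<Longrightarrow> g (\<Sum>a<n. c a *\<^sub>R E a) (E b) = c b"
proof -
  assume b: "b < n"
  have "g (\<Sum>a<n. c a *\<^sub>R E a) (E b) = (\<Sum>a<n. if a = b then c a else 0)"
    unfolding g_sum by (rule sum.cong) (auto simp: g_simps g_frame b)
  then show ?thesis using b by simp
qed

lemma g_pr: "b < n \<Longrightarrow> g (pr i v) (E b) = (if w b = i then g v (E b) else 0)"
  unfolding pr_def by (rule g_lincomb)

lemma pr_add: "pr i (u + v) = pr i u + pr i v"
  by (rule vec_eqI) (simp add: g_pr g_simps)

lemma pr_scale: "pr i (r *\<^sub>R u) = r *\<^sub>R pr i u"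
  by (rule vec_eqI) (simp add: g_pr g_simps)

lemma linear_pr: "linear (pr i)"
  by (rule linearI) (simp_all add: pr_add pr_scale)

lemma pr_pr: "pr i (pr j v) = (if i = j then pr i v else 0)"
  by (rule vec_eqI) (auto simp: g_pr g_simps)

lemma sum_pr: "(\<Sum>i\<in>{1..depth M}. pr i v) = v"
proof (rule vec_eqI)
  fix b assume b: "b < n"
  then have "w b \<in> {1..depth M}" using w_range by auto
  then show "g (\<Sum>i\<in>{1..depth M}. pr i v) (E b) = g v (E b)" using b by (simp add: g_sum g_pr)
qed

lemma filt_add: "u \<in> filt M i x \<Longrightarrow> v \<in> filt M i x \<Longrightarrow> u + v \<in> filt M i x"
  and filt_scale: "u \<in> filt M i x \<Longrightarrow> r *\<^sub>R u \<in> filt M i x"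
  and filt_diff: "u \<in> filt M i x \<Longrightarrow> v \<in> filt M i x \<Longrightarrow> u - v \<in> filt M i x"
  and filt_zero: "0 \<in> filt M i x"
  by (auto simp: filt_iff g_simps)

lemma filt_sum: "(\<And>j. j \<in> J \<Longrightarrow> f j \<in> filt M i x) \<Longrightarrow> (\<Sum>j\<in>J. f j) \<in> filt M i x"
  by (induction J rule: infinite_finite_induct) (simp_all add: filt_zero filt_add)

lemma E_filt: "a < n \<Longrightarrow> w a \<le> i \<Longrightarrow> E a \<in> filt M i x"
  by (auto simp: filt_iff g_frame)

lemma pr_filt: "pr i v \<in> filt M i x"
  by (auto simp: filt_iff g_pr)

lemma filt_pr_diff: "1 \<le> i \<Longrightarrow> v \<in> filt M i x \<Longrightarrow> v - pr i v \<in> filt M (i - 1) x"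
  by (auto simp: filt_iff g_pr g_simps)

lemma orth_compl_iff:
  assumes "1 \<le> i"
  shows "v \<in> orth_compl M i x \<longleftrightarrow> (\<forall>a<n. w a \<noteq> i \<longrightarrow> g v (E a) = 0)"
proof
  assume v: "v \<in> orth_compl M i x"
  show "\<forall>a<n. w a \<noteq> i \<longrightarrow> g v (E a) = 0"
  proof (intro allI impI)
    fix a assume a: "a < n" "w a \<noteq> i"
    show "g v (E a) = 0"
    proof (cases "i < w a")
      case True then show ?thesis using v a by (simp add: orth_compl_def filt_iff)
    next
      case False
      then have "E a \<in> filt M (i - 1) x" using a by (intro E_filt) auto
      then show ?thesis using v by (simp add: orth_compl_def)
    qed
  qed
next
  assume v: "\<forall>a<n. w a \<noteq> i \<longrightarrow> g v (E a) = 0"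
  have "g v u = 0" if u: "u \<in> filt M (i - 1) x" for u
  proof -
    have "g v u = g u v" by (rule g_sym)
    also have "\<dots> = g (\<Sum>a<n. g u (E a) *\<^sub>R E a) v" by (simp add: frame_expand)
    also have "\<dots> = (\<Sum>a<n. g u (E a) * g v (E a))" by (simp add: g_sum g_simps g_sym[of "E _" v])
    also have "\<dots> = 0"
    proof (rule sum.neutral, rule ballI)
      fix a assume "a \<in> {..<n}"
      then show "g u (E a) * g v (E a) = 0" using u v assms by (cases "w a = i") (auto simp: filt_iff)
    qed
    finally show ?thesis .
  qed
  then show "v \<in> orth_compl M i x" using v by (auto simp: orth_compl_def filt_iff)
qed

lemma coset_eqI: "u - v \<in> filt M (i - 1) x \<Longrightarrow> coset M x i u = coset M x i v"
proof -
  assume d: "u - v \<in> filt M (i - 1) x"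
  have "z - u \<in> filt M (i - 1) x \<longleftrightarrow> z - v \<in> filt M (i - 1) x" for z
    using filt_add[OF _ d, of "z - u"] filt_diff[OF _ d, of "z - v"] by (auto simp: algebra_simps)
  then show ?thesis by (auto simp: mem_coset)
qed

lemma coset_pr: "1 \<le> i \<Longrightarrow> v \<in> filt M i x \<Longrightarrow> coset M x i v = coset M x i (pr i v)"
  by (intro coset_eqI filt_pr_diff)

lemma the_orth_compl:
  assumes i: "1 \<le> i" and v: "v \<in> filt M i x"
  shows "(THE u. u \<in> orth_compl M i x \<and> u \<in> coset M x i v) = pr i v"
proof (rule the_equality)
  show "pr i v \<in> orth_compl M i x \<and> pr i v \<in> coset M x i v"
    unfolding coset_pr[OF i v] by (simp add: orth_compl_iff[OF i] g_pr mem_coset filt_zero)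
  fix u assume u: "u \<in> orth_compl M i x \<and> u \<in> coset M x i v"
  then have d: "u - v \<in> filt M (i - 1) x" by (simp add: mem_coset)
  show "u = pr i v"
  proof (rule vec_eqI)
    fix a assume a: "a < n"
    show "g u (E a) = g (pr i v) (E a)"
    proof (cases "w a = i")
      case True
      then have "g (u - v) (E a) = 0" using d a i by (simp add: filt_iff)
      then show ?thesis using True a by (simp add: g_pr g_simps)
    next
      case False then show ?thesis using u a by (simp add: orth_compl_iff[OF i] g_pr)
    qed
  qed
qed

text \<open>The inverse of \<open>gr_to_T\<close>; outside \<open>{1..depth M}\<close> the value is
  \<open>undefined\<close>, as the extensional product in \<open>gr\<close> demands.\<close>

definition to_gr :: "'e \<Rightarrow> nat \<Rightarrow> 'e set" where
  "to_gr v = (\<lambda>i\<in>{1..depth M}. coset M x i (pr i v))"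

lemma to_gr_in: "to_gr v \<in> gr M x"
  unfolding gr_def to_gr_def coset_def using pr_filt by auto

lemma gr_to_T_to_gr: "gr_to_T M x (to_gr v) = v"
proof -
  have "gr_to_T M x (to_gr v) = (\<Sum>i\<in>{1..depth M}. pr i v)"
    unfolding gr_to_T_def
    by (rule sum.cong) (simp_all add: to_gr_def the_orth_compl pr_filt pr_pr)
  then show ?thesis by (simp only: sum_pr)
qed

lemma to_gr_gr_to_T:
  assumes y: "y \<in> gr M x"
  shows "to_gr (gr_to_T M x y) = y"
proof -
  have "\<forall>i\<in>{1..depth M}. \<exists>v. v \<in> filt M i x \<and> y i = coset M x i v"
    using y unfolding gr_def coset_def by (auto simp: PiE_iff)
  then obtain v where v: "v i \<in> filt M i x" "y i = coset M x i (v i)" if "i \<in> {1..depth M}" for i by metis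
  have T: "gr_to_T M x y = (\<Sum>i\<in>{1..depth M}. pr i (v i))"
    unfolding gr_to_T_def by (rule sum.cong) (simp_all add: v the_orth_compl)
  have "pr j (gr_to_T M x y) = pr j (v j)" if j: "j \<in> {1..depth M}" for j
    unfolding T linear_sum[OF linear_pr] pr_pr using j by simp
  then have pr: "pr i (gr_to_T M x y) = pr i (v i)" if "i \<in> {1..depth M}" for i using that by blast
  show ?thesis
  proof
    fix i
    show "to_gr (gr_to_T M x y) i = y i"
    proof (cases "i \<in> {1..depth M}")
      case True
      then have "y i = coset M x i (pr i (v i))" 
        unfolding v(2)[OF True] by (intro coset_pr v(1)[OF True]) (use True in simp)
      moreover have "to_gr (gr_to_T M x y) i = coset M x i (pr i (gr_to_T M x y))"
        unfolding to_gr_def by (rule restrict_apply'[OF True])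
      ultimately show ?thesis by (simp only: pr[OF True])
    next
      case False
      then have "to_gr (gr_to_T M x y) i = undefined" unfolding to_gr_def restrict_def by (rule if_not_P)
      then show ?thesis using PiE_arb[OF y[unfolded gr_def] False] by simp
    qed
  qed
qed

lemma gr_add_to_gr: "gr_add M x (to_gr u) (to_gr v) = to_gr (u + v)"
proof -
  have "{p + q | p q. p \<in> coset M x i (pr i u) \<and> q \<in> coset M x i (pr i v)} = coset M x i (pr i (u + v))" for i
  proof (intro equalityI subsetI)
    fix z assume "z \<in> {p + q | p q. p \<in> coset M x i (pr i u) \<and> q \<in> coset M x i (pr i v)}"
    then obtain p q where z: "z = p + q" "p - pr i u \<in> filt M (i - 1) x" "q - pr i v \<in> filt M (i - 1) x"
      by (auto simp: mem_coset)
    then show "z \<in> coset M x i (pr i (u + v))"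
      using filt_add[OF z(2,3)] by (simp add: mem_coset pr_add algebra_simps)
  next
    fix z assume z: "z \<in> coset M x i (pr i (u + v))"
    then have "pr i u \<in> coset M x i (pr i u)" "z - pr i u \<in> coset M x i (pr i v)"
      by (simp_all add: mem_coset filt_zero pr_add algebra_simps)
    then show "z \<in> {p + q | p q. p \<in> coset M x i (pr i u) \<and> q \<in> coset M x i (pr i v)}"
      by (intro CollectI exI[of _ "pr i u"] exI[of _ "z - pr i u"]) simp
  qed
  then show ?thesis unfolding gr_add_def to_gr_def by (auto simp: fun_eq_iff)
qed

lemma gr_scale_to_gr: "gr_scale M x r (to_gr u) = to_gr (r *\<^sub>R u)"
proof -
  have "{r *\<^sub>R p + q | p q. p \<in> coset M x i (pr i u) \<and> q \<in> filt M (i - 1) x} = coset M x i (pr i (r *\<^sub>R u))" for i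
  proof (intro equalityI subsetI)
    fix z assume "z \<in> {r *\<^sub>R p + q | p q. p \<in> coset M x i (pr i u) \<and> q \<in> filt M (i - 1) x}"
    then obtain p q where z: "z = r *\<^sub>R p + q" "p - pr i u \<in> filt M (i - 1) x" "q \<in> filt M (i - 1) x"
      by (auto simp: mem_coset)
    then show "z \<in> coset M x i (pr i (r *\<^sub>R u))"
      using filt_add[OF filt_scale[OF z(2), of r] z(3)] by (simp add: mem_coset pr_scale algebra_simps)
  next
    fix z assume z: "z \<in> coset M x i (pr i (r *\<^sub>R u))"
    then have "pr i u \<in> coset M x i (pr i u)" "z - r *\<^sub>R pr i u \<in> filt M (i - 1) x"
      by (simp_all add: mem_coset filt_zero pr_scale)
    moreover have "z = r *\<^sub>R pr i u + (z - r *\<^sub>R pr i u)" by simp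
    ultimately show "z \<in> {r *\<^sub>R p + q | p q. p \<in> coset M x i (pr i u) \<and> q \<in> filt M (i - 1) x}" by blast
  qed
  then show ?thesis unfolding gr_scale_def to_gr_def by (auto simp: fun_eq_iff)
qed

lemma gr_to_T_add: "y \<in> gr M x \<Longrightarrow> z \<in> gr M x \<Longrightarrow> gr_to_T M x (gr_add M x y z) = gr_to_T M x y + gr_to_T M x z"
  by (metis gr_add_to_gr gr_to_T_to_gr to_gr_gr_to_T)

lemma gr_to_T_scale: "y \<in> gr M x \<Longrightarrow> gr_to_T M x (gr_scale M x r y) = r *\<^sub>R gr_to_T M x y"
  by (metis gr_scale_to_gr gr_to_T_to_gr to_gr_gr_to_T)

lemma gr_add_in: "y \<in> gr M x \<Longrightarrow> z \<in> gr M x \<Longrightarrow> gr_add M x y z \<in> gr M x"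
  by (metis gr_add_to_gr to_gr_in to_gr_gr_to_T)

lemma gr_scale_in: "y \<in> gr M x \<Longrightarrow> gr_scale M x r y \<in> gr M x"
  by (metis gr_scale_to_gr to_gr_in to_gr_gr_to_T)

lemma map_to_gr: "set ws \<subseteq> gr M x \<Longrightarrow> map to_gr (map (gr_to_T M x) ws) = ws"
  by (induction ws) (auto simp: to_gr_gr_to_T)

lemma map_gr_to_T: "map (gr_to_T M x) (map to_gr vs) = vs"
  by (induction vs) (auto simp: gr_to_T_to_gr)

lemma set_map_to_gr: "set (map to_gr vs) \<subseteq> gr M x"
  using to_gr_in by auto

lemma Phi_ext_gr: "a \<in> ext_T \<Longrightarrow> Phi M x a \<in> ext_gr M x"
proof -
  assume a: "a \<in> ext_T"
  show ?thesis unfolding ext_gr_def ext_alg_def mem_Collect_eq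
  proof (intro conjI allI ballI impI)
    show "Phi M x a vs = 0" if "\<not> set vs \<subseteq> gr M x" for vs using that by (simp add: Phi_def)
    show "Phi M x a (us @ gr_add M x y z # vs) = Phi M x a (us @ y # vs) + Phi M x a (us @ z # vs)"
      if "y \<in> gr M x" "z \<in> gr M x" "set us \<subseteq> gr M x" "set vs \<subseteq> gr M x" for us vs y z
      using that by (simp add: Phi_def gr_to_T_add gr_add_in ext_T_add[OF a])
    show "Phi M x a (us @ gr_scale M x r y # vs) = r * Phi M x a (us @ y # vs)"
      if "y \<in> gr M x" "set us \<subseteq> gr M x" "set vs \<subseteq> gr M x" for us vs r y
      using that by (simp add: Phi_def gr_to_T_scale gr_scale_in ext_T_scale[OF a])
    show "Phi M x a vs = 0" if "set vs \<subseteq> gr M x" "\<not> distinct vs" for vs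
      using that ext_T_alt[OF a, of "map (gr_to_T M x) vs"] by (simp add: Phi_def distinct_map)
  qed
qed

lemma Phi_surj:
  assumes c: "c \<in> ext_gr M x"
  shows "(\<lambda>vs. c (map to_gr vs)) \<in> ext_T" "Phi M x (\<lambda>vs. c (map to_gr vs)) = c"
proof -
  note c' = c[unfolded ext_gr_def ext_alg_def mem_Collect_eq]
  note c0 = c'[THEN conjunct1, rule_format]
    and ca = c'[THEN conjunct2, THEN conjunct1, rule_format]
    and cs = c'[THEN conjunct2, THEN conjunct2, THEN conjunct1, rule_format]
    and cd = c'[THEN conjunct2, THEN conjunct2, THEN conjunct2, rule_format]
  show "(\<lambda>vs. c (map to_gr vs)) \<in> ext_T" unfolding ext_T_iff
  proof (intro conjI allI impI)
    show "c (map to_gr (us @ (u + v) # vs)) = c (map to_gr (us @ u # vs)) + c (map to_gr (us @ v # vs))" for us vs u v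
      using ca[OF to_gr_in to_gr_in set_map_to_gr set_map_to_gr, of us u v vs] by (simp add: gr_add_to_gr)
    show "c (map to_gr (us @ r *\<^sub>R u # vs)) = r * c (map to_gr (us @ u # vs))" for us vs r u
      using cs[OF to_gr_in set_map_to_gr set_map_to_gr, of us r u vs] by (simp add: gr_scale_to_gr)
    show "c (map to_gr vs) = 0" if "\<not> distinct vs" for vs
      using cd[OF set_map_to_gr, of vs] that by (metis distinct_map)
  qed
  show "Phi M x (\<lambda>vs. c (map to_gr vs)) = c"
  proof
    fix ws show "Phi M x (\<lambda>vs. c (map to_gr vs)) ws = c ws"
      using c0[of ws] map_to_gr[of ws] by (cases "set ws \<subseteq> gr M x") (simp_all add: Phi_def)
  qed
qed

lemma Phi_apply: "Phi M x a (map to_gr vs) = a vs"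
  using set_map_to_gr[of vs] map_gr_to_T[of vs] by (simp add: Phi_def)

lemma inj_on_Phi: "inj_on (Phi M x) ext_T"
  by (rule inj_onI) (metis Phi_apply ext)

lemma Phi_inv_Phi: "a \<in> ext_T \<Longrightarrow> Phi_inv M x (Phi M x a) = a"
  unfolding Phi_inv_def by (rule inv_into_f_f[OF inj_on_Phi])

lemma Phi_image: "Phi M x ` ext_T = ext_gr M x"
proof (intro equalityI subsetI)
  fix c assume "c \<in> ext_gr M x"
  then show "c \<in> Phi M x ` ext_T" using Phi_surj[of c] by (metis imageI)
qed (auto intro: Phi_ext_gr)

lemma Phi_Phi_inv: "c \<in> ext_gr M x \<Longrightarrow> Phi M x (Phi_inv M x c) = c"
  unfolding Phi_inv_def using f_inv_into_f Phi_image by metis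

lemma Phi_inv_in: "c \<in> ext_gr M x \<Longrightarrow> Phi_inv M x c \<in> ext_T"
  unfolding Phi_inv_def using inv_into_into Phi_image by metis

lemma Phi_add: "Phi M x (\<lambda>vs. a vs + b vs) = (\<lambda>ws. Phi M x a ws + Phi M x b ws)"
  and Phi_scale: "Phi M x (\<lambda>vs. r * a vs) = (\<lambda>ws. r * Phi M x a ws)"
  and Phi_zero: "Phi M x (\<lambda>_. 0) = (\<lambda>_. 0)"
  by (auto simp: Phi_def fun_eq_iff)

lemma Phi_sum: "Phi M x (\<lambda>vs. \<Sum>i\<in>I. f i vs) = (\<lambda>ws. \<Sum>i\<in>I. Phi M x (f i) ws)"
  by (auto simp: Phi_def fun_eq_iff)

lemma Phi_gram:
  assumes "set us \<subseteq> gr M x"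
  shows "gram_wedge (gr M x) (gr_metric M x) us = Phi M x (gram_wedge UNIV g (map (gr_to_T M x) us))"
proof
  fix ws
  have "Matrix.mat (length us) (length us) (\<lambda>(i, j). gr_metric M x (us ! i) (ws ! j)) =
    Matrix.mat (length us) (length us) (\<lambda>(i, j). g (map (gr_to_T M x) us ! i) (map (gr_to_T M x) ws ! j))"
    if "length us = length ws" by (rule cong_mat) (use that in \<open>auto simp: gr_metric_def\<close>)
  then show "gram_wedge (gr M x) (gr_metric M x) us ws = Phi M x (gram_wedge UNIV g (map (gr_to_T M x) us)) ws"
    by (auto simp: gram_wedge_def Phi_def)
qed

text \<open>This resolves the description operator in \<open>ext_inner\<close>. Existence:
  \<open>ip\<close> is transported along \<open>Phi\<close> and extended by 0. Uniqueness: the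
  images of the \<open>ebas K\<close> are decomposable and span, so bilinearity and the prescribed
  determinants fix every value.\<close>

lemma ext_gr_inner_eq:
  "ext_gr_inner M x = (\<lambda>p q. if p \<in> ext_gr M x \<and> q \<in> ext_gr M x then ip (Phi_inv M x p) (Phi_inv M x q) else 0)"
  (is "_ = ?B")
proof -
  let ?L = "ext_gr M x"
  have PI: "Phi_inv M x p = q" if "q \<in> ext_T" "Phi M x q = p" for p q using Phi_inv_Phi that by blast
  have addL: "(\<lambda>vs. a vs + b vs) \<in> ?L" "Phi_inv M x (\<lambda>vs. a vs + b vs) = (\<lambda>vs. Phi_inv M x a vs + Phi_inv M x b vs)"
    if "a \<in> ?L" "b \<in> ?L" for a b
  proof -
    have e: "(\<lambda>vs. Phi_inv M x a vs + Phi_inv M x b vs) \<in> ext_T" using that by (intro ext_T_plus Phi_inv_in)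
    have p: "Phi M x (\<lambda>vs. Phi_inv M x a vs + Phi_inv M x b vs) = (\<lambda>vs. a vs + b vs)"
      by (simp add: Phi_add Phi_Phi_inv that)
    show "(\<lambda>vs. a vs + b vs) \<in> ?L" using Phi_ext_gr[OF e] p by simp
    show "Phi_inv M x (\<lambda>vs. a vs + b vs) = (\<lambda>vs. Phi_inv M x a vs + Phi_inv M x b vs)" by (rule PI[OF e p])
  qed
  have scL: "(\<lambda>vs. r * a vs) \<in> ?L" "Phi_inv M x (\<lambda>vs. r * a vs) = (\<lambda>vs. r * Phi_inv M x a vs)" if "a \<in> ?L" for a r
  proof -
    have e: "(\<lambda>vs. r * Phi_inv M x a vs) \<in> ext_T" using that by (intro ext_T_scaled Phi_inv_in)
    have p: "Phi M x (\<lambda>vs. r * Phi_inv M x a vs) = (\<lambda>vs. r * a vs)"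
      by (simp add: Phi_scale Phi_Phi_inv that)
    show "(\<lambda>vs. r * a vs) \<in> ?L" using Phi_ext_gr[OF e] p by simp
    show "Phi_inv M x (\<lambda>vs. r * a vs) = (\<lambda>vs. r * Phi_inv M x a vs)" by (rule PI[OF e p])
  qed
  have gT: "gram_wedge UNIV g us \<in> ext_T" for us by (rule gram_wedge_ext_T[OF g_bilinear])
  have gL: "gram_wedge (gr M x) (gr_metric M x) us \<in> ?L" if "set us \<subseteq> gr M x" for us
    unfolding Phi_gram[OF that] by (intro Phi_ext_gr gT)
  have gram: "?B (gram_wedge (gr M x) (gr_metric M x) us) (gram_wedge (gr M x) (gr_metric M x) ws)
     = gram_wedge (gr M x) (gr_metric M x) us ws" if "set us \<subseteq> gr M x" "set ws \<subseteq> gr M x" for us ws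
    using that Phi_ext_gr[OF gT] by (simp add: Phi_gram Phi_inv_Phi gT ip_gram) (simp add: Phi_def)
  show ?thesis unfolding ext_gr_inner_def ext_inner_def Let_def ext_gr_def[symmetric]
  proof (rule the_equality)
    show "(\<forall>a\<in>?L. \<forall>b\<in>?L. \<forall>c\<in>?L. ?B (\<lambda>vs. a vs + b vs) c = ?B a c + ?B b c) \<and>
     (\<forall>a\<in>?L. \<forall>b\<in>?L. \<forall>c\<in>?L. ?B c (\<lambda>vs. a vs + b vs) = ?B c a + ?B c b) \<and>
     (\<forall>r. \<forall>a\<in>?L. \<forall>c\<in>?L. ?B (\<lambda>vs. r * a vs) c = r * ?B a c) \<and>
     (\<forall>r. \<forall>a\<in>?L. \<forall>c\<in>?L. ?B c (\<lambda>vs. r * a vs) = r * ?B c a) \<and>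
     (\<forall>a b. a \<notin> ?L \<or> b \<notin> ?L \<longrightarrow> ?B a b = 0) \<and>
     (\<forall>us ws. set us \<subseteq> gr M x \<longrightarrow> set ws \<subseteq> gr M x \<longrightarrow>
        ?B (gram_wedge (gr M x) (gr_metric M x) us) (gram_wedge (gr M x) (gr_metric M x) ws)
        = gram_wedge (gr M x) (gr_metric M x) us ws)"
      using gram by (simp add: addL scL ip_add ip_scale)
  next
    fix B assume B: "(\<forall>a\<in>?L. \<forall>b\<in>?L. \<forall>c\<in>?L. B (\<lambda>vs. a vs + b vs) c = B a c + B b c) \<and>
     (\<forall>a\<in>?L. \<forall>b\<in>?L. \<forall>c\<in>?L. B c (\<lambda>vs. a vs + b vs) = B c a + B c b) \<and>
     (\<forall>r. \<forall>a\<in>?L. \<forall>c\<in>?L. B (\<lambda>vs. r * a vs) c = r * B a c) \<and>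
     (\<forall>r. \<forall>a\<in>?L. \<forall>c\<in>?L. B c (\<lambda>vs. r * a vs) = r * B c a) \<and>
     (\<forall>a b. a \<notin> ?L \<or> b \<notin> ?L \<longrightarrow> B a b = 0) \<and>
     (\<forall>us ws. set us \<subseteq> gr M x \<longrightarrow> set ws \<subseteq> gr M x \<longrightarrow>
        B (gram_wedge (gr M x) (gr_metric M x) us) (gram_wedge (gr M x) (gr_metric M x) ws)
        = gram_wedge (gr M x) (gr_metric M x) us ws)"
    note Ba1 = B[THEN conjunct1, rule_format]
      and Ba2 = B[THEN conjunct2, THEN conjunct1, rule_format]
      and Bs1 = B[THEN conjunct2, THEN conjunct2, THEN conjunct1, rule_format]
      and Bs2 = B[THEN conjunct2, THEN conjunct2, THEN conjunct2, THEN conjunct1, rule_format]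
      and B0 = B[THEN conjunct2, THEN conjunct2, THEN conjunct2, THEN conjunct2, THEN conjunct1, rule_format]
      and Bg = B[THEN conjunct2, THEN conjunct2, THEN conjunct2, THEN conjunct2, THEN conjunct2, rule_format]
    define W where "W K = gram_wedge (gr M x) (gr_metric M x) (map to_gr (map E K))" for K
    have WP: "W K = Phi M x (ebas K)" for K
      unfolding W_def by (subst Phi_gram[OF set_map_to_gr]) (simp only: map_gr_to_T ebas_def)
    have WL: "W K \<in> ?L" for K unfolding WP by (intro Phi_ext_gr ebas_ext_T)
    have z: "(\<lambda>_. 0) \<in> ?L" using Phi_ext_gr[OF ext_T_zero] by (simp add: Phi_zero)
    have sumL: "(\<lambda>vs. \<Sum>K\<in>J. c K * W K vs) \<in> ?L" for c J
      by (induction J rule: infinite_finite_induct) (simp_all add: z addL scL WL)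
    have Bz: "B (\<lambda>_. 0) c = 0" "B c (\<lambda>_. 0) = 0" if "c \<in> ?L" for c
      using Bs1[OF z that, of 0] Bs2[OF z that, of 0] by simp_all
    have Bsum1: "B (\<lambda>vs. \<Sum>K\<in>J. c K * W K vs) q = (\<Sum>K\<in>J. c K * B (W K) q)" if "q \<in> ?L" for c J q
      by (induction J rule: infinite_finite_induct) (simp_all add: Bz that Ba1 scL WL sumL Bs1)
    have Bsum2: "B q (\<lambda>vs. \<Sum>K\<in>J. c K * W K vs) = (\<Sum>K\<in>J. c K * B q (W K))" if "q \<in> ?L" for c J q
      by (induction J rule: infinite_finite_induct) (simp_all add: Bz that Ba2 scL WL sumL Bs2)
    have ex: "p = (\<lambda>vs. \<Sum>K\<in>idx n. Phi_inv M x p (map E K) * W K vs)" if "p \<in> ?L" for p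
    proof -
      have "Phi_inv M x p = (\<lambda>vs. \<Sum>K\<in>idx n. Phi_inv M x p (map E K) * ebas K vs)"
        using ext_T_expand[OF Phi_inv_in[OF that]] by blast
      then have "Phi M x (Phi_inv M x p) = Phi M x (\<lambda>vs. \<Sum>K\<in>idx n. Phi_inv M x p (map E K) * ebas K vs)" by metis
      then show ?thesis using that by (simp add: Phi_Phi_inv Phi_sum Phi_scale WP)
    qed
    have WW: "B (W K) (W J) = (if K = J then 1 else 0)" if "K \<in> idx n" "J \<in> idx n" for K J
    proof -
      \<comment> \<open>The clause on decomposable elements turns this inner product into the value
        of \<open>W K\<close> on the frame vectors listed by \<open>J\<close>.\<close>
      have "B (W K) (W J) = W K (map to_gr (map E J))" unfolding W_def by (rule Bg[OF set_map_to_gr set_map_to_gr])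
      also have "\<dots> = ebas K (map E J)" unfolding WP by (rule Phi_apply)
      finally show ?thesis using ebas_frame that by simp
    qed
    show "B = ?B"
    proof (intro ext)
      fix p q
      show "B p q = ?B p q"
      proof (cases "p \<in> ?L \<and> q \<in> ?L")
        case True
        then have p: "p \<in> ?L" and q: "q \<in> ?L" by auto
        have "B p q = (\<Sum>K\<in>idx n. Phi_inv M x p (map E K) * B (W K) q)"
          by (subst ex[OF p]) (rule Bsum1[OF q])
        also have "\<dots> = (\<Sum>K\<in>idx n. Phi_inv M x p (map E K) * Phi_inv M x q (map E K))"
        proof (rule sum.cong[OF refl])
          fix K assume K: "K \<in> idx n"
          have "B (W K) q = (\<Sum>J\<in>idx n. Phi_inv M x q (map E J) * B (W K) (W J))"
            by (subst ex[OF q]) (rule Bsum2[OF WL])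
          also have "\<dots> = (\<Sum>J\<in>idx n. if J = K then Phi_inv M x q (map E J) else 0)"
            by (rule sum.cong) (auto simp: WW K)
          also have "\<dots> = Phi_inv M x q (map E K)" using K by simp
          finally show "Phi_inv M x p (map E K) * B (W K) q = Phi_inv M x p (map E K) * Phi_inv M x q (map E K)" by simp
        qed
        finally show ?thesis using True by (simp add: ip_def)
      qed (use B0 in auto)
    qed
  qed
qed

lemma ext_gr_inner_Phi: "a \<in> ext_T \<Longrightarrow> b \<in> ext_T \<Longrightarrow> ext_gr_inner M x (Phi M x a) (Phi M x b) = ip a b"
  by (simp add: ext_gr_inner_eq Phi_ext_gr Phi_inv_Phi)

lemma fin_inner_space_ext_gr:
  "fin_inner_space (ext_gr M x) (ext_gr_inner M x) (\<lambda>K. Phi M x (ebas K)) (idx n)"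
proof -
  note im = Phi_image[symmetric]
  have add: "(\<lambda>w. Phi M x a w + Phi M x b w) = Phi M x (\<lambda>w. a w + b w)" for a b by (simp add: Phi_add)
  have scale: "(\<lambda>w. r * Phi M x a w) = Phi M x (\<lambda>w. r * a w)" for a r by (simp add: Phi_scale)
  show ?thesis
  proof
    show "(\<lambda>_. 0) \<in> ext_gr M x" using Phi_ext_gr[OF ext_T_zero] by (simp add: Phi_zero)
    show "(\<lambda>w. a w + b w) \<in> ext_gr M x" if "a \<in> ext_gr M x" "b \<in> ext_gr M x" for a b
      using that unfolding im by (auto simp: add intro: ext_T_plus)
    show "(\<lambda>w. r * a w) \<in> ext_gr M x" if "a \<in> ext_gr M x" for a r
      using that unfolding im by (auto simp: scale intro: ext_T_scaled)
    show "ext_gr_inner M x (\<lambda>w. a w + b w) c = ext_gr_inner M x a c + ext_gr_inner M x b c"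
      if "a \<in> ext_gr M x" "b \<in> ext_gr M x" "c \<in> ext_gr M x" for a b c
      using that unfolding im by (auto simp: add ext_gr_inner_Phi ext_T_plus ip_add)
    show "ext_gr_inner M x (\<lambda>w. r * a w) c = r * ext_gr_inner M x a c"
      if "a \<in> ext_gr M x" "c \<in> ext_gr M x" for a c r
      using that unfolding im by (auto simp: scale ext_gr_inner_Phi ext_T_scaled ip_scale)
    show "ext_gr_inner M x a b = ext_gr_inner M x b a" for a b
      by (simp add: ext_gr_inner_eq ip_sym)
    show "a = (\<lambda>_. 0)" if "a \<in> ext_gr M x" "ext_gr_inner M x a a = 0" for a
      using that ip_pos Phi_zero unfolding im by (auto simp: ext_gr_inner_Phi)
    show "finite (idx n)" by simp
    show "Phi M x (ebas K) \<in> ext_gr M x" for K by (intro Phi_ext_gr ebas_ext_T)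
    show "a = (\<lambda>w. \<Sum>K\<in>idx n. ext_gr_inner M x a (Phi M x (ebas K)) * Phi M x (ebas K) w)"
      if "a \<in> ext_gr M x" for a
    proof -
      obtain b where b: "b \<in> ext_T" "a = Phi M x b" using \<open>a \<in> ext_gr M x\<close> unfolding im by blast
      have "(\<lambda>w. \<Sum>K\<in>idx n. ext_gr_inner M x a (Phi M x (ebas K)) * Phi M x (ebas K) w)
        = (\<lambda>w. \<Sum>K\<in>idx n. b (map E K) * Phi M x (ebas K) w)"
        by (auto simp: b ext_gr_inner_Phi ebas_ext_T ip_ebas)
      also have "\<dots> = Phi M x (\<lambda>w. \<Sum>K\<in>idx n. b (map E K) * ebas K w)" by (simp add: Phi_sum Phi_scale)
      also have "(\<lambda>w. \<Sum>K\<in>idx n. b (map E K) * ebas K w) = b" by (rule ext) (rule ext_T_expand[OF b(1), symmetric])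
      finally show ?thesis using b by simp
    qed
  qed
qed

end

text \<open>\<open>bracket_rep\<close> is a choice that is determined only modulo
  \<open>H^(i+j-1)\<close>. So the assumption fixes just its components of weight exactly
  \<open>i + j\<close>, through bilinear forms \<open>\<beta> c\<close>, and otherwise its
  membership in \<open>H^(i+j)\<close>.\<close>

locale osculating_frame = adapted_frame +
  fixes \<beta> :: "nat \<Rightarrow> 'b \<Rightarrow> 'b \<Rightarrow> real"
  assumes \<beta>_bilinear: "c < n \<Longrightarrow> bilinear (\<beta> c)"
    and \<beta>_anti: "c < n \<Longrightarrow> \<beta> c u v = - \<beta> c v u"
    and bracket: "1 \<le> i \<Longrightarrow> 1 \<le> j \<Longrightarrow> i + j \<le> depth M \<Longrightarrow> u \<in> filt M i x \<Longrightarrow> v \<in> filt M j x \<Longrightarrow>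
      bracket_rep M x i j (coset M x i u) (coset M x j v) \<in> filt M (i + j) x \<and>
      (\<forall>c<n. w c = i + j \<longrightarrow> gTM M x (bracket_rep M x i j (coset M x i u) (coset M x j v)) (E c) = \<beta> c u v)"
begin

text \<open>The osculating bracket carried over to the tangent space: the component along
  \<open>E c\<close> collects the brackets of homogeneous parts whose degrees add up to
  \<open>w c\<close>.\<close>

definition br :: "'b \<Rightarrow> 'b \<Rightarrow> 'b" where
  "br u v = (\<Sum>c<n. (\<Sum>i\<in>{1..<w c}. \<beta> c (pr i u) (pr (w c - i) v)) *\<^sub>R E c)"

lemma g_br: "c < n \<Longrightarrow> g (br u v) (E c) = (\<Sum>i\<in>{1..<w c}. \<beta> c (pr i u) (pr (w c - i) v))"
  unfolding br_def by (rule g_lincomb)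

lemma br_bilinear: "bilinear br"
proof -
  note bl = pr_add pr_scale bilinear_ladd[OF \<beta>_bilinear] bilinear_radd[OF \<beta>_bilinear]
    bilinear_lmul[OF \<beta>_bilinear] bilinear_rmul[OF \<beta>_bilinear] sum.distrib sum_distrib_left
  have "linear (br u)" for u
    by (rule linearI; rule vec_eqI) (simp_all add: g_br g_simps bl)
  moreover have "linear (\<lambda>u. br u v)" for v
    by (rule linearI; rule vec_eqI) (simp_all add: g_br g_simps bl)
  ultimately show ?thesis by (simp add: bilinear_def)
qed

lemma br_anti: "br u v = - br v u"
proof (rule vec_eqI)
  fix c assume c: "c < n"
  have "(\<Sum>i\<in>{1..<w c}. \<beta> c (pr i u) (pr (w c - i) v)) = (\<Sum>i\<in>{1..<w c}. - \<beta> c (pr i v) (pr (w c - i) u))"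
    by (rule sum.reindex_bij_witness[of _ "\<lambda>i. w c - i" "\<lambda>i. w c - i"]) (auto simp: \<beta>_anti[OF c, of "pr i u" for i])
  then show "g (br u v) (E c) = g (- br v u) (E c)"
    using c by (simp add: g_simps g_br sum_negf)
qed

text \<open>A coset in degree \<open>k\<close> only remembers the homogeneous part of degree
  \<open>k\<close>, and there the chosen representatives agree with \<open>br\<close>.\<close>

lemma gr_bracket_to_gr: "gr_bracket M x (to_gr u) (to_gr v) = to_gr (br u v)"
proof
  fix k
  show "gr_bracket M x (to_gr u) (to_gr v) k = to_gr (br u v) k"
  proof (cases "k \<in> {1..depth M}")
    case True
    define r where "r i = bracket_rep M x i (k - i) (coset M x i (pr i u)) (coset M x (k - i) (pr (k - i) v))" for i
    have r: "r i \<in> filt M k x" "c < n \<Longrightarrow> w c = k \<Longrightarrow> g (r i) (E c) = \<beta> c (pr i u) (pr (k - i) v)"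
      if "i \<in> {1..<k}" for i c
      using bracket[of i "k - i" "pr i u" "pr (k - i) v"] that True pr_filt by (auto simp: r_def)
    have eq: "gr_bracket M x (to_gr u) (to_gr v) k = coset M x k (\<Sum>i\<in>{1..<k}. r i)"
      using True unfolding gr_bracket_def coset_def[of M x k] r_def to_gr_def
      by (auto intro!: image_cong arg_cong2[where f = "(+)"] sum.cong)
    have "coset M x k (\<Sum>i\<in>{1..<k}. r i) = coset M x k (pr k (\<Sum>i\<in>{1..<k}. r i))"
      by (rule coset_pr) (use True r in \<open>auto intro: filt_sum\<close>)
    also have "pr k (\<Sum>i\<in>{1..<k}. r i) = pr k (br u v)"
      by (rule vec_eqI) (auto simp: g_pr g_sum r g_br)
    finally show ?thesis using eq True by (simp add: to_gr_def)
  qed (auto simp: gr_bracket_def to_gr_def)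
qed

definition ce :: "('b list \<Rightarrow> real) \<Rightarrow> 'b list \<Rightarrow> real" where
  "ce a = altsum2 br a (\<lambda>v. v)"

lemma ce_ext_T: "a \<in> ext_T \<Longrightarrow> ce a \<in> ext_T"
  unfolding ce_def by (rule altsum2_ext_T[OF br_bilinear br_anti])

lemma chevalley_eilenberg_Phi: "chevalley_eilenberg M x (Phi M x a) = Phi M x (ce a)"
proof
  fix ws
  show "chevalley_eilenberg M x (Phi M x a) ws = Phi M x (ce a) ws"
  proof (cases "set ws \<subseteq> gr M x")
    case True
    have b: "gr_bracket M x y z = to_gr (br (gr_to_T M x y) (gr_to_T M x z))" if "y \<in> gr M x" "z \<in> gr M x" for y z
      using gr_bracket_to_gr to_gr_gr_to_T that by metis
    have "Phi M x a (gr_bracket M x (ws ! i) (ws ! j) # nths ws (- {i, j})) =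
      a (br (map (gr_to_T M x) ws ! i) (map (gr_to_T M x) ws ! j) # nths (map (gr_to_T M x) ws) (- {i, j}))"
      if "j < length ws" "i < j" for i j
    proof -
      have in_gr: "ws ! i \<in> gr M x" "ws ! j \<in> gr M x" using True that by (auto intro: nth_mem[THEN subsetD[OF True]])
      have "set (nths ws (- {i, j})) \<subseteq> gr M x" using True set_nths_subset[of ws] by blast
      then show ?thesis using that by (simp add: Phi_def b in_gr to_gr_in gr_to_T_to_gr nths_map)
    qed
    then show ?thesis using True unfolding chevalley_eilenberg_def ce_def altsum2_def Phi_def[of M x "\<lambda>xs. _ xs"]
      by (simp add: Phi_def)
  qed (simp add: chevalley_eilenberg_def Phi_def)
qed

lemma ce_add: "ce (\<lambda>vs. a vs + b vs) = (\<lambda>vs. ce a vs + ce b vs)"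
  by (simp add: ce_def altsum2_add fun_eq_iff)

lemma ce_scale: "ce (\<lambda>vs. r * a vs) = (\<lambda>vs. r * ce a vs)"
  by (simp add: ce_def altsum2_scale fun_eq_iff)

lemma fin_inner_map_ext_gr:
  "fin_inner_map (ext_gr M x) (ext_gr_inner M x) (\<lambda>K. Phi M x (ebas K)) (idx n) (chevalley_eilenberg M x)"
proof -
  interpret fin_inner_space "ext_gr M x" "ext_gr_inner M x" "\<lambda>K. Phi M x (ebas K)" "idx n"
    by (rule fin_inner_space_ext_gr)
  show ?thesis
    by unfold_locales
      (auto simp: Phi_image[symmetric] chevalley_eilenberg_Phi Phi_add[symmetric] Phi_scale[symmetric] ce_add ce_scale intro: ce_ext_T)
qed

end

sublocale osculating_frame \<subseteq> gr: fin_inner_map "ext_gr M x" "ext_gr_inner M x" "\<lambda>K. Phi M x (ebas K)" "idx n" "chevalley_eilenberg M x"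
  by (rule fin_inner_map_ext_gr)

subsection \<open>Charts, tangent vectors and smooth functions\<close>

definition tr :: "('m, 'e) chart \<Rightarrow> ('m, 'e) chart \<Rightarrow> 'e \<Rightarrow> 'e" where
  "tr c c' y = snd c' (chart_inv c y)"

text \<open>The differential of a change of charts, indexed by the point and not by its coordinates.
  Both \<open>tang_to\<close> and \<open>tang_from\<close> are instances with the reference chart,
  so the rules for tangent vectors come from the chain rule \<open>dtr_chain\<close>.\<close>

definition dtr :: "('m, 'e::euclidean_space) chart \<Rightarrow> ('m, 'e) chart \<Rightarrow> 'm \<Rightarrow> 'e \<Rightarrow> 'e" where
  "dtr c c' p = frechet_derivative (tr c c') (at (snd c p))"

locale filtered_manifold =
  fixes M :: "('m::{t2_space, second_countable_topology}, 'e::euclidean_space) filtered_space"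
  assumes filtered: "filtered_riemannian_manifold M"
begin

abbreviation "img c U \<equiv> snd c ` (fst c \<inter> U)"

lemma smooth_atlas_M: "smooth_atlas (atlas M)"
  using filtered by (simp add: filtered_riemannian_manifold_def)

lemma chart_open: "c \<in> atlas M \<Longrightarrow> open (fst c)"
  and chart_homeo: "c \<in> atlas M \<Longrightarrow> homeomorphism (fst c) (snd c ` fst c) (snd c) (chart_inv c)"
  and chart_open_image: "c \<in> atlas M \<Longrightarrow> open (snd c ` fst c)"
proof -
  assume c: "c \<in> atlas M"
  obtain U \<phi> where "c = (U, \<phi>)" by fastforce
  with c have "open U \<and> open (\<phi> ` U) \<and> homeomorphism U (\<phi> ` U) \<phi> (chart_inv c)"
    using bspec[OF smooth_atlas_M[unfolded smooth_atlas_def, THEN conjunct1], of "(U, \<phi>)"] by simp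
  then show "open (fst c)" "homeomorphism (fst c) (snd c ` fst c) (snd c) (chart_inv c)" "open (snd c ` fst c)"
    using \<open>c = (U, \<phi>)\<close> by simp_all
qed

lemma chart_inv_snd: "c \<in> atlas M \<Longrightarrow> p \<in> fst c \<Longrightarrow> chart_inv c (snd c p) = p"
  using chart_homeo homeomorphism_apply1 by blast

lemma chart_inv_in: "c \<in> atlas M \<Longrightarrow> y \<in> img c U \<Longrightarrow> chart_inv c y \<in> fst c \<and> chart_inv c y \<in> U \<and> snd c (chart_inv c y) = y"
  by (erule imageE) (simp add: chart_inv_snd)

lemma open_img: "c \<in> atlas M \<Longrightarrow> open U \<Longrightarrow> open (img c U)"
proof -
  assume c: "c \<in> atlas M" and U: "open U"
  have "openin (top_of_set (snd c ` fst c)) (snd c ` (fst c \<inter> U))"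
    using homeomorphism_imp_open_map[OF chart_homeo[OF c]] U by (simp add: openin_open_Int)
  then show ?thesis using chart_open_image[OF c] openin_open_trans by blast
qed

lemma chart_at: "chart_at M p \<in> atlas M" "p \<in> fst (chart_at M p)"
proof -
  have "\<exists>c. c \<in> atlas M \<and> p \<in> fst c"
    using smooth_atlas_M unfolding smooth_atlas_def by blast
  then have "chart_at M p \<in> atlas M \<and> p \<in> fst (chart_at M p)" unfolding chart_at_def by (rule someI_ex)
  then show "chart_at M p \<in> atlas M" "p \<in> fst (chart_at M p)" by auto
qed

lemma smooth_tr: "c \<in> atlas M \<Longrightarrow> c' \<in> atlas M \<Longrightarrow> smooth_on (img c (fst c')) (tr c c')"
proof -
  assume "c \<in> atlas M" "c' \<in> atlas M"
  moreover obtain U \<phi> V \<psi> where "c = (U, \<phi>)" "c' = (V, \<psi>)" by fastforce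
  moreover have "tr c c' = snd c' \<circ> chart_inv c" by (simp add: tr_def fun_eq_iff)
  ultimately show ?thesis using smooth_atlas_M unfolding smooth_atlas_def by fastforce
qed

lemma tr_in: "c \<in> atlas M \<Longrightarrow> y \<in> img c (fst c' \<inter> U) \<Longrightarrow> tr c c' y \<in> img c' (fst c \<inter> U)"
  using chart_inv_in[of c y "fst c' \<inter> U"] by (auto simp: tr_def)

lemma chart_inv_tr: "c \<in> atlas M \<Longrightarrow> c' \<in> atlas M \<Longrightarrow> y \<in> img c (fst c') \<Longrightarrow> chart_inv c' (tr c c' y) = chart_inv c y"
  using chart_inv_in[of c y "fst c'"] by (auto simp: tr_def chart_inv_snd)

lemma dtr_has_derivative:
  "c \<in> atlas M \<Longrightarrow> c' \<in> atlas M \<Longrightarrow> p \<in> fst c \<Longrightarrow> p \<in> fst c' \<Longrightarrow> (tr c c' has_derivative dtr c c' p) (at (snd c p))"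
  unfolding dtr_def by (rule smooth_on_has_derivative[OF smooth_tr]) auto

lemma linear_dtr: "c \<in> atlas M \<Longrightarrow> c' \<in> atlas M \<Longrightarrow> p \<in> fst c \<Longrightarrow> p \<in> fst c' \<Longrightarrow> linear (dtr c c' p)"
  using dtr_has_derivative has_derivative_linear by blast

lemma dtr_chain:
  assumes "c \<in> atlas M" "c' \<in> atlas M" "c'' \<in> atlas M" "p \<in> fst c" "p \<in> fst c'" "p \<in> fst c''"
  shows "dtr c' c'' p (dtr c c' p v) = dtr c c'' p v"
proof -
  have tr: "tr c c' (snd c p) = snd c' p" using assms by (simp add: tr_def chart_inv_snd)
  have "((\<lambda>y. tr c' c'' (tr c c' y)) has_derivative (\<lambda>v. dtr c' c'' p (dtr c c' p v))) (at (snd c p))"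
    using has_derivative_compose[OF dtr_has_derivative[of c c' p]] dtr_has_derivative[of c' c'' p] assms tr by metis
  moreover have "tr c' c'' (tr c c' y) = tr c c'' y" if "y \<in> img c (fst c')" for y
    using chart_inv_tr[OF assms(1,2) that] by (simp add: tr_def)
  ultimately have "(tr c c'' has_derivative (\<lambda>v. dtr c' c'' p (dtr c c' p v))) (at (snd c p))"
    using has_derivative_transform_within_open[of "\<lambda>y. tr c' c'' (tr c c' y)" _ "snd c p" UNIV "img c (fst c')" "tr c c''"]
      open_img[OF assms(1) chart_open[OF assms(2)]] assms by auto
  then show ?thesis using dtr_has_derivative[of c c'' p] assms has_derivative_unique by metis
qed

lemma dtr_id: "c \<in> atlas M \<Longrightarrow> p \<in> fst c \<Longrightarrow> dtr c c p v = v"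
proof -
  assume c: "c \<in> atlas M" and p: "p \<in> fst c"
  have "tr c c y = y" if "y \<in> img c UNIV" for y using chart_inv_in[OF c that] by (simp add: tr_def)
  then have "(tr c c has_derivative (\<lambda>v. v)) (at (snd c p))"
    using has_derivative_transform_within_open[of "\<lambda>y. y" "\<lambda>v. v" "snd c p" UNIV "img c UNIV" "tr c c"]
      open_img[OF c open_UNIV] p by auto
  then show ?thesis using dtr_has_derivative[OF c c p p] has_derivative_unique by metis
qed

lemma tang_to_dtr: "tang_to M c p = dtr (chart_at M p) c p"
  and tang_from_dtr: "tang_from M c p = dtr c (chart_at M p) p"
  by (simp_all add: tang_to_def tang_from_def dtr_def tr_def[abs_def] comp_def)

lemma tang_to_from: "c \<in> atlas M \<Longrightarrow> p \<in> fst c \<Longrightarrow> tang_to M c p (tang_from M c p v) = v"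
  and tang_from_to: "c \<in> atlas M \<Longrightarrow> p \<in> fst c \<Longrightarrow> tang_from M c p (tang_to M c p v) = v"
  and linear_tang_from: "c \<in> atlas M \<Longrightarrow> p \<in> fst c \<Longrightarrow> linear (tang_from M c p)"
  and linear_tang_to: "c \<in> atlas M \<Longrightarrow> p \<in> fst c \<Longrightarrow> linear (tang_to M c p)"
  and tang_from_chart_at: "tang_from M (chart_at M p) p v = v"
  and tang_to_chart_at: "tang_to M (chart_at M p) p v = v"
  and tang_to_from_dtr: "c \<in> atlas M \<Longrightarrow> c' \<in> atlas M \<Longrightarrow> p \<in> fst c \<Longrightarrow> p \<in> fst c' \<Longrightarrow>
    tang_to M c' p (tang_from M c p v) = dtr c c' p v"
  and tang_from_dtr_eq: "c \<in> atlas M \<Longrightarrow> c' \<in> atlas M \<Longrightarrow> p \<in> fst c \<Longrightarrow> p \<in> fst c' \<Longrightarrow>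
    tang_from M c' p (dtr c c' p v) = tang_from M c p v"
  and dtr_tang_to_eq: "c \<in> atlas M \<Longrightarrow> c' \<in> atlas M \<Longrightarrow> p \<in> fst c \<Longrightarrow> p \<in> fst c' \<Longrightarrow>
    dtr c c' p (tang_to M c p v) = tang_to M c' p v"
  by (simp_all add: tang_to_dtr tang_from_dtr dtr_chain dtr_id chart_at linear_dtr)

section \<open>Smooth functions on open subsets of the manifold\<close>

definition smf :: "'m set \<Rightarrow> ('m \<Rightarrow> real) \<Rightarrow> bool" where
  "smf U f \<longleftrightarrow> open U \<and> (\<forall>c\<in>atlas M. smooth_on (img c U) (\<lambda>y. f (chart_inv c y)))"

lemma smfI: "open U \<Longrightarrow> (\<And>c. c \<in> atlas M \<Longrightarrow> smooth_on (img c U) (\<lambda>y. f (chart_inv c y))) \<Longrightarrow> smf U f"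
  by (simp add: smf_def)

lemma smfD: "smf U f \<Longrightarrow> c \<in> atlas M \<Longrightarrow> smooth_on (img c U) (\<lambda>y. f (chart_inv c y))"
  and smf_open: "smf U f \<Longrightarrow> open U"
  by (simp_all add: smf_def)

lemma smf_const: "open U \<Longrightarrow> smf U (\<lambda>_. r)"
  by (simp add: smf_def)

lemma smf_mult: "smf U f \<Longrightarrow> smf U h \<Longrightarrow> smf U (\<lambda>p. f p * h p)"
  by (auto simp: smf_def intro: smooth_on_mult open_img)

lemma smf_uminus: "smf U f \<Longrightarrow> smf U (\<lambda>p. - f p)"
  by (auto simp: smf_def intro: smooth_on_uminus open_img)

lemma smf_sum: "open U \<Longrightarrow> (\<And>i. i \<in> I \<Longrightarrow> smf U (f i)) \<Longrightarrow> smf U (\<lambda>p. \<Sum>i\<in>I. f i p)"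
  by (rule smfI) (auto intro!: smooth_on_sum open_img simp del: snd_conv dest: smfD)

lemma smf_powr: "smf U f \<Longrightarrow> (\<And>p. p \<in> U \<Longrightarrow> f p > 0) \<Longrightarrow> smf U (\<lambda>p. f p powr a)"
  unfolding smf_def using chart_inv_in by (auto intro!: smooth_on_powr_fun open_img)

lemma smf_subset: "smf U f \<Longrightarrow> V \<subseteq> U \<Longrightarrow> open V \<Longrightarrow> smf V f"
  unfolding smf_def by (meson Int_mono image_mono order_refl smooth_on_subset)

lemma smf_cong: "(\<And>p. p \<in> U \<Longrightarrow> f p = h p) \<Longrightarrow> smf U f \<longleftrightarrow> smf U h"
proof -
  assume e: "\<And>p. p \<in> U \<Longrightarrow> f p = h p"
  have "smooth_on (img c U) (\<lambda>y. f (chart_inv c y)) \<longleftrightarrow> smooth_on (img c U) (\<lambda>y. h (chart_inv c y))"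
    if "c \<in> atlas M" "open U" for c
    by (rule smooth_on_cong[OF open_img[OF that]]) (use chart_inv_in[OF that(1)] e in blast)
  then show ?thesis unfolding smf_def by blast
qed

lemma smooth_img_local:
  assumes c: "c \<in> atlas M" and l: "\<And>x. x \<in> U \<Longrightarrow> \<exists>V. open V \<and> x \<in> V \<and> smooth_on (img c (U \<inter> V)) F" and U: "open U"
  shows "smooth_on (img c U) F"
proof (rule smooth_on_local)
  fix y assume y: "y \<in> img c U"
  then have x: "chart_inv c y \<in> U" "chart_inv c y \<in> fst c" "snd c (chart_inv c y) = y" using chart_inv_in[OF c] by auto
  then obtain V where V: "open V" "chart_inv c y \<in> V" "smooth_on (img c (U \<inter> V)) F" using l by blast
  then show "\<exists>T. open T \<and> y \<in> T \<and> smooth_on T F"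
    using x by (intro exI[of _ "img c (U \<inter> V)"]) (auto intro!: open_img c U image_eqI[of _ _ "chart_inv c y"])
qed

lemma smf_local:
  assumes "open U" "\<And>x. x \<in> U \<Longrightarrow> \<exists>V. open V \<and> x \<in> V \<and> smf (U \<inter> V) f"
  shows "smf U f"
proof (rule smfI[OF assms(1)])
  fix c assume c: "c \<in> atlas M"
  show "smooth_on (img c U) (\<lambda>y. f (chart_inv c y))"
  proof (rule smooth_img_local[OF c _ assms(1)])
    fix x assume "x \<in> U"
    then obtain V where "open V" "x \<in> V" "smf (U \<inter> V) f" using assms(2) by blast
    then show "\<exists>V. open V \<and> x \<in> V \<and> smooth_on (img c (U \<inter> V)) (\<lambda>y. f (chart_inv c y))"
      using smfD[OF _ c] by blast
  qed
qed

text \<open>Every other chart sees \<open>f\<close> through a smooth change of coordinates.\<close>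

lemma smf_one_chart:
  assumes c: "c \<in> atlas M" and U: "open U" "U \<subseteq> fst c" and f: "smooth_on (img c U) (\<lambda>y. f (chart_inv c y))"
  shows "smf U f"
proof (rule smfI[OF U(1)])
  fix c' assume c': "c' \<in> atlas M"
  have sub: "img c' U = img c' (fst c \<inter> U)" using U by blast
  have "smooth_on (img c' (fst c \<inter> U)) (\<lambda>y. f (chart_inv c (tr c' c y)))"
  proof (rule smooth_on_compose[OF _ open_img[OF c U(1)] _ f])
    show "open (img c' (fst c \<inter> U))" using c' U c by (intro open_img open_Int chart_open)
    show "tr c' c ` img c' (fst c \<inter> U) \<subseteq> img c U" using tr_in[OF c', of _ c U] by blast
    show "smooth_on (img c' (fst c \<inter> U)) (tr c' c)" by (rule smooth_on_subset[OF smooth_tr[OF c' c]]) auto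
  qed
  moreover have "chart_inv c (tr c' c y) = chart_inv c' y" if "y \<in> img c' (fst c \<inter> U)" for y
    using chart_inv_tr[OF c' c, of y] that by blast
  moreover have "open (img c' (fst c \<inter> U))" by (intro open_img[OF c'] open_Int chart_open[OF c] U(1))
  ultimately show "smooth_on (img c' U) (\<lambda>y. f (chart_inv c' y))" unfolding sub
    by (subst smooth_on_cong[of _ _ "\<lambda>y. f (chart_inv c (tr c' c y))"]) auto
qed

subsection \<open>Vector fields\<close>

lemma smooth_vfI: "(\<And>c. c \<in> atlas M \<Longrightarrow> smooth_on (img c U) (vf_rep M c X)) \<Longrightarrow> smooth_vf_on M U X"
  by (simp add: smooth_vf_on_def)

lemma smooth_vfD: "smooth_vf_on M U X \<Longrightarrow> c \<in> atlas M \<Longrightarrow> smooth_on (img c U) (vf_rep M c X)"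
  by (simp add: smooth_vf_on_def)

lemma smooth_vf_subset: "smooth_vf_on M U X \<Longrightarrow> V \<subseteq> U \<Longrightarrow> smooth_vf_on M V X"
  unfolding smooth_vf_on_def by (meson Int_mono image_mono order_refl smooth_on_subset)

lemma smooth_vf_cong:
  assumes "open U" "\<And>p. p \<in> U \<Longrightarrow> X p = Y p" "smooth_vf_on M U Y"
  shows "smooth_vf_on M U X"
proof (rule smooth_vfI)
  fix c assume c: "c \<in> atlas M"
  have "smooth_on (img c U) (vf_rep M c X) \<longleftrightarrow> smooth_on (img c U) (vf_rep M c Y)"
    by (rule smooth_on_cong[OF open_img[OF c assms(1)]]) (use chart_inv_in[OF c] assms(2) in \<open>auto simp: vf_rep_def\<close>)
  then show "smooth_on (img c U) (vf_rep M c X)" using smooth_vfD[OF assms(3) c] by simp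
qed

lemma smooth_vf_local:
  assumes "open U" "\<And>x. x \<in> U \<Longrightarrow> \<exists>V. open V \<and> x \<in> V \<and> smooth_vf_on M (U \<inter> V) X"
  shows "smooth_vf_on M U X"
proof (rule smooth_vfI)
  fix c assume c: "c \<in> atlas M"
  show "smooth_on (img c U) (vf_rep M c X)"
    by (rule smooth_img_local[OF c _ assms(1)]) (meson assms(2) smooth_vfD c)
qed

lemma smooth_vf_lincomb:
  assumes U: "open U" and f: "\<And>i. i \<in> I \<Longrightarrow> smf U (f i)" and X: "\<And>i. i \<in> I \<Longrightarrow> smooth_vf_on M U (X i)"
  shows "smooth_vf_on M U (\<lambda>p. \<Sum>i\<in>I. f i p *\<^sub>R X i p)"
proof (rule smooth_vfI)
  fix c assume c: "c \<in> atlas M"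
  have "vf_rep M c (\<lambda>p. \<Sum>i\<in>I. f i p *\<^sub>R X i p) y = (\<Sum>i\<in>I. f i (chart_inv c y) *\<^sub>R vf_rep M c (X i) y)"
    if "y \<in> img c U" for y
    using linear_tang_to[OF c, of "chart_inv c y"] chart_inv_in[OF c that]
    by (simp add: vf_rep_def linear_sum linear_scale)
  then show "smooth_on (img c U) (vf_rep M c (\<lambda>p. \<Sum>i\<in>I. f i p *\<^sub>R X i p))"
    by (subst smooth_on_cong[OF open_img[OF c U]])
      (auto intro!: smooth_on_sum smooth_on_scaleR open_img c U smfD f smooth_vfD X)
qed

lemma smooth_vf_scale: "smf U f \<Longrightarrow> smooth_vf_on M U X \<Longrightarrow> smooth_vf_on M U (\<lambda>p. f p *\<^sub>R X p)"
  using smooth_vf_lincomb[of U "{()}" "\<lambda>_. f" "\<lambda>_. X"] smf_open by simp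

lemma smooth_vf_add: "open U \<Longrightarrow> smooth_vf_on M U X \<Longrightarrow> smooth_vf_on M U Y \<Longrightarrow> smooth_vf_on M U (\<lambda>p. X p + Y p)"
  using smooth_vf_lincomb[of U "UNIV::bool set" "\<lambda>_ _. 1" "\<lambda>b. if b then X else Y"] smf_const[of U 1]
  by (simp add: UNIV_bool add.commute)

lemma smooth_vf_diff: "open U \<Longrightarrow> smooth_vf_on M U X \<Longrightarrow> smooth_vf_on M U Y \<Longrightarrow> smooth_vf_on M U (\<lambda>p. X p - Y p)"
  using smooth_vf_add[of U X "\<lambda>p. (- 1) *\<^sub>R Y p"] smooth_vf_scale[OF smf_const, of U Y "-1"] by simp

text \<open>The values may jump with the arbitrary reference charts, but read in a chart
  \<open>c'\<close> the field is the image of \<open>u\<close> under the Jacobian of the change of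
  charts, which is smooth.\<close>

lemma smooth_vf_coord:
  assumes c: "c \<in> atlas M"
  shows "smooth_vf_on M (fst c) (\<lambda>p. tang_from M c p u)"
proof (rule smooth_vfI)
  fix c' assume c': "c' \<in> atlas M"
  have "smooth_on (img c' (fst c)) (\<lambda>y. frechet_derivative (tr c c') (at (tr c' c y)) u)"
  proof (rule smooth_on_compose[where g = "\<lambda>z. frechet_derivative (tr c c') (at z) u"])
    show "open (img c' (fst c))" "open (img c (fst c'))" using c c' by (auto intro: open_img chart_open)
    show "tr c' c ` img c' (fst c) \<subseteq> img c (fst c')" using tr_in[OF c', of _ c UNIV] by auto
    show "smooth_on (img c (fst c')) (\<lambda>z. frechet_derivative (tr c c') (at z) u)"
      by (rule smooth_on_derivative[OF smooth_tr[OF c c']])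
    show "smooth_on (img c' (fst c)) (tr c' c)" by (rule smooth_tr[OF c' c])
  qed
  moreover have "vf_rep M c' (\<lambda>p. tang_from M c p u) y = frechet_derivative (tr c c') (at (tr c' c y)) u"
    if "y \<in> img c' (fst c)" for y
    using chart_inv_in[OF c' that] c c' by (simp add: vf_rep_def tang_to_from_dtr) (simp add: dtr_def tr_def)
  ultimately show "smooth_on (img c' (fst c)) (vf_rep M c' (\<lambda>p. tang_from M c p u))"
    using smooth_on_cong[OF open_img[OF c' chart_open[OF c]], of "vf_rep M c' (\<lambda>p. tang_from M c p u)"] by metis
qed

lemma vf_rep_tang_from: "c \<in> atlas M \<Longrightarrow> y \<in> img c UNIV \<Longrightarrow> tang_from M c (chart_inv c y) (vf_rep M c X y) = X (chart_inv c y)"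
  using chart_inv_in[of c y UNIV] by (simp add: vf_rep_def tang_from_to)

lemma metric_M: "bilinear (gTM M p)" "gTM M p u v = gTM M p v u" "v \<noteq> 0 \<Longrightarrow> gTM M p v v > 0"
  and metric_smooth: "c \<in> atlas M \<Longrightarrow> smooth_on (snd c ` fst c)
        (\<lambda>y. gTM M (chart_inv c y) (tang_from M c (chart_inv c y) u) (tang_from M c (chart_inv c y) v))"
  using filtered unfolding filtered_riemannian_manifold_def riemannian_metric_def by auto

text \<open>The metric is assumed smooth on coordinate fields; arbitrary fields are expanded in
  these with smooth components.\<close>

lemma smf_metric:
  assumes U: "open U" and X: "smooth_vf_on M U X" and Y: "smooth_vf_on M U Y"
  shows "smf U (\<lambda>p. gTM M p (X p) (Y p))"
proof (rule smfI[OF U])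
  fix c assume c: "c \<in> atlas M"
  let ?F = "\<lambda>b y. tang_from M c (chart_inv c y) b"
  have "gTM M (chart_inv c y) (X (chart_inv c y)) (Y (chart_inv c y)) =
    (\<Sum>a\<in>Basis. \<Sum>b\<in>Basis. (vf_rep M c X y \<bullet> a) * (vf_rep M c Y y \<bullet> b) * gTM M (chart_inv c y) (?F a y) (?F b y))"
    if y: "y \<in> img c U" for y
  proof -
    have lin: "linear (tang_from M c (chart_inv c y))" using chart_inv_in[OF c y] linear_tang_from[OF c] by blast
    have ex: "Z (chart_inv c y) = (\<Sum>a\<in>Basis. (vf_rep M c Z y \<bullet> a) *\<^sub>R ?F a y)" for Z
    proof -
      have "Z (chart_inv c y) = tang_from M c (chart_inv c y) (\<Sum>a\<in>Basis. (vf_rep M c Z y \<bullet> a) *\<^sub>R a)"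
        using vf_rep_tang_from[OF c, of y Z] y by (auto simp: euclidean_representation)
      then show ?thesis by (simp add: linear_sum[OF lin] linear_scale[OF lin])
    qed
    have bl: "linear (\<lambda>u. gTM M (chart_inv c y) u v)" "linear (gTM M (chart_inv c y) u)" for u v
      using metric_M(1) bilinear_def by blast+
    have "gTM M (chart_inv c y) (X (chart_inv c y)) (Y (chart_inv c y)) =
      (\<Sum>b\<in>Basis. \<Sum>a\<in>Basis. (vf_rep M c X y \<bullet> a) * (vf_rep M c Y y \<bullet> b) * gTM M (chart_inv c y) (?F a y) (?F b y))"
      by (subst ex[of X], subst ex[of Y])
        (simp add: linear_sum[OF bl(1)] linear_sum[OF bl(2)] linear_scale[OF bl(1)] linear_scale[OF bl(2)]
          sum_distrib_left mult_ac)
    then show ?thesis by (subst sum.swap)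
  qed
  moreover have "smooth_on (img c U) (\<lambda>y. \<Sum>a\<in>Basis. \<Sum>b\<in>Basis. (vf_rep M c X y \<bullet> a) * (vf_rep M c Y y \<bullet> b) * gTM M (chart_inv c y) (?F a y) (?F b y))"
    by (intro smooth_on_sum smooth_on_mult smooth_on_inner smooth_on_const smooth_vfD X Y c open_img U
      smooth_on_subset[OF metric_smooth[OF c]]) auto
  ultimately show "smooth_on (img c U) (\<lambda>y. gTM M (chart_inv c y) (X (chart_inv c y)) (Y (chart_inv c y)))"
    using smooth_on_cong[OF open_img[OF c U]] by (metis (no_types, lifting))
qed

definition Dm :: "('m \<Rightarrow> real) \<Rightarrow> 'm \<Rightarrow> 'e \<Rightarrow> real" where
  "Dm f p v = frechet_derivative (\<lambda>y. f (chart_inv (chart_at M p) y)) (at (snd (chart_at M p) p)) v"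

text \<open>\<open>Dm\<close> is read off in the reference chart of the point; the chain rule makes
  it available in every chart.\<close>

lemma Dm_chart:
  assumes f: "smf U f" and c: "c \<in> atlas M" and p: "p \<in> fst c" "p \<in> U"
  shows "frechet_derivative (\<lambda>y. f (chart_inv c y)) (at (snd c p)) u = Dm f p (tang_from M c p u)"
proof -
  let ?r = "chart_at M p"
  have U: "open U" by (rule smf_open[OF f])
  have tr: "tr c ?r (snd c p) = snd ?r p" using c p by (simp add: tr_def chart_inv_snd)
  have h: "((\<lambda>y. f (chart_inv ?r y)) has_derivative Dm f p) (at (snd ?r p))"
    unfolding Dm_def[abs_def] using chart_at p by (intro smooth_on_has_derivative[OF smfD[OF f]]) auto
  have "((\<lambda>y. f (chart_inv ?r (tr c ?r y))) has_derivative (\<lambda>u. Dm f p (dtr c ?r p u))) (at (snd c p))"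
    by (rule has_derivative_compose[OF dtr_has_derivative]) (use c p chart_at h tr in auto)
  then have "((\<lambda>y. f (chart_inv c y)) has_derivative (\<lambda>u. Dm f p (dtr c ?r p u))) (at (snd c p))"
    by (rule has_derivative_transform_within_open[OF _ open_img[OF c chart_open[OF chart_at(1)[of p]]]])
      (use c p chart_at chart_inv_tr in auto)
  then show ?thesis by (simp add: frechet_derivative_eq tang_from_dtr)
qed

lemma Dm_cong: "open V \<Longrightarrow> p \<in> V \<Longrightarrow> (\<And>q. q \<in> V \<Longrightarrow> f q = h q) \<Longrightarrow> Dm f p = Dm h p"
proof -
  assume V: "open V" "p \<in> V" "\<And>q. q \<in> V \<Longrightarrow> f q = h q"
  show ?thesis unfolding Dm_def[abs_def]
    by (rule frechet_derivative_cong_open[of "img (chart_at M p) V"])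
      (use V chart_at chart_inv_in[OF chart_at(1)] in \<open>auto intro!: open_img\<close>)
qed

lemma Dm_const: "Dm (\<lambda>_. r) p v = 0"
  by (simp add: Dm_def frechet_derivative_const)

lemma lie_bracket_cong:
  assumes V: "open V" "p \<in> V" "\<And>q. q \<in> V \<Longrightarrow> X q = X' q" "\<And>q. q \<in> V \<Longrightarrow> Y q = Y' q"
  shows "lie_bracket M X Y p = lie_bracket M X' Y' p"
proof -
  let ?c = "chart_at M p"
  have "frechet_derivative (vf_rep M ?c Z) (at (snd ?c p)) = frechet_derivative (vf_rep M ?c Z') (at (snd ?c p))"
    if "\<And>q. q \<in> V \<Longrightarrow> Z q = Z' q" for Z Z'
    by (rule frechet_derivative_cong_open[of "img ?c V"])
      (use V that chart_at chart_inv_in[OF chart_at(1)] in \<open>auto intro!: open_img simp: vf_rep_def\<close>)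
  from this[OF V(3)] this[OF V(4)] show ?thesis using V by (simp add: lie_bracket_def Let_def)
qed

end

subsection \<open>Smooth families of alternating forms\<close>

lemma ext_T_expand_Basis:
  "a \<in> ext_T \<Longrightarrow> a (us @ v # vs) = (\<Sum>b\<in>Basis. (v \<bullet> b) * a (us @ b # vs))"
  by (subst euclidean_representation[of v, symmetric]) (simp add: ext_T_sum_arg ext_T_scale)

lemma ext_T_pullback:
  assumes "a \<in> ext_T" "linear f"
  shows "(\<lambda>us. a (map f us)) \<in> ext_T"
  using ext_T_add[OF assms(1)] ext_T_scale[OF assms(1)] ext_T_alt[OF assms(1)]
  by (auto simp: ext_T_iff linear_add[OF assms(2)] linear_scale[OF assms(2)] distinct_map)

lemma smooth_on_multi:
  fixes \<rho> :: "'e::euclidean_space \<Rightarrow> 'e list \<Rightarrow> real"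
  assumes S: "open S"
  shows "(\<And>y. y \<in> S \<Longrightarrow> \<rho> y \<in> ext_T) \<Longrightarrow> (\<And>us. smooth_on S (\<lambda>y. \<rho> y us)) \<Longrightarrow>
    (\<And>x. x \<in> set xs \<Longrightarrow> smooth_on S (V x)) \<Longrightarrow> smooth_on S (\<lambda>y. \<rho> y (map (\<lambda>x. V x y) xs))"
proof (induction xs arbitrary: \<rho>)
  case Nil then show ?case by simp
next
  case (Cons x xs)
  have t: "smooth_on S (\<lambda>y. \<rho> y (b # map (\<lambda>x. V x y) xs))" for b
  proof (rule Cons.IH[of "\<lambda>y us. \<rho> y (b # us)"])
    show "(\<lambda>us. \<rho> y (b # us)) \<in> ext_T" if "y \<in> S" for y by (rule ext_T_tail[OF Cons.prems(1)[OF that]])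
    show "smooth_on S (\<lambda>y. \<rho> y (b # us))" for us by (rule Cons.prems(2))
    show "smooth_on S (V z)" if "z \<in> set xs" for z by (rule Cons.prems(3)) (simp add: that)
  qed
  have v: "smooth_on S (V x)" by (rule Cons.prems(3)) simp
  have "smooth_on S (\<lambda>y. \<Sum>b\<in>Basis. (V x y \<bullet> b) * \<rho> y (b # map (\<lambda>x. V x y) xs))"
    by (intro smooth_on_sum[OF S] smooth_on_mult[OF S] t smooth_on_inner[OF S v smooth_on_const])
  moreover have eq: "\<rho> y (map (\<lambda>x. V x y) (x # xs)) = (\<Sum>b\<in>Basis. (V x y \<bullet> b) * \<rho> y (b # map (\<lambda>x. V x y) xs))"
    if "y \<in> S" for y
    using ext_T_expand_Basis[OF Cons.prems(1)[OF that], of "[]" "V x y" "map (\<lambda>x. V x y) xs"] by simp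
  ultimately show ?case by (subst smooth_on_cong[OF S eq])
qed

lemma ext_T_derivative:
  fixes \<rho> :: "'a::euclidean_space \<Rightarrow> 'e::euclidean_space list \<Rightarrow> real"
  assumes S: "open S" "y0 \<in> S" and ext: "\<And>y. y \<in> S \<Longrightarrow> \<rho> y \<in> ext_T"
    and diff: "\<And>us. (\<lambda>y. \<rho> y us) differentiable (at y0)"
  shows "(\<lambda>us. frechet_derivative (\<lambda>y. \<rho> y us) (at y0) h) \<in> ext_T"
  unfolding ext_T_iff
proof (intro conjI allI impI)
  note d = diff[unfolded frechet_derivative_works]
  fix us vs x y
  have "frechet_derivative (\<lambda>z. \<rho> z (us @ (x + y) # vs)) (at y0)
      = frechet_derivative (\<lambda>z. \<rho> z (us @ x # vs) + \<rho> z (us @ y # vs)) (at y0)"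
    by (rule frechet_derivative_cong_open[OF S]) (rule ext_T_add[OF ext])
  also have "\<dots> = (\<lambda>h. frechet_derivative (\<lambda>z. \<rho> z (us @ x # vs)) (at y0) h + frechet_derivative (\<lambda>z. \<rho> z (us @ y # vs)) (at y0) h)"
    by (rule frechet_derivative_eq[OF has_derivative_add[OF d d]])
  finally show "frechet_derivative (\<lambda>z. \<rho> z (us @ (x + y) # vs)) (at y0) h =
     frechet_derivative (\<lambda>z. \<rho> z (us @ x # vs)) (at y0) h + frechet_derivative (\<lambda>z. \<rho> z (us @ y # vs)) (at y0) h" by simp
next
  note d = diff[unfolded frechet_derivative_works]
  fix us vs r x
  have "frechet_derivative (\<lambda>z. \<rho> z (us @ (r *\<^sub>R x) # vs)) (at y0) = frechet_derivative (\<lambda>z. r * \<rho> z (us @ x # vs)) (at y0)"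
    by (rule frechet_derivative_cong_open[OF S]) (rule ext_T_scale[OF ext])
  also have "\<dots> = (\<lambda>h. r * frechet_derivative (\<lambda>z. \<rho> z (us @ x # vs)) (at y0) h)"
    by (rule frechet_derivative_eq[OF has_derivative_mult_right[OF d]])
  finally show "frechet_derivative (\<lambda>z. \<rho> z (us @ (r *\<^sub>R x) # vs)) (at y0) h =
     r * frechet_derivative (\<lambda>z. \<rho> z (us @ x # vs)) (at y0) h" by simp
next
  fix vs :: "'e list" assume "\<not> distinct vs"
  then have "frechet_derivative (\<lambda>z. \<rho> z vs) (at y0) = frechet_derivative (\<lambda>z. 0) (at y0)"
    by (intro frechet_derivative_cong_open[OF S]) (rule ext_T_alt[OF ext])
  then show "frechet_derivative (\<lambda>z. \<rho> z vs) (at y0) h = 0" by (simp add: frechet_derivative_const)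
qed

text \<open>The product rule for a form with moving arguments. Expanding each argument in the basis
  reduces it to products of scalar functions.\<close>

lemma has_derivative_multi:
  fixes \<rho> :: "'a::euclidean_space \<Rightarrow> 'e::euclidean_space list \<Rightarrow> real"
  assumes S: "open S" "y0 \<in> S" and V: "\<And>x. (V x has_derivative \<delta> x) (at y0)"
  shows "(\<And>y. y \<in> S \<Longrightarrow> \<rho> y \<in> ext_T) \<Longrightarrow> (\<And>us. (\<lambda>y. \<rho> y us) differentiable (at y0)) \<Longrightarrow>
    ((\<lambda>y. \<rho> y (map (\<lambda>x. V x y) xs)) has_derivative
      (\<lambda>h. frechet_derivative (\<lambda>y. \<rho> y (map (\<lambda>x. V x y0) xs)) (at y0) h
        + derivsum (\<lambda>x. \<delta> x h) (\<rho> y0) (\<lambda>x. V x y0) xs)) (at y0)"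
proof (induction xs arbitrary: \<rho>)
  case Nil then show ?case by (simp add: frechet_derivative_works[symmetric])
next
  case (Cons x xs)
  let ?m = "map (\<lambda>x. V x y0) xs"
  have IH: "((\<lambda>y. \<rho> y (b # map (\<lambda>x. V x y) xs)) has_derivative
      (\<lambda>h. frechet_derivative (\<lambda>y. \<rho> y (b # ?m)) (at y0) h
        + derivsum (\<lambda>x. \<delta> x h) (\<lambda>us. \<rho> y0 (b # us)) (\<lambda>x. V x y0) xs)) (at y0)" for b
    by (rule Cons.IH) (use Cons.prems in \<open>auto intro: ext_T_tail\<close>)
  have "((\<lambda>y. \<Sum>b\<in>Basis. (V x y \<bullet> b) * \<rho> y (b # map (\<lambda>x. V x y) xs)) has_derivative
      (\<lambda>h. \<Sum>b\<in>Basis. (V x y0 \<bullet> b) * (frechet_derivative (\<lambda>y. \<rho> y (b # ?m)) (at y0) h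
        + derivsum (\<lambda>x. \<delta> x h) (\<lambda>us. \<rho> y0 (b # us)) (\<lambda>x. V x y0) xs) + (\<delta> x h \<bullet> b) * \<rho> y0 (b # ?m))) (at y0)"
    by (intro has_derivative_sum has_derivative_mult IH has_derivative_inner_left V)
  moreover have "(\<Sum>b\<in>Basis. (V x y0 \<bullet> b) * (frechet_derivative (\<lambda>y. \<rho> y (b # ?m)) (at y0) h
        + derivsum (\<lambda>x. \<delta> x h) (\<lambda>us. \<rho> y0 (b # us)) (\<lambda>x. V x y0) xs) + (\<delta> x h \<bullet> b) * \<rho> y0 (b # ?m))
     = frechet_derivative (\<lambda>y. \<rho> y (map (\<lambda>x. V x y0) (x # xs))) (at y0) h
        + derivsum (\<lambda>x. \<delta> x h) (\<rho> y0) (\<lambda>x. V x y0) (x # xs)" for h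
  proof -
    have r: "\<rho> y0 \<in> ext_T" by (rule Cons.prems(1)[OF S(2)])
    have d: "(\<lambda>us. frechet_derivative (\<lambda>y. \<rho> y us) (at y0) h) \<in> ext_T"
      by (rule ext_T_derivative[OF S Cons.prems])
    have c: "(\<lambda>us. derivsum (\<lambda>x. \<delta> x h) (\<lambda>vs. \<rho> y0 (u # vs)) (\<lambda>x. V x y0) us) xs =
       (\<Sum>b\<in>Basis. (u \<bullet> b) * derivsum (\<lambda>x. \<delta> x h) (\<lambda>us. \<rho> y0 (b # us)) (\<lambda>x. V x y0) xs)" for u
      unfolding derivsum_def
      by (simp add: ext_T_expand_Basis[OF r, of "[]" u, simplified] sum_distrib_left)
        (rule sum.swap)
    show ?thesis
      using ext_T_expand_Basis[OF d, of "[]" "V x y0" ?m] ext_T_expand_Basis[OF r, of "[]" "\<delta> x h" ?m] c[of "V x y0"]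
      by (simp add: derivsum_Cons sum.distrib distrib_left)
  qed
  ultimately have "((\<lambda>y. \<Sum>b\<in>Basis. (V x y \<bullet> b) * \<rho> y (b # map (\<lambda>x. V x y) xs)) has_derivative
      (\<lambda>h. frechet_derivative (\<lambda>y. \<rho> y (map (\<lambda>x. V x y0) (x # xs))) (at y0) h
        + derivsum (\<lambda>x. \<delta> x h) (\<rho> y0) (\<lambda>x. V x y0) (x # xs))) (at y0)" by simp
  then show ?case
    by (rule has_derivative_transform_within_open[OF _ S])
      (use ext_T_expand_Basis[OF Cons.prems(1), of _ "[]"] in auto)
qed

text \<open>The common source of two facts. If the arguments come from the Jacobian of a change of
  charts, the second sum vanishes by symmetry of second derivatives, which gives chart independence
  of the exterior derivative; for general fields it contains the Lie brackets of Cartan's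
  formula.\<close>

lemma altsum_deriv:
  fixes \<rho> :: "'a::euclidean_space \<Rightarrow> 'e::euclidean_space list \<Rightarrow> real"
  assumes S: "open S" "y0 \<in> S" and V: "\<And>x. (V x has_derivative \<delta> x) (at y0)"
    and ext: "\<And>y. y \<in> S \<Longrightarrow> \<rho> y \<in> ext_T" and diff: "\<And>us. (\<lambda>y. \<rho> y us) differentiable (at y0)"
  shows "(\<Sum>i<length xs. (-1) ^ i * frechet_derivative (\<lambda>y. \<rho> y (map (\<lambda>x. V x y) (nths xs (- {i})))) (at y0) (u (xs ! i)))
    = altsum1 (\<lambda>x us. frechet_derivative (\<lambda>y. \<rho> y us) (at y0) (u x)) (\<lambda>x. V x y0) xs
      - altsum2 (\<lambda>x y. \<delta> y (u x) - \<delta> x (u y)) (\<rho> y0) (\<lambda>x. V x y0) xs"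
proof -
  have D: "frechet_derivative (\<lambda>y. \<rho> y (map (\<lambda>x. V x y) ys)) (at y0) h =
      frechet_derivative (\<lambda>y. \<rho> y (map (\<lambda>x. V x y0) ys)) (at y0) h
        + derivsum (\<lambda>x. \<delta> x h) (\<rho> y0) (\<lambda>x. V x y0) ys" for ys h
    using frechet_derivative_eq[OF has_derivative_multi[OF S V ext diff]] by (rule fun_cong)
  show ?thesis unfolding D using altsum_commutator[OF ext[OF S(2)], where xs = xs and \<delta> = \<delta> and u = u and v = "\<lambda>x. V x y0"]
    by (simp add: distrib_left sum.distrib altsum1_def)
qed

text \<open>The reason for \<open>d d = 0\<close> when \<open>H\<close> is a second derivative: each
  pair of directions occurs twice, with opposite signs.\<close>

lemma altsum1_symmetric:
  assumes "\<And>u v ws. H u v ws = H v u ws"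
  shows "altsum1 (\<lambda>u ws. altsum1 (H u) (\<lambda>v. v) ws) (\<lambda>v. v) xs = 0"
  using assms
proof (induction xs arbitrary: H)
  case Nil then show ?case by simp
next
  case (Cons x xs)
  have "altsum1 (\<lambda>u vs. altsum1 (H u) (\<lambda>v. v) (x # vs)) (\<lambda>v. v) xs
    = altsum1 (\<lambda>u vs. H u x vs + - altsum1 (\<lambda>v ws. H u v (x # ws)) (\<lambda>v. v) vs) (\<lambda>v. v) xs"
    by (simp add: altsum1_Cons)
  also have "\<dots> = altsum1 (\<lambda>u vs. H u x vs) (\<lambda>v. v) xs"
    using Cons.IH[of "\<lambda>u v ws. H u v (x # ws)"] Cons.prems unfolding altsum1_add altsum1_minus by simp
  also have "(\<lambda>u vs. H u x vs) = H x" using Cons.prems by (simp add: fun_eq_iff)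
  finally show ?case by (simp add: altsum1_Cons)
qed

text \<open>Forms over \<open>U\<close> are set to 0 outside \<open>U\<close>, a normalisation that
  \<open>de_rham\<close> need not respect: outside \<open>U\<close> it evaluates derivatives of
  functions that may fail to be differentiable there.\<close>

definition restr :: "'m set \<Rightarrow> ('m \<Rightarrow> 'v \<Rightarrow> real) \<Rightarrow> 'm \<Rightarrow> 'v \<Rightarrow> real" where
  "restr U \<omega> = (\<lambda>x. if x \<in> U then \<omega> x else (\<lambda>_. 0))"

lemma restr_in [simp]: "x \<in> U \<Longrightarrow> restr U \<omega> x = \<omega> x"
  and restr_out: "x \<notin> U \<Longrightarrow> restr U \<omega> x = (\<lambda>_. 0)"
  by (simp_all add: restr_def)

lemma restr_UNIV [simp]: "restr UNIV \<omega> = \<omega>"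
  by (simp add: restr_def)

definition form_deriv :: "('m, 'e::euclidean_space) filtered_space \<Rightarrow> ('m, 'e) chart \<Rightarrow>
    ('m, 'e) form \<Rightarrow> 'e \<Rightarrow> 'e \<Rightarrow> 'e list \<Rightarrow> real" where
  "form_deriv M c \<omega> y u us = frechet_derivative (\<lambda>y. form_rep M c \<omega> y us) (at y) u"

lemma de_rham_altsum1:
  "de_rham M \<omega> x = altsum1 (form_deriv M (chart_at M x) \<omega> (snd (chart_at M x) x)) (\<lambda>v. v)"
  by (simp add: fun_eq_iff de_rham_def altsum1_def form_deriv_def Let_def)

context filtered_manifold
begin

subsection \<open>Differential forms\<close>

lemma forms_onI:
  assumes "\<And>x. x \<in> U \<Longrightarrow> \<omega> x \<in> ext_T" "\<And>x. x \<notin> U \<Longrightarrow> \<omega> x = (\<lambda>_. 0)"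
    "\<And>c us. c \<in> atlas M \<Longrightarrow> smooth_on (img c U) (\<lambda>y. form_rep M c \<omega> y us)"
  shows "\<omega> \<in> forms_on M U"
  using assms by (simp add: forms_on_def)

lemma forms_on_ext: "\<omega> \<in> forms_on M U \<Longrightarrow> \<omega> x \<in> ext_T"
proof -
  assume "\<omega> \<in> forms_on M U"
  then have "x \<in> U \<Longrightarrow> \<omega> x \<in> ext_T" "x \<notin> U \<Longrightarrow> \<omega> x = (\<lambda>_. 0)" by (simp_all add: forms_on_def)
  then show ?thesis using ext_T_zero by metis
qed

lemma forms_on_out: "\<omega> \<in> forms_on M U \<Longrightarrow> x \<notin> U \<Longrightarrow> \<omega> x = (\<lambda>_. 0)"
  and forms_on_smooth: "\<omega> \<in> forms_on M U \<Longrightarrow> c \<in> atlas M \<Longrightarrow> smooth_on (img c U) (\<lambda>y. form_rep M c \<omega> y us)"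
  by (auto simp: forms_on_def)

lemma form_rep_ext: "\<omega> (chart_inv c y) \<in> ext_T \<Longrightarrow> c \<in> atlas M \<Longrightarrow> y \<in> img c UNIV \<Longrightarrow> form_rep M c \<omega> y \<in> ext_T"
  unfolding form_rep_def[abs_def]
  by (rule ext_T_pullback) (use chart_inv_in[of c y UNIV] in \<open>auto intro: linear_tang_from\<close>)

lemma forms_on_local:
  assumes U: "open U" and out: "\<And>x. x \<notin> U \<Longrightarrow> \<omega> x = (\<lambda>_. 0)"
    and loc: "\<And>x. x \<in> U \<Longrightarrow> \<exists>V \<eta>. open V \<and> x \<in> V \<and> \<eta> \<in> forms_on M V \<and> (\<forall>q\<in>U \<inter> V. \<omega> q = \<eta> q)"
  shows "\<omega> \<in> forms_on M U"
proof (rule forms_onI[OF _ out])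
  show "\<omega> x \<in> ext_T" if "x \<in> U" for x using loc[OF that] forms_on_ext that by fastforce
  fix c us assume c: "c \<in> atlas M"
  show "smooth_on (img c U) (\<lambda>y. form_rep M c \<omega> y us)"
  proof (rule smooth_img_local[OF c _ U])
    fix x assume "x \<in> U"
    then obtain V \<eta> where V: "open V" "x \<in> V" "\<eta> \<in> forms_on M V" "\<forall>q\<in>U \<inter> V. \<omega> q = \<eta> q" using loc by blast
    have "smooth_on (img c (U \<inter> V)) (\<lambda>y. form_rep M c \<eta> y us)"
      by (rule smooth_on_subset[OF forms_on_smooth[OF V(3) c]]) auto
    moreover have "form_rep M c \<omega> y us = form_rep M c \<eta> y us" if "y \<in> img c (U \<inter> V)" for y
      using chart_inv_in[OF c that] V(4) by (simp add: form_rep_def)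
    ultimately show "\<exists>V. open V \<and> x \<in> V \<and> smooth_on (img c (U \<inter> V)) (\<lambda>y. form_rep M c \<omega> y us)"
      using V smooth_on_cong[OF open_img[OF c open_Int[OF U V(1)]]] by (metis (no_types, lifting))
  qed
qed

lemma forms_on_lincomb:
  assumes U: "open U" and f: "\<And>i. i \<in> I \<Longrightarrow> smf U (f i)" and w: "\<And>i. i \<in> I \<Longrightarrow> \<omega> i \<in> forms_on M U"
  shows "(\<lambda>x vs. \<Sum>i\<in>I. f i x * \<omega> i x vs) \<in> forms_on M U"
proof (rule forms_onI)
  show "(\<lambda>vs. \<Sum>i\<in>I. f i x * \<omega> i x vs) \<in> ext_T" for x
    by (intro ext_T_sum ext_T_scaled forms_on_ext[OF w])
  show "(\<lambda>vs. \<Sum>i\<in>I. f i x * \<omega> i x vs) = (\<lambda>_. 0)" if "x \<notin> U" for x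
    using forms_on_out[OF w that] by (simp add: fun_eq_iff)
  fix c us assume c: "c \<in> atlas M"
  show "smooth_on (img c U) (\<lambda>y. form_rep M c (\<lambda>x vs. \<Sum>i\<in>I. f i x * \<omega> i x vs) y us)"
    unfolding form_rep_def
    by (intro smooth_on_sum smooth_on_mult open_img c U smfD[OF f]) (use forms_on_smooth[OF w c] in \<open>auto simp: form_rep_def\<close>)
qed

lemma forms_on_add: "open U \<Longrightarrow> \<omega> \<in> forms_on M U \<Longrightarrow> \<eta> \<in> forms_on M U \<Longrightarrow> (\<lambda>x vs. \<omega> x vs + \<eta> x vs) \<in> forms_on M U"
  using forms_on_lincomb[of U "UNIV::bool set" "\<lambda>_ _. 1" "\<lambda>b. if b then \<omega> else \<eta>"] smf_const[of U 1]
  by (simp add: UNIV_bool add.commute)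

lemma forms_on_mult: "smf U f \<Longrightarrow> \<omega> \<in> forms_on M U \<Longrightarrow> (\<lambda>x vs. f x * \<omega> x vs) \<in> forms_on M U"
  using forms_on_lincomb[of U "{()}" "\<lambda>_. f" "\<lambda>_. \<omega>"] smf_open by simp

lemma forms_on_scale: "open U \<Longrightarrow> \<omega> \<in> forms_on M U \<Longrightarrow> (\<lambda>x vs. r * \<omega> x vs) \<in> forms_on M U"
  using forms_on_mult[OF smf_const] by blast

lemma forms_on_diff: "open U \<Longrightarrow> \<omega> \<in> forms_on M U \<Longrightarrow> \<eta> \<in> forms_on M U \<Longrightarrow> (\<lambda>x vs. \<omega> x vs - \<eta> x vs) \<in> forms_on M U"
  using forms_on_add[of U \<omega> "\<lambda>x vs. (-1) * \<eta> x vs"] forms_on_scale[of U \<eta> "-1"] by simp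

lemma forms_on_zero: "(\<lambda>x vs. 0) \<in> forms_on M U"
  by (rule forms_onI) (simp_all add: form_rep_def)

lemma forms_on_restr:
  assumes "\<omega> \<in> forms_on M U" "V \<subseteq> U" "open V"
  shows "restr V \<omega> \<in> forms_on M V"
proof (rule forms_onI)
  show "restr V \<omega> x \<in> ext_T" for x using forms_on_ext[OF assms(1)] by (simp add: restr_def)
  show "restr V \<omega> x = (\<lambda>_. 0)" if "x \<notin> V" for x using that by (rule restr_out)
  fix c us assume c: "c \<in> atlas M"
  have "smooth_on (img c V) (\<lambda>y. form_rep M c \<omega> y us)"
    by (rule smooth_on_subset[OF forms_on_smooth[OF assms(1) c]]) (use assms in auto)
  moreover have "form_rep M c (restr V \<omega>) y us = form_rep M c \<omega> y us" if "y \<in> img c V" for y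
    using chart_inv_in[OF c that] by (simp add: form_rep_def)
  ultimately show "smooth_on (img c V) (\<lambda>y. form_rep M c (restr V \<omega>) y us)"
    using smooth_on_cong[OF open_img[OF c assms(3)]] by (metis (no_types, lifting))
qed

lemma form_rep_vf_rep:
  assumes "c \<in> atlas M" "y \<in> img c UNIV"
  shows "form_rep M c \<omega> y (map (\<lambda>i. vf_rep M c (X i) y) K) = \<omega> (chart_inv c y) (map (\<lambda>i. X i (chart_inv c y)) K)"
  by (simp add: form_rep_def comp_def vf_rep_tang_from[OF assms])

lemma smf_form_eval:
  assumes w: "\<omega> \<in> forms_on M U" and W: "open W" "W \<subseteq> U" and X: "\<And>i. i \<in> set K \<Longrightarrow> smooth_vf_on M W (X i)"
  shows "smf W (\<lambda>q. \<omega> q (map (\<lambda>i. X i q) K))"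
proof (rule smfI[OF W(1)])
  fix c assume c: "c \<in> atlas M"
  have "smooth_on (img c W) (\<lambda>y. form_rep M c \<omega> y (map (\<lambda>i. vf_rep M c (X i) y) K))"
  proof (rule smooth_on_multi[OF open_img[OF c W(1)]])
    show "form_rep M c \<omega> y \<in> ext_T" if "y \<in> img c W" for y
      by (rule form_rep_ext[OF forms_on_ext[OF w] c]) (use that in auto)
    show "smooth_on (img c W) (\<lambda>y. form_rep M c \<omega> y us)" for us
      by (rule smooth_on_subset[OF forms_on_smooth[OF w c]]) (use W in auto)
  qed (use X smooth_vfD c in blast)
  then show "smooth_on (img c W) (\<lambda>y. \<omega> (chart_inv c y) (map (\<lambda>i. X i (chart_inv c y)) K))"
  proof (subst smooth_on_cong[OF open_img[OF c W(1)]])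
    fix y assume "y \<in> img c W"
    then have "y \<in> img c UNIV" by blast
    from form_rep_vf_rep[OF c this]
    show "\<omega> (chart_inv c y) (map (\<lambda>i. X i (chart_inv c y)) K) = form_rep M c \<omega> y (map (\<lambda>i. vf_rep M c (X i) y) K)" ..
  qed
qed

subsection \<open>The exterior derivative\<close>

lemma form_deriv_ext:
  assumes w: "\<omega> \<in> forms_on M U" and U: "open U" and c: "c \<in> atlas M" and y: "y \<in> img c U"
  shows "form_deriv M c \<omega> y u \<in> ext_T"
  unfolding form_deriv_def[abs_def]
proof (rule ext_T_derivative[OF open_img[OF c U] y])
  show "form_rep M c \<omega> z \<in> ext_T" if "z \<in> img c U" for z
    by (rule form_rep_ext[OF forms_on_ext[OF w] c]) (use that in blast)
  show "(\<lambda>z. form_rep M c \<omega> z us) differentiable (at y)" for us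
    by (rule smooth_on_differentiable[OF forms_on_smooth[OF w c] y])
qed

lemma linear_form_deriv:
  assumes w: "\<omega> \<in> forms_on M U" and c: "c \<in> atlas M" and y: "y \<in> img c U"
  shows "linear (\<lambda>u. form_deriv M c \<omega> y u us)"
  unfolding form_deriv_def
  by (rule linear_frechet_derivative) (rule smooth_on_differentiable[OF forms_on_smooth[OF w c] y])

lemma altsum1_form_deriv_ext:
  assumes w: "\<omega> \<in> forms_on M U" and U: "open U" and c: "c \<in> atlas M" and y: "y \<in> img c U"
  shows "altsum1 (form_deriv M c \<omega> y) (\<lambda>v. v) \<in> ext_T"
  using linear_form_deriv[OF w c y]
  by (intro altsum1_ext_T form_deriv_ext[OF assms]) (simp_all add: linear_add[OF linear_form_deriv[OF w c y]] linear_scale[OF linear_form_deriv[OF w c y]])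

lemma de_rham_ext: "\<omega> \<in> forms_on M U \<Longrightarrow> open U \<Longrightarrow> x \<in> U \<Longrightarrow> de_rham M \<omega> x \<in> ext_T"
  unfolding de_rham_altsum1 by (rule altsum1_form_deriv_ext) (use chart_at[of x] in auto)

lemma de_rham_chart:
  assumes w: "\<omega> \<in> forms_on M U" and U: "open U" and c: "c \<in> atlas M" and p: "p \<in> fst c" "p \<in> U"
  shows "de_rham M \<omega> p (map (tang_from M c p) us) = altsum1 (form_deriv M c \<omega> (snd c p)) (\<lambda>v. v) us"
proof -
  let ?r = "chart_at M p" and ?y0 = "snd c p"
  note r = chart_at[of p]
  define S where "S = img c (fst ?r \<inter> U)"
  have S: "open S" "?y0 \<in> S" unfolding S_def using c r U p by (auto intro!: open_img open_Int chart_open)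
  \<comment> \<open>Near \<open>p\<close> the form in chart \<open>c\<close> is the pullback of its
    expression in the reference chart: \<open>\<rho>\<close> is that expression at the transformed
    point, and \<open>V u\<close> is the image of \<open>u\<close> under the Jacobian.\<close>
  define \<rho> where "\<rho> y = form_rep M ?r \<omega> (tr c ?r y)" for y
  define V where "V u y = frechet_derivative (tr c ?r) (at y) u" for u y
  define \<delta> where "\<delta> u h = frechet_derivative (V u) (at ?y0) h" for u h
  have trS: "tr c ?r ` S \<subseteq> img ?r U" using tr_in[OF c, of _ ?r U] unfolding S_def by blast
  have tr0: "tr c ?r ?y0 = snd ?r p" using c p by (simp add: tr_def chart_inv_snd)
  have smtr: "smooth_on S (tr c ?r)" by (rule smooth_on_subset[OF smooth_tr[OF c r(1)]]) (auto simp: S_def)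
  have ext: "\<rho> y \<in> ext_T" if "y \<in> S" for y unfolding \<rho>_def
    by (rule form_rep_ext[OF forms_on_ext[OF w] r(1)]) (use trS that in auto)
  have sm\<rho>: "smooth_on S (\<lambda>y. \<rho> y us)" for us unfolding \<rho>_def
    by (rule smooth_on_compose[OF S(1) open_img[OF r(1) U] trS forms_on_smooth[OF w r(1)] smtr])
  have V: "(V u has_derivative \<delta> u) (at ?y0)" for u
    unfolding \<delta>_def[abs_def] V_def[abs_def] by (rule smooth_on_has_derivative[OF smooth_on_derivative[OF smtr] S(2)])
  have V0: "V u ?y0 = tang_from M c p u" for u by (simp add: V_def tang_from_dtr dtr_def)
  have rep: "form_rep M c \<omega> y ws = \<rho> y (map (\<lambda>u. V u y) ws)" if y: "y \<in> S" for y ws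
  proof -
    have q: "chart_inv c y \<in> fst c" "chart_inv c y \<in> fst ?r" "snd c (chart_inv c y) = y"
      using chart_inv_in[OF c, of y "fst ?r \<inter> U"] y by (auto simp: S_def)
    have "tang_from M c (chart_inv c y) = (\<lambda>u. tang_from M ?r (chart_inv c y) (V u y))"
      using tang_from_dtr_eq[OF c r(1) q(1,2)] q(3) by (simp add: V_def dtr_def fun_eq_iff)
    moreover have "chart_inv ?r (tr c ?r y) = chart_inv c y"
      by (rule chart_inv_tr[OF c r(1)]) (use y in \<open>auto simp: S_def\<close>)
    ultimately show ?thesis by (simp add: form_rep_def \<rho>_def comp_def)
  qed
  have D: "frechet_derivative (\<lambda>y. \<rho> y ws) (at ?y0) h = form_deriv M ?r \<omega> (snd ?r p) (V h ?y0) ws" for ws h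
  proof -
    have "((\<lambda>y. \<rho> y ws) has_derivative (\<lambda>h. frechet_derivative (\<lambda>y. form_rep M ?r \<omega> y ws) (at (tr c ?r ?y0))
        (frechet_derivative (tr c ?r) (at ?y0) h))) (at ?y0)"
      unfolding \<rho>_def
      by (rule has_derivative_compose[OF smooth_on_has_derivative[OF smtr S(2)]])
        (rule smooth_on_has_derivative[OF forms_on_smooth[OF w r(1)]], use trS S in blast)
    then show ?thesis by (simp add: frechet_derivative_eq form_deriv_def V_def tr0)
  qed
  have "altsum1 (form_deriv M c \<omega> ?y0) (\<lambda>v. v) us =
    (\<Sum>i<length us. (-1) ^ i * frechet_derivative (\<lambda>y. \<rho> y (map (\<lambda>x. V x y) (nths us (- {i})))) (at ?y0) (us ! i))"
    unfolding altsum1_def form_deriv_def using frechet_derivative_cong_open[OF S rep] by simp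
  also have "\<dots> = altsum1 (\<lambda>x us. frechet_derivative (\<lambda>y. \<rho> y us) (at ?y0) x) (\<lambda>x. V x ?y0) us
      - altsum2 (\<lambda>x y. \<delta> y x - \<delta> x y) (\<rho> ?y0) (\<lambda>x. V x ?y0) us"
    by (rule altsum_deriv[OF S V ext, where u = "\<lambda>x. x"]) (use sm\<rho> S smooth_on_differentiable in blast)+
  \<comment> \<open>The \<open>\<delta>\<close> are second derivatives of the change of charts, so
    their antisymmetric part is zero.\<close>
  also have "(\<lambda>x y. \<delta> y x - \<delta> x y) = (\<lambda>x y. 0)"
    unfolding \<delta>_def V_def[abs_def] using second_derivative_symmetric[OF S(1) smtr S(2)] by (simp add: fun_eq_iff)
  also have "altsum2 (\<lambda>x y. 0) (\<rho> ?y0) (\<lambda>x. V x ?y0) us = 0"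
    using ext_T_zero_arg[OF ext[OF S(2)], of "[]"] by (simp add: altsum2_def)
  also have "altsum1 (\<lambda>x us. frechet_derivative (\<lambda>y. \<rho> y us) (at ?y0) x) (\<lambda>x. V x ?y0) us
      = altsum1 (form_deriv M ?r \<omega> (snd ?r p)) (\<lambda>v. v) (map (\<lambda>x. V x ?y0) us)"
    by (simp add: altsum1_def D nths_map)
  finally show ?thesis by (simp add: de_rham_altsum1 V0)
qed

lemma form_rep_de_rham:
  assumes w: "\<omega> \<in> forms_on M U" and U: "open U" and c: "c \<in> atlas M" and y: "y \<in> img c U"
  shows "form_rep M c (de_rham M \<omega>) y us = altsum1 (form_deriv M c \<omega> y) (\<lambda>v. v) us"
  using de_rham_chart[OF w U c, of "chart_inv c y"] chart_inv_in[OF c y] by (simp add: form_rep_def)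

lemma de_rham_cong:
  assumes "open V" "x \<in> V" "\<And>q. q \<in> V \<Longrightarrow> \<omega> q = \<eta> q"
  shows "de_rham M \<omega> x = de_rham M \<eta> x"
proof -
  let ?c = "chart_at M x"
  have "form_deriv M ?c \<omega> (snd ?c x) = form_deriv M ?c \<eta> (snd ?c x)"
    unfolding form_deriv_def[abs_def]
    by (intro ext fun_cong[OF frechet_derivative_cong_open[of "img ?c V"]])
      (use assms chart_at[of x] chart_inv_in[of ?c] in \<open>auto intro!: open_img simp: form_rep_def\<close>)
  then show ?thesis by (simp add: de_rham_altsum1)
qed

lemma de_rham_forms_on:
  assumes w: "\<omega> \<in> forms_on M U" and U: "open U"
  shows "restr U (de_rham M \<omega>) \<in> forms_on M U"
proof (rule forms_onI)
  show "restr U (de_rham M \<omega>) x \<in> ext_T" if "x \<in> U" for x using de_rham_ext[OF w U that] that by simp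
  show "restr U (de_rham M \<omega>) x = (\<lambda>_. 0)" if "x \<notin> U" for x using that by (rule restr_out)
  fix c us assume c: "c \<in> atlas M"
  have "form_rep M c (restr U (de_rham M \<omega>)) y us = altsum1 (form_deriv M c \<omega> y) (\<lambda>v. v) us" if "y \<in> img c U" for y
    using form_rep_de_rham[OF w U c that] chart_inv_in[OF c that] by (simp add: form_rep_def)
  moreover have "smooth_on (img c U) (\<lambda>y. altsum1 (form_deriv M c \<omega> y) (\<lambda>v. v) us)"
    unfolding altsum1_def form_deriv_def
    by (intro smooth_on_sum smooth_on_mult smooth_on_const smooth_on_derivative forms_on_smooth[OF w c] open_img c U)
  ultimately show "smooth_on (img c U) (\<lambda>y. form_rep M c (restr U (de_rham M \<omega>)) y us)"
    using smooth_on_cong[OF open_img[OF c U]] by (metis (no_types, lifting))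
qed

lemma de_rham_de_rham:
  assumes w: "\<omega> \<in> forms_on M U" and U: "open U" and x: "x \<in> U"
  shows "de_rham M (de_rham M \<omega>) x = (\<lambda>_. 0)"
proof
  fix vs
  let ?c = "chart_at M x" and ?y0 = "snd (chart_at M x) x"
  note c = chart_at[of x]
  have S: "open (img ?c U)" "?y0 \<in> img ?c U" using c x by (auto intro!: open_img U)
  define H where "H u v ws = frechet_derivative (\<lambda>y. form_deriv M ?c \<omega> y v ws) (at ?y0) u" for u v ws
  have sym: "H u v ws = H v u ws" for u v ws
    unfolding H_def form_deriv_def
    by (rule second_derivative_symmetric[OF S(1) forms_on_smooth[OF w c(1)] S(2)])
  have sm: "smooth_on (img ?c U) (\<lambda>y. form_deriv M ?c \<omega> y v ws)" for v ws
    unfolding form_deriv_def by (rule smooth_on_derivative[OF forms_on_smooth[OF w c(1)]])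
  have "form_deriv M ?c (de_rham M \<omega>) ?y0 u ws = altsum1 (H u) (\<lambda>v. v) ws" for u ws
  proof -
    have "frechet_derivative (\<lambda>y. form_rep M ?c (de_rham M \<omega>) y ws) (at ?y0)
      = frechet_derivative (\<lambda>y. altsum1 (form_deriv M ?c \<omega> y) (\<lambda>v. v) ws) (at ?y0)"
      by (rule frechet_derivative_cong_open[OF S form_rep_de_rham[OF w U c(1)]])
    also have "\<dots> = (\<lambda>u. altsum1 (H u) (\<lambda>v. v) ws)"
      unfolding altsum1_def H_def
      by (rule frechet_derivative_eq, intro has_derivative_sum has_derivative_mult_right smooth_on_has_derivative[OF sm S(2)])
    finally show ?thesis by (simp add: form_deriv_def)
  qed
  then have e: "form_deriv M ?c (de_rham M \<omega>) ?y0 = (\<lambda>u ws. altsum1 (H u) (\<lambda>v. v) ws)" by (intro ext)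
  show "de_rham M (de_rham M \<omega>) x vs = 0"
    unfolding de_rham_altsum1[of M "de_rham M \<omega>"] e by (rule altsum1_symmetric[OF sym])
qed

lemma de_rham_linear:
  assumes w: "\<omega> \<in> forms_on M U" "\<eta> \<in> forms_on M U" and x: "x \<in> U"
  shows "de_rham M (\<lambda>x vs. r * \<omega> x vs + s * \<eta> x vs) x vs = r * de_rham M \<omega> x vs + s * de_rham M \<eta> x vs"
proof -
  let ?c = "chart_at M x" and ?y0 = "snd (chart_at M x) x"
  note c = chart_at[of x]
  have y: "?y0 \<in> img ?c U" using c x by auto
  have "form_deriv M ?c (\<lambda>x vs. r * \<omega> x vs + s * \<eta> x vs) ?y0 u us
    = r * form_deriv M ?c \<omega> ?y0 u us + s * form_deriv M ?c \<eta> ?y0 u us" for u us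
    using frechet_derivative_eq[OF has_derivative_add[OF
      has_derivative_mult_right[OF smooth_on_has_derivative[OF forms_on_smooth[OF w(1) c(1), of us] y], of r]
      has_derivative_mult_right[OF smooth_on_has_derivative[OF forms_on_smooth[OF w(2) c(1), of us] y], of s]]]
    by (simp add: form_deriv_def form_rep_def)
  then show ?thesis by (simp add: de_rham_altsum1 altsum1_def distrib_left sum.distrib sum_distrib_left mult_ac)
qed

text \<open>In the reference chart at \<open>x\<close>, the derivative of the evaluated form splits
  into a derivative of the form and derivatives of the fields. The latter combine into antisymmetric
  pairs, which are the coordinate expressions of the brackets.\<close>

lemma de_rham_cartan:
  assumes w: "\<omega> \<in> forms_on M U" and U: "open U" and x: "x \<in> U" and X: "\<And>i. smooth_vf_on M U (X i)"
  shows "de_rham M \<omega> x (map (\<lambda>i. X i x) K) =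
    (\<Sum>k<length K. (-1) ^ k * Dm (\<lambda>q. \<omega> q (map (\<lambda>i. X i q) (nths K (- {k})))) x (X (K ! k) x))
    + altsum2 (\<lambda>i j. lie_bracket M (X i) (X j) x) (\<omega> x) (\<lambda>i. X i x) K"
proof -
  let ?c = "chart_at M x" and ?y0 = "snd (chart_at M x) x"
  note c = chart_at[of x]
  define S where "S = img ?c U"
  have S: "open S" "?y0 \<in> S" unfolding S_def using c x by (auto intro!: open_img U)
  define V where "V i = vf_rep M ?c (X i)" for i
  define \<delta> where "\<delta> i = frechet_derivative (V i) (at ?y0)" for i
  have V: "(V i has_derivative \<delta> i) (at ?y0)" for i
    unfolding V_def \<delta>_def by (rule smooth_on_has_derivative[OF smooth_vfD[OF X c(1)] S(2)[unfolded S_def]])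
  have V0: "V i ?y0 = X i x" for i unfolding V_def vf_rep_def chart_inv_snd[OF c] by (rule tang_to_chart_at)
  have ext: "form_rep M ?c \<omega> y \<in> ext_T" if "y \<in> S" for y
    by (rule form_rep_ext[OF forms_on_ext[OF w] c(1)]) (use that S_def in auto)
  have diff: "(\<lambda>y. form_rep M ?c \<omega> y us) differentiable (at ?y0)" for us
    by (rule smooth_on_differentiable[OF forms_on_smooth[OF w c(1)] S(2)[unfolded S_def]])
  have rep: "form_rep M ?c \<omega> y (map (\<lambda>i. V i y) J) = \<omega> (chart_inv ?c y) (map (\<lambda>i. X i (chart_inv ?c y)) J)"
    if "y \<in> S" for y J
    unfolding V_def by (rule form_rep_vf_rep[OF c(1)]) (use that S_def in auto)
  have "(\<Sum>k<length K. (-1) ^ k * frechet_derivative (\<lambda>y. form_rep M ?c \<omega> y (map (\<lambda>i. V i y) (nths K (- {k})))) (at ?y0) (X (K ! k) x))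
    = altsum1 (\<lambda>i. form_deriv M ?c \<omega> ?y0 (X i x)) (\<lambda>i. V i ?y0) K
      - altsum2 (\<lambda>i j. \<delta> j (X i x) - \<delta> i (X j x)) (form_rep M ?c \<omega> ?y0) (\<lambda>i. V i ?y0) K"
    unfolding form_deriv_def by (rule altsum_deriv[OF S V ext diff])
  moreover have "frechet_derivative (\<lambda>y. form_rep M ?c \<omega> y (map (\<lambda>i. V i y) J)) (at ?y0)
      = Dm (\<lambda>q. \<omega> q (map (\<lambda>i. X i q) J)) x" for J
    unfolding Dm_def[abs_def] by (rule frechet_derivative_cong_open[OF S rep])
  moreover have "\<delta> j (X i x) - \<delta> i (X j x) = lie_bracket M (X i) (X j) x" for i j
    by (simp add: lie_bracket_def Let_def \<delta>_def V_def)
  moreover have "form_rep M ?c \<omega> ?y0 = \<omega> x"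
    by (rule HOL.ext) (simp add: form_rep_def chart_inv_snd[OF c] tang_from_chart_at map_idI)
  moreover have "altsum1 (\<lambda>i. form_deriv M ?c \<omega> ?y0 (X i x)) (\<lambda>i. V i ?y0) K = de_rham M \<omega> x (map (\<lambda>i. X i x) K)"
    by (simp add: de_rham_altsum1 altsum1_def V0 nths_map)
  ultimately show ?thesis by (simp add: V0)
qed

end

subsection \<open>Adapted orthonormal frames\<close>

context filtered_manifold
begin

abbreviation gm :: "'m \<Rightarrow> 'e \<Rightarrow> 'e \<Rightarrow> real" where "gm \<equiv> gTM M"

lemmas gm_simps = bilinear_ladd[OF metric_M(1)] bilinear_lmul[OF metric_M(1)] bilinear_lzero[OF metric_M(1)]
  bilinear_lsub[OF metric_M(1)] bilinear_lneg[OF metric_M(1)] bilinear_radd[OF metric_M(1)]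
  bilinear_rmul[OF metric_M(1)] bilinear_rzero[OF metric_M(1)] bilinear_rsub[OF metric_M(1)]

lemma gm_sum: "gm p (\<Sum>i\<in>I. f i) v = (\<Sum>i\<in>I. gm p (f i) v)"
  by (induction I rule: infinite_finite_induct) (simp_all add: gm_simps)

section \<open>Orthonormal systems and orthogonal projections at a point\<close>

definition orthon :: "'m \<Rightarrow> (nat \<Rightarrow> 'e) \<Rightarrow> nat \<Rightarrow> bool" where
  "orthon p E m \<longleftrightarrow> (\<forall>a<m. \<forall>b<m. gm p (E a) (E b) = (if a = b then 1 else 0))"

definition oproj :: "'m \<Rightarrow> (nat \<Rightarrow> 'e) \<Rightarrow> nat \<Rightarrow> 'e \<Rightarrow> 'e" where
  "oproj p E m v = (\<Sum>a<m. gm p v (E a) *\<^sub>R E a)"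

lemma orthon_lincomb: "orthon p E m \<Longrightarrow> b < m \<Longrightarrow> gm p (\<Sum>a<m. c a *\<^sub>R E a) (E b) = c b"
proof -
  assume o: "orthon p E m" and b: "b < m"
  have "gm p (\<Sum>a<m. c a *\<^sub>R E a) (E b) = (\<Sum>a<m. if a = b then c a else 0)"
    unfolding gm_sum by (rule sum.cong) (use o b in \<open>auto simp: gm_simps orthon_def\<close>)
  then show ?thesis using b by simp
qed

lemma orthon_residual: "orthon p E m \<Longrightarrow> b < m \<Longrightarrow> gm p (v - oproj p E m v) (E b) = 0"
  using orthon_lincomb[of p E m b "\<lambda>a. gm p v (E a)"] by (simp add: gm_simps oproj_def)

lemma orthon_extend:
  assumes "orthon p E m" "\<And>b. b < m \<Longrightarrow> gm p u (E b) = 0" "gm p u u = 1"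
  shows "orthon p (E(m := u)) (Suc m)"
proof -
  have "gm p (E b) u = 0" if "b < m" for b using assms(2)[OF that] by (simp only: metric_M(2)[of p "E b" u])
  then show ?thesis using assms by (auto simp: orthon_def less_Suc_eq)
qed

lemma orthon_le_dim:
  assumes o: "orthon p E m" and E: "\<And>a. a < m \<Longrightarrow> E a \<in> S" and S: "subspace S"
  shows "m \<le> dim S"
proof -
  have inj: "inj_on E {..<m}"
  proof (rule inj_onI)
    fix a b assume ab: "a \<in> {..<m}" "b \<in> {..<m}" "E a = E b"
    have "gm p (E a) (E a) = 1" "a \<noteq> b \<Longrightarrow> gm p (E a) (E b) = 0" using o ab(1,2) by (simp_all add: orthon_def)
    then show "a = b" using ab(3) by auto
  qed
  have "independent (E ` {..<m})"
  proof (rule independent_if_scalars_zero)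
    fix f v assume z: "(\<Sum>v\<in>E ` {..<m}. f v *\<^sub>R v) = 0" and "v \<in> E ` {..<m}"
    then obtain a where a: "a < m" "v = E a" by auto
    have "gm p (\<Sum>a<m. f (E a) *\<^sub>R E a) (E a) = f (E a)" by (rule orthon_lincomb[OF o a(1)])
    then show "f v = 0" using z a by (simp add: sum.reindex[OF inj] gm_simps)
  qed simp
  moreover have "E ` {..<m} \<subseteq> S" using E by auto
  ultimately have "card (E ` {..<m}) \<le> dim S" using independent_card_le_dim by blast
  then show ?thesis by (simp add: card_image[OF inj])
qed

lemma orthon_normalize: "u \<noteq> 0 \<Longrightarrow> gm p ((gm p u u powr (-1/2)) *\<^sub>R u) ((gm p u u powr (-1/2)) *\<^sub>R u) = 1"
proof -
  assume "u \<noteq> 0"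
  then have pos: "gm p u u > 0" by (rule metric_M(3))
  then have "gm p u u powr (-1/2) * (gm p u u powr (-1/2) * gm p u u powr 1) = 1"
    unfolding powr_add[symmetric] by simp
  then show ?thesis using pos by (simp add: gm_simps mult.assoc)
qed

text \<open>A nonzero residual could be normalised and added to the system, which would then exceed
  the dimension.\<close>

lemma orthon_span:
  assumes o: "orthon p E m" and E: "\<And>a. a < m \<Longrightarrow> E a \<in> S" and S: "subspace S" "dim S \<le> m" and v: "v \<in> S"
  shows "oproj p E m v = v"
proof (rule ccontr)
  assume ne: "oproj p E m v \<noteq> v"
  define u where "u = v - oproj p E m v"
  define u' where "u' = (gm p u u powr (-1/2)) *\<^sub>R u"
  have "u \<noteq> 0" using ne by (simp add: u_def)
  then have "gm p u' u' = 1" unfolding u'_def by (rule orthon_normalize)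
  moreover have "gm p u' (E b) = 0" if "b < m" for b
    using orthon_residual[OF o that] by (simp add: u'_def u_def gm_simps)
  ultimately have "orthon p (E(m := u')) (Suc m)" by (intro orthon_extend o)
  moreover have "oproj p E m v \<in> S" unfolding oproj_def by (intro subspace_sum[OF S(1)] subspace_scale[OF S(1)] E) simp
  then have "u' \<in> S" unfolding u'_def u_def by (intro subspace_scale[OF S(1)] subspace_diff[OF S(1)] v)
  ultimately have "Suc m \<le> dim S"
  proof (intro orthon_le_dim[of p "E(m := u')" "Suc m" S] S(1))
    show "(E(m := u')) a \<in> S" if "u' \<in> S" "a < Suc m" for a using that E by (cases "a = m") auto
  qed
  then show False using S by simp
qed

lemma orthon_ex_residual:
  assumes "m < dim S" "S \<subseteq> span (X ` {..<r::nat})"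
  shows "\<exists>j<r. X j - oproj p E m (X j) \<noteq> 0"
proof (rule ccontr)
  assume "\<not> (\<exists>j<r. X j - oproj p E m (X j) \<noteq> 0)"
  then have "X j = oproj p E m (X j)" if "j < r" for j using that by simp
  moreover have "oproj p E m v \<in> span (E ` {..<m})" for v
    unfolding oproj_def by (intro span_sum span_scale span_base) auto
  ultimately have "X j \<in> span (E ` {..<m})" if "j < r" for j using that by metis
  then have "X ` {..<r} \<subseteq> span (E ` {..<m})" by auto
  then have "S \<subseteq> span (E ` {..<m})" using assms(2) span_minimal[OF _ subspace_span] by (meson order_trans)
  then have "dim S \<le> card (E ` {..<m})" by (intro dim_le_card) auto
  also have "\<dots> \<le> m" using card_image_le[of "{..<m}" E] by simp
  finally show False using assms(1) by simp
qed

lemma filt_M: "vector_subbundle M (filt M i)" "filt M 0 p = {0}" "i \<le> j \<Longrightarrow> filt M i p \<subseteq> filt M j p"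
  "depth M \<le> i \<Longrightarrow> filt M i p = UNIV"
  "X \<in> sections M (filt M i) \<Longrightarrow> Y \<in> sections M (filt M j) \<Longrightarrow> lie_bracket M X Y \<in> sections M (filt M (i + j))"
proof -
  note f = filtered[unfolded filtered_riemannian_manifold_def, THEN conjunct2]
  show "vector_subbundle M (filt M i)" by (rule f[THEN conjunct1, THEN spec])
  note f = f[THEN conjunct2]
  show "filt M 0 p = {0}" by (rule f[THEN conjunct1, THEN spec])
  note f = f[THEN conjunct2]
  show "filt M i p \<subseteq> filt M j p" if "i \<le> j" by (rule f[THEN conjunct1, rule_format, OF that])
  note f = f[THEN conjunct2]
  show "filt M i p = UNIV" if "depth M \<le> i" by (rule f[THEN conjunct1, rule_format, OF that])
  note f = f[THEN conjunct2]
  show "lie_bracket M X Y \<in> sections M (filt M (i + j))"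
    if "X \<in> sections M (filt M i)" "Y \<in> sections M (filt M j)"
    by (rule f[THEN conjunct1, rule_format, OF that])
qed

lemma filt_local_frame:
  obtains V r X where "open V" "x \<in> V" "\<And>j. j < r \<Longrightarrow> smooth_vf_on M V (X j)"
    "\<And>q. q \<in> V \<Longrightarrow> span ((\<lambda>j. X j q) ` {..<r::nat}) = filt M i q"
    "\<And>q. q \<in> V \<Longrightarrow> dim (filt M i q) = r"
proof -
  obtain V r X where V: "open V \<and> x \<in> V \<and> (\<forall>j<r. smooth_vf_on M V (X j)) \<and>
    (\<forall>q\<in>V. inj_on (\<lambda>j. X j q) {..<r::nat} \<and> independent ((\<lambda>j. X j q) ` {..<r}) \<and> span ((\<lambda>j. X j q) ` {..<r}) = filt M i q)"
    using filt_M(1)[of i, unfolded vector_subbundle_def, THEN spec, of x] by (elim exE)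
  show thesis
  proof (rule that[of V r X])
    show "open V" "x \<in> V" "\<And>j. j < r \<Longrightarrow> smooth_vf_on M V (X j)" using V by simp_all
    fix q assume q: "q \<in> V"
    have inj: "inj_on (\<lambda>j. X j q) {..<r}" and ind: "independent ((\<lambda>j. X j q) ` {..<r})"
      and sp: "span ((\<lambda>j. X j q) ` {..<r}) = filt M i q"
      using V q by simp_all
    show "span ((\<lambda>j. X j q) ` {..<r}) = filt M i q" by (rule sp)
    show "dim (filt M i q) = r"
      unfolding sp[symmetric] using dim_span_eq_card_independent[OF ind] card_image[OF inj] by simp
  qed
qed

lemma subspace_filt: "subspace (filt M i q)"
proof -
  obtain V r X where "open V" "q \<in> V" "\<And>j. j < r \<Longrightarrow> smooth_vf_on M V (X j)"
    "\<And>q. q \<in> V \<Longrightarrow> span ((\<lambda>j. X j q) ` {..<r::nat}) = filt M i q"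
    "\<And>q. q \<in> V \<Longrightarrow> dim (filt M i q) = r"
    by (rule filt_local_frame) (rule that)
  then show ?thesis using subspace_span[of "(\<lambda>j. X j q) ` {..<r}"] by simp
qed

section \<open>Gram-Schmidt along the filtration\<close>

definition pre_frame :: "'m set \<Rightarrow> (nat \<Rightarrow> 'm \<Rightarrow> 'e) \<Rightarrow> (nat \<Rightarrow> nat) \<Rightarrow> nat \<Rightarrow> nat \<Rightarrow> bool" where
  "pre_frame W E w m i \<longleftrightarrow> open W \<and> (\<forall>a<m. smooth_vf_on M W (E a) \<and> 1 \<le> w a \<and> w a \<le> i) \<and>
     (\<forall>q\<in>W. orthon q (\<lambda>a. E a q) m \<and>
       (\<forall>a<m. E a q \<in> filt M (w a) q \<and> (\<forall>j<w a. \<forall>v\<in>filt M j q. gm q v (E a q) = 0)))"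

definition frame_covers :: "'m set \<Rightarrow> (nat \<Rightarrow> 'm \<Rightarrow> 'e) \<Rightarrow> nat \<Rightarrow> nat \<Rightarrow> bool" where
  "frame_covers W E m i \<longleftrightarrow> (\<forall>q\<in>W. \<forall>v\<in>filt M i q. oproj q (\<lambda>a. E a q) m v = v)"

lemma pre_frame_subset: "pre_frame W E w m i \<Longrightarrow> open V \<Longrightarrow> V \<subseteq> W \<Longrightarrow> pre_frame V E w m i"
  unfolding pre_frame_def by (meson smooth_vf_subset subsetD)

text \<open>Some member of a local frame of \<open>H^(i+1)\<close> has a nonzero residual at
  \<open>x\<close>, hence on a neighbourhood, where it can be normalised smoothly. As the old fields
  already span \<open>H^i\<close>, being orthogonal to them makes the new field orthogonal to all of
  \<open>H^i\<close>.\<close>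

lemma pre_frame_step:
  assumes W: "pre_frame W E w m (Suc i)" "frame_covers W E m i" "x \<in> W" and m: "m < dim (filt M (Suc i) x)"
  shows "\<exists>W E w. x \<in> W \<and> pre_frame W E w (Suc m) (Suc i) \<and> frame_covers W E (Suc m) i"
proof -
  note pf = W(1)[unfolded pre_frame_def]
  obtain V r X where V: "open V" "x \<in> V" "\<And>j. j < r \<Longrightarrow> smooth_vf_on M V (X j)"
    "\<And>q. q \<in> V \<Longrightarrow> span ((\<lambda>j. X j q) ` {..<r::nat}) = filt M (Suc i) q"
    "\<And>q. q \<in> V \<Longrightarrow> dim (filt M (Suc i) q) = r"
    by (rule filt_local_frame) (rule that)
  obtain j where j: "j < r" "X j x - oproj x (\<lambda>a. E a x) m (X j x) \<noteq> 0"
    using orthon_ex_residual[OF m, of "\<lambda>j. X j x" r, where p = x and E = "\<lambda>a. E a x"] V(4)[OF V(2)] by auto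
  define Y where "Y q = X j q - oproj q (\<lambda>a. E a q) m (X j q)" for q
  have o: "open (W \<inter> V)" using pf V by auto
  have Xs: "smooth_vf_on M (W \<inter> V) (X j)" by (rule smooth_vf_subset[OF V(3)[OF j(1)]]) auto
  have Es: "smooth_vf_on M (W \<inter> V) (E a)" if "a < m" for a
    using pf that smooth_vf_subset[of W "E a" "W \<inter> V"] by auto
  have Ys: "smooth_vf_on M (W \<inter> V) Y"
    unfolding Y_def oproj_def by (intro smooth_vf_diff o Xs smooth_vf_lincomb smf_metric) (auto intro: Es)
  define f where "f q = gm q (Y q) (Y q)" for q
  have f: "smf (W \<inter> V) f" unfolding f_def by (rule smf_metric[OF o Ys Ys])
  have fx: "f x > 0" unfolding f_def using j(2) by (intro metric_M(3)) (simp add: Y_def)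
  \<comment> \<open>Continuity of \<open>f\<close> is known in the chart, so the set where it is
    positive is formed in coordinates and pulled back.\<close>
  obtain V' where V': "open V'" "x \<in> V'" "V' \<subseteq> W \<inter> V" "\<And>q. q \<in> V' \<Longrightarrow> f q > 0"
  proof -
    let ?c = "chart_at M x"
    note c = chart_at[of x]
    have oi: "open (img ?c (W \<inter> V))" by (rule open_img[OF c(1) o])
    have cont: "continuous_on (img ?c (W \<inter> V)) (\<lambda>y. f (chart_inv ?c y))"
      by (rule smooth_on_continuous_on[OF smfD[OF f c(1)]])
    have "open (img ?c (W \<inter> V) \<inter> (\<lambda>y. f (chart_inv ?c y)) -` {0<..})"
      by (rule continuous_open_preimage[OF cont oi]) simp
    then have op: "open (fst ?c \<inter> snd ?c -` (img ?c (W \<inter> V) \<inter> (\<lambda>y. f (chart_inv ?c y)) -` {0<..}))"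
      using chart_homeo[OF c(1)]
      by (intro continuous_open_preimage[of "fst (chart_at M x)" "snd (chart_at M x)", OF _ chart_open[OF c(1)]])
        (simp_all only: homeomorphism_def)
    show thesis
    proof (rule that[OF op])
      show "x \<in> fst ?c \<inter> snd ?c -` (img ?c (W \<inter> V) \<inter> (\<lambda>y. f (chart_inv ?c y)) -` {0<..})"
        using c W(3) V(2) fx by (auto simp: chart_inv_snd)
      show "fst ?c \<inter> snd ?c -` (img ?c (W \<inter> V) \<inter> (\<lambda>y. f (chart_inv ?c y)) -` {0<..}) \<subseteq> W \<inter> V"
        using chart_inv_snd[OF c(1)] by (auto; metis)
      show "f q > 0" if "q \<in> fst ?c \<inter> snd ?c -` (img ?c (W \<inter> V) \<inter> (\<lambda>y. f (chart_inv ?c y)) -` {0<..})" for q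
        using that chart_inv_snd[OF c(1), of q] by auto
    qed
  qed
  define Z where "Z q = (f q powr (-1/2)) *\<^sub>R Y q" for q
  have Zs: "smooth_vf_on M V' Z" unfolding Z_def
    by (intro smooth_vf_scale smf_powr smf_subset[OF f] smooth_vf_subset[OF Ys] V')
  have Y0: "Y q \<noteq> 0" if "q \<in> V'" for q using V'(4)[OF that] by (auto simp: f_def gm_simps)
  have Z1: "gm q (Z q) (Z q) = 1" if "q \<in> V'" for q
    unfolding Z_def f_def by (rule orthon_normalize[OF Y0[OF that]])
  have ZE: "gm q (Z q) (E a q) = 0" if "q \<in> V'" "a < m" for q a
  proof -
    have "orthon q (\<lambda>a. E a q) m" using pf V'(3) that(1) by blast
    from orthon_residual[OF this that(2), of "X j q"] have "gm q (Y q) (E a q) = 0" by (simp only: Y_def)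
    then show ?thesis by (simp add: Z_def gm_simps)
  qed
  have Zfilt: "Z q \<in> filt M (Suc i) q" if q: "q \<in> V'" for q
  proof -
    have "E a q \<in> filt M (Suc i) q" if "a < m" for a
      using pf q V' that filt_M(3)[of "w a" "Suc i" q] by blast
    moreover have "X j q \<in> filt M (Suc i) q"
    proof -
      have "X j q \<in> span ((\<lambda>j. X j q) ` {..<r})" by (intro span_base) (use j in auto)
      moreover have "q \<in> V" using V'(3) q by blast
      ultimately show ?thesis using V(4) by blast
    qed
    ultimately show ?thesis unfolding Z_def Y_def oproj_def
      by (intro subspace_scale[OF subspace_filt] subspace_diff[OF subspace_filt] subspace_sum[OF subspace_filt]) auto
  qed
  have Zorth: "gm q v (Z q) = 0" if "q \<in> V'" "v \<in> filt M i q" for q v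
  proof -
    have "v = oproj q (\<lambda>a. E a q) m v" using W(2) that V' by (auto simp: frame_covers_def)
    then have "gm q v (Z q) = gm q (oproj q (\<lambda>a. E a q) m v) (Z q)" by simp
    also have "\<dots> = 0" unfolding oproj_def gm_sum
      using ZE[OF that(1)] metric_M(2)[of q "Z q"] by (intro sum.neutral) (auto simp: gm_simps)
    finally show ?thesis .
  qed
  let ?E = "E(m := Z)" and ?w = "w(m := Suc i)"
  have upd: "(\<lambda>a. ?E a q) = (\<lambda>a. E a q)(m := Z q)" for q by auto
  have "pre_frame V' ?E ?w (Suc m) (Suc i)"
    unfolding pre_frame_def upd
  proof (intro conjI ballI allI impI V')
    fix a assume a: "a < Suc m"
    show "smooth_vf_on M V' (?E a)"
    proof (cases "a = m")
      case False
      then have "a < m" using a by simp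
      then show ?thesis using smooth_vf_subset[OF Es V'(3)] False by simp
    qed (simp add: Zs)
    show "1 \<le> ?w a" "?w a \<le> Suc i" using a pf by (auto simp: less_Suc_eq)
  next
    fix q assume q: "q \<in> V'"
    show "orthon q ((\<lambda>a. E a q)(m := Z q)) (Suc m)"
      using pf q V' ZE Z1 by (intro orthon_extend) auto
    fix a assume a: "a < Suc m"
    show "?E a q \<in> filt M (?w a) q" using a pf q V' Zfilt by (auto simp: less_Suc_eq)
    fix j v assume "j < ?w a" "v \<in> filt M j q"
    then show "gm q v (?E a q) = 0"
      using a pf q V' Zorth filt_M(3)[of j i q] by (cases "a = m") (auto simp: less_Suc_eq_le)
  qed
  moreover have "frame_covers V' ?E (Suc m) i"
    unfolding frame_covers_def upd
  proof (intro ballI)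
    fix q v assume "q \<in> V'" "v \<in> filt M i q"
    then show "oproj q ((\<lambda>a. E a q)(m := Z q)) (Suc m) v = v"
      using W(2) V' Zorth by (auto simp: frame_covers_def oproj_def)
  qed
  ultimately show ?thesis using V' by blast
qed

lemma pre_frame_fill:
  "pre_frame W E w m (Suc i) \<Longrightarrow> frame_covers W E m i \<Longrightarrow> x \<in> W \<Longrightarrow>
    \<exists>W E w m. x \<in> W \<and> pre_frame W E w m (Suc i) \<and> dim (filt M (Suc i) x) \<le> m"
proof (induction "dim (filt M (Suc i) x) - m" arbitrary: W E w m)
  case 0 then show ?case by (metis diff_is_0_eq)
next
  case (Suc k)
  then have "m < dim (filt M (Suc i) x)" by simp
  from pre_frame_step[OF Suc.prems this] obtain W' E' w'
    where "x \<in> W'" "pre_frame W' E' w' (Suc m) (Suc i)" "frame_covers W' E' (Suc m) i" by blast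
  moreover have "k = dim (filt M (Suc i) x) - Suc m" using Suc.hyps(2) by simp
  ultimately show ?case using Suc.hyps(1) by blast
qed

lemma ex_pre_frame: "\<exists>W E w m. x \<in> W \<and> pre_frame W E w m i \<and> frame_covers W E m i"
proof (induction i)
  case 0
  show ?case
    by (intro exI[of _ UNIV] exI[of _ "\<lambda>_ _. 0"] exI[of _ "\<lambda>_. 0"] exI[of _ 0])
      (simp add: pre_frame_def frame_covers_def orthon_def filt_M(2) oproj_def)
next
  case (Suc i)
  then obtain W E w m where W: "x \<in> W" "pre_frame W E w m i" "frame_covers W E m i" by blast
  then have "pre_frame W E w m (Suc i)" unfolding pre_frame_def by (meson le_SucI)
  from pre_frame_fill[OF this W(3,1)] obtain W E w m
    where W: "x \<in> W" "pre_frame W E w m (Suc i)" "dim (filt M (Suc i) x) \<le> m" by blast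
  \<comment> \<open>The rank of \<open>H^(i+1)\<close> is locally constant, so a system with enough
    members at \<open>x\<close> spans it at all nearby points.\<close>
  obtain V r X where V: "open V" "x \<in> V" and "\<And>j. j < r \<Longrightarrow> smooth_vf_on M V (X j)"
    "\<And>q. q \<in> V \<Longrightarrow> span ((\<lambda>j. X j q) ` {..<r::nat}) = filt M (Suc i) q"
    and Vd: "\<And>q. q \<in> V \<Longrightarrow> dim (filt M (Suc i) q) = r"
    by (rule filt_local_frame) (rule that)
  have W': "pre_frame (W \<inter> V) E w m (Suc i)"
    using W V by (intro pre_frame_subset[OF W(2)]) (auto simp: pre_frame_def)
  note pf = W'[unfolded pre_frame_def]
  have "frame_covers (W \<inter> V) E m (Suc i)" unfolding frame_covers_def
  proof (intro ballI)
    fix q v assume q: "q \<in> W \<inter> V" and v: "v \<in> filt M (Suc i) q"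
    show "oproj q (\<lambda>a. E a q) m v = v"
    proof (rule orthon_span[OF _ _ subspace_filt _ v])
      show "orthon q (\<lambda>a. E a q) m" using pf q by blast
      show "E a q \<in> filt M (Suc i) q" if "a < m" for a
        using pf q that filt_M(3)[of "w a" "Suc i" q] by blast
      show "dim (filt M (Suc i) q) \<le> m" using W(3) Vd[OF V(2)] Vd[of q] q by simp
    qed
  qed
  then show ?case using W W' V by blast
qed

lemma ex_frame:
  obtains W E n w where "open W" "x \<in> W" "\<And>a. smooth_vf_on M W (E a)"
    "\<And>q. q \<in> W \<Longrightarrow> adapted_frame M q (\<lambda>a. E a q) n w"
proof -
  obtain W E w n where W: "x \<in> W" "pre_frame W E w n (depth M)" "frame_covers W E n (depth M)"
    using ex_pre_frame by blast
  note pf = W(2)[unfolded pre_frame_def]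
  \<comment> \<open>Indices beyond the length of the frame get the zero field, so that smoothness
    holds for every index.\<close>
  define E' where "E' a = (if a < n then E a else (\<lambda>_. 0))" for a
  have E': "a < n \<Longrightarrow> E' a = E a" for a by (simp add: E'_def)
  have "smooth_vf_on M W (\<lambda>_. 0)" using smooth_vf_lincomb[of W "{}"] pf by simp
  then have sm: "smooth_vf_on M W (E' a)" for a using pf by (simp add: E'_def)
  have "adapted_frame M q (\<lambda>a. E' a q) n w" if q: "q \<in> W" for q
  proof
    show "bilinear (gm q)" "gm q u v = gm q v u" for u v by (rule metric_M)+
    have on: "orthon q (\<lambda>a. E a q) n" using pf q by blast
    then show "gm q (E' i q) (E' j q) = (if i = j then 1 else 0)" if "i < n" "j < n" for i j
      using that by (simp add: orthon_def E')
    show ex: "(\<Sum>i<n. gm q v (E' i q) *\<^sub>R E' i q) = v" for v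
      using W(3) q by (simp add: frame_covers_def oproj_def filt_M(4) E')
    show "1 \<le> w a \<and> w a \<le> depth M" if "a < n" for a using pf that by blast
    show "v \<in> filt M i q \<longleftrightarrow> (\<forall>a<n. i < w a \<longrightarrow> gm q v (E' a q) = 0)" for v i
    proof
      assume "v \<in> filt M i q" then show "\<forall>a<n. i < w a \<longrightarrow> gm q v (E' a q) = 0" using pf q E' by simp
    next
      assume z: "\<forall>a<n. i < w a \<longrightarrow> gm q v (E' a q) = 0"
      have "gm q v (E' a q) *\<^sub>R E' a q \<in> filt M i q" if "a < n" for a
      proof (cases "i < w a")
        case True then show ?thesis using z that subspace_0[OF subspace_filt] by simp
      next
        case False
        then have "E' a q \<in> filt M i q" using pf q that E' filt_M(3)[of "w a" i q] by auto
        then show ?thesis by (rule subspace_scale[OF subspace_filt])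
      qed
      then have "(\<Sum>i<n. gm q v (E' i q) *\<^sub>R E' i q) \<in> filt M i q" by (intro subspace_sum[OF subspace_filt]) auto
      then show "v \<in> filt M i q" by (simp only: ex)
    qed
  qed
  then show thesis using that[of W E' n w] sm W(1) pf by blast
qed

subsection \<open>Cutoff functions\<close>

text \<open>\<open>C\<close> is the image of a closed coordinate ball, which is compact and hence
  closed in a Hausdorff space. Therefore multiplying by the cutoff and extending by 0 keeps
  smoothness on the whole manifold.\<close>

lemma ex_cutoff:
  assumes W: "open W" "x \<in> W"
  obtains ch C V where "smf UNIV ch" "closed C" "C \<subseteq> W" "open V" "x \<in> V" "V \<subseteq> C"
    "\<And>q. q \<in> V \<Longrightarrow> ch q = 1" "\<And>q. q \<notin> C \<Longrightarrow> ch q = 0"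
proof -
  let ?c = "chart_at M x" and ?y0 = "snd (chart_at M x) x"
  note c = chart_at[of x]
  have oi: "open (img ?c W)" by (rule open_img[OF c(1) W(1)])
  have "?y0 \<in> img ?c W" using c W by auto
  then obtain r where r: "r > 0" "cball ?y0 r \<subseteq> img ?c W" using oi open_contains_cball by blast
  obtain f :: "'e \<Rightarrow> real" where f: "smooth_on UNIV f" "\<And>y. dist y ?y0 < r / 2 \<Longrightarrow> f y = 1" "\<And>y. dist y ?y0 \<ge> r \<Longrightarrow> f y = 0"
    using bump_function[OF r(1), of ?y0] by blast
  define C where "C = chart_inv ?c ` cball ?y0 r"
  define V where "V = fst ?c \<inter> snd ?c -` ball ?y0 (r / 2)"
  define ch where "ch q = (if q \<in> fst ?c then f (snd ?c q) else 0)" for q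
  have hom: "continuous_on (fst ?c) (snd ?c)" "continuous_on (snd ?c ` fst ?c) (chart_inv ?c)"
    using chart_homeo[OF c(1)] by (auto simp: homeomorphism_def)
  have "continuous_on (cball ?y0 r) (chart_inv ?c)" by (rule continuous_on_subset[OF hom(2)]) (use r in auto)
  then have "compact C" unfolding C_def by (rule compact_continuous_image) simp
  then have C: "closed C" by (rule compact_imp_closed)
  have CW: "C \<subseteq> W" unfolding C_def using chart_inv_in[OF c(1)] r(2) by blast
  have V: "open V" unfolding V_def by (rule continuous_open_preimage[OF hom(1) chart_open[OF c(1)]]) simp
  have xV: "x \<in> V" using c r by (simp add: V_def)
  have inC: "q \<in> C" if "q \<in> fst ?c" "snd ?c q \<in> cball ?y0 r" for q
    unfolding C_def by (rule image_eqI[OF _ that(2)]) (simp add: chart_inv_snd[OF c(1) that(1)])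
  have VC: "V \<subseteq> C"
  proof
    fix q assume "q \<in> V" then show "q \<in> C" using r by (intro inC) (auto simp: V_def)
  qed
  have one: "ch q = 1" if "q \<in> V" for q using that f(2)[of "snd ?c q"] by (auto simp: V_def ch_def dist_commute)
  have zero: "ch q = 0" if "q \<notin> C" for q
  proof (cases "q \<in> fst ?c")
    case True
    then have "\<not> dist (snd ?c q) ?y0 \<le> r" using inC that by (auto simp: dist_commute)
    then show ?thesis using f(3)[of "snd ?c q"] True by (simp add: ch_def)
  qed (simp add: ch_def)
  have "smf UNIV ch"
  proof (rule smf_local)
    fix q :: 'm
    show "\<exists>V. open V \<and> q \<in> V \<and> smf (UNIV \<inter> V) ch"
    proof (cases "q \<in> fst ?c")
      case True
      have "smf (fst ?c) ch"
      proof (rule smf_one_chart[OF c(1) chart_open[OF c(1)]])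
        have "smooth_on (img ?c (fst ?c)) f" by (rule smooth_on_subset[OF f(1)]) simp
        moreover have "ch (chart_inv ?c y) = f y" if "y \<in> img ?c (fst ?c)" for y
          using chart_inv_in[OF c(1) that] by (simp add: ch_def)
        ultimately show "smooth_on (img ?c (fst ?c)) (\<lambda>y. ch (chart_inv ?c y))"
          using smooth_on_cong[OF open_img[OF c(1) chart_open[OF c(1)]]] by (metis (no_types, lifting))
      qed simp
      then show ?thesis using True chart_open[OF c(1)] by auto
    next
      case False
      have "q \<in> - C" using False chart_inv_in[OF c(1)] r(2) by (auto simp: C_def)
      moreover have "smf (- C) ch" using smf_cong[of "- C" ch "\<lambda>_. 0"] zero smf_const[of "- C" 0] C by auto
      ultimately show ?thesis using C by (intro exI[of _ "- C"]) auto
    qed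
  qed simp
  then show thesis using that C CW V xV VC one zero by blast
qed

text \<open>The bracket condition of the filtration speaks of global sections, so local fields have
  to be extended before it can be used.\<close>

lemma extend_section:
  assumes W: "open W" "x \<in> W" and X: "smooth_vf_on M W X" "\<And>q. q \<in> W \<Longrightarrow> X q \<in> filt M i q"
  obtains X' V where "X' \<in> sections M (filt M i)" "open V" "x \<in> V" "V \<subseteq> W" "\<And>q. q \<in> V \<Longrightarrow> X' q = X q"
proof -
  obtain ch C V where ch: "smf UNIV ch" "closed C" "C \<subseteq> W" "open V" "x \<in> V" "V \<subseteq> C"
    "\<And>q. q \<in> V \<Longrightarrow> ch q = 1" "\<And>q. q \<notin> C \<Longrightarrow> ch q = 0" using ex_cutoff[OF W] by metis
  define X' where "X' q = (if q \<in> W then ch q *\<^sub>R X q else 0)" for q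
  have "smooth_vf_on M UNIV X'"
  proof (rule smooth_vf_local)
    fix q :: 'm
    show "\<exists>V. open V \<and> q \<in> V \<and> smooth_vf_on M (UNIV \<inter> V) X'"
    proof (cases "q \<in> W")
      case True
      have "smooth_vf_on M W X'"
        by (rule smooth_vf_cong[OF W(1), of _ "\<lambda>q. ch q *\<^sub>R X q"])
          (auto simp: X'_def intro: smooth_vf_scale smf_subset[OF ch(1)] W X)
      then show ?thesis using True W by auto
    next
      case False
      have "smooth_vf_on M (- C) (\<lambda>_. 0)" using smooth_vf_lincomb[OF open_Compl[OF ch(2)], of "{}"] by simp
      then have "smooth_vf_on M (- C) X'" by (intro smooth_vf_cong[of "- C" X' "\<lambda>_. 0"]) (use ch in \<open>auto simp: X'_def\<close>)
      then show ?thesis using False ch by (intro exI[of _ "- C"]) auto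
    qed
  qed simp
  moreover have "X' q \<in> filt M i q" for q
    using X(2) subspace_scale[OF subspace_filt] subspace_0[OF subspace_filt] by (simp add: X'_def)
  ultimately have "X' \<in> sections M (filt M i)" by (simp add: sections_def)
  moreover have "X' q = X q" if "q \<in> V" for q using that ch(3,6,7) by (auto simp: X'_def)
  ultimately show thesis using that[of X' V] ch(3-6) by blast
qed

text \<open>The conclusion exposes the cutoff factor because multiplication by a function preserves
  linear conditions on the fibres, such as membership in the weight filtration.\<close>

lemma extend_form:
  assumes W: "open W" "x \<in> W" and w: "\<omega> \<in> forms_on M W"
  obtains \<eta> V ch where "\<eta> \<in> forms_on M UNIV" "open V" "x \<in> V" "V \<subseteq> W" "\<And>q. q \<in> V \<Longrightarrow> \<eta> q = \<omega> q"
    "smf UNIV ch" "\<And>q. \<eta> q = (\<lambda>vs. ch q * \<omega> q vs)"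
proof -
  obtain ch C V where ch: "smf UNIV ch" "closed C" "C \<subseteq> W" "open V" "x \<in> V" "V \<subseteq> C"
    "\<And>q. q \<in> V \<Longrightarrow> ch q = 1" "\<And>q. q \<notin> C \<Longrightarrow> ch q = 0" using ex_cutoff[OF W] by metis
  define \<eta> where "\<eta> = (\<lambda>q vs. ch q * \<omega> q vs)"
  have "\<eta> \<in> forms_on M UNIV"
  proof (rule forms_on_local)
    fix q :: 'm
    show "\<exists>V \<eta>'. open V \<and> q \<in> V \<and> \<eta>' \<in> forms_on M V \<and> (\<forall>p\<in>UNIV \<inter> V. \<eta> p = \<eta>' p)"
    proof (cases "q \<in> W")
      case True
      then show ?thesis
        using forms_on_mult[OF smf_subset[OF ch(1), of W] w] W by (intro exI[of _ W] exI[of _ \<eta>]) (simp add: \<eta>_def)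
    next
      case False
      then show ?thesis using forms_on_zero[of "- C"] ch by (intro exI[of _ "- C"] exI[of _ "\<lambda>_ _. 0"]) (auto simp: \<eta>_def)
    qed
  qed simp_all
  then show thesis using that[of \<eta> V ch] ch by (auto simp: \<eta>_def)
qed

end

subsection \<open>The osculating brackets in a frame\<close>

locale frame_nbhd = filtered_manifold M
  for M :: "('m::{t2_space, second_countable_topology}, 'e::euclidean_space) filtered_space" +
  fixes W :: "'m set" and E :: "nat \<Rightarrow> 'm \<Rightarrow> 'e" and n :: nat and w :: "nat \<Rightarrow> nat"
  assumes open_W: "open W"
    and E_smooth: "smooth_vf_on M W (E a)"
    and frame: "q \<in> W \<Longrightarrow> adapted_frame M q (\<lambda>a. E a q) n w"
begin

abbreviation "EK K q \<equiv> map (\<lambda>a. E a q) K"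

lemma E_smooth': "V \<subseteq> W \<Longrightarrow> smooth_vf_on M V (E a)"
  using smooth_vf_subset E_smooth by blast

text \<open>A chart tests a form on coordinate vectors; these are expanded in the frame one argument
  at a time, with smooth coefficients given by the metric.\<close>

lemma forms_on_frameI:
  assumes U: "open U" "U \<subseteq> W" and ext: "\<And>x. x \<in> U \<Longrightarrow> \<omega> x \<in> ext_T" and out: "\<And>x. x \<notin> U \<Longrightarrow> \<omega> x = (\<lambda>_. 0)"
    and sm: "\<And>K. set K \<subseteq> {..<n} \<Longrightarrow> smf U (\<lambda>q. \<omega> q (EK K q))"
  shows "\<omega> \<in> forms_on M U"
proof (rule forms_onI[OF ext out])
  fix c us assume c: "c \<in> atlas M"
  define U' where "U' = U \<inter> fst c"
  have U': "open U'" "U' \<subseteq> W" unfolding U'_def using U chart_open[OF c] by auto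
  define X where "X u q = tang_from M c q u" for u q
  have X: "smooth_vf_on M U' (X u)" for u
    unfolding X_def by (rule smooth_vf_subset[OF smooth_vf_coord[OF c]]) (auto simp: U'_def)
  have "smf U' (\<lambda>q. \<omega> q (EK K q @ map (\<lambda>u. X u q) us))" if "set K \<subseteq> {..<n}" for K us
    using that
  proof (induction us arbitrary: K)
    case Nil then show ?case using smf_subset[OF sm[OF Nil] _ U'(1)] by (simp add: U'_def)
  next
    case (Cons u us)
    have "smf U' (\<lambda>q. \<Sum>i<n. gm q (X u q) (E i q) * \<omega> q (EK (K @ [i]) q @ map (\<lambda>u. X u q) us))"
      by (intro smf_sum smf_mult smf_metric U' X E_smooth' Cons.IH) (use Cons.prems in auto)
    moreover have "\<omega> q (EK K q @ map (\<lambda>u. X u q) (u # us)) =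
        (\<Sum>i<n. gm q (X u q) (E i q) * \<omega> q (EK (K @ [i]) q @ map (\<lambda>u. X u q) us))" if "q \<in> U'" for q
    proof -
      have q: "q \<in> W" "q \<in> U" using that U' by (auto simp: U'_def)
      interpret adapted_frame M q "\<lambda>a. E a q" n w by (rule frame[OF q(1)])
      show ?thesis using ext_T_expand_arg[OF ext[OF q(2)], of "EK K q" "X u q" "map (\<lambda>u. X u q) us"] by simp
    qed
    ultimately show ?case using smf_cong[of U'] by (metis (no_types, lifting))
  qed
  from this[of "[]"] have "smf U' (\<lambda>q. \<omega> q (map (\<lambda>u. X u q) us))" by simp
  from smfD[OF this c] show "smooth_on (img c U) (\<lambda>y. form_rep M c \<omega> y us)"
    by (simp add: form_rep_def X_def U'_def Int_commute Int_left_commute)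
qed

definition eb :: "nat list \<Rightarrow> ('m, 'e) form" where
  "eb J = restr W (\<lambda>q. gram_wedge UNIV (gm q) (EK J q))"

lemma eb_ext: "eb J q \<in> ext_T"
  using gram_wedge_ext_T[OF metric_M(1)] by (simp add: eb_def restr_def)

lemma eb_frame:
  assumes "q \<in> W" "set J \<subseteq> {..<n}" "set K \<subseteq> {..<n}"
  shows "eb J q (EK K q) = (if length J = length K then
    Determinant.det (Matrix.mat (length J) (length J) (\<lambda>(i, j). if J ! i = K ! j then 1 else 0)) else 0)"
proof -
  interpret adapted_frame M q "\<lambda>a. E a q" n w by (rule frame[OF assms(1)])
  have "Matrix.mat (length J) (length J) (\<lambda>(i, j). gm q (EK J q ! i) (EK K q ! j)) =
    Matrix.mat (length J) (length J) (\<lambda>(i, j). if J ! i = K ! j then 1 else 0)" if "length J = length K"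
  proof (rule cong_mat[OF refl refl])
    fix i j assume ij: "i < length J" "j < length J"
    then have "J ! i < n" "K ! j < n" using assms(2,3) that by (metis lessThan_iff nth_mem subsetD)+
    from g_frame[OF this] show "(case (i, j) of (i, j) \<Rightarrow> gm q (EK J q ! i) (EK K q ! j)) = (case (i, j) of (i, j) \<Rightarrow> if J ! i = K ! j then 1 else 0)"
      using ij that by simp
  qed
  then show ?thesis using assms by (auto simp: eb_def gram_wedge_def)
qed

lemma eb_forms_on: "set J \<subseteq> {..<n} \<Longrightarrow> eb J \<in> forms_on M W"
proof (rule forms_on_frameI[OF open_W order_refl eb_ext])
  show "eb J q = (\<lambda>_. 0)" if "q \<notin> W" for q using that by (simp add: eb_def restr_def)
  fix K assume JK: "set J \<subseteq> {..<n}" "set K \<subseteq> {..<n}"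
  show "smf W (\<lambda>q. eb J q (EK K q))"
    by (subst smf_cong[OF eb_frame[OF _ JK]]) (assumption, rule smf_const[OF open_W])
qed

lemma eb_single: "q \<in> W \<Longrightarrow> eb [c] q [v] = gm q (E c q) v"
  by (simp add: eb_def gram_wedge_def det_single)

text \<open>The tensor \<open>- d\<theta>\<close> for the covector \<open>\<theta>\<close> dual to
  \<open>E c\<close>. By Cartan's formula it computes the \<open>c\<close>-component of the bracket
  of fields annihilated by \<open>\<theta>\<close>, and it only sees the values of the fields at the
  point.\<close>

definition \<beta> :: "'m \<Rightarrow> nat \<Rightarrow> 'e \<Rightarrow> 'e \<Rightarrow> real" where
  "\<beta> q c u v = - de_rham M (eb [c]) q [u, v]"

text \<open>Fields of filtration degree below \<open>w c\<close> have vanishing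
  \<open>c\<close>-component on all of \<open>V\<close>, so the derivative terms in Cartan's formula
  drop out.\<close>

lemma bracket_component:
  assumes V: "open V" "q \<in> V" "V \<subseteq> W" and X: "smooth_vf_on M V X" "\<And>p. p \<in> V \<Longrightarrow> X p \<in> filt M i p"
    and Y: "smooth_vf_on M V Y" "\<And>p. p \<in> V \<Longrightarrow> Y p \<in> filt M j p" and c: "c < n" "i < w c" "j < w c"
  shows "gm q (lie_bracket M X Y q) (E c q) = \<beta> q c (X q) (Y q)"
proof -
  let ?Z = "\<lambda>b. if b then Y else X"
  have e: "restr V (eb [c]) \<in> forms_on M V" using eb_forms_on[of "[c]"] c V by (intro forms_on_restr) auto
  have z: "restr V (eb [c]) p [?Z b p] = 0" if "p \<in> V" for p b
  proof -
    interpret adapted_frame M p "\<lambda>a. E a p" n w using frame V that by blast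
    have "gm p (?Z b p) (E c p) = 0" using X(2)[OF that] Y(2)[OF that] c by (auto simp: filt_iff)
    then show ?thesis using that V eb_single[of p c] metric_M(2)[of p "E c p"] by auto
  qed
  have D: "Dm (\<lambda>p. restr V (eb [c]) p [?Z b p]) q v = 0" for b v
    using Dm_cong[OF V(1,2), of "\<lambda>p. restr V (eb [c]) p [?Z b p]" "\<lambda>_. 0"] z by (simp add: Dm_const)
  have "de_rham M (restr V (eb [c])) q (map (\<lambda>b. ?Z b q) [False, True]) =
      (\<Sum>k<length [False, True]. (-1) ^ k * Dm (\<lambda>p. restr V (eb [c]) p (map (\<lambda>b. ?Z b p) (nths [False, True] (- {k})))) q (?Z ([False, True] ! k) q))
      + altsum2 (\<lambda>i j. lie_bracket M (?Z i) (?Z j) q) (restr V (eb [c]) q) (\<lambda>b. ?Z b q) [False, True]"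
    by (rule de_rham_cartan[OF e V(1,2)]) (use X Y in auto)
  moreover have "nths [False, True] (- {0}) = [True]" "nths [False, True] (- {Suc 0}) = [False]"
    "nths [False, True] (- {0, Suc 0}) = []" by (simp_all add: nths_Cons)
  ultimately have "de_rham M (restr V (eb [c])) q [X q, Y q] = - restr V (eb [c]) q [lie_bracket M X Y q]"
    using D[of True] D[of False] by (simp add: altsum2_def)
  moreover have "de_rham M (restr V (eb [c])) q = de_rham M (eb [c]) q" by (rule de_rham_cong[OF V(1,2)]) simp
  moreover have "restr V (eb [c]) q [lie_bracket M X Y q] = gm q (lie_bracket M X Y q) (E c q)"
    using V eb_single[of q c] metric_M(2)[of q "E c q"] by auto
  ultimately show ?thesis by (simp add: \<beta>_def)
qed

text \<open>A field with constant components in the frame stays in the filtration; a cutoff makes it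
  global.\<close>

lemma section_through:
  assumes q: "q \<in> W" and u: "u \<in> filt M i q"
  obtains X where "X \<in> sections M (filt M i)" "X q = u"
proof -
  define X where "X p = (\<Sum>a<n. gm q u (E a q) *\<^sub>R E a p)" for p
  have sm: "smooth_vf_on M W X" unfolding X_def by (intro smooth_vf_lincomb open_W smf_const E_smooth)
  have fi: "X p \<in> filt M i p" if "p \<in> W" for p
  proof -
    interpret q: adapted_frame M q "\<lambda>a. E a q" n w by (rule frame[OF q])
    interpret adapted_frame M p "\<lambda>a. E a p" n w by (rule frame[OF that])
    show ?thesis using u unfolding X_def filt_iff q.filt_iff by (simp add: g_lincomb)
  qed
  obtain X' V where "X' \<in> sections M (filt M i)" "open V" "q \<in> V" "V \<subseteq> W" "\<And>q. q \<in> V \<Longrightarrow> X' q = X q"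
    by (rule extend_section[OF open_W q sm fi]) (assumption, rule that)
  moreover have "X q = u"
  proof -
    interpret adapted_frame M q "\<lambda>a. E a q" n w by (rule frame[OF q])
    show ?thesis unfolding X_def by (rule frame_expand)
  qed
  ultimately show thesis using that by metis
qed

lemma section_bracket:
  assumes q: "q \<in> W" and X: "X \<in> sections M (filt M i)" and Y: "Y \<in> sections M (filt M j)" and c: "c < n" "i < w c" "j < w c"
  shows "gm q (lie_bracket M X Y q) (E c q) = \<beta> q c (X q) (Y q)"
  by (rule bracket_component[OF open_W q order_refl _ _ _ _ c])
    (use X Y smooth_vf_subset[of UNIV] in \<open>auto simp: sections_def\<close>)

lemma \<beta>_props:
  assumes q: "q \<in> W" and c: "c < n"
  shows "bilinear (\<beta> q c)" "\<beta> q c u v = - \<beta> q c v u"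
proof -
  have e: "de_rham M (eb [c]) q \<in> ext_T"
    by (rule de_rham_ext[OF eb_forms_on open_W q]) (use c in simp)
  show "bilinear (\<beta> q c)" unfolding bilinear_def \<beta>_def
    using ext_T_add[OF e, of "[]"] ext_T_add[OF e, of "[_]" _ _ "[]"] ext_T_scale[OF e, of "[]"] ext_T_scale[OF e, of "[_]" _ _ "[]"]
    by (auto intro!: linearI)
  show "\<beta> q c u v = - \<beta> q c v u" using ext_T_swap0[OF e, of u v "[]"] by (simp add: \<beta>_def)
qed

text \<open>Realised by sections, \<open>\<beta>\<close> is a component of their bracket. That
  bracket lies in \<open>H^(i+j)\<close>, where components of degree above \<open>i + j\<close> are
  zero.\<close>

lemma \<beta>_filt:
  assumes q: "q \<in> W" and c: "c < n" and i: "i + j < w c" and u: "u \<in> filt M i q" and v: "v \<in> filt M j q"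
  shows "\<beta> q c u v = 0"
proof -
  obtain X where X: "X \<in> sections M (filt M i)" "X q = u" using section_through[OF q u] by blast
  obtain Y where Y: "Y \<in> sections M (filt M j)" "Y q = v" using section_through[OF q v] by blast
  interpret adapted_frame M q "\<lambda>a. E a q" n w by (rule frame[OF q])
  have "lie_bracket M X Y q \<in> filt M (i + j) q" using filt_M(5)[OF X(1) Y(1)] by (simp add: sections_def)
  then have "gm q (lie_bracket M X Y q) (E c q) = 0" using c i by (auto simp: filt_iff)
  then show ?thesis using section_bracket[OF q X(1) Y(1) c] i X Y by simp
qed

lemma osculating:
  assumes q: "q \<in> W"
  shows "osculating_frame M q (\<lambda>a. E a q) n w (\<beta> q)"
proof -
  interpret adapted_frame M q "\<lambda>a. E a q" n w by (rule frame[OF q])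
  show ?thesis
  proof
    show "bilinear (\<beta> q c)" "\<beta> q c u v = - \<beta> q c v u" if "c < n" for c u v by (rule \<beta>_props[OF q that])+
    fix i j u v assume i: "1 \<le> i" "1 \<le> j" "i + j \<le> depth M" and u: "u \<in> filt M i q" and v: "v \<in> filt M j q"
    let ?r = "bracket_rep M q i j (coset M q i u) (coset M q j v)"
    have cosI: "u \<in> coset M q i u" for i u by (simp add: mem_coset filt_zero)
    have "\<exists>r. \<exists>X\<in>sections M (filt M i). \<exists>Y\<in>sections M (filt M j).
        X q \<in> coset M q i u \<and> Y q \<in> coset M q j v \<and> r = lie_bracket M X Y q"
      using section_through[OF q u] section_through[OF q v] cosI by metis
    then have "\<exists>X\<in>sections M (filt M i). \<exists>Y\<in>sections M (filt M j).
        X q \<in> coset M q i u \<and> Y q \<in> coset M q j v \<and> ?r = lie_bracket M X Y q"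
      unfolding bracket_rep_def by (rule someI_ex)
    then obtain X Y where X: "X \<in> sections M (filt M i)" "X q \<in> coset M q i u"
      and Y: "Y \<in> sections M (filt M j)" "Y q \<in> coset M q j v" and r: "?r = lie_bracket M X Y q" by blast
    have "?r \<in> filt M (i + j) q" using filt_M(5)[OF X(1) Y(1)] r by (simp add: sections_def)
    moreover have "gm q ?r (E c q) = \<beta> q c u v" if c: "c < n" "w c = i + j" for c
    proof -
      have "gm q ?r (E c q) = \<beta> q c (X q) (Y q)"
        unfolding r by (rule section_bracket[OF q X(1) Y(1) c(1)]) (use c i in auto)
      \<comment> \<open>\<open>X q\<close> and \<open>u\<close> lie in the same coset, so their
        difference is in \<open>H^(i-1)\<close> and the degrees add up to less than
        \<open>w c\<close>.\<close>
      moreover have "\<beta> q c (X q - u) (Y q) = 0"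
        by (rule \<beta>_filt[OF q c(1), of "i - 1" j]) (use c i X Y in \<open>auto simp: mem_coset sections_def\<close>)
      moreover have "\<beta> q c u (Y q - v) = 0"
        by (rule \<beta>_filt[OF q c(1), of i "j - 1"]) (use c i u X Y in \<open>auto simp: mem_coset sections_def\<close>)
      ultimately show ?thesis
        by (simp add: bilinear_lsub[OF \<beta>_props(1)[OF q c(1)]] bilinear_rsub[OF \<beta>_props(1)[OF q c(1)]])
    qed
    ultimately show "?r \<in> filt M (i + j) q \<and> (\<forall>c<n. w c = i + j \<longrightarrow> gm q ?r (E c q) = \<beta> q c u v)" by blast
  qed
qed

end

subsection \<open>Weights\<close>

text \<open>The forms of weight at least \<open>k\<close>, described without a frame. In an adapted
  frame this is the vanishing of all coefficients of smaller weight, see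
  \<open>Fil_iff\<close>.\<close>

definition Fil :: "('m, 'e::euclidean_space) filtered_space \<Rightarrow> nat \<Rightarrow> 'm \<Rightarrow> ('e list \<Rightarrow> real) set" where
  "Fil M k x = {a \<in> ext_T. \<forall>vs is. list_all2 (\<lambda>v i. v \<in> filt M i x) vs is \<longrightarrow> sum_list is < k \<longrightarrow> a vs = 0}"

definition lin_op :: "(('e::euclidean_space list \<Rightarrow> real) \<Rightarrow> 'e list \<Rightarrow> real) \<Rightarrow> bool" where
  "lin_op A \<longleftrightarrow> (\<forall>a\<in>ext_T. A a \<in> ext_T) \<and> (\<forall>a\<in>ext_T. \<forall>b\<in>ext_T. A (\<lambda>vs. a vs + b vs) = (\<lambda>vs. A a vs + A b vs)) \<and>
    (\<forall>a\<in>ext_T. \<forall>r. A (\<lambda>vs. r * a vs) = (\<lambda>vs. r * A a vs))"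

lemma lin_opD:
  assumes "lin_op A" "a \<in> ext_T" "b \<in> ext_T"
  shows "A a \<in> ext_T" "A (\<lambda>vs. a vs + b vs) = (\<lambda>vs. A a vs + A b vs)" "A (\<lambda>vs. r * a vs) = (\<lambda>vs. r * A a vs)"
  using assms by (auto simp: lin_op_def)

lemma lin_op_zero: "lin_op A \<Longrightarrow> A (\<lambda>_. 0) = (\<lambda>_. 0)"
  using lin_opD(3)[of A "\<lambda>_. 0" "\<lambda>_. 0" 0] by simp

lemma lin_op_diff: "lin_op A \<Longrightarrow> a \<in> ext_T \<Longrightarrow> b \<in> ext_T \<Longrightarrow> A (\<lambda>vs. a vs - b vs) = (\<lambda>vs. A a vs - A b vs)"
  using lin_opD(2)[of A a "\<lambda>vs. -1 * b vs"] lin_opD(3)[of A b b "-1"] ext_T_scaled[of b "-1"] by simp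

lemma lin_op_sum:
  assumes A: "lin_op A" and f: "\<And>j. j \<in> J \<Longrightarrow> f j \<in> ext_T"
  shows "A (\<lambda>vs. \<Sum>j\<in>J. c j * f j vs) = (\<lambda>vs. \<Sum>j\<in>J. c j * A (f j) vs)"
  using f
proof (induction J rule: infinite_finite_induct)
  case (insert x F)
  have "(\<lambda>vs. \<Sum>j\<in>F. c j * f j vs) \<in> ext_T" "(\<lambda>vs. c x * f x vs) \<in> ext_T"
    using insert.prems by (auto intro!: ext_T_sum ext_T_scaled)
  then show ?case using insert lin_opD(3)[OF A, of "f x" "f x" "c x"] by (simp add: lin_opD(2)[OF A])
qed (use lin_op_zero[OF A] in simp_all)

lemma lin_op_comp: "lin_op A \<Longrightarrow> lin_op B \<Longrightarrow> lin_op (\<lambda>a. A (B a))"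
  by (simp add: lin_op_def)

lemma lin_op_lincomb: "lin_op A \<Longrightarrow> lin_op B \<Longrightarrow> lin_op (\<lambda>a vs. r * A a vs + s * B a vs)"
  unfolding lin_op_def by (auto intro!: ext_T_plus ext_T_scaled simp: algebra_simps)

lemma lin_op_id: "lin_op (\<lambda>a. a)"
  by (simp add: lin_op_def)

context adapted_frame
begin

definition wt :: "nat list \<Rightarrow> nat" where
  "wt K = sum_list (map w K)"

lemma wt_Cons [simp]: "wt (a # K) = w a + wt K"
  and wt_Nil [simp]: "wt [] = 0"
  by (simp_all add: wt_def)

lemma wt_nths1: "i < length J \<Longrightarrow> wt J = w (J ! i) + wt (nths J (- {i}))"
proof (induction J arbitrary: i)
  case (Cons a J)
  then show ?case by (cases i) (auto simp: nths_Cons_0 nths_Cons_Suc)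
qed simp

lemma wt_nths2: "i < j \<Longrightarrow> j < length J \<Longrightarrow> wt J = w (J ! i) + w (J ! j) + wt (nths J (- {i, j}))"
proof (induction J arbitrary: i j)
  case (Cons a J)
  obtain j' where j: "j = Suc j'" using Cons.prems(1) by (cases j) auto
  show ?case
  proof (cases i)
    case 0 then show ?thesis using Cons.prems wt_nths1[of j' J] by (simp add: j nths_Cons_0_Suc)
  next
    case (Suc i')
    then show ?thesis using Cons.prems Cons.IH[of i' j'] by (simp add: j nths_Cons_Suc_Suc)
  qed
qed simp

lemma wt_mset: "mset K = mset J \<Longrightarrow> wt K = wt J"
  unfolding wt_def by (metis mset_map sum_mset_sum_list)

lemma wt_le: "K \<in> idx n \<Longrightarrow> wt K \<le> n * depth M"
proof -
  assume K: "K \<in> idx n"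
  have "wt K \<le> length K * depth M" if "set K \<subseteq> {..<n}" for K
    using that
  proof (induction K)
    case (Cons a K)
    then have "w a \<le> depth M" using w_range[of a] by simp
    then show ?case using Cons by simp
  qed simp
  then have "wt K \<le> length K * depth M" using idx_set[OF K] by blast
  also have "\<dots> \<le> n * depth M" using idx_length[OF K] by simp
  finally show ?thesis .
qed

lemma vanish_sort:
  assumes a: "a \<in> ext_T" and K: "set K \<subseteq> {..<n}" and z: "distinct K \<Longrightarrow> a (map E (sort K)) = 0"
  shows "a (map E K) = 0"
proof (cases "distinct K")
  case True
  have "mset (map E K) = mset (map E (sort K))" by simp
  from ext_T_permute[OF a this, of "[]"] z[OF True] show ?thesis by auto
next
  case False
  then show ?thesis using ext_T_alt[OF a] by (meson distinct_map)
qed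

text \<open>The forms that are homogeneous of weight \<open>k\<close>. Unlike the filtration
  \<open>Fil\<close>, this splitting depends on the metric, through the complements
  \<open>G^i\<close>.\<close>

definition Hom :: "nat \<Rightarrow> ('e list \<Rightarrow> real) set" where
  "Hom k = {a \<in> ext_T. \<forall>K\<in>idx n. wt K \<noteq> k \<longrightarrow> a (map E K) = 0}"

lemma Hom_list: "a \<in> Hom k \<Longrightarrow> set K \<subseteq> {..<n} \<Longrightarrow> wt K \<noteq> k \<Longrightarrow> a (map E K) = 0"
  by (rule vanish_sort) (use idx_sort wt_mset[of K "sort K"] in \<open>auto simp: Hom_def\<close>)

lemma Fil_iff_list: "a \<in> Fil M k x \<longleftrightarrow> a \<in> ext_T \<and> (\<forall>K. set K \<subseteq> {..<n} \<longrightarrow> wt K < k \<longrightarrow> a (map E K) = 0)"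
proof
  assume a: "a \<in> Fil M k x"
  have "list_all2 (\<lambda>v i. v \<in> filt M i x) (map E K) (map w K)" if "set K \<subseteq> {..<n}" for K
    using that by (induction K) (auto intro: E_filt)
  then show "a \<in> ext_T \<and> (\<forall>K. set K \<subseteq> {..<n} \<longrightarrow> wt K < k \<longrightarrow> a (map E K) = 0)"
    using a unfolding Fil_def wt_def by blast
next
  assume a: "a \<in> ext_T \<and> (\<forall>K. set K \<subseteq> {..<n} \<longrightarrow> wt K < k \<longrightarrow> a (map E K) = 0)"
  have "list_all2 (\<lambda>v i. v \<in> filt M i x) vs is \<Longrightarrow> set K \<subseteq> {..<n} \<Longrightarrow> wt K + sum_list is < k \<Longrightarrow> a (map E K @ vs) = 0" for K vs "is"
  proof (induction arbitrary: K rule: list_all2_induct)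
    case Nil then show ?case using a by simp
  next
    case (Cons v vs i "is")
    have "g v (E c) * a (map E K @ E c # vs) = 0" if c: "c < n" for c
    proof (cases "w c \<le> i")
      case True
      have "wt (K @ [c]) = wt K + w c" by (simp add: wt_def)
      then show ?thesis using Cons.IH[of "K @ [c]"] Cons.prems c True by simp
    next
      case False then show ?thesis using Cons.hyps(1) c by (simp add: filt_iff)
    qed
    then show ?case using a by (subst ext_T_expand_arg) (auto intro!: sum.neutral)
  qed
  from this[of _ _ "[]"] show "a \<in> Fil M k x" using a by (auto simp: Fil_def)
qed

lemma Fil_iff: "a \<in> Fil M k x \<longleftrightarrow> a \<in> ext_T \<and> (\<forall>K\<in>idx n. wt K < k \<longrightarrow> a (map E K) = 0)"
proof
  assume "a \<in> Fil M k x"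
  then show "a \<in> ext_T \<and> (\<forall>K\<in>idx n. wt K < k \<longrightarrow> a (map E K) = 0)" using idx_set unfolding Fil_iff_list by blast
next
  assume a: "a \<in> ext_T \<and> (\<forall>K\<in>idx n. wt K < k \<longrightarrow> a (map E K) = 0)"
  have "a (map E K) = 0" if "set K \<subseteq> {..<n}" "wt K < k" for K
    by (rule vanish_sort) (use a that idx_sort wt_mset[of K "sort K"] in auto)
  then show "a \<in> Fil M k x" using a unfolding Fil_iff_list by blast
qed

lemma Fil_top: "n * depth M < k \<Longrightarrow> a \<in> Fil M k x \<Longrightarrow> a = (\<lambda>_. 0)"
  unfolding Fil_iff using wt_le by (intro ext_T_eq_0I) (auto intro: le_less_trans)

lemma Hom_Fil: "a \<in> Hom k \<Longrightarrow> a \<in> Fil M k x"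
  by (auto simp: Hom_def Fil_iff)

lemma Hom_Fil_Suc: "a \<in> Hom k \<Longrightarrow> a \<in> Fil M (Suc k) x \<Longrightarrow> a = (\<lambda>_. 0)"
  by (rule ext_T_eq_0I) (auto simp: Hom_def Fil_iff less_Suc_eq)

lemma ebas_Hom: "K \<in> idx n \<Longrightarrow> ebas K \<in> Hom (wt K)"
  by (auto simp: Hom_def ebas_ext_T ebas_frame)

definition piece :: "nat \<Rightarrow> ('e list \<Rightarrow> real) \<Rightarrow> 'e list \<Rightarrow> real" where
  "piece k a = (\<lambda>vs. \<Sum>K\<in>idx n. (if wt K = k then a (map E K) else 0) * ebas K vs)"

lemma piece_ext_T: "piece k a \<in> ext_T"
  unfolding piece_def by (rule ext_T_lincomb)

lemma piece_frame: "K \<in> idx n \<Longrightarrow> piece k a (map E K) = (if wt K = k then a (map E K) else 0)"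
  unfolding piece_def by (subst lincomb_ebas_frame) auto

lemma piece_Hom: "piece k a \<in> Hom k"
  by (simp add: Hom_def piece_ext_T piece_frame)

lemma Hom_piece: "a \<in> Hom k \<Longrightarrow> piece k a = a"
  by (rule ext_T_eqI) (auto simp: piece_ext_T piece_frame Hom_def)

lemma Fil_piece_eq_0: "a \<in> Fil M k x \<Longrightarrow> piece k a = (\<lambda>_. 0) \<Longrightarrow> a \<in> Fil M (Suc k) x"
proof -
  assume a: "a \<in> Fil M k x" and p: "piece k a = (\<lambda>_. 0)"
  have "a (map E K) = 0" if "K \<in> idx n" "wt K = k" for K using piece_frame[OF that(1), of k a] p that by simp
  then show ?thesis using a by (auto simp: Fil_iff less_Suc_eq)
qed

lemma ip_piece: "ip (piece k a) b = ip a (piece k b)"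
  unfolding ip_def by (rule sum.cong) (auto simp: piece_frame)

lemma op_matrix:
  assumes A: "lin_op A" and a: "a \<in> ext_T"
  shows "A a vs = (\<Sum>K\<in>idx n. a (map E K) * A (ebas K) vs)"
proof -
  have "a = (\<lambda>vs. \<Sum>K\<in>idx n. a (map E K) * ebas K vs)" by (rule ext) (rule ext_T_expand[OF a])
  then have "A a = A (\<lambda>vs. \<Sum>K\<in>idx n. a (map E K) * ebas K vs)" by simp
  also have "\<dots> = (\<lambda>vs. \<Sum>K\<in>idx n. a (map E K) * A (ebas K) vs)" by (rule lin_op_sum[OF A ebas_ext_T])
  finally show ?thesis by simp
qed

definition graded :: "(('e list \<Rightarrow> real) \<Rightarrow> 'e list \<Rightarrow> real) \<Rightarrow> bool" where
  "graded A \<longleftrightarrow> lin_op A \<and> (\<forall>K\<in>idx n. A (ebas K) \<in> Hom (wt K))"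

lemma graded_lin_op: "graded A \<Longrightarrow> lin_op A"
  by (simp add: graded_def)

lemma graded_frame:
  assumes A: "graded A" and a: "a \<in> ext_T" and J: "J \<in> idx n"
  shows "A a (map E J) = (\<Sum>K\<in>idx n. if wt K = wt J then a (map E K) * A (ebas K) (map E J) else 0)"
  unfolding op_matrix[OF graded_lin_op[OF A] a]
  by (rule sum.cong) (use A J in \<open>auto simp: graded_def Hom_def\<close>)

lemma graded_piece: "graded A \<Longrightarrow> a \<in> ext_T \<Longrightarrow> A (piece k a) = piece k (A a)"
proof (rule ext_T_eqI)
  assume A: "graded A" and a: "a \<in> ext_T"
  show "A (piece k a) \<in> ext_T" using lin_opD(1)[OF graded_lin_op[OF A] piece_ext_T piece_ext_T] .
  show "piece k (A a) \<in> ext_T" by (rule piece_ext_T)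
  show "A (piece k a) (map E J) = piece k (A a) (map E J)" if J: "J \<in> idx n" for J
    unfolding piece_frame[OF J] graded_frame[OF A piece_ext_T J] graded_frame[OF A a J]
    by (auto simp: piece_frame intro!: sum.cong sum.neutral)
qed

lemma graded_Hom: "graded A \<Longrightarrow> a \<in> Hom k \<Longrightarrow> A a \<in> Hom k"
  using graded_piece[of A a k] Hom_piece[of a k] piece_Hom[of k "A a"] by (simp add: Hom_def)

lemma graded_Fil: "graded A \<Longrightarrow> a \<in> Fil M k x \<Longrightarrow> A a \<in> Fil M k x"
  unfolding Fil_iff using lin_opD(1)[OF graded_lin_op] by (auto simp: graded_frame intro!: sum.neutral)

lemma graded_comp: "graded A \<Longrightarrow> graded B \<Longrightarrow> graded (\<lambda>a. A (B a))"
  using graded_Hom[of A] by (auto simp: graded_def intro: lin_op_comp)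

lemma graded_lincomb: "graded A \<Longrightarrow> graded B \<Longrightarrow> graded (\<lambda>a vs. r * A a vs + s * B a vs)"
  unfolding graded_def Hom_def by (auto intro!: lin_op_lincomb ext_T_plus ext_T_scaled)

lemma graded_id: "graded (\<lambda>a. a)"
  by (simp add: graded_def lin_op_id ebas_Hom)

end

context osculating_frame
begin

subsection \<open>The algebraic operators at a point\<close>

lemma d0_at_ce: "a \<in> ext_T \<Longrightarrow> d0_at M x a = ce a"
  by (simp add: d0_at_def chevalley_eilenberg_Phi Phi_inv_Phi ce_ext_T)

lemma Phi_d0_at: "a \<in> ext_T \<Longrightarrow> Phi M x (d0_at M x a) = chevalley_eilenberg M x (Phi M x a)"
  by (simp add: d0_at_ce chevalley_eilenberg_Phi)

lemma Phi_t_at: "a \<in> ext_T \<Longrightarrow> Phi M x (t_at M x a) = gr.tr (Phi M x a)"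
  unfolding t_at_def by (intro Phi_Phi_inv gr.tr_in Phi_ext_gr)

lemma Phi_h_at: "a \<in> ext_T \<Longrightarrow> Phi M x (h_at M x a) = gr.pinv (Phi M x a)"
  unfolding h_at_def by (intro Phi_Phi_inv gr.pinv_props Phi_ext_gr)

lemma d0_at_in: "a \<in> ext_T \<Longrightarrow> d0_at M x a \<in> ext_T"
  and t_at_in: "a \<in> ext_T \<Longrightarrow> t_at M x a \<in> ext_T"
  and h_at_in: "a \<in> ext_T \<Longrightarrow> h_at M x a \<in> ext_T"
  unfolding d0_at_def t_at_def h_at_def
  by (auto intro!: Phi_inv_in gr.tr_in gr.pinv_props Phi_ext_gr gr.T_in)

lemma Phi_inj: "a \<in> ext_T \<Longrightarrow> b \<in> ext_T \<Longrightarrow> Phi M x a = Phi M x b \<Longrightarrow> a = b"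
  using inj_on_Phi by (auto simp: inj_on_def)

lemma lin_op_d0_at: "lin_op (d0_at M x)"
  unfolding lin_op_def
  by (auto simp: d0_at_ce ce_ext_T ext_T_plus ext_T_scaled ce_add ce_scale)

lemma lin_op_t_at: "lin_op (t_at M x)"
  unfolding lin_op_def
proof (intro conjI ballI allI t_at_in)
  show "t_at M x (\<lambda>vs. a vs + b vs) = (\<lambda>vs. t_at M x a vs + t_at M x b vs)" if "a \<in> ext_T" "b \<in> ext_T" for a b
    by (rule Phi_inj) (use that in \<open>simp_all add: t_at_in ext_T_plus Phi_t_at Phi_add gr.tr_add Phi_ext_gr\<close>)
  show "t_at M x (\<lambda>vs. r * a vs) = (\<lambda>vs. r * t_at M x a vs)" if "a \<in> ext_T" for a r
    by (rule Phi_inj) (use that in \<open>simp_all add: t_at_in ext_T_scaled Phi_t_at Phi_scale gr.tr_scale Phi_ext_gr\<close>)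
qed

lemma lin_op_h_at: "lin_op (h_at M x)"
  unfolding lin_op_def
proof (intro conjI ballI allI h_at_in)
  show "h_at M x (\<lambda>vs. a vs + b vs) = (\<lambda>vs. h_at M x a vs + h_at M x b vs)" if "a \<in> ext_T" "b \<in> ext_T" for a b
    by (rule Phi_inj) (use that in \<open>simp_all add: h_at_in ext_T_plus Phi_h_at Phi_add gr.pinv_add Phi_ext_gr\<close>)
  show "h_at M x (\<lambda>vs. r * a vs) = (\<lambda>vs. r * h_at M x a vs)" if "a \<in> ext_T" for a r
    by (rule Phi_inj) (use that in \<open>simp_all add: h_at_in ext_T_scaled Phi_h_at Phi_scale gr.pinv_scale Phi_ext_gr\<close>)
qed

lemma ip_d0_t: "a \<in> ext_T \<Longrightarrow> b \<in> ext_T \<Longrightarrow> ip (d0_at M x a) b = ip a (t_at M x b)"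
  using gr.tr_adj[OF Phi_ext_gr Phi_ext_gr, of a b]
  by (simp add: Phi_d0_at[symmetric] Phi_t_at[symmetric] ext_gr_inner_Phi d0_at_in t_at_in)

text \<open>The characterisation \<open>pinv_unique\<close>, moved from \<open>gr\<close> to the
  tangent space along the isometry \<open>Phi\<close>.\<close>

lemma h_at_unique:
  assumes b: "b \<in> ext_T" and a: "a \<in> ext_T" "\<And>k. k \<in> ext_T \<Longrightarrow> d0_at M x k = (\<lambda>_. 0) \<Longrightarrow> ip a k = 0"
    "\<And>c. c \<in> ext_T \<Longrightarrow> ip (d0_at M x a) (d0_at M x c) = ip b (d0_at M x c)"
  shows "h_at M x b = a"
proof (rule Phi_inj[OF h_at_in[OF b] a(1)])
  show "Phi M x (h_at M x b) = Phi M x a" unfolding Phi_h_at[OF b]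
  proof (rule gr.pinv_unique[OF Phi_ext_gr[OF b] Phi_ext_gr[OF a(1)]])
    fix k assume "k \<in> ext_gr M x" and z: "chevalley_eilenberg M x k = (\<lambda>_. 0)"
    then obtain c where c: "c \<in> ext_T" "k = Phi M x c" unfolding Phi_image[symmetric] by blast
    have "Phi M x (d0_at M x c) = Phi M x (\<lambda>_. 0)" using z c by (simp add: Phi_d0_at Phi_zero)
    then have "d0_at M x c = (\<lambda>_. 0)" using Phi_inj[OF d0_at_in ext_T_zero] c by blast
    then show "ext_gr_inner M x (Phi M x a) k = 0" using a c by (simp add: ext_gr_inner_Phi)
  next
    fix k assume "k \<in> ext_gr M x"
    then obtain c where c: "c \<in> ext_T" "k = Phi M x c" unfolding Phi_image[symmetric] by blast
    show "ext_gr_inner M x (chevalley_eilenberg M x (Phi M x a)) (chevalley_eilenberg M x k)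
        = ext_gr_inner M x (Phi M x b) (chevalley_eilenberg M x k)"
      using a b c by (simp add: Phi_d0_at[symmetric] ext_gr_inner_Phi d0_at_in)
  qed
qed

lemma h_at_orth: "b \<in> ext_T \<Longrightarrow> k \<in> ext_T \<Longrightarrow> d0_at M x k = (\<lambda>_. 0) \<Longrightarrow> ip (h_at M x b) k = 0"
  using gr.pinv_props(2)[OF Phi_ext_gr Phi_ext_gr, of b k]
  by (simp add: Phi_d0_at[symmetric] Phi_h_at[symmetric] ext_gr_inner_Phi h_at_in Phi_zero)

lemma h_at_proj: "b \<in> ext_T \<Longrightarrow> c \<in> ext_T \<Longrightarrow> ip (d0_at M x (h_at M x b)) (d0_at M x c) = ip b (d0_at M x c)"
  using gr.pinv_props(3)[OF Phi_ext_gr Phi_ext_gr, of b c]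
  by (simp add: Phi_d0_at[symmetric] Phi_h_at[symmetric] ext_gr_inner_Phi h_at_in d0_at_in)

lemma t_d0_h: "b \<in> ext_T \<Longrightarrow> t_at M x (d0_at M x (h_at M x b)) = t_at M x b"
  by (rule Phi_inj) (simp_all add: t_at_in d0_at_in h_at_in Phi_t_at Phi_d0_at Phi_h_at gr.tr_T_pinv Phi_ext_gr)

lemma h_d0_h: "b \<in> ext_T \<Longrightarrow> h_at M x (d0_at M x (h_at M x b)) = h_at M x b"
  by (rule Phi_inj) (simp_all add: t_at_in d0_at_in h_at_in Phi_t_at Phi_d0_at Phi_h_at gr.pinv_T_pinv Phi_ext_gr)

lemma h_d0_t: "b \<in> ext_T \<Longrightarrow> h_at M x (d0_at M x (t_at M x b)) = t_at M x b"
  by (rule Phi_inj) (simp_all add: t_at_in d0_at_in h_at_in Phi_t_at Phi_d0_at Phi_h_at gr.pinv_T_tr Phi_ext_gr)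

lemma d0_h_d0: "b \<in> ext_T \<Longrightarrow> d0_at M x (h_at M x (d0_at M x b)) = d0_at M x b"
  by (rule Phi_inj) (simp_all add: t_at_in d0_at_in h_at_in Phi_t_at Phi_d0_at Phi_h_at gr.T_pinv_T Phi_ext_gr)

text \<open>\<open>d0 d0 = 0\<close> is a hypothesis at this stage; it is supplied later by
  \<open>d0_d0\<close>, whose proof relies on the behaviour of \<open>d0\<close> under
  weights.\<close>

lemma differential_consequences:
  assumes dd: "\<And>a. a \<in> ext_T \<Longrightarrow> d0_at M x (d0_at M x a) = (\<lambda>_. 0)" and b: "b \<in> ext_T"
  shows "t_at M x (h_at M x b) = (\<lambda>_. 0)" "t_at M x (t_at M x b) = (\<lambda>_. 0)" "h_at M x (h_at M x b) = (\<lambda>_. 0)"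
proof -
  interpret gr: fin_inner_differential "ext_gr M x" "ext_gr_inner M x" "\<lambda>K. Phi M x (ebas K)" "idx n" "chevalley_eilenberg M x"
    by unfold_locales (auto simp: Phi_image[symmetric] Phi_d0_at[symmetric] d0_at_in dd Phi_zero)
  show "t_at M x (h_at M x b) = (\<lambda>_. 0)" "t_at M x (t_at M x b) = (\<lambda>_. 0)" "h_at M x (h_at M x b) = (\<lambda>_. 0)"
    by (rule Phi_inj, simp_all add: b t_at_in h_at_in Phi_t_at Phi_h_at Phi_zero gr.tr_pinv gr.tr_tr gr.pinv_pinv Phi_ext_gr)+
qed

lemma pr_E: "a < n \<Longrightarrow> pr i (E a) = (if w a = i then E a else 0)"
  by (rule vec_eqI) (auto simp: g_pr g_frame g_simps)

lemma g_br_E: "a < n \<Longrightarrow> b < n \<Longrightarrow> c < n \<Longrightarrow> g (br (E a) (E b)) (E c) = (if w c = w a + w b then \<beta> c (E a) (E b) else 0)"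
proof -
  assume a: "a < n" and b: "b < n" and c: "c < n"
  have "g (br (E a) (E b)) (E c) = (\<Sum>i\<in>{1..<w c}. if i = w a then (if w c = w a + w b then \<beta> c (E a) (E b) else 0) else 0)"
    unfolding g_br[OF c]
  proof (rule sum.cong[OF refl])
    fix i assume i: "i \<in> {1..<w c}"
    have "w c - i = w b \<longleftrightarrow> w c = i + w b" using i by auto
    then show "\<beta> c (pr i (E a)) (pr (w c - i) (E b)) = (if i = w a then (if w c = w a + w b then \<beta> c (E a) (E b) else 0) else 0)"
      using a b c by (auto simp: pr_E bilinear_lzero[OF \<beta>_bilinear] bilinear_rzero[OF \<beta>_bilinear])
  qed
  also have "\<dots> = (if w c = w a + w b then \<beta> c (E a) (E b) else 0)"
    using w_range[OF a] w_range[OF b] by (auto simp: sum.delta)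
  finally show ?thesis .
qed

lemma ce_frame:
  assumes a: "a \<in> ext_T" and K: "set K \<subseteq> {..<n}"
  shows "ce a (map E K) = (\<Sum>j<length K. \<Sum>i<j. \<Sum>c<n. (-1) ^ (i + j) *
    ((if w c = w (K ! i) + w (K ! j) then \<beta> c (E (K ! i)) (E (K ! j)) else 0) * a (map E (c # nths K (- {i, j})))))"
  unfolding ce_def altsum2_def
proof (simp only: length_map, intro sum.cong refl)
  fix j i assume ji: "j \<in> {..<length K}" "i \<in> {..<j}"
  then have "K ! i \<in> set K" "K ! j \<in> set K" by auto
  then have "K ! i < n" "K ! j < n" using K by auto
  then have "a (br (E (K ! i)) (E (K ! j)) # map E (nths K (- {i, j}))) =
    (\<Sum>c<n. (if w c = w (K ! i) + w (K ! j) then \<beta> c (E (K ! i)) (E (K ! j)) else 0) * a (map E (c # nths K (- {i, j}))))"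
    using ext_T_expand_arg[OF a, of "[]" "br (E (K ! i)) (E (K ! j))" "map E (nths K (- {i, j}))"] by (simp add: g_br_E)
  then show "(-1) ^ (i + j) * a (br (map E K ! i) (map E K ! j) # map (\<lambda>v. v) (nths (map E K) (- {i, j}))) =
    (\<Sum>c<n. (-1) ^ (i + j) * ((if w c = w (K ! i) + w (K ! j) then \<beta> c (E (K ! i)) (E (K ! j)) else 0) * a (map E (c # nths K (- {i, j})))))"
    using ji by (simp add: nths_map sum_distrib_left)
qed

lemma set_nths_idx: "set K \<subseteq> {..<n} \<Longrightarrow> set (nths K I) \<subseteq> {..<n}"
  using set_nths_subset[of K I] by blast

text \<open>The bracket of \<open>E a\<close> and \<open>E b\<close> only involves those
  \<open>E c\<close> with \<open>w c = w a + w b\<close>, so replacing two arguments by their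
  bracket leaves the total weight unchanged.\<close>

lemma graded_d0_at: "graded (d0_at M x)"
  unfolding graded_def
proof (intro conjI lin_op_d0_at ballI)
  fix K assume K: "K \<in> idx n"
  have "ce (ebas K) (map E J) = 0" if J: "J \<in> idx n" "wt J \<noteq> wt K" for J
    unfolding ce_frame[OF ebas_ext_T idx_set[OF J(1)]]
  proof (intro sum.neutral ballI)
    fix j i c assume j: "j \<in> {..<length J}" and i: "i \<in> {..<j}" and c: "c \<in> {..<n}"
    have "ebas K (map E (c # nths J (- {i, j}))) = 0" if "w c = w (J ! i) + w (J ! j)"
    proof (rule Hom_list[OF ebas_Hom[OF K]])
      show "set (c # nths J (- {i, j})) \<subseteq> {..<n}" using set_nths_idx[OF idx_set[OF J(1)]] c by simp
      show "wt (c # nths J (- {i, j})) \<noteq> wt K" using wt_nths2[of i j J] i j J(2) that by simp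
    qed
    then show "(-1) ^ (i + j) * ((if w c = w (J ! i) + w (J ! j) then \<beta> c (E (J ! i)) (E (J ! j)) else 0) *
      ebas K (map E (c # nths J (- {i, j})))) = 0" by auto
  qed
  then show "d0_at M x (ebas K) \<in> Hom (wt K)"
    by (simp add: Hom_def d0_at_ce ebas_ext_T ce_ext_T)
qed

lemma t_at_frame:
  assumes "a \<in> ext_T" "K \<in> idx n"
  shows "t_at M x a (map E K) = (\<Sum>J\<in>idx n. a (map E J) * d0_at M x (ebas K) (map E J))"
proof -
  have "t_at M x a (map E K) = ip (ebas K) (t_at M x a)" using assms by (simp add: ip_ebas)
  also have "\<dots> = ip (d0_at M x (ebas K)) a" using assms by (simp add: ip_d0_t ebas_ext_T)
  finally show ?thesis by (simp add: ip_def mult.commute)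
qed

text \<open>In an orthonormal basis the matrix is the transposed one, which is again block diagonal
  by weight.\<close>

lemma graded_t_at: "graded (t_at M x)"
  unfolding graded_def
proof (intro conjI lin_op_t_at ballI)
  fix K assume K: "K \<in> idx n"
  have "t_at M x (ebas K) (map E J) = 0" if J: "J \<in> idx n" "wt J \<noteq> wt K" for J
  proof -
    have "t_at M x (ebas K) (map E J) = d0_at M x (ebas J) (map E K)"
      unfolding t_at_frame[OF ebas_ext_T J(1)] using lincomb_ebas_frame[OF K, of "\<lambda>_. 1"] K
      by (subst sum.cong[OF refl, of _ _ "\<lambda>L. if L = K then d0_at M x (ebas J) (map E L) else 0"]) (auto simp: ebas_frame)
    also have "\<dots> = 0" using graded_d0_at K J by (auto simp: graded_def Hom_def)
    finally show ?thesis .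
  qed
  then show "t_at M x (ebas K) \<in> Hom (wt K)" by (simp add: Hom_def t_at_in ebas_ext_T)
qed

text \<open>For \<open>b\<close> of weight \<open>k\<close>, the weight \<open>k\<close> piece of
  \<open>h b\<close> satisfies the conditions that characterise \<open>h b\<close>, because the
  weight projections are symmetric and commute with \<open>d0\<close>.\<close>

lemma graded_h_at: "graded (h_at M x)"
  unfolding graded_def
proof (intro conjI lin_op_h_at ballI)
  fix K assume K: "K \<in> idx n"
  let ?b = "ebas K" and ?k = "wt K"
  have "h_at M x ?b = piece ?k (h_at M x ?b)"
  proof (rule h_at_unique[OF ebas_ext_T piece_ext_T])
    fix c assume c: "c \<in> ext_T" "d0_at M x c = (\<lambda>_. 0)"
    have "d0_at M x (piece ?k c) = piece ?k (d0_at M x c)" by (rule graded_piece[OF graded_d0_at c(1)])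
    also have "\<dots> = (\<lambda>_. 0)" by (simp add: c(2) piece_def)
    finally show "ip (piece ?k (h_at M x ?b)) c = 0"
      unfolding ip_piece by (intro h_at_orth ebas_ext_T piece_ext_T)
  next
    fix c :: "'b list \<Rightarrow> real" assume c: "c \<in> ext_T"
    have "ip (d0_at M x (piece ?k (h_at M x ?b))) (d0_at M x c) = ip (d0_at M x (h_at M x ?b)) (d0_at M x (piece ?k c))"
      by (simp add: graded_piece[OF graded_d0_at] h_at_in ebas_ext_T c ip_piece)
    also have "\<dots> = ip ?b (d0_at M x (piece ?k c))" by (intro h_at_proj ebas_ext_T piece_ext_T)
    also have "\<dots> = ip (piece ?k ?b) (d0_at M x c)" by (simp add: graded_piece[OF graded_d0_at] c ip_piece)
    also have "piece ?k ?b = ?b" by (rule Hom_piece[OF ebas_Hom[OF K]])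
    finally show "ip (d0_at M x (piece ?k (h_at M x ?b))) (d0_at M x c) = ip ?b (d0_at M x c)" .
  qed
  then show "h_at M x ?b \<in> Hom ?k" using piece_Hom by metis
qed

end

subsection \<open>Smoothness of the algebraic operators\<close>

context filtered_manifold
begin

lemma frame_nbhd_at:
  obtains W E n w where "x \<in> W" "frame_nbhd M W E n w"
proof -
  obtain W E n w where "open W" "x \<in> W" "\<And>a. smooth_vf_on M W (E a)"
    "\<And>q. q \<in> W \<Longrightarrow> adapted_frame M q (\<lambda>a. E a q) n w"
    by (rule ex_frame) (rule that)
  then have "frame_nbhd M W E n w"
    by (intro frame_nbhd.intro filtered_manifold_axioms frame_nbhd_axioms.intro)
  then show thesis using that \<open>x \<in> W\<close> by blast
qed

lemma osculating_at:
  obtains E n w \<beta> where "osculating_frame M x E n w \<beta>"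
proof -
  obtain W E n w where W: "x \<in> W" "frame_nbhd M W E n w" by (rule frame_nbhd_at)
  show thesis by (rule that[OF frame_nbhd.osculating[OF W(2,1)]])
qed

lemma lin_op_at: "lin_op (d0_at M x)" "lin_op (t_at M x)" "lin_op (h_at M x)"
proof -
  obtain E n w \<beta> where "osculating_frame M x E n w \<beta>" by (rule osculating_at)
  then interpret osculating_frame M x E n w \<beta> .
  show "lin_op (d0_at M x)" "lin_op (t_at M x)" "lin_op (h_at M x)"
    by (rule lin_op_d0_at lin_op_t_at lin_op_h_at)+
qed

lemma at_in: "a \<in> ext_T \<Longrightarrow> d0_at M x a \<in> ext_T" "a \<in> ext_T \<Longrightarrow> t_at M x a \<in> ext_T" "a \<in> ext_T \<Longrightarrow> h_at M x a \<in> ext_T"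
  using lin_op_at[of x] by (simp_all add: lin_op_def)

lemma at_zero: "d0_at M x (\<lambda>_. 0) = (\<lambda>_. 0)" "t_at M x (\<lambda>_. 0) = (\<lambda>_. 0)" "h_at M x (\<lambda>_. 0) = (\<lambda>_. 0)"
  using lin_op_at[of x] by (simp_all add: lin_op_zero)

lemma at_identities:
  assumes "a \<in> ext_T"
  shows "t_at M x (d0_at M x (h_at M x a)) = t_at M x a" "h_at M x (d0_at M x (h_at M x a)) = h_at M x a"
    "h_at M x (d0_at M x (t_at M x a)) = t_at M x a" "d0_at M x (h_at M x (d0_at M x a)) = d0_at M x a"
proof -
  obtain E n w \<beta> where "osculating_frame M x E n w \<beta>" by (rule osculating_at)
  then interpret osculating_frame M x E n w \<beta> .
  show "t_at M x (d0_at M x (h_at M x a)) = t_at M x a" "h_at M x (d0_at M x (h_at M x a)) = h_at M x a"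
    "h_at M x (d0_at M x (t_at M x a)) = t_at M x a" "d0_at M x (h_at M x (d0_at M x a)) = d0_at M x a"
    by (rule t_d0_h[OF assms] h_d0_h[OF assms] h_d0_t[OF assms] d0_h_d0[OF assms])+
qed

lemma at_Fil: "a \<in> Fil M k x \<Longrightarrow> d0_at M x a \<in> Fil M k x" "a \<in> Fil M k x \<Longrightarrow> t_at M x a \<in> Fil M k x"
  "a \<in> Fil M k x \<Longrightarrow> h_at M x a \<in> Fil M k x"
proof -
  obtain E n w \<beta> where "osculating_frame M x E n w \<beta>" by (rule osculating_at)
  then interpret osculating_frame M x E n w \<beta> .
  show "a \<in> Fil M k x \<Longrightarrow> d0_at M x a \<in> Fil M k x" "a \<in> Fil M k x \<Longrightarrow> t_at M x a \<in> Fil M k x"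
    "a \<in> Fil M k x \<Longrightarrow> h_at M x a \<in> Fil M k x"
    by (rule graded_Fil[OF graded_d0_at] graded_Fil[OF graded_t_at] graded_Fil[OF graded_h_at]; assumption)+
qed

lemma Fil_ext: "a \<in> Fil M k x \<Longrightarrow> a \<in> ext_T"
  by (simp add: Fil_def)

lemma Fil_0: "Fil M 0 x = ext_T"
  by (auto simp: Fil_def)

lemma Fil_lincomb: "a \<in> Fil M k x \<Longrightarrow> b \<in> Fil M k x \<Longrightarrow> (\<lambda>vs. r * a vs + s * b vs) \<in> Fil M k x"
  unfolding Fil_def by (auto intro!: ext_T_plus ext_T_scaled)

lemma Fil_add: "a \<in> Fil M k x \<Longrightarrow> b \<in> Fil M k x \<Longrightarrow> (\<lambda>vs. a vs + b vs) \<in> Fil M k x"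
  and Fil_diff: "a \<in> Fil M k x \<Longrightarrow> b \<in> Fil M k x \<Longrightarrow> (\<lambda>vs. a vs - b vs) \<in> Fil M k x"
  and Fil_uminus: "a \<in> Fil M k x \<Longrightarrow> (\<lambda>vs. - a vs) \<in> Fil M k x"
  using Fil_lincomb[of a k x b 1 1] Fil_lincomb[of a k x b 1 "-1"] Fil_lincomb[of a k x a "-1" 0] by simp_all

lemma Fil_zero: "(\<lambda>_. 0) \<in> Fil M k x"
  by (simp add: Fil_def)

lemma Fil_mono: "k \<le> l \<Longrightarrow> Fil M l x \<subseteq> Fil M k x"
  by (auto simp: Fil_def)

text \<open>One more than any weight that can occur: an adapted frame has at most
  \<open>DIM('e)\<close> members, each of degree at most \<open>depth M\<close>, and an increasing
  multi-index uses each of them at most once.\<close>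

definition top_weight :: nat where
  "top_weight = Suc (DIM('e) * depth M)"

lemma Fil_top_weight: "a \<in> Fil M top_weight x \<Longrightarrow> a = (\<lambda>_. 0)"
proof -
  assume a: "a \<in> Fil M top_weight x"
  obtain E n w \<beta> where "osculating_frame M x E n w \<beta>" by (rule osculating_at)
  then interpret osculating_frame M x E n w \<beta> .
  have "n \<le> dim (UNIV :: 'e set)"
    by (rule orthon_le_dim[of x E]) (auto simp: orthon_def g_frame)
  then have "n * depth M < top_weight" by (simp add: top_weight_def less_Suc_eq_le)
  then show ?thesis using a by (rule Fil_top)
qed

end

context frame_nbhd
begin

lemma ebas_eb: "q \<in> W \<Longrightarrow> orthonormal_frame.ebas (gm q) (\<lambda>a. E a q) K = eb K q"
proof -
  assume q: "q \<in> W"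
  interpret adapted_frame M q "\<lambda>a. E a q" n w by (rule frame[OF q])
  show ?thesis using q by (simp add: ebas_def eb_def)
qed

lemma forms_on_frame_idxI:
  assumes U: "open U" "U \<subseteq> W" and ext: "\<And>x. x \<in> U \<Longrightarrow> \<omega> x \<in> ext_T" and out: "\<And>x. x \<notin> U \<Longrightarrow> \<omega> x = (\<lambda>_. 0)"
    and sm: "\<And>K. K \<in> idx n \<Longrightarrow> smf U (\<lambda>q. \<omega> q (EK K q))"
  shows "\<omega> \<in> forms_on M U"
proof (rule forms_on_frameI[OF U ext out])
  fix K assume K: "set K \<subseteq> {..<n}"
  have "\<omega> q (EK K q) = (\<Sum>J\<in>idx n. \<omega> q (EK J q) * eb J q (EK K q))" if "q \<in> U" for q
  proof -
    have q: "q \<in> W" using that U by blast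
    interpret adapted_frame M q "\<lambda>a. E a q" n w by (rule frame[OF q])
    show ?thesis using ext_T_expand[OF ext[OF that], of "EK K q"] by (simp add: ebas_eb[OF q])
  qed
  moreover have "smf U (\<lambda>q. \<Sum>J\<in>idx n. \<omega> q (EK J q) * eb J q (EK K q))"
    by (intro smf_sum smf_mult sm U smf_form_eval[OF eb_forms_on] E_smooth' idx_set)
  ultimately show "smf U (\<lambda>q. \<omega> q (EK K q))" by (subst smf_cong) auto
qed

lemma smf_coeff:
  assumes "\<omega> \<in> forms_on M U" "open V" "V \<subseteq> U" "V \<subseteq> W"
  shows "smf V (\<lambda>q. \<omega> q (EK K q))"
  by (rule smf_form_eval[OF assms(1-3)]) (rule E_smooth'[OF assms(4)])

text \<open>The structure functions of the osculating brackets. They are smooth because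
  \<open>\<beta>\<close> comes from exterior derivatives of the coframe, and they make
  \<open>d0\<close>, and then its transpose, preserve smooth forms.\<close>

definition \<gamma> :: "nat \<Rightarrow> nat \<Rightarrow> nat \<Rightarrow> 'm \<Rightarrow> real" where
  "\<gamma> a b c q = (if w c = w a + w b then \<beta> q c (E a q) (E b q) else 0)"

lemma smf_\<gamma>: "c < n \<Longrightarrow> smf W (\<gamma> a b c)"
proof -
  assume c: "c < n"
  have "smf W (\<lambda>q. restr W (de_rham M (eb [c])) q (EK [a, b] q))"
    by (rule smf_coeff[OF de_rham_forms_on[OF eb_forms_on]]) (use c open_W in auto)
  then have "smf W (\<lambda>q. - restr W (de_rham M (eb [c])) q (EK [a, b] q))" by (rule smf_uminus)
  moreover have "- restr W (de_rham M (eb [c])) q (EK [a, b] q) = \<beta> q c (E a q) (E b q)" if "q \<in> W" for q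
    using that by (simp add: \<beta>_def)
  ultimately have "smf W (\<lambda>q. \<beta> q c (E a q) (E b q))" by (subst smf_cong) auto
  then show ?thesis unfolding \<gamma>_def[abs_def] using smf_const[OF open_W] by (cases "w c = w a + w b") auto
qed

lemma d0_at_frame:
  assumes q: "q \<in> W" and a: "a \<in> ext_T" and K: "set K \<subseteq> {..<n}"
  shows "d0_at M q a (EK K q) = (\<Sum>j<length K. \<Sum>i<j. \<Sum>c<n. (-1) ^ (i + j) *
    (\<gamma> (K ! i) (K ! j) c q * a (EK (c # nths K (- {i, j})) q)))"
proof -
  interpret osculating_frame M q "\<lambda>a. E a q" n w "\<beta> q" by (rule osculating[OF q])
  show ?thesis unfolding d0_at_ce[OF a] \<gamma>_def by (rule ce_frame[OF a K])
qed

lemma smf_d0_coeff: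
  assumes w: "\<omega> \<in> forms_on M U" and V: "open V" "V \<subseteq> U" "V \<subseteq> W" and K: "set K \<subseteq> {..<n}"
  shows "smf V (\<lambda>q. d0_at M q (\<omega> q) (EK K q))"
proof -
  have "smf V (\<lambda>q. \<Sum>j<length K. \<Sum>i<j. \<Sum>c<n. (-1) ^ (i + j) *
    (\<gamma> (K ! i) (K ! j) c q * \<omega> q (EK (c # nths K (- {i, j})) q)))"
    by (intro smf_sum smf_mult smf_const V smf_coeff[OF w] smf_subset[OF smf_\<gamma>]) auto
  moreover have "d0_at M q (\<omega> q) (EK K q) = (\<Sum>j<length K. \<Sum>i<j. \<Sum>c<n. (-1) ^ (i + j) *
    (\<gamma> (K ! i) (K ! j) c q * \<omega> q (EK (c # nths K (- {i, j})) q)))" if "q \<in> V" for q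
    by (rule d0_at_frame[OF _ forms_on_ext[OF w] K]) (use that V in blast)
  ultimately show ?thesis by (subst smf_cong) auto
qed

lemma t_at_coeff:
  assumes q: "q \<in> W" and a: "a \<in> ext_T" and K: "K \<in> idx n"
  shows "t_at M q a (EK K q) = (\<Sum>J\<in>idx n. a (EK J q) * d0_at M q (eb K q) (EK J q))"
proof -
  interpret osculating_frame M q "\<lambda>a. E a q" n w "\<beta> q" by (rule osculating[OF q])
  show ?thesis using t_at_frame[OF a K] by (simp add: ebas_eb[OF q])
qed

lemma d0_forms_on_frame: "\<omega> \<in> forms_on M U \<Longrightarrow> open U \<Longrightarrow> U \<subseteq> W \<Longrightarrow> d0 M \<omega> \<in> forms_on M U"
  by (rule forms_on_frame_idxI)
    (auto simp: pointwise_ops at_in forms_on_ext forms_on_out at_zero intro!: smf_d0_coeff idx_set)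

lemma t_forms_on_frame:
  assumes w: "\<omega> \<in> forms_on M U" and U: "open U" "U \<subseteq> W"
  shows "d0_t M \<omega> \<in> forms_on M U"
proof (rule forms_on_frame_idxI[OF U])
  show "d0_t M \<omega> x \<in> ext_T" for x by (simp add: pointwise_ops at_in forms_on_ext[OF w])
  show "d0_t M \<omega> x = (\<lambda>_. 0)" if "x \<notin> U" for x by (simp add: pointwise_ops forms_on_out[OF w that] at_zero)
  fix K assume K: "K \<in> idx n"
  have "smf U (\<lambda>q. \<Sum>J\<in>idx n. \<omega> q (EK J q) * d0_at M q (eb K q) (EK J q))"
    by (intro smf_sum smf_mult U smf_coeff[OF w] order_refl smf_d0_coeff[OF eb_forms_on] idx_set K)
  moreover have "d0_t M \<omega> q (EK K q) = (\<Sum>J\<in>idx n. \<omega> q (EK J q) * d0_at M q (eb K q) (EK J q))" if "q \<in> U" for q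
    unfolding pointwise_ops by (rule t_at_coeff[OF _ forms_on_ext[OF w] K]) (use that U in blast)
  ultimately show "smf U (\<lambda>q. d0_t M \<omega> q (EK K q))" by (subst smf_cong) auto
qed

subsection \<open>The leading part of the exterior derivative\<close>

lemma E_filt_nbhd: "p \<in> W \<Longrightarrow> a < n \<Longrightarrow> E a p \<in> filt M (w a) p"
proof -
  assume p: "p \<in> W" and a: "a < n"
  interpret adapted_frame M p "\<lambda>a. E a p" n w by (rule frame[OF p])
  show ?thesis by (rule E_filt[OF a order_refl])
qed

lemma lie_bracket_E:
  assumes q: "q \<in> W" and a: "a < n" "b < n"
  shows "lie_bracket M (E a) (E b) q \<in> filt M (w a + w b) q"
proof -
  obtain X V where X: "X \<in> sections M (filt M (w a))" "open V" "q \<in> V" "V \<subseteq> W" "\<And>p. p \<in> V \<Longrightarrow> X p = E a p"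
    by (rule extend_section[OF open_W q E_smooth E_filt_nbhd]) (assumption, rule a, rule that)
  obtain Y V' where Y: "Y \<in> sections M (filt M (w b))" "open V'" "q \<in> V'" "V' \<subseteq> W" "\<And>p. p \<in> V' \<Longrightarrow> Y p = E b p"
    by (rule extend_section[OF open_W q E_smooth E_filt_nbhd]) (assumption, rule a, rule that)
  have "lie_bracket M X Y q = lie_bracket M (E a) (E b) q"
    by (rule lie_bracket_cong[of "V \<inter> V'"]) (use X Y in auto)
  moreover have "lie_bracket M X Y q \<in> filt M (w a + w b) q"
    using filt_M(5)[OF X(1) Y(1)] by (simp add: sections_def)
  ultimately show ?thesis by (simp only:)
qed

text \<open>Cartan's formula on frame lists of total weight at most \<open>k\<close>. A derivative
  term omits an argument of weight at least 1, so its coefficient has weight below \<open>k\<close>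
  and vanishes near \<open>x\<close>. In the bracket terms only the components of weight
  \<open>w a + w b\<close> survive, and there the Lie bracket is the osculating one.\<close>

lemma raise_frame:
  assumes om: "\<omega> \<in> forms_on M U" and U: "open U" "U \<subseteq> W" "x \<in> U" and k: "\<And>p. p \<in> U \<Longrightarrow> \<omega> p \<in> Fil M k p"
  shows "(\<lambda>vs. de_rham M \<omega> x vs - d0_at M x (\<omega> x) vs) \<in> Fil M (Suc k) x"
proof -
  have x: "x \<in> W" using U by blast
  interpret osculating_frame M x "\<lambda>a. E a x" n w "\<beta> x" by (rule osculating[OF x])
  have van: "\<omega> p (EK K p) = 0" if "p \<in> U" "set K \<subseteq> {..<n}" "wt K < k" for p K
  proof -
    have "p \<in> W" using that U by blast
    then interpret p: adapted_frame M p "\<lambda>a. E a p" n w by (rule frame)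
    have "p.wt K = wt K" by (simp add: p.wt_def wt_def)
    then show ?thesis using k[OF that(1)] that by (simp add: p.Fil_iff_list)
  qed
  have ext: "\<omega> x \<in> ext_T" by (rule forms_on_ext[OF om])
  show ?thesis unfolding Fil_iff_list
  proof (intro conjI allI impI)
    show "(\<lambda>vs. de_rham M \<omega> x vs - d0_at M x (\<omega> x) vs) \<in> ext_T"
      by (intro ext_T_minus de_rham_ext[OF om] U at_in ext)
    fix K assume K: "set K \<subseteq> {..<n}" "wt K < Suc k"
    have "Dm (\<lambda>q. \<omega> q (map (\<lambda>i. E i q) (nths K (- {i})))) x v = 0" if i: "i < length K" for i v
    proof -
      have "K ! i < n" using K(1) nth_mem[OF i] by blast
      then have "wt (nths K (- {i})) < k" using wt_nths1[OF i] w_range[of "K ! i"] K(2) by linarith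
      then have "Dm (\<lambda>q. \<omega> q (EK (nths K (- {i})) q)) x = Dm (\<lambda>_. 0) x"
        by (intro Dm_cong[OF U(1,3)] van set_nths_idx K) auto
      then show ?thesis by (simp add: Dm_const)
    qed
    then have "de_rham M \<omega> x (EK K x) = altsum2 (\<lambda>i j. lie_bracket M (E i) (E j) x) (\<omega> x) (\<lambda>i. E i x) K"
      using de_rham_cartan[OF om U(1,3), of E K] E_smooth'[OF U(2)] by simp
    also have "\<dots> = altsum2 br (\<omega> x) (\<lambda>v. v) (EK K x)"
      unfolding altsum2_def length_map
    proof (intro sum.cong refl)
      fix j i assume ji: "j \<in> {..<length K}" "i \<in> {..<j}"
      let ?a = "K ! i" and ?b = "K ! j" and ?L = "nths K (- {i, j})"
      have "?a \<in> set K" "?b \<in> set K" using ji by auto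
      then have ab: "?a < n" "?b < n" using K(1) by auto
      have wt: "wt K = w ?a + w ?b + wt ?L" using ji by (intro wt_nths2) auto
      have "\<omega> x (lie_bracket M (E ?a) (E ?b) x # EK ?L x) = \<omega> x (br (E ?a x) (E ?b x) # EK ?L x)"
      proof -
        have eq: "gm x (lie_bracket M (E ?a) (E ?b) x) (E c x) * \<omega> x (E c x # EK ?L x) =
          gm x (br (E ?a x) (E ?b x)) (E c x) * \<omega> x (E c x # EK ?L x)" if c: "c < n" for c
        proof -
          \<comment> \<open>Components of lower weight meet a vanishing coefficient of the form,
            those of equal weight are given by \<open>\<beta>\<close> on both sides, and those of
            higher weight are zero by the bracket condition of the filtration.\<close>
          consider "w c < w ?a + w ?b" | "w c = w ?a + w ?b" | "w ?a + w ?b < w c" by linarith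
          then show ?thesis
          proof cases
            case 1
            then have "\<omega> x (EK (c # ?L) x) = 0"
              using wt K(2) c set_nths_idx[OF K(1)] by (intro van U(3)) auto
            then show ?thesis by simp
          next
            case 2
            have "gm x (lie_bracket M (E ?a) (E ?b) x) (E c x) = \<beta> x c (E ?a x) (E ?b x)"
              by (rule bracket_component[OF open_W x order_refl E_smooth E_filt_nbhd[OF _ ab(1)] E_smooth E_filt_nbhd[OF _ ab(2)] c])
                (use 2 w_range ab in \<open>auto simp: Suc_le_eq\<close>)
            then show ?thesis using 2 g_br_E[OF ab c] by simp
          next
            case 3
            then have "gm x (lie_bracket M (E ?a) (E ?b) x) (E c x) = 0"
              using lie_bracket_E[OF x ab] c by (simp add: filt_iff)
            then show ?thesis using 3 g_br_E[OF ab c] by simp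
          qed
        qed
        show ?thesis
          using sum.cong[OF refl, of "{..<n}", OF eq]
            ext_T_expand_arg[OF ext, of "[]" "lie_bracket M (E ?a) (E ?b) x" "EK ?L x"]
            ext_T_expand_arg[OF ext, of "[]" "br (E ?a x) (E ?b x)" "EK ?L x"] by (simp only: append_Nil lessThan_iff)
      qed
      then show "(-1) ^ (i + j) * \<omega> x (lie_bracket M (E ?a) (E ?b) x # map (\<lambda>i. E i x) ?L) =
        (-1) ^ (i + j) * \<omega> x (br (EK K x ! i) (EK K x ! j) # map (\<lambda>v. v) (nths (EK K x) (- {i, j})))"
        using ji by (simp add: nths_map)
    qed
    finally show "de_rham M \<omega> x (EK K x) - d0_at M x (\<omega> x) (EK K x) = 0"
      by (simp add: d0_at_ce[OF ext] ce_def)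
  qed
qed

text \<open>The weight preserving part of \<open>d d = 0\<close>. On a basis form of weight
  \<open>k\<close> both \<open>d d - d0 d\<close> and \<open>d0 d - d0 d0\<close> raise the weight,
  hence so does \<open>d0 d0\<close>. But \<open>d0 d0\<close> maps it to a form homogeneous of
  weight \<open>k\<close>, which must then be 0.\<close>

lemma d0_d0_frame:
  assumes x: "x \<in> W" and a: "a \<in> ext_T"
  shows "d0_at M x (d0_at M x a) = (\<lambda>_. 0)"
proof -
  interpret osculating_frame M x "\<lambda>a. E a x" n w "\<beta> x" by (rule osculating[OF x])
  have "d0_at M x (d0_at M x (ebas K)) = (\<lambda>_. 0)" if K: "K \<in> idx n" for K
  proof -
    let ?k = "wt K" and ?e = "eb K" and ?\<eta> = "restr W (de_rham M (eb K))"
    have e: "?e \<in> forms_on M W" by (rule eb_forms_on[OF idx_set[OF K]])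
    have eF: "?e p \<in> Fil M ?k p" if p: "p \<in> W" for p
    proof -
      interpret p: adapted_frame M p "\<lambda>a. E a p" n w by (rule frame[OF p])
      show ?thesis using p.Hom_Fil[OF p.ebas_Hom[OF K]] by (simp add: ebas_eb[OF p] p.wt_def wt_def)
    qed
    have r: "(\<lambda>vs. de_rham M ?e p vs - d0_at M p (?e p) vs) \<in> Fil M (Suc ?k) p" if p: "p \<in> W" for p
      by (rule raise_frame[OF e open_W order_refl p eF])
    have \<eta>: "?\<eta> \<in> forms_on M W" by (rule de_rham_forms_on[OF e open_W])
    have \<eta>F: "?\<eta> p \<in> Fil M ?k p" if p: "p \<in> W" for p
    proof -
      have "(\<lambda>vs. de_rham M ?e p vs - d0_at M p (?e p) vs) \<in> Fil M ?k p"
        using Fil_mono[of ?k "Suc ?k" p] r[OF p] by auto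
      from Fil_add[OF this at_Fil(1)[OF eF[OF p]]] show ?thesis using p by simp
    qed
    have "(\<lambda>vs. de_rham M ?\<eta> x vs - d0_at M x (?\<eta> x) vs) \<in> Fil M (Suc ?k) x"
      by (rule raise_frame[OF \<eta> open_W order_refl x \<eta>F])
    moreover have "de_rham M ?\<eta> x = (\<lambda>_. 0)"
      using de_rham_cong[OF open_W x, of ?\<eta> "de_rham M ?e"] de_rham_de_rham[OF e open_W x] by simp
    ultimately have 1: "(\<lambda>vs. - d0_at M x (de_rham M ?e x) vs) \<in> Fil M (Suc ?k) x" using x by simp
    have dx: "de_rham M ?e x \<in> ext_T" by (rule de_rham_ext[OF e open_W x])
    have ex: "?e x \<in> ext_T" by (rule eb_ext)
    have 2: "(\<lambda>vs. d0_at M x (de_rham M ?e x) vs - d0_at M x (d0_at M x (?e x)) vs) \<in> Fil M (Suc ?k) x"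
      using at_Fil(1)[OF r[OF x]] lin_op_diff[OF lin_op_at(1) dx at_in(1)[OF ex]] by simp
    have "(\<lambda>vs. - d0_at M x (d0_at M x (?e x)) vs) \<in> Fil M (Suc ?k) x" using Fil_add[OF 1 2] by simp
    then have "d0_at M x (d0_at M x (?e x)) \<in> Fil M (Suc ?k) x" using Fil_uminus by fastforce
    moreover have "d0_at M x (d0_at M x (?e x)) \<in> Hom ?k"
      using graded_Hom[OF graded_d0_at graded_Hom[OF graded_d0_at ebas_Hom[OF K]]] by (simp add: ebas_eb[OF x])
    ultimately show ?thesis using Hom_Fil_Suc by (simp add: ebas_eb[OF x])
  qed
  then show ?thesis
    using op_matrix[OF lin_op_comp[OF lin_op_d0_at lin_op_d0_at] a] by (simp add: fun_eq_iff)
qed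

end

context filtered_manifold
begin

lemma d0_d0: "a \<in> ext_T \<Longrightarrow> d0_at M x (d0_at M x a) = (\<lambda>_. 0)"
proof -
  assume a: "a \<in> ext_T"
  obtain W E n w where W: "x \<in> W" "frame_nbhd M W E n w" by (rule frame_nbhd_at)
  show ?thesis by (rule frame_nbhd.d0_d0_frame[OF W(2,1) a])
qed

lemma at_squares:
  assumes "a \<in> ext_T"
  shows "t_at M x (h_at M x a) = (\<lambda>_. 0)" "t_at M x (t_at M x a) = (\<lambda>_. 0)" "h_at M x (h_at M x a) = (\<lambda>_. 0)"
proof -
  obtain E n w \<beta> where "osculating_frame M x E n w \<beta>" by (rule osculating_at)
  then interpret osculating_frame M x E n w \<beta> .
  show "t_at M x (h_at M x a) = (\<lambda>_. 0)" "t_at M x (t_at M x a) = (\<lambda>_. 0)" "h_at M x (h_at M x a) = (\<lambda>_. 0)"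
    by (rule differential_consequences[OF d0_d0 assms]; assumption)+
qed

lemma pointwise_forms_on:
  assumes w: "\<omega> \<in> forms_on M U" and U: "open U" and A0: "\<And>x. A x (\<lambda>_. 0) = (\<lambda>_. 0)"
    and loc: "\<And>x. x \<in> U \<Longrightarrow> \<exists>V. open V \<and> x \<in> V \<and> V \<subseteq> U \<and> (\<lambda>q. A q (restr V \<omega> q)) \<in> forms_on M V"
  shows "(\<lambda>q. A q (\<omega> q)) \<in> forms_on M U"
proof (rule forms_on_local[OF U])
  show "A x (\<omega> x) = (\<lambda>_. 0)" if "x \<notin> U" for x by (simp add: forms_on_out[OF w that] A0)
  fix x assume "x \<in> U"
  then obtain V where "open V" "x \<in> V" "V \<subseteq> U" "(\<lambda>q. A q (restr V \<omega> q)) \<in> forms_on M V" using loc by blast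
  then show "\<exists>V \<eta>. open V \<and> x \<in> V \<and> \<eta> \<in> forms_on M V \<and> (\<forall>q\<in>U \<inter> V. A q (\<omega> q) = \<eta> q)"
    by (intro exI[of _ V] exI[of _ "\<lambda>q. A q (restr V \<omega> q)"]) simp
qed

lemma d0_t_forms_on:
  assumes w: "\<omega> \<in> forms_on M U" and U: "open U"
  shows "d0 M \<omega> \<in> forms_on M U" "d0_t M \<omega> \<in> forms_on M U"
proof -
  have "\<exists>V. open V \<and> x \<in> V \<and> V \<subseteq> U \<and> d0 M (restr V \<omega>) \<in> forms_on M V \<and> d0_t M (restr V \<omega>) \<in> forms_on M V"
    if x: "x \<in> U" for x
  proof -
    obtain W E n w where W: "x \<in> W" "frame_nbhd M W E n w" by (rule frame_nbhd_at)
    then interpret frame_nbhd M W E n w by simp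
    have V: "open (U \<inter> W)" using U open_W by blast
    have r: "restr (U \<inter> W) \<omega> \<in> forms_on M (U \<inter> W)" by (rule forms_on_restr[OF w _ V]) auto
    show ?thesis using d0_forms_on_frame[OF r V] t_forms_on_frame[OF r V] x W V by (intro exI[of _ "U \<inter> W"]) auto
  qed
  note loc = this[unfolded pointwise_ops[abs_def]]
  show "d0 M \<omega> \<in> forms_on M U"
    unfolding pointwise_ops[abs_def]
  proof (rule pointwise_forms_on[OF w U, where A = "d0_at M"])
    fix x assume "x \<in> U"
    from loc[OF this] show "\<exists>V. open V \<and> x \<in> V \<and> V \<subseteq> U \<and> (\<lambda>q. d0_at M q (restr V \<omega> q)) \<in> forms_on M V" by auto
  qed (rule at_zero)
  show "d0_t M \<omega> \<in> forms_on M U"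
    unfolding pointwise_ops[abs_def]
  proof (rule pointwise_forms_on[OF w U, where A = "t_at M"])
    fix x assume "x \<in> U"
    from loc[OF this] show "\<exists>V. open V \<and> x \<in> V \<and> V \<subseteq> U \<and> (\<lambda>q. t_at M q (restr V \<omega> q)) \<in> forms_on M V" by auto
  qed (rule at_zero)
qed

lemma raise:
  assumes w: "\<omega> \<in> forms_on M U" and U: "open U" "x \<in> U" and k: "\<And>p. p \<in> U \<Longrightarrow> \<omega> p \<in> Fil M k p"
  shows "(\<lambda>vs. de_rham M \<omega> x vs - d0_at M x (\<omega> x) vs) \<in> Fil M (Suc k) x"
proof -
  obtain W E n w where W: "x \<in> W" "frame_nbhd M W E n w" by (rule frame_nbhd_at)
  then interpret frame_nbhd M W E n w by simp
  have V: "open (U \<inter> W)" "x \<in> U \<inter> W" using U open_W W by auto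
  have "(\<lambda>vs. de_rham M (restr (U \<inter> W) \<omega>) x vs - d0_at M x (restr (U \<inter> W) \<omega> x) vs) \<in> Fil M (Suc k) x"
    by (rule raise_frame[OF forms_on_restr[OF w _ V(1)] V(1) _ V(2)]) (use k in auto)
  moreover have "de_rham M (restr (U \<inter> W) \<omega>) x = de_rham M \<omega> x" by (rule de_rham_cong[OF V]) simp
  ultimately show ?thesis using V by simp
qed

end

subsection \<open>The projection \<open>\<Pi>\<close>\<close>

text \<open>The orthogonal projections inside \<open>h\<close> may jump where the rank of
  \<open>d0\<close> changes, so the smoothness of \<open>h\<close> is an assumption on the manifold;
  for \<open>d0\<close> and its transpose it was proved from the structure functions.\<close>

locale smooth_partial_inverse = filtered_manifold M
  for M :: "('m::{t2_space, second_countable_topology}, 'e::euclidean_space) filtered_space" +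
  assumes h_UNIV: "\<omega> \<in> forms_on M UNIV \<Longrightarrow> d0_inv M \<omega> \<in> forms_on M UNIV"
begin

text \<open>\<open>h\<close> acts fibrewise, so near each point a local form may be replaced by a
  global one, to which the assumption applies.\<close>

lemma h_forms_on:
  assumes w: "\<omega> \<in> forms_on M U" and U: "open U"
  shows "d0_inv M \<omega> \<in> forms_on M U"
  unfolding pointwise_ops[abs_def]
proof (rule pointwise_forms_on[OF w U, where A = "h_at M"])
  show "h_at M x (\<lambda>_. 0) = (\<lambda>_. 0)" for x by (rule at_zero)
  fix x assume x: "x \<in> U"
  obtain \<eta> V ch where \<eta>: "\<eta> \<in> forms_on M UNIV" "open V" "x \<in> V" "V \<subseteq> U" "\<And>q. q \<in> V \<Longrightarrow> \<eta> q = \<omega> q"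
    "smf UNIV ch" "\<And>q. \<eta> q = (\<lambda>vs. ch q * \<omega> q vs)"
    by (rule extend_form[OF U x w]) (rule that)
  have "restr V (d0_inv M \<eta>) \<in> forms_on M V" by (rule forms_on_restr[OF h_UNIV[OF \<eta>(1)]]) (use \<eta> in auto)
  moreover have "restr V (d0_inv M \<eta>) = (\<lambda>q. h_at M q (restr V \<omega> q))"
    by (rule ext) (use \<eta>(5) in \<open>auto simp: restr_def pointwise_ops at_zero\<close>)
  ultimately show "\<exists>V. open V \<and> x \<in> V \<and> V \<subseteq> U \<and> (\<lambda>q. h_at M q (restr V \<omega> q)) \<in> forms_on M V" using \<eta> by auto
qed

abbreviation "F \<equiv> forms_on M UNIV"
abbreviation "d \<equiv> de_rham M"
abbreviation "h \<equiv> d0_inv M"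

lemma d_F: "\<omega> \<in> F \<Longrightarrow> d \<omega> \<in> F"
  using de_rham_forms_on[of \<omega> UNIV] by simp

lemma F_add: "\<omega> \<in> F \<Longrightarrow> \<eta> \<in> F \<Longrightarrow> (\<lambda>x vs. \<omega> x vs + \<eta> x vs) \<in> F"
  and F_diff: "\<omega> \<in> F \<Longrightarrow> \<eta> \<in> F \<Longrightarrow> (\<lambda>x vs. \<omega> x vs - \<eta> x vs) \<in> F"
  by (auto intro: forms_on_add forms_on_diff)

lemma d_add: "\<omega> \<in> F \<Longrightarrow> \<eta> \<in> F \<Longrightarrow> d (\<lambda>x vs. \<omega> x vs + \<eta> x vs) = (\<lambda>x vs. d \<omega> x vs + d \<eta> x vs)"
  and d_diff: "\<omega> \<in> F \<Longrightarrow> \<eta> \<in> F \<Longrightarrow> d (\<lambda>x vs. \<omega> x vs - \<eta> x vs) = (\<lambda>x vs. d \<omega> x vs - d \<eta> x vs)"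
  using de_rham_linear[of \<omega> UNIV \<eta> _ 1 1] de_rham_linear[of \<omega> UNIV \<eta> _ 1 "-1"] by (auto simp: fun_eq_iff)

lemma d_zero: "d (\<lambda>x vs. 0) = (\<lambda>x vs. 0)"
  using d_diff[OF forms_on_zero forms_on_zero] by simp

lemma d_d: "\<omega> \<in> F \<Longrightarrow> d (d \<omega>) = (\<lambda>x vs. 0)"
  using de_rham_de_rham[of \<omega> UNIV] by (auto simp: fun_eq_iff)

lemma h_diff: "\<omega> \<in> F \<Longrightarrow> \<eta> \<in> F \<Longrightarrow> h (\<lambda>x vs. \<omega> x vs - \<eta> x vs) = (\<lambda>x vs. h \<omega> x vs - h \<eta> x vs)"
  by (auto simp: fun_eq_iff pointwise_ops lin_op_diff[OF lin_op_at(3)] forms_on_ext)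

lemma h_add: "\<omega> \<in> F \<Longrightarrow> \<eta> \<in> F \<Longrightarrow> h (\<lambda>x vs. \<omega> x vs + \<eta> x vs) = (\<lambda>x vs. h \<omega> x vs + h \<eta> x vs)"
  by (auto simp: fun_eq_iff pointwise_ops lin_opD(2)[OF lin_op_at(3)] forms_on_ext)

lemma d0_F: "\<omega> \<in> F \<Longrightarrow> d0 M \<omega> \<in> F"
  by (rule d0_t_forms_on) auto

lemma b_eq: "\<omega> \<in> F \<Longrightarrow> b_op M \<omega> = h (\<lambda>x vs. d0 M \<omega> x vs - d \<omega> x vs)"
  by (simp add: b_op_def h_diff d0_F d_F)

lemma b_F: "\<omega> \<in> F \<Longrightarrow> b_op M \<omega> \<in> F"
  by (simp add: b_eq h_UNIV F_diff d0_F d_F)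

lemma d0_diff: "\<omega> \<in> F \<Longrightarrow> \<eta> \<in> F \<Longrightarrow> d0 M (\<lambda>x vs. \<omega> x vs - \<eta> x vs) = (\<lambda>x vs. d0 M \<omega> x vs - d0 M \<eta> x vs)"
  by (auto simp: fun_eq_iff pointwise_ops lin_op_diff[OF lin_op_at(1)] forms_on_ext)

lemma b_diff: "\<omega> \<in> F \<Longrightarrow> \<eta> \<in> F \<Longrightarrow> b_op M (\<lambda>x vs. \<omega> x vs - \<eta> x vs) = (\<lambda>x vs. b_op M \<omega> x vs - b_op M \<eta> x vs)"
  by (simp add: b_op_def d0_diff d_diff h_diff d0_F d_F algebra_simps)

text \<open>\<open>b\<close> is \<open>h\<close> applied to \<open>d0 - d\<close>, and
  \<open>h\<close> preserves weights.\<close>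

lemma b_raise: "\<omega> \<in> F \<Longrightarrow> (\<And>p. \<omega> p \<in> Fil M k p) \<Longrightarrow> b_op M \<omega> x \<in> Fil M (Suc k) x"
proof -
  assume w: "\<omega> \<in> F" and k: "\<And>p. \<omega> p \<in> Fil M k p"
  have "(\<lambda>vs. d \<omega> x vs - d0_at M x (\<omega> x) vs) \<in> Fil M (Suc k) x" by (rule raise[OF w]) (use k in auto)
  then have "(\<lambda>vs. - (d \<omega> x vs - d0_at M x (\<omega> x) vs)) \<in> Fil M (Suc k) x" by (rule Fil_uminus)
  then show ?thesis using at_Fil(3) by (simp add: b_eq[OF w] pointwise_ops)
qed

lemma I_minus_b_surj:
  assumes "\<eta> \<in> F"
  shows "\<exists>u\<in>F. (\<lambda>x vs. u x vs - b_op M u x vs) = \<eta>"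
proof -
  have "\<exists>u\<in>F. \<forall>p. (\<lambda>vs. \<eta> p vs - (u p vs - b_op M u p vs)) \<in> Fil M k p" for k
  proof (induction k)
    case 0
    show ?case
      unfolding Fil_0
      by (rule bexI[OF _ forms_on_zero], intro allI ext_T_minus forms_on_ext[OF assms] ext_T_zero forms_on_ext[OF b_F[OF forms_on_zero]])
  next
    case (Suc k)
    then obtain u where u: "u \<in> F" "\<And>p. (\<lambda>vs. \<eta> p vs - (u p vs - b_op M u p vs)) \<in> Fil M k p" by blast
    \<comment> \<open>Neumann iteration: adding the residual \<open>r\<close> to \<open>u\<close>
      turns the residual into \<open>b r\<close>, which has higher weight.\<close>
    define r where "r = (\<lambda>p vs. \<eta> p vs - (u p vs - b_op M u p vs))"
    have r: "r \<in> F" unfolding r_def by (intro F_diff assms u b_F)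
    have nr: "(\<lambda>x vs. - r x vs) \<in> F" using F_diff[OF forms_on_zero r] by simp
    have bz: "b_op M (\<lambda>x vs. 0) = (\<lambda>x vs. 0)" using b_diff[OF r r] by simp
    have bn: "b_op M (\<lambda>x vs. - r x vs) = (\<lambda>x vs. - b_op M r x vs)"
      using b_diff[OF forms_on_zero r] by (simp add: bz)
    have "b_op M (\<lambda>x vs. u x vs + r x vs) = (\<lambda>x vs. b_op M u x vs + b_op M r x vs)"
      using b_diff[OF u(1) nr] by (simp add: bn)
    then have "(\<lambda>vs. \<eta> p vs - ((u p vs + r p vs) - b_op M (\<lambda>x vs. u x vs + r x vs) p vs)) = b_op M r p" for p
      by (simp add: r_def fun_eq_iff)
    moreover have "b_op M r p \<in> Fil M (Suc k) p" for p by (rule b_raise[OF r]) (use u in \<open>simp add: r_def\<close>)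
    ultimately show ?case by (intro bexI[of _ "\<lambda>x vs. u x vs + r x vs"]) (auto intro: F_add u r)
  qed
  then obtain u where u: "u \<in> F" "\<And>p. (\<lambda>vs. \<eta> p vs - (u p vs - b_op M u p vs)) \<in> Fil M top_weight p" by blast
  have "u p vs - b_op M u p vs = \<eta> p vs" for p vs
    using fun_cong[OF Fil_top_weight[OF u(2)[of p]], of vs] by simp
  then show ?thesis using u(1) by (intro bexI[of _ u]) auto
qed

text \<open>Surjectivity makes \<open>inv_into\<close> a right inverse, and it is in this form that
  the operator is used from here on.\<close>

lemma I_minus_b_inv:
  assumes "\<eta> \<in> F"
  shows "I_minus_b_inv M \<eta> \<in> F" "(\<lambda>x vs. I_minus_b_inv M \<eta> x vs - b_op M (I_minus_b_inv M \<eta>) x vs) = \<eta>"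
proof -
  have "\<eta> \<in> (\<lambda>\<omega> x vs. \<omega> x vs - b_op M \<omega> x vs) ` F" using I_minus_b_surj[OF assms] by (auto simp: image_iff)
  then show "I_minus_b_inv M \<eta> \<in> F" "(\<lambda>x vs. I_minus_b_inv M \<eta> x vs - b_op M (I_minus_b_inv M \<eta>) x vs) = \<eta>"
    unfolding I_minus_b_inv_def by (rule inv_into_into, rule f_inv_into_f)
qed

text \<open>On the image of \<open>h = d\<^sub>0\<^sup>-\<^sup>1\<close> the operator \<open>h d\<close> is \<open>I - b\<close>.\<close>

lemma I_minus_b_inv_h:
  assumes w: "\<omega> \<in> F"
  shows "\<exists>s\<in>F. I_minus_b_inv M (h \<omega>) = h s" "h (d (I_minus_b_inv M (h \<omega>))) = h \<omega>" "h (I_minus_b_inv M (h \<omega>)) = (\<lambda>x vs. 0)"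
proof -
  let ?v = "I_minus_b_inv M (h \<omega>)"
  note v = I_minus_b_inv[OF h_UNIV[OF w]]
  \<comment> \<open>From \<open>v = h \<omega> + b v\<close> and \<open>b v = h (d0 v - d v)\<close>
    it follows that \<open>v\<close> is itself a value of \<open>h\<close>.\<close>
  define s where "s = (\<lambda>x vs. \<omega> x vs + (d0 M ?v x vs - d ?v x vs))"
  have s: "s \<in> F" unfolding s_def by (intro F_add w F_diff d0_F d_F v)
  have "?v x vs = h s x vs" for x vs
    using fun_cong[OF fun_cong[OF v(2)], of x vs]
    by (simp add: s_def h_add[OF w F_diff[OF d0_F[OF v(1)] d_F[OF v(1)]]] b_eq[OF v(1)])
  then have vs: "?v = h s" by blast
  then show "\<exists>s\<in>F. ?v = h s" using s by blast
  show "h ?v = (\<lambda>x vs. 0)" unfolding vs by (simp add: pointwise_ops fun_eq_iff at_squares forms_on_ext[OF s])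
  have "h (d0 M ?v) = ?v" unfolding vs by (simp add: pointwise_ops fun_eq_iff at_identities forms_on_ext[OF s])
  then have "h (d ?v) x vs = ?v x vs - b_op M ?v x vs" for x vs by (simp add: b_op_def)
  then show "h (d ?v) = h \<omega>" using v(2) by (simp add: fun_eq_iff)
qed

text \<open>The form to which the resolvent can be applied: each summand is handled by an equation
  whose right-hand side, \<open>h s1\<close> or \<open>h s2\<close>, lies in the image of
  \<open>h\<close>.\<close>

lemma Pi_op_decompose:
  assumes w: "\<omega> \<in> F"
  shows "\<exists>s1\<in>F. \<exists>s2\<in>F. Pi_op M \<omega> = (\<lambda>x vs. h s1 x vs + d (h s2) x vs)"
  using I_minus_b_inv_h(1)[OF w] I_minus_b_inv_h(1)[OF d_F[OF w]] unfolding Pi_op_def by metis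

lemma Pi_op_F: "\<omega> \<in> F \<Longrightarrow> Pi_op M \<omega> \<in> F"
  unfolding Pi_op_def by (intro F_add d_F I_minus_b_inv h_UNIV)

lemma Box_I_minus_Pi:
  assumes w: "\<omega> \<in> F"
  shows "Box M (\<lambda>x vs. \<omega> x vs - Pi_op M \<omega> x vs) = (\<lambda>x vs. 0)"
proof -
  let ?v1 = "I_minus_b_inv M (h (d \<omega>))" and ?v2 = "I_minus_b_inv M (h \<omega>)"
  let ?q = "\<lambda>x vs. \<omega> x vs - Pi_op M \<omega> x vs"
  have v: "?v1 \<in> F" "?v2 \<in> F" by (intro I_minus_b_inv h_UNIV d_F w)+
  have q: "?q \<in> F" by (intro F_diff w Pi_op_F)
  have "h (Pi_op M \<omega>) = h \<omega>"
    unfolding Pi_op_def by (simp add: h_add v d_F I_minus_b_inv_h w)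
  then have 1: "h ?q = (\<lambda>x vs. 0)" by (simp add: h_diff w Pi_op_F)
  have "d (Pi_op M \<omega>) = d ?v1" unfolding Pi_op_def by (simp add: d_add v d_F d_d)
  then have "h (d (Pi_op M \<omega>)) = h (d \<omega>)" by (simp add: I_minus_b_inv_h d_F w)
  then have 2: "h (d ?q) = (\<lambda>x vs. 0)" by (simp add: d_diff w Pi_op_F h_diff d_F)
  \<comment> \<open>On each fibre \<open>t = t d0 h\<close>, so the kernel of \<open>h\<close> is
    contained in that of \<open>t\<close>.\<close>
  have tz: "d0_t M \<eta> = (\<lambda>x vs. 0)" if "\<eta> \<in> F" "h \<eta> = (\<lambda>x vs. 0)" for \<eta>
  proof
    fix x
    have "h_at M x (\<eta> x) = (\<lambda>_. 0)" using that(2) by (simp add: pointwise_ops[abs_def] fun_eq_iff)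
    then show "d0_t M \<eta> x = (\<lambda>_. 0)"
      using at_identities(1)[OF forms_on_ext[OF that(1)], of x x] by (simp add: pointwise_ops at_zero)
  qed
  show ?thesis unfolding Box_def tz[OF q 1] tz[OF d_F[OF q] 2] by (simp add: d_zero)
qed

end

subsection \<open>Families that are smooth in the point and holomorphic in the parameter\<close>

text \<open>The expressions from which solutions are built: smooth functions of the point, the
  parameter, and rational operations on them. Rule induction then yields smoothness in
  \<open>y\<close> and complex differentiability in \<open>z\<close>, while the rule
  \<open>cong\<close> makes values outside \<open>D \<times> S\<close> irrelevant.\<close>

inductive_set smooth_hol :: "complex set \<Rightarrow> 'e::euclidean_space set \<Rightarrow> (complex \<Rightarrow> 'e \<Rightarrow> complex) set"
  for D :: "complex set" and S :: "'e::euclidean_space set" where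
  smooth: "smooth_on S f \<Longrightarrow> (\<lambda>z y. f y) \<in> smooth_hol D S"
| param: "(\<lambda>z y. z) \<in> smooth_hol D S"
| add: "f \<in> smooth_hol D S \<Longrightarrow> g \<in> smooth_hol D S \<Longrightarrow> (\<lambda>z y. f z y + g z y) \<in> smooth_hol D S"
| mult: "f \<in> smooth_hol D S \<Longrightarrow> g \<in> smooth_hol D S \<Longrightarrow> (\<lambda>z y. f z y * g z y) \<in> smooth_hol D S"
| inverse: "f \<in> smooth_hol D S \<Longrightarrow> (\<And>z y. z \<in> D \<Longrightarrow> y \<in> S \<Longrightarrow> f z y \<noteq> 0) \<Longrightarrow> (\<lambda>z y. inverse (f z y)) \<in> smooth_hol D S"
| cong: "f \<in> smooth_hol D S \<Longrightarrow> (\<And>z y. z \<in> D \<Longrightarrow> y \<in> S \<Longrightarrow> g z y = f z y) \<Longrightarrow> g \<in> smooth_hol D S"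

lemma smooth_hol_const: "(\<lambda>z y. c) \<in> smooth_hol D S"
  by (rule smooth_hol.smooth) simp

lemma smooth_hol_sum: "(\<And>i. i \<in> I \<Longrightarrow> f i \<in> smooth_hol D S) \<Longrightarrow> (\<lambda>z y. \<Sum>i\<in>I. f i z y) \<in> smooth_hol D S"
  by (induction I rule: infinite_finite_induct) (auto intro: smooth_hol_const smooth_hol.add)

lemma smooth_hol_prod: "(\<And>i. i \<in> I \<Longrightarrow> f i \<in> smooth_hol D S) \<Longrightarrow> (\<lambda>z y. \<Prod>i\<in>I. f i z y) \<in> smooth_hol D S"
  by (induction I rule: infinite_finite_induct) (auto intro: smooth_hol_const smooth_hol.mult)

lemma smooth_hol_uminus: "f \<in> smooth_hol D S \<Longrightarrow> (\<lambda>z y. - f z y) \<in> smooth_hol D S"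
  using smooth_hol.mult[OF smooth_hol_const[of "-1"]] by fastforce

lemma smooth_hol_diff: "f \<in> smooth_hol D S \<Longrightarrow> g \<in> smooth_hol D S \<Longrightarrow> (\<lambda>z y. f z y - g z y) \<in> smooth_hol D S"
  using smooth_hol.add[OF _ smooth_hol_uminus] by fastforce

lemma smooth_hol_derivative:
  assumes S: "open S" and f: "f \<in> smooth_hol D S"
  shows "(\<forall>z\<in>D. \<forall>y\<in>S. (f z) differentiable (at y)) \<and>
    (\<exists>g\<in>smooth_hol D S. \<forall>z\<in>D. \<forall>y\<in>S. frechet_derivative (f z) (at y) v = g z y)"
  using f
proof induction
  case (smooth f)
  have "(\<lambda>z y. frechet_derivative f (at y) v) \<in> smooth_hol D S"
    by (rule smooth_hol.smooth[OF smooth_on_derivative[OF smooth]])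
  then show ?case using smooth_on_differentiable[OF smooth] by (metis (lifting))
next
  case param
  show ?case by (auto simp: frechet_derivative_const intro!: bexI[OF _ smooth_hol_const[of 0]])
next
  case (add f g)
  obtain f' where f: "f' \<in> smooth_hol D S" "\<forall>z\<in>D. \<forall>y\<in>S. frechet_derivative (f z) (at y) v = f' z y"
    using add.IH(1) by blast
  obtain g' where g: "g' \<in> smooth_hol D S" "\<forall>z\<in>D. \<forall>y\<in>S. frechet_derivative (g z) (at y) v = g' z y"
    using add.IH(2) by blast
  note fg = f(1) g(1) f(2) g(2)
  have H: "((\<lambda>y. f z y + g z y) has_derivative (\<lambda>v. frechet_derivative (f z) (at y) v + frechet_derivative (g z) (at y) v)) (at y)"
    if "z \<in> D" "y \<in> S" for z y
  proof -
    have "f z differentiable (at y)" "g z differentiable (at y)" using add.IH that by blast+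
    then show ?thesis unfolding frechet_derivative_works by (rule has_derivative_add)
  qed
  show ?case
  proof (intro conjI ballI)
    show "(\<lambda>y. f z y + g z y) differentiable (at y)" if "z \<in> D" "y \<in> S" for z y
      using H[OF that] by (auto simp: differentiable_def)
    show "\<exists>h\<in>smooth_hol D S. \<forall>z\<in>D. \<forall>y\<in>S. frechet_derivative (\<lambda>y. f z y + g z y) (at y) v = h z y"
      using fg frechet_derivative_eq[OF H] by (intro bexI[OF _ smooth_hol.add[OF fg(1,2)]]) simp
  qed
next
  case (mult f g)
  obtain f' where f: "f' \<in> smooth_hol D S" "\<forall>z\<in>D. \<forall>y\<in>S. frechet_derivative (f z) (at y) v = f' z y"
    using mult.IH(1) by blast
  obtain g' where g: "g' \<in> smooth_hol D S" "\<forall>z\<in>D. \<forall>y\<in>S. frechet_derivative (g z) (at y) v = g' z y"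
    using mult.IH(2) by blast
  note fg = f(1) g(1) f(2) g(2)
  have H: "((\<lambda>y. f z y * g z y) has_derivative (\<lambda>v. f z y * frechet_derivative (g z) (at y) v + frechet_derivative (f z) (at y) v * g z y)) (at y)"
    if "z \<in> D" "y \<in> S" for z y
  proof -
    have "f z differentiable (at y)" "g z differentiable (at y)" using mult.IH that by blast+
    then show ?thesis unfolding frechet_derivative_works by (rule has_derivative_mult)
  qed
  show ?case
  proof (intro conjI ballI)
    show "(\<lambda>y. f z y * g z y) differentiable (at y)" if "z \<in> D" "y \<in> S" for z y
      using H[OF that] by (auto simp: differentiable_def)
    show "\<exists>h\<in>smooth_hol D S. \<forall>z\<in>D. \<forall>y\<in>S. frechet_derivative (\<lambda>y. f z y * g z y) (at y) v = h z y"
      using fg frechet_derivative_eq[OF H]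
      by (intro bexI[OF _ smooth_hol.add[OF smooth_hol.mult[OF mult.hyps(1) fg(2)] smooth_hol.mult[OF fg(1) mult.hyps(2)]]]) simp
  qed
next
  case (inverse f)
  then obtain f' where f: "f' \<in> smooth_hol D S"
    "\<And>z y. z \<in> D \<Longrightarrow> y \<in> S \<Longrightarrow> frechet_derivative (f z) (at y) v = f' z y" by blast
  have H: "((\<lambda>y. inverse (f z y)) has_derivative (\<lambda>v. - (inverse (f z y) * frechet_derivative (f z) (at y) v * inverse (f z y)))) (at y)"
    if "z \<in> D" "y \<in> S" for z y
  proof -
    have "f z differentiable (at y)" using inverse.IH that by blast
    with inverse.hyps(2)[OF that] show ?thesis
      unfolding frechet_derivative_works by (rule Deriv.has_derivative_inverse)
  qed
  note i = smooth_hol.inverse[OF inverse.hyps]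
  show ?case
  proof (intro conjI ballI)
    show "(\<lambda>y. inverse (f z y)) differentiable (at y)" if "z \<in> D" "y \<in> S" for z y
      using H[OF that] by (auto simp: differentiable_def)
    show "\<exists>h\<in>smooth_hol D S. \<forall>z\<in>D. \<forall>y\<in>S. frechet_derivative (\<lambda>y. inverse (f z y)) (at y) v = h z y"
      using f frechet_derivative_eq[OF H]
      by (intro bexI[OF _ smooth_hol_uminus[OF smooth_hol.mult[OF smooth_hol.mult[OF i f(1)] i]]]) simp
  qed
next
  case (cong f g)
  have "(g z) differentiable (at y) \<longleftrightarrow> (f z) differentiable (at y)" if "z \<in> D" "y \<in> S" for z y
    by (rule differentiable_cong_open[OF S that(2)]) (rule cong.hyps(2)[OF that(1)])
  moreover have "frechet_derivative (g z) (at y) = frechet_derivative (f z) (at y)" if "z \<in> D" "y \<in> S" for z y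
    by (rule frechet_derivative_cong_open[OF S that(2)]) (rule cong.hyps(2)[OF that(1)])
  ultimately show ?case using cong.IH by simp
qed

text \<open>For fixed \<open>z\<close> the slices of the class are closed under directional
  derivatives, so \<open>smooth_on_coinduct\<close> applies.\<close>

lemma smooth_hol_smooth_on:
  assumes S: "open S" and f: "f \<in> smooth_hol D S" and z: "z \<in> D"
  shows "smooth_on S (f z)"
proof (rule smooth_on_coinduct[OF S, of _ "(\<lambda>f. f z) ` smooth_hol D S"])
  show "f z \<in> (\<lambda>f. f z) ` smooth_hol D S" using f by simp
  show "h differentiable at x" if "h \<in> (\<lambda>f. f z) ` smooth_hol D S" "x \<in> S" for h x
    using that smooth_hol_derivative[OF S] z by blast
  show "\<exists>g\<in>(\<lambda>f. f z) ` smooth_hol D S. \<forall>x\<in>S. frechet_derivative h (at x) v = g x"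
    if "h \<in> (\<lambda>f. f z) ` smooth_hol D S" for h v
    using that smooth_hol_derivative[OF S, of _ D v] z by fast
qed

lemma smooth_hol_derivative_dir:
  assumes S: "open S" and f: "f \<in> smooth_hol D S" and V: "smooth_on S V"
  shows "(\<lambda>z y. frechet_derivative (f z) (at y) (V y)) \<in> smooth_hol D S"
proof -
  obtain g where g: "\<And>b. g b \<in> smooth_hol D S" "\<And>b z y. z \<in> D \<Longrightarrow> y \<in> S \<Longrightarrow> frechet_derivative (f z) (at y) b = g b z y"
    using smooth_hol_derivative[OF S f] by metis
  have "(\<lambda>z y. \<Sum>b\<in>Basis. complex_of_real (V y \<bullet> b) * g b z y) \<in> smooth_hol D S"
  proof (intro smooth_hol_sum smooth_hol.mult g smooth_hol.smooth)
    fix b show "smooth_on S (\<lambda>y. complex_of_real (V y \<bullet> b))"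
      by (rule smooth_on_compose[OF S open_UNIV _ smooth_on_bounded_linear[OF bounded_linear_of_real]])
        (auto intro: smooth_on_inner S V)
  qed
  moreover have "frechet_derivative (f z) (at y) (V y) = (\<Sum>b\<in>Basis. complex_of_real (V y \<bullet> b) * g b z y)"
    if "z \<in> D" "y \<in> S" for z y
    using frechet_derivative_expand[of "f z" y "V y"] smooth_hol_derivative[OF S f] that g(2)
    by (simp add: scaleR_conv_of_real)
  ultimately show ?thesis by (rule smooth_hol.cong)
qed

text \<open>These are the hypotheses of Cauchy's formula when \<open>D\<close> is a closed disc;
  passing to the interior avoids complex derivatives at boundary points.\<close>

lemma smooth_hol_holomorphic:
  assumes "f \<in> smooth_hol D S" "y \<in> S"
  shows "continuous_on D (\<lambda>z. f z y) \<and> (\<forall>z\<in>interior D. (\<lambda>z. f z y) field_differentiable (at z))"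
  using assms(1)
proof induction
  case (cong f g)
  have "continuous_on D (\<lambda>z. g z y)"
    using cong.IH cong.hyps(2) assms(2) by (metis (no_types, lifting) continuous_on_cong)
  moreover have "(\<lambda>z. g z y) field_differentiable (at z)" if "z \<in> interior D" for z
  proof -
    have ev: "\<forall>\<^sub>F z in nhds z. f z y = g z y"
      using that cong.hyps(2) assms(2) interior_subset[of D] by (auto simp: eventually_nhds intro!: exI[of _ "interior D"])
    then show ?thesis using cong.IH that DERIV_cong_ev[OF refl ev refl]
      unfolding field_differentiable_def by blast
  qed
  ultimately show ?case by blast
next
  case (inverse f)
  have "z \<in> D" if "z \<in> interior D" for z using that interior_subset by blast
  then show ?case using inverse assms(2)
    by (auto intro!: continuous_intros field_differentiable_inverse)
qed (auto intro!: continuous_intros field_differentiable_add field_differentiable_mult)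

lemma smooth_hol_det:
  assumes M: "\<And>z y. M z y \<in> carrier_mat k k" and f: "\<And>i j. i < k \<Longrightarrow> j < k \<Longrightarrow> (\<lambda>z y. M z y $$ (i, j)) \<in> smooth_hol D S"
  shows "(\<lambda>z y. Determinant.det (M z y)) \<in> smooth_hol D S"
proof -
  have "p i < k" if "p permutes {0..<k}" "i < k" for p i using that permutes_in_image[of p "{0..<k}" i] by simp
  then have "(\<lambda>z y. \<Sum>p\<in>{p. p permutes {0..<k}}. signof p * (\<Prod>i = 0..<k. M z y $$ (i, p i))) \<in> smooth_hol D S"
    by (intro smooth_hol_sum smooth_hol.mult smooth_hol_const smooth_hol_prod f) auto
  then show ?thesis using det_def'[OF M] by (simp add: fun_eq_iff)
qed

text \<open>Entries of the adjugate are signed minors. Together with the reciprocal of the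
  determinant this keeps Cramer's rule inside the class.\<close>

lemma smooth_hol_adj:
  assumes M: "\<And>z y. M z y \<in> carrier_mat k k" and f: "\<And>i j. i < k \<Longrightarrow> j < k \<Longrightarrow> (\<lambda>z y. M z y $$ (i, j)) \<in> smooth_hol D S"
    and ij: "i < k" "j < k"
  shows "(\<lambda>z y. adj_mat (M z y) $$ (i, j)) \<in> smooth_hol D S"
proof -
  have dim: "dim_row (M z y) = k" "dim_col (M z y) = k" for z y using M by auto
  have "(\<lambda>z y. Determinant.det (mat_delete (M z y) j i)) \<in> smooth_hol D S"
  proof (rule smooth_hol_det)
    show "mat_delete (M z y) j i \<in> carrier_mat (k - 1) (k - 1)" for z y using mat_delete_carrier[OF M] by simp
    fix a b assume "a < k - 1" "b < k - 1"
    then have "mat_delete (M z y) j i $$ (a, b) = M z y $$ (if a < j then a else Suc a, if b < i then b else Suc b)" for z y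
      by (simp add: mat_delete_def dim)
    then show "(\<lambda>z y. mat_delete (M z y) j i $$ (a, b)) \<in> smooth_hol D S"
      using \<open>a < k - 1\<close> \<open>b < k - 1\<close> by (auto intro!: f)
  qed
  then have "(\<lambda>z y. (-1) ^ (j + i) * Determinant.det (mat_delete (M z y) j i)) \<in> smooth_hol D S"
    by (intro smooth_hol.mult smooth_hol_const)
  then show ?thesis using ij by (simp add: adj_mat_def dim cofactor_def)
qed

subsection \<open>Complexified operators\<close>

definition cext :: "('e::euclidean_space list \<Rightarrow> complex) set" where
  "cext = {a. (\<lambda>vs. Re (a vs)) \<in> ext_T \<and> (\<lambda>vs. Im (a vs)) \<in> ext_T}"

definition cop :: "(('e list \<Rightarrow> real) \<Rightarrow> 'e list \<Rightarrow> real) \<Rightarrow> ('e list \<Rightarrow> complex) \<Rightarrow> 'e list \<Rightarrow> complex" where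
  "cop A a = (\<lambda>vs. Complex (A (\<lambda>vs. Re (a vs)) vs) (A (\<lambda>vs. Im (a vs)) vs))"

lemma cop_parts [simp]: "(\<lambda>vs. Re (cop A a vs)) = A (\<lambda>vs. Re (a vs))" "(\<lambda>vs. Im (cop A a vs)) = A (\<lambda>vs. Im (a vs))"
  by (simp_all add: cop_def)

lemma cop_comp: "cop A (cop B a) = cop (\<lambda>a. A (B a)) a"
  by (subst (1 3) cop_def) (simp only: cop_parts)

lemma cext_zero: "(\<lambda>_. 0) \<in> cext"
  by (simp add: cext_def)

lemma cop_in: "lin_op A \<Longrightarrow> a \<in> cext \<Longrightarrow> cop A a \<in> cext"
  by (simp add: cext_def lin_op_def)

lemma cext_add: "a \<in> cext \<Longrightarrow> b \<in> cext \<Longrightarrow> (\<lambda>vs. a vs + b vs) \<in> cext"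
  by (simp add: cext_def ext_T_plus)

lemma cext_scale: "a \<in> cext \<Longrightarrow> (\<lambda>vs. c * a vs) \<in> cext"
  by (auto simp: cext_def intro!: ext_T_plus ext_T_minus ext_T_scaled)

lemma cext_diff: "a \<in> cext \<Longrightarrow> b \<in> cext \<Longrightarrow> (\<lambda>vs. a vs - b vs) \<in> cext"
  by (simp add: cext_def ext_T_minus)

lemma cext_sum: "(\<And>i. i \<in> I \<Longrightarrow> f i \<in> cext) \<Longrightarrow> (\<lambda>vs. \<Sum>i\<in>I. f i vs) \<in> cext"
  by (simp add: cext_def ext_T_sum)

lemma cop_scale:
  assumes A: "lin_op A" and a: "a \<in> cext"
  shows "cop A (\<lambda>vs. c * a vs) = (\<lambda>vs. c * cop A a vs)"
proof -
  have r: "(\<lambda>vs. Re (a vs)) \<in> ext_T" and i: "(\<lambda>vs. Im (a vs)) \<in> ext_T" using a by (auto simp: cext_def)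
  note s = ext_T_scaled[OF r] ext_T_scaled[OF i] lin_opD(3)[OF A r r] lin_opD(3)[OF A i i]
  show ?thesis
    by (simp add: cop_def complex_eq_iff fun_eq_iff lin_op_diff[OF A] lin_opD(2)[OF A] s)
qed

lemma cop_add: "lin_op A \<Longrightarrow> a \<in> cext \<Longrightarrow> b \<in> cext \<Longrightarrow> cop A (\<lambda>vs. a vs + b vs) = (\<lambda>vs. cop A a vs + cop A b vs)"
proof -
  assume A: "lin_op A" and "a \<in> cext" "b \<in> cext"
  then show ?thesis using lin_opD(2)[OF A] by (simp add: cop_def complex_eq_iff fun_eq_iff cext_def)
qed

lemma cop_diff: "lin_op A \<Longrightarrow> a \<in> cext \<Longrightarrow> b \<in> cext \<Longrightarrow> cop A (\<lambda>vs. a vs - b vs) = (\<lambda>vs. cop A a vs - cop A b vs)"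
proof -
  assume A: "lin_op A" and "a \<in> cext" "b \<in> cext"
  then show ?thesis using lin_op_diff[OF A] by (simp add: cop_def complex_eq_iff fun_eq_iff cext_def)
qed

lemma cop_zero: "lin_op A \<Longrightarrow> cop A (\<lambda>_. 0) = (\<lambda>_. 0)"
  by (simp add: cop_def complex_eq_iff fun_eq_iff lin_op_zero)

definition cFil :: "('m, 'e::euclidean_space) filtered_space \<Rightarrow> nat \<Rightarrow> 'm \<Rightarrow> ('e list \<Rightarrow> complex) set" where
  "cFil M k x = {a. (\<lambda>vs. Re (a vs)) \<in> Fil M k x \<and> (\<lambda>vs. Im (a vs)) \<in> Fil M k x}"

definition no_eigenvalue :: "(('e::euclidean_space list \<Rightarrow> real) \<Rightarrow> 'e list \<Rightarrow> real) \<Rightarrow> complex \<Rightarrow> bool" where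
  "no_eigenvalue A z \<longleftrightarrow> (\<forall>a\<in>cext. (\<lambda>vs. z * a vs) = cop A a \<longrightarrow> a = (\<lambda>_. 0))"

context orthonormal_frame
begin

definition cbas :: "nat list \<Rightarrow> 'e list \<Rightarrow> complex" where
  "cbas K = (\<lambda>vs. complex_of_real (ebas K vs))"

lemma cbas_cext: "cbas K \<in> cext"
  by (simp add: cbas_def cext_def ebas_ext_T)

lemma cext_expand: "a \<in> cext \<Longrightarrow> a vs = (\<Sum>K\<in>idx n. a (map E K) * cbas K vs)"
  using ext_T_expand[of "\<lambda>vs. Re (a vs)" vs] ext_T_expand[of "\<lambda>vs. Im (a vs)" vs]
  by (simp add: complex_eq_iff cext_def cbas_def)

lemma cext_eqI:
  assumes "a \<in> cext" "b \<in> cext" "\<And>K. K \<in> idx n \<Longrightarrow> a (map E K) = b (map E K)"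
  shows "a = b"
proof
  fix vs
  have "a vs = (\<Sum>K\<in>idx n. a (map E K) * cbas K vs)" by (rule cext_expand[OF assms(1)])
  also have "\<dots> = (\<Sum>K\<in>idx n. b (map E K) * cbas K vs)" using assms(3) by simp
  also have "\<dots> = b vs" by (rule cext_expand[OF assms(2), symmetric])
  finally show "a vs = b vs" .
qed

lemma cop_matrix:
  assumes A: "lin_op A" and a: "a \<in> cext"
  shows "cop A a vs = (\<Sum>K\<in>idx n. a (map E K) * complex_of_real (A (ebas K) vs))"
proof -
  have m: "A a vs = (\<Sum>K\<in>idx n. a (map E K) * A (ebas K) vs)" if "a \<in> ext_T" for a
  proof -
    have "a = (\<lambda>vs. \<Sum>K\<in>idx n. a (map E K) * ebas K vs)" by (rule ext) (rule ext_T_expand[OF that])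
    then have "A a = A (\<lambda>vs. \<Sum>K\<in>idx n. a (map E K) * ebas K vs)" by simp
    also have "\<dots> = (\<lambda>vs. \<Sum>K\<in>idx n. a (map E K) * A (ebas K) vs)" by (rule lin_op_sum[OF A ebas_ext_T])
    finally show ?thesis by simp
  qed
  show ?thesis using a m[of "\<lambda>vs. Re (a vs)"] m[of "\<lambda>vs. Im (a vs)"]
    by (simp add: cop_def complex_eq_iff cext_def)
qed

text \<open>The matrix of \<open>z - A\<close> in the basis \<open>ebas\<close>;
  \<open>\<kappa>\<close> numbers the multi-indices because matrices are indexed by natural
  numbers.\<close>

definition char_matrix :: "nat \<Rightarrow> (nat \<Rightarrow> nat list) \<Rightarrow> (('e list \<Rightarrow> real) \<Rightarrow> 'e list \<Rightarrow> real) \<Rightarrow> complex \<Rightarrow> complex mat" where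
  "char_matrix m \<kappa> A z = Matrix.mat m m (\<lambda>(i, j). (if i = j then z else 0) - complex_of_real (A (ebas (\<kappa> j)) (map E (\<kappa> i))))"

lemma char_matrix_apply:
  assumes \<kappa>: "bij_betw \<kappa> {..<m} (idx n)" and A: "lin_op A" and i: "i < m" and a: "a \<in> cext"
  shows "(\<Sum>j<m. char_matrix m \<kappa> A z $$ (i, j) * a (map E (\<kappa> j))) = z * a (map E (\<kappa> i)) - cop A a (map E (\<kappa> i))"
proof -
  have "cop A a (map E (\<kappa> i)) = (\<Sum>j<m. a (map E (\<kappa> j)) * complex_of_real (A (ebas (\<kappa> j)) (map E (\<kappa> i))))"
    unfolding cop_matrix[OF A a] by (rule sum.reindex_bij_betw[OF \<kappa>, symmetric])
  moreover have "(\<Sum>j<m. (if i = j then z else 0) * a (map E (\<kappa> j))) = z * a (map E (\<kappa> i))"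
    using i by (subst sum.cong[OF refl, where h = "\<lambda>j. if j = i then z * a (map E (\<kappa> i)) else 0"]) auto
  ultimately show ?thesis using i
    by (simp add: char_matrix_def algebra_simps sum_subtractf)
qed

lemma cext_of_coeffs:
  fixes m :: nat
  assumes \<kappa>: "bij_betw \<kappa> {..<m} (idx n)"
  shows "(\<lambda>vs. \<Sum>j<m. c j * cbas (\<kappa> j) vs) \<in> cext"
    "i < m \<Longrightarrow> (\<Sum>j<m. c j * cbas (\<kappa> j) (map E (\<kappa> i))) = c i"
proof -
  show "(\<lambda>vs. \<Sum>j<m. c j * cbas (\<kappa> j) vs) \<in> cext" by (intro cext_sum cext_scale cbas_cext)
  assume i: "i < m"
  have idx: "\<kappa> j \<in> idx n" if "j < m" for j using \<kappa> that by (auto simp: bij_betw_def)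
  have inj: "\<kappa> j = \<kappa> i \<longleftrightarrow> j = i" if "j < m" for j using \<kappa> that i by (auto simp: bij_betw_def inj_on_def)
  have "(\<Sum>j<m. c j * cbas (\<kappa> j) (map E (\<kappa> i))) = (\<Sum>j<m. if j = i then c j else 0)"
    using idx inj i by (intro sum.cong) (auto simp: cbas_def ebas_frame)
  then show "(\<Sum>j<m. c j * cbas (\<kappa> j) (map E (\<kappa> i))) = c i" using i by simp
qed

lemma char_matrix_det_iff:
  assumes \<kappa>: "bij_betw \<kappa> {..<m} (idx n)" and A: "lin_op A"
  shows "Determinant.det (char_matrix m \<kappa> A z) \<noteq> 0 \<longleftrightarrow> no_eigenvalue A z"
proof -
  let ?M = "char_matrix m \<kappa> A z"
  have c: "?M \<in> carrier_mat m m" by (simp add: char_matrix_def)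
  have idx: "\<exists>i<m. K = \<kappa> i" if "K \<in> idx n" for K using \<kappa> that by (auto simp: bij_betw_def)
  have mv: "(?M *\<^sub>v v) $ i = (\<Sum>j<m. ?M $$ (i, j) * v $ j)" if "i < m" "v \<in> carrier_vec m" for i v
    using that c by (auto simp: scalar_prod_def lessThan_atLeast0 intro!: sum.cong)
  show ?thesis
  proof
    assume d: "Determinant.det ?M \<noteq> 0"
    show "no_eigenvalue A z" unfolding no_eigenvalue_def
    proof (intro ballI impI)
      fix a assume a: "a \<in> cext" and e: "(\<lambda>vs. z * a vs) = cop A a"
      define v where "v = vec m (\<lambda>j. a (map E (\<kappa> j)))"
      have v: "v \<in> carrier_vec m" by (simp add: v_def)
      have "?M *\<^sub>v v = 0\<^sub>v m"
      proof (rule eq_vecI)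
        fix i assume "i < dim_vec (0\<^sub>v m :: complex vec)"
        then have i: "i < m" by simp
        have "(?M *\<^sub>v v) $ i = (\<Sum>j<m. ?M $$ (i, j) * a (map E (\<kappa> j)))" unfolding mv[OF i v] by (simp add: v_def)
        then show "(?M *\<^sub>v v) $ i = 0\<^sub>v m $ i"
          using char_matrix_apply[OF \<kappa> A i a, of z] fun_cong[OF e, of "map E (\<kappa> i)"] i by simp
      qed (use c in auto)
      then have "v = 0\<^sub>v m" using d det_0_iff_vec_prod_zero[OF c] v by blast
      then have z: "a (map E (\<kappa> i)) = 0" if "i < m" for i using that by (auto simp: v_def dest!: arg_cong[where f = "\<lambda>v. Matrix.vec_index v i"])
      show "a = (\<lambda>_. 0)" by (rule cext_eqI[OF a cext_zero]) (use idx z in blast)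
    qed
  next
    assume ne: "no_eigenvalue A z"
    show "Determinant.det ?M \<noteq> 0"
    proof
      assume "Determinant.det ?M = 0"
      then obtain v where v: "v \<in> carrier_vec m" "v \<noteq> 0\<^sub>v m" "?M *\<^sub>v v = 0\<^sub>v m"
        using det_0_iff_vec_prod_zero[OF c] by blast
      define a where "a = (\<lambda>vs. \<Sum>j<m. v $ j * cbas (\<kappa> j) vs)"
      have a: "a \<in> cext" "\<And>i. i < m \<Longrightarrow> a (map E (\<kappa> i)) = v $ i"
        unfolding a_def by (rule cext_of_coeffs(1)[OF \<kappa>], rule cext_of_coeffs(2)[OF \<kappa>])
      have "(\<lambda>vs. z * a vs) = cop A a"
      proof (rule cext_eqI[OF cext_scale[OF a(1)] cop_in[OF A a(1)]])
        fix K assume "K \<in> idx n"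
        then obtain i where i: "i < m" "K = \<kappa> i" using idx by blast
        have "(\<Sum>j<m. ?M $$ (i, j) * a (map E (\<kappa> j))) = (?M *\<^sub>v v) $ i" unfolding mv[OF i(1) v(1)] by (simp add: a)
        then show "z * a (map E K) = cop A a (map E K)"
          using char_matrix_apply[OF \<kappa> A i(1) a(1), of z] v(3) i by simp
      qed
      then have "a = (\<lambda>_. 0)" using ne a(1) unfolding no_eigenvalue_def by blast
      then have "v = 0\<^sub>v m" using a(2) v(1) by (intro eq_vecI) auto
      then show False using v(2) by simp
    qed
  qed
qed

text \<open>Cramer's rule. The explicit formula matters as much as existence: it makes the
  dependence of the solution on the point smooth and that on \<open>z\<close> holomorphic.\<close>

lemma resolvent_coeffs:
  assumes \<kappa>: "bij_betw \<kappa> {..<m} (idx n)" and A: "lin_op A" and ne: "no_eigenvalue A z" and b: "b \<in> cext"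
  defines "a \<equiv> (\<lambda>vs. \<Sum>i<m. ((\<Sum>j<m. adj_mat (char_matrix m \<kappa> A z) $$ (i, j) * b (map E (\<kappa> j))) *
      inverse (Determinant.det (char_matrix m \<kappa> A z))) * cbas (\<kappa> i) vs)"
  shows "a \<in> cext" "(\<lambda>vs. z * a vs - cop A a vs) = b"
proof -
  let ?M = "char_matrix m \<kappa> A z"
  have c: "?M \<in> carrier_mat m m" by (simp add: char_matrix_def)
  have d: "Determinant.det ?M \<noteq> 0" using char_matrix_det_iff[OF \<kappa> A] ne by blast
  have idx: "\<exists>i<m. K = \<kappa> i" if "K \<in> idx n" for K using \<kappa> that by (auto simp: bij_betw_def)
  show a: "a \<in> cext" unfolding a_def by (rule cext_of_coeffs(1)[OF \<kappa>])
  have ai: "a (map E (\<kappa> i)) = (\<Sum>j<m. adj_mat ?M $$ (i, j) * b (map E (\<kappa> j))) * inverse (Determinant.det ?M)" if "i < m" for i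
    unfolding a_def by (rule cext_of_coeffs(2)[OF \<kappa> that])
  show "(\<lambda>vs. z * a vs - cop A a vs) = b"
  proof (rule cext_eqI[OF cext_diff[OF cext_scale[OF a] cop_in[OF A a]] b])
    fix K assume "K \<in> idx n"
    then obtain i where i: "i < m" "K = \<kappa> i" using idx by blast
    have adj: "(\<Sum>l<m. ?M $$ (i, l) * adj_mat ?M $$ (l, j)) = (if i = j then Determinant.det ?M else 0)" if "j < m" for j
    proof -
      have "(?M * adj_mat ?M) $$ (i, j) = (Determinant.det ?M \<cdot>\<^sub>m 1\<^sub>m m) $$ (i, j)" using adj_mat(2)[OF c] by simp
      moreover have "(?M * adj_mat ?M) $$ (i, j) = (\<Sum>l<m. ?M $$ (i, l) * adj_mat ?M $$ (l, j))"
        using c adj_mat(1)[OF c] i that by (auto simp: scalar_prod_def lessThan_atLeast0 intro!: sum.cong)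
      ultimately show ?thesis using i that by simp
    qed
    have "z * a (map E K) - cop A a (map E K) = (\<Sum>l<m. ?M $$ (i, l) * a (map E (\<kappa> l)))"
      unfolding i(2) by (rule char_matrix_apply[OF \<kappa> A i(1) a, symmetric])
    also have "\<dots> = (\<Sum>l<m. \<Sum>j<m. ?M $$ (i, l) * adj_mat ?M $$ (l, j) * b (map E (\<kappa> j)) * inverse (Determinant.det ?M))"
      by (simp add: ai sum_distrib_left sum_distrib_right mult.assoc)
    also have "\<dots> = (\<Sum>j<m. (\<Sum>l<m. ?M $$ (i, l) * adj_mat ?M $$ (l, j)) * b (map E (\<kappa> j)) * inverse (Determinant.det ?M))"
      by (subst sum.swap) (simp add: sum_distrib_right)
    also have "\<dots> = (\<Sum>j<m. if j = i then b (map E K) else 0)"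
      using d i by (intro sum.cong refl) (auto simp: adj)
    finally show "z * a (map E K) - cop A a (map E K) = b (map E K)" using i by simp
  qed
qed

end

subsection \<open>Eigenvalues of the leading part of the box operator\<close>

lemma cFil_iff: "a \<in> cFil M k x \<longleftrightarrow> (\<lambda>vs. Re (a vs)) \<in> Fil M k x \<and> (\<lambda>vs. Im (a vs)) \<in> Fil M k x"
  by (simp add: cFil_def)

context adapted_frame
begin

lemma lin_op_piece: "lin_op (piece k)"
  unfolding lin_op_def
proof (intro conjI ballI allI)
  show "piece k a \<in> ext_T" for a by (rule piece_ext_T)
  show "piece k (\<lambda>vs. a vs + b vs) = (\<lambda>vs. piece k a vs + piece k b vs)" for a b
    unfolding piece_def by (rule ext) (auto simp: sum.distrib[symmetric] distrib_right intro!: sum.cong)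
  show "piece k (\<lambda>vs. r * a vs) = (\<lambda>vs. r * piece k a vs)" for r a
    unfolding piece_def by (rule ext) (auto simp: sum_distrib_left mult.assoc intro!: sum.cong)
qed

lemma Fil_Suc_piece: "a \<in> Fil M (Suc k) x \<Longrightarrow> piece k a = (\<lambda>_. 0)"
  by (rule ext_T_eqI) (auto simp: piece_ext_T piece_frame Fil_iff)

lemma cop_piece: "graded A \<Longrightarrow> a \<in> cext \<Longrightarrow> cop (piece k) (cop A a) = cop A (cop (piece k) a)"
  unfolding cop_comp by (simp add: cop_def graded_piece cext_def)

text \<open>A graded \<open>A\<close> commutes with the weight projections, so each piece of
  \<open>a\<close> of weight below \<open>k\<close> solves the homogeneous equation and
  vanishes.\<close>

lemma graded_resolvent_Fil:
  assumes A: "graded A" and ne: "no_eigenvalue A z" and a: "a \<in> cext"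
    and r: "(\<lambda>vs. z * a vs - cop A a vs) \<in> cFil M k x"
  shows "a \<in> cFil M k x"
proof -
  note lA = graded_lin_op[OF A]
  have "j \<le> k \<Longrightarrow> a \<in> cFil M j x" for j
  proof (induction j)
    case 0 then show ?case using a by (simp add: cFil_iff Fil_iff cext_def)
  next
    case (Suc j)
    let ?p = "cop (piece j) a"
    have p: "?p \<in> cext" by (rule cop_in[OF lin_op_piece a])
    have "(\<lambda>vs. z * a vs - cop A a vs) \<in> cFil M (Suc j) x"
      using r Suc.prems by (auto simp: cFil_iff Fil_iff)
    then have "cop (piece j) (\<lambda>vs. z * a vs - cop A a vs) = (\<lambda>_. 0)"
      unfolding cFil_iff cop_def by (auto simp: Fil_Suc_piece complex_eq_iff)
    then have "(\<lambda>vs. z * ?p vs - cop A ?p vs) = (\<lambda>_. 0)"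
      by (simp only: cop_diff[OF lin_op_piece cext_scale[OF a] cop_in[OF lA a]] cop_scale[OF lin_op_piece a] cop_piece[OF A a])
    then have "(\<lambda>vs. z * ?p vs) = cop A ?p" by (simp add: fun_eq_iff)
    then have "?p = (\<lambda>_. 0)" using ne p unfolding no_eigenvalue_def by blast
    then have "piece j (\<lambda>vs. Re (a vs)) = (\<lambda>_. 0)" "piece j (\<lambda>vs. Im (a vs)) = (\<lambda>_. 0)"
      by (auto simp: cop_def complex_eq_iff fun_eq_iff)
    then show ?case using Suc Fil_piece_eq_0 by (auto simp: cFil_iff)
  qed
  then show ?thesis by blast
qed

end

context orthonormal_frame
begin

text \<open>Bilinear rather than Hermitian, so that a real symmetric operator stays symmetric and a
  complex factor \<open>z\<close> moves from one side to the other unchanged.\<close>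

definition cip :: "('e list \<Rightarrow> complex) \<Rightarrow> ('e list \<Rightarrow> complex) \<Rightarrow> complex" where
  "cip a b = (\<Sum>K\<in>idx n. a (map E K) * b (map E K))"

lemma cip_parts: "cip a b = Complex
   (ip (\<lambda>vs. Re (a vs)) (\<lambda>vs. Re (b vs)) - ip (\<lambda>vs. Im (a vs)) (\<lambda>vs. Im (b vs)))
   (ip (\<lambda>vs. Re (a vs)) (\<lambda>vs. Im (b vs)) + ip (\<lambda>vs. Im (a vs)) (\<lambda>vs. Re (b vs)))"
  by (simp add: cip_def ip_def complex_eq_iff sum_subtractf sum.distrib)

lemma cip_symmetric:
  assumes "\<And>a b. a \<in> ext_T \<Longrightarrow> b \<in> ext_T \<Longrightarrow> ip (A a) b = ip a (A b)" "a \<in> cext" "b \<in> cext"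
  shows "cip (cop A a) b = cip a (cop A b)"
  using assms by (simp add: cip_parts cext_def)

end

context filtered_manifold
begin

text \<open>The leading part of \<open>Box\<close>. The factors 1 give it the shape expected by
  \<open>lin_op_lincomb\<close> and \<open>graded_lincomb\<close>.\<close>

definition box0 :: "'m \<Rightarrow> ('e list \<Rightarrow> real) \<Rightarrow> 'e list \<Rightarrow> real" where
  "box0 x a = (\<lambda>vs. 1 * d0_at M x (t_at M x a) vs + 1 * t_at M x (d0_at M x a) vs)"

text \<open>\<open>box0\<close> always has the eigenvalue \<open>0\<close>, for instance on functions. Replacing it by a scalar \<open>C\<close>
  on a complement of the image of \<open>d\<^sub>0\<^sup>-\<^sup>1\<close> removes this eigenvalue, so that the resolvent becomes
  holomorphic across \<open>0\<close>.\<close>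

definition aux_op :: "real \<Rightarrow> 'm \<Rightarrow> ('e list \<Rightarrow> real) \<Rightarrow> 'e list \<Rightarrow> real" where
  "aux_op C x a = (\<lambda>vs. 1 * t_at M x (d0_at M x a) vs + C * (1 * a vs + (-1) * h_at M x (d0_at M x a) vs))"

lemma lin_op_box0: "lin_op (box0 x)"
  unfolding box0_def[abs_def]
  by (rule lin_op_lincomb[OF lin_op_comp[OF lin_op_at(1) lin_op_at(2)] lin_op_comp[OF lin_op_at(2) lin_op_at(1)]])

lemma lin_op_aux: "lin_op (aux_op C x)"
  unfolding aux_op_def[abs_def]
  by (rule lin_op_lincomb[OF lin_op_comp[OF lin_op_at(2) lin_op_at(1)]
    lin_op_lincomb[OF lin_op_id lin_op_comp[OF lin_op_at(3) lin_op_at(1)]]])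

lemma (in osculating_frame) graded_pair:
  "graded (\<lambda>a. d0_at M x (t_at M x a))" "graded (\<lambda>a. t_at M x (d0_at M x a))" "graded (\<lambda>a. h_at M x (d0_at M x a))"
  by (rule graded_comp[OF graded_d0_at graded_t_at] graded_comp[OF graded_t_at graded_d0_at] graded_comp[OF graded_h_at graded_d0_at])+

lemma resolvent_Fil:
  assumes "A = box0 x \<or> A = aux_op C x" and ne: "no_eigenvalue A z" and a: "a \<in> cext"
    and r: "(\<lambda>vs. z * a vs - cop A a vs) \<in> cFil M k x"
  shows "a \<in> cFil M k x"
proof -
  obtain E n w \<beta> where "osculating_frame M x E n w \<beta>" by (rule osculating_at)
  then interpret osculating_frame M x E n w \<beta> .
  have "graded (box0 x)" "graded (aux_op C x)"
    unfolding box0_def[abs_def] aux_op_def[abs_def] by (intro graded_lincomb graded_pair graded_id)+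
  then have "graded A" using assms(1) by auto
  then show ?thesis by (rule graded_resolvent_Fil[OF _ ne a r])
qed

text \<open>The squared length of \<open>d0 a\<close> is the inner product of \<open>a\<close> with
  \<open>t d0 a\<close>.\<close>

lemma t_d0_eq_0:
  assumes a: "a \<in> ext_T" and z: "t_at M x (d0_at M x a) = (\<lambda>_. 0)"
  shows "d0_at M x a = (\<lambda>_. 0)"
proof -
  obtain E n w \<beta> where "osculating_frame M x E n w \<beta>" by (rule osculating_at)
  then interpret osculating_frame M x E n w \<beta> .
  have "ip (d0_at M x a) (d0_at M x a) = ip a (\<lambda>_. 0)" using ip_d0_t[OF a d0_at_in[OF a]] z by simp
  then show ?thesis by (intro ip_pos[OF d0_at_in[OF a]]) (simp add: ip_def)
qed

lemma cop_at:
  assumes "a \<in> cext"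
  shows "cop (\<lambda>a. h_at M x (d0_at M x (t_at M x a))) a = cop (t_at M x) a"
    "cop (\<lambda>a. h_at M x (d0_at M x (h_at M x a))) a = cop (h_at M x) a"
    "cop (\<lambda>a. t_at M x (h_at M x a)) a = (\<lambda>_. 0)" "cop (\<lambda>a. t_at M x (t_at M x a)) a = (\<lambda>_. 0)"
    "cop (\<lambda>a. d0_at M x (d0_at M x a)) a = (\<lambda>_. 0)"
  using assms by (auto simp add: cop_def cext_def at_identities at_squares d0_d0 fun_eq_iff zero_complex.code)

lemma cop_box0: "cop (box0 x) a = (\<lambda>vs. cop (d0_at M x) (cop (t_at M x) a) vs + cop (t_at M x) (cop (d0_at M x) a) vs)"
  by (simp add: cop_comp cop_def box0_def complex_eq_iff fun_eq_iff)

lemma cop_aux: "cop (aux_op C x) a = (\<lambda>vs. cop (t_at M x) (cop (d0_at M x) a) vs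
    + complex_of_real C * (a vs - cop (h_at M x) (cop (d0_at M x) a) vs))"
  by (simp add: cop_comp cop_def aux_op_def complex_eq_iff fun_eq_iff algebra_simps)

lemma cop_at_in: "a \<in> cext \<Longrightarrow> cop (d0_at M x) a \<in> cext" "a \<in> cext \<Longrightarrow> cop (t_at M x) a \<in> cext" "a \<in> cext \<Longrightarrow> cop (h_at M x) a \<in> cext"
  by (simp_all add: cop_in lin_op_at)

text \<open>\<open>h d0\<close> is a projection that fixes the images of \<open>h\<close> and
  \<open>t\<close> and kills the term with \<open>C\<close>. Applied to the equation it gives
  \<open>z h d0 a = t d0 a + t b + h u\<close>; comparison with the equation itself leaves
  \<open>(z - C)(a - h d0 a) = 0\<close>.\<close>

lemma aux_range:
  assumes z: "z \<noteq> complex_of_real C" and a: "a \<in> cext" and b: "b \<in> cext" and u: "u \<in> cext"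
    and e: "\<And>vs. z * a vs - cop (aux_op C x) a vs - cop (t_at M x) b vs = cop (h_at M x) u vs"
  shows "cop (h_at M x) (cop (d0_at M x) a) = a"
proof -
  let ?h = "cop (h_at M x)" and ?D = "cop (d0_at M x)" and ?t = "cop (t_at M x)"
  let ?P = "cop (\<lambda>a. h_at M x (d0_at M x a))"
  have lP: "lin_op (\<lambda>a. h_at M x (d0_at M x a))" by (rule lin_op_comp[OF lin_op_at(3) lin_op_at(1)])
  note i = cop_at_in cext_diff cext_scale cext_add a b u
  have P: "?P c = ?h (?D c)" for c by (simp add: cop_comp)
  have Pt: "?P (?t c) = ?t c" and Ph: "?P (?h c) = ?h c" if "c \<in> cext" for c
    using cop_at(1,2)[OF that] by (simp_all add: cop_comp)
  have ee: "(\<lambda>vs. z * a vs) = (\<lambda>vs. (?t (?D a) vs + ?t b vs + ?h u vs) + complex_of_real C * (a vs - ?h (?D a) vs))"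
    (is "_ = (\<lambda>vs. ?s vs + complex_of_real C * ?q vs)")
    using e unfolding cop_aux by (simp add: fun_eq_iff algebra_simps)
  have q0: "?P ?q = (\<lambda>_. 0)"
    by (simp add: cop_diff[OF lP] i Ph) (simp add: P)
  have s: "?s \<in> cext" by (intro i)
  have q: "?q \<in> cext" by (intro i)
  have "(\<lambda>vs. z * ?P a vs) = ?P (\<lambda>vs. ?s vs + complex_of_real C * ?q vs)"
    unfolding ee[symmetric] by (rule cop_scale[OF lP a, symmetric])
  also have "\<dots> = ?s"
    unfolding cop_add[OF lP s cext_scale[OF q]] cop_scale[OF lP q] q0
    by (simp add: cop_add[OF lP] Pt Ph i)
  finally have "z * ?h (?D a) vs = ?s vs" for vs by (simp add: P fun_eq_iff)
  then have "(z - complex_of_real C) * ?q vs = 0" for vs using fun_cong[OF ee, of vs] by (simp add: algebra_simps)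
  then show ?thesis using z by (simp add: fun_eq_iff)
qed

text \<open>An eigenvector lies in the image of \<open>h\<close> by \<open>aux_range\<close>, so
  \<open>z a = t d0 a\<close>. For \<open>z = 0\<close> this forces \<open>d0 a = 0\<close> and thus
  \<open>a = h d0 a = 0\<close>; otherwise \<open>t a = t h d0 a = 0\<close> makes \<open>a\<close>
  an eigenvector of \<open>box0\<close>.\<close>

lemma aux_no_eigenvalue:
  assumes z: "z \<noteq> complex_of_real C" and ne: "z = 0 \<or> no_eigenvalue (box0 x) z"
  shows "no_eigenvalue (aux_op C x) z"
  unfolding no_eigenvalue_def
proof (intro ballI impI)
  fix a assume a: "a \<in> cext" and e: "(\<lambda>vs. z * a vs) = cop (aux_op C x) a"
  let ?h = "cop (h_at M x)" and ?D = "cop (d0_at M x)" and ?t = "cop (t_at M x)"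
  have hD: "?h (?D a) = a"
    by (rule aux_range[OF z a cext_zero cext_zero]) (simp add: e[symmetric] fun_eq_iff cop_zero lin_op_at)
  have za: "(\<lambda>vs. z * a vs) = ?t (?D a)" unfolding e cop_aux hD by simp
  show "a = (\<lambda>_. 0)"
  proof (cases "z = 0")
    case True
    then have "?t (?D a) = (\<lambda>_. 0)" using za by simp
    then have "t_at M x (d0_at M x (\<lambda>vs. Re (a vs))) = (\<lambda>_. 0)" "t_at M x (d0_at M x (\<lambda>vs. Im (a vs))) = (\<lambda>_. 0)"
      by (simp_all add: cop_comp cop_def complex_eq_iff fun_eq_iff)
    then have "d0_at M x (\<lambda>vs. Re (a vs)) = (\<lambda>_. 0)" "d0_at M x (\<lambda>vs. Im (a vs)) = (\<lambda>_. 0)"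
      using a t_d0_eq_0 by (auto simp: cext_def)
    then have "?D a = (\<lambda>_. 0)" by (simp add: cop_def complex_eq_iff fun_eq_iff)
    then show ?thesis using hD by (simp add: cop_zero lin_op_at)
  next
    case False
    have "?t a = ?t (?h (?D a))" by (simp add: hD)
    also have "\<dots> = (\<lambda>_. 0)" using cop_at(3)[OF cop_at_in(1)[OF a]] by (simp add: cop_comp)
    finally have "(\<lambda>vs. z * a vs) = cop (box0 x) a" unfolding cop_box0 by (simp add: cop_zero lin_op_at za)
    then show ?thesis using ne False a unfolding no_eigenvalue_def by blast
  qed
qed

text \<open>If \<open>a\<close> is an eigenvector of \<open>box0\<close>, then \<open>t a\<close>
  and \<open>t d0 a\<close> satisfy the eigenvalue equation of \<open>aux_op\<close>, which agrees
  with \<open>t d0\<close> on values of \<open>t\<close>. Both therefore vanish, and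
  \<open>z a = d0 t a + t d0 a\<close> becomes 0.\<close>

lemma box0_no_eigenvalue:
  assumes z: "z \<noteq> 0" and ne: "no_eigenvalue (aux_op C x) z"
  shows "no_eigenvalue (box0 x) z"
  unfolding no_eigenvalue_def
proof (intro ballI impI)
  fix a assume a: "a \<in> cext" and e: "(\<lambda>vs. z * a vs) = cop (box0 x) a"
  let ?h = "cop (h_at M x)" and ?D = "cop (d0_at M x)" and ?t = "cop (t_at M x)"
  note i = cop_at_in a
  have htD: "?h (?D (?t c)) = ?t c" and tt: "?t (?t c) = (\<lambda>_. 0)" and DD: "?D (?D c) = (\<lambda>_. 0)" if "c \<in> cext" for c
    using cop_at(1,4,5)[OF that] by (simp_all add: cop_comp)
  have zt: "(\<lambda>vs. z * ?t a vs) = ?t (?D (?t a))"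
  proof -
    have "(\<lambda>vs. z * ?t a vs) = ?t (cop (box0 x) a)" unfolding e[symmetric] by (rule cop_scale[OF lin_op_at(2) a, symmetric])
    then show ?thesis unfolding cop_box0 by (simp add: cop_add[OF lin_op_at(2)] i tt)
  qed
  have "(\<lambda>vs. z * ?t a vs) = cop (aux_op C x) (?t a)" unfolding cop_aux by (simp add: zt htD a)
  then have t0: "?t a = (\<lambda>_. 0)" using ne cop_at_in(2)[OF a] unfolding no_eigenvalue_def by blast
  have zD: "(\<lambda>vs. z * ?D a vs) = ?D (?t (?D a))"
  proof -
    have "(\<lambda>vs. z * ?D a vs) = ?D (cop (box0 x) a)" unfolding e[symmetric] by (rule cop_scale[OF lin_op_at(1) a, symmetric])
    then show ?thesis unfolding cop_box0 by (simp add: cop_add[OF lin_op_at(1)] i DD)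
  qed
  have "(\<lambda>vs. z * ?t (?D a) vs) = ?t (?D (?t (?D a)))"
    unfolding zD[symmetric] by (rule cop_scale[OF lin_op_at(2), symmetric]) (intro i)
  then have "(\<lambda>vs. z * ?t (?D a) vs) = cop (aux_op C x) (?t (?D a))" unfolding cop_aux by (simp add: htD i)
  then have "?t (?D a) = (\<lambda>_. 0)" using ne cop_at_in(2)[OF cop_at_in(1)[OF a]] unfolding no_eigenvalue_def by blast
  then have "(\<lambda>vs. z * a vs) = (\<lambda>_. 0)" unfolding e cop_box0 t0 by (simp add: cop_zero lin_op_at)
  then show "a = (\<lambda>_. 0)" using z by (simp add: fun_eq_iff)
qed

subsection \<open>Complex-valued forms\<close>

abbreviation "CF \<equiv> cforms_on M"
abbreviation "cd \<equiv> cplx (de_rham M)"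
abbreviation "ct \<equiv> cplx (d0_t M)"

definition crestr :: "'m set \<Rightarrow> ('m, 'e) cform \<Rightarrow> ('m, 'e) cform" where
  "crestr U \<zeta> = (\<lambda>x. if x \<in> U then \<zeta> x else (\<lambda>_. 0))"

lemma crestr_in [simp]: "x \<in> U \<Longrightarrow> crestr U \<zeta> x = \<zeta> x"
  and crestr_parts: "(\<lambda>x vs. Re (crestr U \<zeta> x vs)) = restr U (\<lambda>x vs. Re (\<zeta> x vs))"
    "(\<lambda>x vs. Im (crestr U \<zeta> x vs)) = restr U (\<lambda>x vs. Im (\<zeta> x vs))"
  by (auto simp: crestr_def restr_def fun_eq_iff)

lemma cplx_parts [simp]: "(\<lambda>x vs. Re (cplx T \<zeta> x vs)) = T (\<lambda>x vs. Re (\<zeta> x vs))" "(\<lambda>x vs. Im (cplx T \<zeta> x vs)) = T (\<lambda>x vs. Im (\<zeta> x vs))"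
  by (simp_all add: cplx_def fun_eq_iff)

lemma cplx_pointwise: "cplx (d0 M) \<zeta> x = cop (d0_at M x) (\<zeta> x)" "ct \<zeta> x = cop (t_at M x) (\<zeta> x)" "cplx (d0_inv M) \<zeta> x = cop (h_at M x) (\<zeta> x)"
  by (simp_all add: cplx_def cop_def fun_eq_iff pointwise_ops)

lemma CF_cext: "\<zeta> \<in> CF U \<Longrightarrow> \<zeta> x \<in> cext"
  by (auto simp: cforms_on_def cext_def dest: forms_on_ext[where x = x])

lemma CF_out: "\<zeta> \<in> CF U \<Longrightarrow> x \<notin> U \<Longrightarrow> \<zeta> x = (\<lambda>_. 0)"
  using forms_on_out[of "\<lambda>x vs. Re (\<zeta> x vs)" U x] forms_on_out[of "\<lambda>x vs. Im (\<zeta> x vs)" U x]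
  by (auto simp: cforms_on_def fun_eq_iff complex_eq_iff)

lemma CF_add: "open U \<Longrightarrow> \<zeta> \<in> CF U \<Longrightarrow> \<xi> \<in> CF U \<Longrightarrow> (\<lambda>x vs. \<zeta> x vs + \<xi> x vs) \<in> CF U"
  by (simp add: cforms_on_def forms_on_add)

lemma CF_diff: "open U \<Longrightarrow> \<zeta> \<in> CF U \<Longrightarrow> \<xi> \<in> CF U \<Longrightarrow> (\<lambda>x vs. \<zeta> x vs - \<xi> x vs) \<in> CF U"
  by (simp add: cforms_on_def forms_on_diff)

lemma CF_scale: "open U \<Longrightarrow> \<zeta> \<in> CF U \<Longrightarrow> (\<lambda>x vs. c * \<zeta> x vs) \<in> CF U"
  by (auto simp: cforms_on_def intro!: forms_on_add forms_on_diff forms_on_scale)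

lemma CF_restr: "\<zeta> \<in> CF U \<Longrightarrow> V \<subseteq> U \<Longrightarrow> open V \<Longrightarrow> crestr V \<zeta> \<in> CF V"
  using forms_on_restr[of "\<lambda>x vs. Re (\<zeta> x vs)" U V] forms_on_restr[of "\<lambda>x vs. Im (\<zeta> x vs)" U V]
  by (simp add: cforms_on_def crestr_parts)

lemma cd_CF: "\<zeta> \<in> CF U \<Longrightarrow> open U \<Longrightarrow> crestr U (cd \<zeta>) \<in> CF U"
  by (simp add: cforms_on_def crestr_parts de_rham_forms_on)

lemma ct_CF: "\<zeta> \<in> CF U \<Longrightarrow> open U \<Longrightarrow> ct \<zeta> \<in> CF U"
  by (simp add: cforms_on_def d0_t_forms_on)

lemma cd_cong: "open V \<Longrightarrow> x \<in> V \<Longrightarrow> (\<And>q. q \<in> V \<Longrightarrow> \<zeta> q = \<xi> q) \<Longrightarrow> cd \<zeta> x = cd \<xi> x"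
  unfolding cplx_def by (rule ext) (simp add: de_rham_cong[of V x "\<lambda>x vs. Re (\<zeta> x vs)" "\<lambda>x vs. Re (\<xi> x vs)"]
    de_rham_cong[of V x "\<lambda>x vs. Im (\<zeta> x vs)" "\<lambda>x vs. Im (\<xi> x vs)"])

lemma cd_lincomb:
  assumes z: "\<zeta> \<in> CF U" and x: "\<xi> \<in> CF U" and U: "open U" "p \<in> U"
  shows "cd (\<lambda>x vs. c * \<zeta> x vs + \<xi> x vs) p vs = c * cd \<zeta> p vs + cd \<xi> p vs"
proof -
  let ?R = "\<lambda>\<zeta> x vs. Re (\<zeta> x vs :: complex)" and ?I = "\<lambda>\<zeta> x vs. Im (\<zeta> x vs :: complex)"
  have f: "?R \<zeta> \<in> forms_on M U" "?I \<zeta> \<in> forms_on M U" "?R \<xi> \<in> forms_on M U" "?I \<xi> \<in> forms_on M U"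
    using z x by (auto simp: cforms_on_def)
  have lin3: "de_rham M (\<lambda>x vs. r * a x vs + (s * b x vs + e x vs)) p vs = r * de_rham M a p vs + (s * de_rham M b p vs + de_rham M e p vs)"
    if "a \<in> forms_on M U" "b \<in> forms_on M U" "e \<in> forms_on M U" for r s a b e
  proof -
    have "(\<lambda>x vs. s * b x vs + e x vs) \<in> forms_on M U" using that U by (intro forms_on_add forms_on_scale)
    from de_rham_linear[OF that(1) this U(2), of r 1 vs] de_rham_linear[OF that(2,3) U(2), of s 1 vs]
    show ?thesis by simp
  qed
  show ?thesis
    using lin3[OF f(1,2,3), of "Re c" "- Im c"] lin3[OF f(2,1,4), of "Re c" "Im c"]
    by (simp add: cplx_def complex_eq_iff algebra_simps)
qed

lemma cd_zero: "cd (\<lambda>x vs. 0) p vs = 0"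
  using de_rham_linear[OF forms_on_zero forms_on_zero UNIV_I, of 0 0 p vs]
  by (simp add: cplx_def complex_eq_iff)

lemma cd_cd: "\<zeta> \<in> CF U \<Longrightarrow> open U \<Longrightarrow> p \<in> U \<Longrightarrow> cd (cd \<zeta>) p = (\<lambda>_. 0)"
  using de_rham_de_rham[of "\<lambda>x vs. Re (\<zeta> x vs)" U p] de_rham_de_rham[of "\<lambda>x vs. Im (\<zeta> x vs)" U p]
  by (simp add: cplx_def[of "de_rham M" "cd \<zeta>"] cforms_on_def fun_eq_iff zero_complex.code)

lemma cBox_eq: "cplx (Box M) \<zeta> x vs = cd (ct \<zeta>) x vs + cop (t_at M x) (cd \<zeta> x) vs"
  by (simp add: cplx_def Box_def cop_def pointwise_ops(3)[of M "de_rham M _"] complex_eq_iff)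

lemma cBox_restr:
  assumes V: "open V" "x \<in> V" and e: "\<And>q. q \<in> V \<Longrightarrow> \<zeta> q = \<xi> q"
  shows "cplx (Box M) \<zeta> x = cplx (Box M) \<xi> x"
proof -
  have "cd \<zeta> x = cd \<xi> x" by (rule cd_cong[OF V e])
  moreover have "cd (ct \<zeta>) x = cd (ct \<xi>) x" by (rule cd_cong[OF V]) (simp add: cplx_pointwise e)
  ultimately show ?thesis by (intro ext) (simp only: cBox_eq)
qed

lemma cBox_lincomb:
  assumes z: "\<zeta> \<in> CF U" and x: "\<xi> \<in> CF U" and U: "open U" "p \<in> U"
  shows "cplx (Box M) (\<lambda>x vs. c * \<zeta> x vs + \<xi> x vs) p vs = c * cplx (Box M) \<zeta> p vs + cplx (Box M) \<xi> p vs"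
proof -
  have l: "cop (t_at M q) (\<lambda>vs. c * a vs + b vs) = (\<lambda>vs. c * cop (t_at M q) a vs + cop (t_at M q) b vs)"
    if "a \<in> cext" "b \<in> cext" for a b q
    using that by (simp add: cop_add[OF lin_op_at(2) cext_scale] cop_scale[OF lin_op_at(2)])
  have ct: "ct (\<lambda>x vs. c * \<zeta> x vs + \<xi> x vs) = (\<lambda>x vs. c * ct \<zeta> x vs + ct \<xi> x vs)"
    by (intro ext) (simp add: cplx_pointwise l CF_cext[OF z] CF_cext[OF x])
  have d: "cd \<eta> p \<in> cext" if "\<eta> \<in> CF U" for \<eta> using CF_cext[OF cd_CF[OF that U(1)], of p] U(2) by simp
  have "cd (\<lambda>x vs. c * \<zeta> x vs + \<xi> x vs) p = (\<lambda>vs. c * cd \<zeta> p vs + cd \<xi> p vs)"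
    by (rule ext) (rule cd_lincomb[OF z x U])
  then show ?thesis
    by (simp only: cBox_eq ct cd_lincomb[OF ct_CF[OF z U(1)] ct_CF[OF x U(1)] U] l[OF d[OF z] d[OF x]]) (simp add: algebra_simps)
qed

text \<open>Both \<open>t\<close> and \<open>d0\<close> preserve weights, so the two summands
  inherit the property from \<open>d - d0\<close>.\<close>

lemma Box_raise:
  assumes w: "\<omega> \<in> forms_on M U" and U: "open U" "x \<in> U" and k: "\<And>p. p \<in> U \<Longrightarrow> \<omega> p \<in> Fil M k p"
  shows "(\<lambda>vs. Box M \<omega> x vs - box0 x (\<omega> x) vs) \<in> Fil M (Suc k) x"
proof -
  have t: "d0_t M \<omega> \<in> forms_on M U" by (rule d0_t_forms_on[OF w U(1)])
  have "(\<lambda>vs. de_rham M (d0_t M \<omega>) x vs - d0_at M x (d0_t M \<omega> x) vs) \<in> Fil M (Suc k) x"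
    by (rule raise[OF t U]) (simp add: pointwise_ops at_Fil k)
  moreover have "t_at M x (\<lambda>vs. de_rham M \<omega> x vs - d0_at M x (\<omega> x) vs) \<in> Fil M (Suc k) x"
    by (intro at_Fil raise[OF w U] k)
  moreover have "t_at M x (\<lambda>vs. de_rham M \<omega> x vs - d0_at M x (\<omega> x) vs) = (\<lambda>vs. t_at M x (de_rham M \<omega> x) vs - t_at M x (d0_at M x (\<omega> x)) vs)"
    by (intro lin_op_diff lin_op_at de_rham_ext[OF w U] at_in forms_on_ext[OF w])
  ultimately have "(\<lambda>vs. (de_rham M (d0_t M \<omega>) x vs - d0_at M x (d0_t M \<omega> x) vs)
      + (t_at M x (de_rham M \<omega> x) vs - t_at M x (d0_at M x (\<omega> x)) vs)) \<in> Fil M (Suc k) x"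
    by (simp only: Fil_add)
  then show ?thesis by (simp add: Box_def box0_def pointwise_ops algebra_simps)
qed

lemma cBox_raise:
  assumes "\<zeta> \<in> CF U" "open U" "x \<in> U" "\<And>p. p \<in> U \<Longrightarrow> \<zeta> p \<in> cFil M k p"
  shows "(\<lambda>vs. cplx (Box M) \<zeta> x vs - cop (box0 x) (\<zeta> x) vs) \<in> cFil M (Suc k) x"
  using Box_raise[of "\<lambda>x vs. Re (\<zeta> x vs)" U x k] Box_raise[of "\<lambda>x vs. Im (\<zeta> x vs)" U x k] assms
  by (simp add: cforms_on_def cFil_iff cplx_def cop_def)

lemma cFil_add: "a \<in> cFil M k x \<Longrightarrow> b \<in> cFil M k x \<Longrightarrow> (\<lambda>vs. a vs + b vs) \<in> cFil M k x"
  and cFil_diff: "a \<in> cFil M k x \<Longrightarrow> b \<in> cFil M k x \<Longrightarrow> (\<lambda>vs. a vs - b vs) \<in> cFil M k x"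
  by (simp_all add: cFil_iff Fil_add Fil_diff)

lemma cFil_0: "a \<in> cext \<Longrightarrow> a \<in> cFil M 0 x"
  by (simp add: cFil_iff Fil_0 cext_def)

lemma cFil_mono: "k \<le> l \<Longrightarrow> a \<in> cFil M l x \<Longrightarrow> a \<in> cFil M k x"
  unfolding cFil_iff using Fil_mono by blast

lemma cFil_zero: "(\<lambda>_. 0) \<in> cFil M k x"
  by (simp add: cFil_iff Fil_zero)

lemma cFil_top: "a \<in> cFil M top_weight x \<Longrightarrow> a = (\<lambda>_. 0)"
  using Fil_top_weight[of "\<lambda>vs. Re (a vs)" x] Fil_top_weight[of "\<lambda>vs. Im (a vs)" x]
  by (auto simp: cFil_iff fun_eq_iff complex_eq_iff)

text \<open>The homogeneous equation reads \<open>(z - box0)\<zeta> = (Box - box0)\<zeta>\<close>.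
  Its right-hand side has higher weight than \<open>\<zeta>\<close>, and fibrewise injectivity of
  \<open>z - box0\<close> passes the gain on to \<open>\<zeta>\<close>.\<close>

lemma Box_resolvent_unique:
  assumes U: "open U" and ne: "\<And>x. x \<in> U \<Longrightarrow> no_eigenvalue (box0 x) z" and \<zeta>: "\<zeta> \<in> CF U"
    and e: "\<And>x vs. x \<in> U \<Longrightarrow> z * \<zeta> x vs - cplx (Box M) \<zeta> x vs = 0"
  shows "\<zeta> = (\<lambda>x vs. 0)"
proof -
  have "\<forall>x\<in>U. \<zeta> x \<in> cFil M k x" for k
  proof (induction k)
    case 0 then show ?case using CF_cext[OF \<zeta>] by (auto intro: cFil_0)
  next
    case (Suc k)
    show ?case
    proof
      fix x assume x: "x \<in> U"
      have "(\<lambda>vs. z * \<zeta> x vs - cop (box0 x) (\<zeta> x) vs) = (\<lambda>vs. cplx (Box M) \<zeta> x vs - cop (box0 x) (\<zeta> x) vs)"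
        using e[OF x] by (auto simp: fun_eq_iff)
      also have "\<dots> \<in> cFil M (Suc k) x" by (rule cBox_raise[OF \<zeta> U x]) (use Suc in blast)
      finally show "\<zeta> x \<in> cFil M (Suc k) x" by (rule resolvent_Fil[OF disjI1[OF refl] ne[OF x] CF_cext[OF \<zeta>]])
    qed
  qed
  then have "\<zeta> x = (\<lambda>_. 0)" for x using cFil_top CF_out[OF \<zeta>, of x] by (cases "x \<in> U") blast+
  then show ?thesis by blast
qed

text \<open>Constant coefficients in an adapted frame keep the weight at neighbouring points, and so
  does the cutoff factor.\<close>

lemma extend_value:
  assumes a: "a \<in> Fil M k x"
  shows "\<exists>\<eta>\<in>forms_on M UNIV. \<eta> x = a \<and> (\<forall>q. \<eta> q \<in> Fil M k q)"
proof -
  obtain W E n w where W: "x \<in> W" "frame_nbhd M W E n w" by (rule frame_nbhd_at)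
  then interpret frame_nbhd M W E n w by simp
  interpret x: adapted_frame M x "\<lambda>a. E a x" n w by (rule frame[OF W(1)])
  define \<omega> where "\<omega> = (\<lambda>q vs. \<Sum>K\<in>idx n. a (EK K x) * eb K q vs)"
  have w: "\<omega> \<in> forms_on M W"
    unfolding \<omega>_def by (intro forms_on_lincomb open_W smf_const eb_forms_on idx_set)
  have wF: "\<omega> q \<in> Fil M k q" for q
  proof (cases "q \<in> W")
    case True
    interpret q: adapted_frame M q "\<lambda>a. E a q" n w by (rule frame[OF True])
    have "\<omega> q (EK K q) = a (EK K x)" if "K \<in> idx n" for K
      unfolding \<omega>_def using q.lincomb_ebas_frame[OF that, of "\<lambda>K. a (EK K x)"] by (simp add: ebas_eb[OF True])
    moreover have "q.wt = x.wt" by (rule ext) (simp add: q.wt_def x.wt_def)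
    ultimately show ?thesis using a forms_on_ext[OF w, of q] unfolding q.Fil_iff x.Fil_iff by auto
  next
    case False then show ?thesis using forms_on_out[OF w False] by (simp add: Fil_zero)
  qed
  have wx: "\<omega> x = a"
  proof
    fix vs show "\<omega> x vs = a vs"
      using x.ext_T_expand[OF Fil_ext[OF a], of vs] unfolding \<omega>_def ebas_eb[OF W(1)] by (rule sym)
  qed
  obtain \<eta> V ch where \<eta>: "\<eta> \<in> forms_on M UNIV" "open V" "x \<in> V" "V \<subseteq> W" "\<And>q. q \<in> V \<Longrightarrow> \<eta> q = \<omega> q"
    "smf UNIV ch" "\<And>q. \<eta> q = (\<lambda>vs. ch q * \<omega> q vs)"
    by (rule extend_form[OF open_W W(1) w]) (rule that)
  have "\<eta> q \<in> Fil M k q" for q using Fil_lincomb[OF wF[of q] wF[of q], of "ch q" 0] \<eta>(7) by simp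
  then show ?thesis using \<eta>(1) \<eta>(5)[OF \<eta>(3)] wx by auto
qed

lemma cextend_value:
  assumes "a \<in> cFil M k x"
  shows "\<exists>\<eta>\<in>CF UNIV. \<eta> x = a \<and> (\<forall>q. \<eta> q \<in> cFil M k q)"
proof -
  obtain \<eta>1 where 1: "\<eta>1 \<in> forms_on M UNIV" "\<eta>1 x = (\<lambda>vs. Re (a vs))" "\<And>q. \<eta>1 q \<in> Fil M k q"
    using extend_value assms unfolding cFil_iff by blast
  obtain \<eta>2 where 2: "\<eta>2 \<in> forms_on M UNIV" "\<eta>2 x = (\<lambda>vs. Im (a vs))" "\<And>q. \<eta>2 q \<in> Fil M k q"
    using extend_value assms unfolding cFil_iff by blast
  show ?thesis
    by (rule bexI[of _ "\<lambda>q vs. Complex (\<eta>1 q vs) (\<eta>2 q vs)"]) (use 1 2 in \<open>auto simp: cforms_on_def cFil_iff\<close>)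
qed

text \<open>Solvability of \<open>(z - \<box>)\<zeta> = \<eta>\<close> forces \<open>z - box0\<close> to be injective on each graded piece, by
  induction on the weight: the lower pieces of a solution for \<open>\<eta>\<close> of weight \<open>k\<close> vanish, hence
  \<open>z - box0\<close> is onto in weight \<open>k\<close>, and \<open>box0\<close> is symmetric.\<close>

lemma small_enough_no_eigenvalue:
  assumes U: "open U" and sm: "\<And>\<eta>. \<eta> \<in> CF U \<Longrightarrow> \<exists>\<zeta>. solves_resolvent M U z \<eta> \<zeta>" and x: "x \<in> U"
  shows "no_eigenvalue (box0 x) z"
proof -
  have P: "\<forall>x\<in>U. \<forall>a\<in>cFil M k x. (\<lambda>vs. z * a vs - cop (box0 x) a vs) \<in> cFil M (Suc k) x \<longrightarrow> a \<in> cFil M (Suc k) x" for k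
  proof (induction k rule: less_induct)
    case (less k)
    show ?case
    proof (intro ballI impI)
      fix x a assume x: "x \<in> U" and a: "a \<in> cFil M k x" and r: "(\<lambda>vs. z * a vs - cop (box0 x) a vs) \<in> cFil M (Suc k) x"
      obtain E n w \<beta> where "osculating_frame M x E n w \<beta>" by (rule osculating_at)
      then interpret osculating_frame M x E n w \<beta> .
      have gb: "graded (box0 x)" unfolding box0_def[abs_def] by (intro graded_lincomb graded_pair)
      have ac: "a \<in> cext" using a by (auto simp: cFil_iff cext_def Fil_ext)
      define p where "p = cop (piece k) a"
      have p: "p \<in> cext" unfolding p_def by (rule cop_in[OF lin_op_piece ac])
      have "cop (piece k) (\<lambda>vs. z * a vs - cop (box0 x) a vs) = (\<lambda>_. 0)"
        using r unfolding cFil_iff cop_def by (auto simp: Fil_Suc_piece complex_eq_iff)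
      then have pz: "(\<lambda>vs. z * p vs - cop (box0 x) p vs) = (\<lambda>_. 0)" unfolding p_def
        by (simp only: cop_diff[OF lin_op_piece cext_scale[OF ac] cop_in[OF lin_op_box0 ac]] cop_scale[OF lin_op_piece ac] cop_piece[OF gb ac])
      have pk: "p (map E K) = 0" if "K \<in> idx n" "wt K \<noteq> k" for K
        using that by (simp add: p_def cop_def piece_frame complex_eq_iff)
      \<comment> \<open>The right-hand side is chosen to be the conjugate of \<open>p\<close> at
        \<open>x\<close>: its bilinear pairing with \<open>p\<close> is the sum of the squared
        moduli of the coefficients of \<open>p\<close>.\<close>
      have "(\<lambda>vs. cnj (p vs)) \<in> cFil M k x"
        using p pk by (auto simp: cFil_iff Fil_iff cext_def ext_T_scaled[of _ "-1", simplified] complex_eq_iff)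
      then obtain \<eta> where \<eta>: "\<eta> \<in> CF UNIV" "\<eta> x = (\<lambda>vs. cnj (p vs))" "\<And>q. \<eta> q \<in> cFil M k q"
        using cextend_value by blast
      obtain \<zeta> where "solves_resolvent M U z (crestr U \<eta>) \<zeta>" using sm[OF CF_restr[OF \<eta>(1) subset_UNIV U]] by blast
      then have \<zeta>: "\<zeta> \<in> CF U" and e: "\<And>q vs. q \<in> U \<Longrightarrow> z * \<zeta> q vs - cplx (Box M) \<zeta> q vs = \<eta> q vs"
        by (auto simp: solves_resolvent_def)
      have e': "(\<lambda>vs. z * \<zeta> q vs - cop (box0 q) (\<zeta> q) vs) =
        (\<lambda>vs. \<eta> q vs + (cplx (Box M) \<zeta> q vs - cop (box0 q) (\<zeta> q) vs))" if "q \<in> U" for q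
        using e[OF that] by (auto simp: fun_eq_iff algebra_simps)
      \<comment> \<open>The weight of the solution climbs from 0 to \<open>k\<close> one step at a
        time; each step is the outer induction hypothesis for a smaller weight, used at every point
        of \<open>U\<close>.\<close>
      have \<zeta>F: "j \<le> k \<Longrightarrow> \<forall>q\<in>U. \<zeta> q \<in> cFil M j q" for j
      proof (induction j)
        case 0 then show ?case using CF_cext[OF \<zeta>] by (auto intro: cFil_0)
      next
        case (Suc j)
        show ?case
        proof
          fix q assume q: "q \<in> U"
          have "(\<lambda>vs. z * \<zeta> q vs - cop (box0 q) (\<zeta> q) vs) \<in> cFil M (Suc j) q" unfolding e'[OF q]
            by (intro cFil_add cFil_mono[OF Suc.prems \<eta>(3)] cBox_raise[OF \<zeta> U q]) (use Suc in auto)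
          then show "\<zeta> q \<in> cFil M (Suc j) q" using less[of j] Suc q by auto
        qed
      qed
      let ?r = "\<lambda>vs. cplx (Box M) \<zeta> x vs - cop (box0 x) (\<zeta> x) vs"
      have r: "?r \<in> cFil M (Suc k) x" by (rule cBox_raise[OF \<zeta> U x]) (use \<zeta>F in auto)
      have ip0: "ip (box0 x a) b = ip a (box0 x b)" if "a \<in> ext_T" "b \<in> ext_T" for a b
      proof -
        have "ip (t_at M x (d0_at M x a)) b = ip (d0_at M x a) (d0_at M x b)"
          using ip_d0_t[OF that(2) d0_at_in[OF that(1)]] by (simp add: ip_sym)
        moreover have "ip a (t_at M x (d0_at M x b)) = ip (d0_at M x a) (d0_at M x b)"
          using ip_d0_t[OF that(1) d0_at_in[OF that(2)]] by simp
        moreover have "ip (d0_at M x (t_at M x a)) b = ip (t_at M x a) (t_at M x b)"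
          by (rule ip_d0_t[OF t_at_in[OF that(1)] that(2)])
        moreover have "ip a (d0_at M x (t_at M x b)) = ip (t_at M x a) (t_at M x b)"
          using ip_d0_t[OF t_at_in[OF that(2)] that(1)] by (simp add: ip_sym)
        ultimately show ?thesis by (simp add: box0_def ip_add)
      qed
      \<comment> \<open>Symmetry moves \<open>z - box0\<close> onto \<open>p\<close>, where it gives
        0. On the other side, in weight \<open>k\<close>, stands the pairing of
        \<open>\<eta> x\<close> with \<open>p\<close>, since the remainder of higher weight has no
        such component.\<close>
      have "cip (cop (box0 x) (\<zeta> x)) p = cip (\<zeta> x) (cop (box0 x) p)"
        by (rule cip_symmetric[OF ip0 CF_cext[OF \<zeta>] p])
      also have "cop (box0 x) p = (\<lambda>vs. z * p vs)" using pz by (auto simp: fun_eq_iff)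
      finally have "(\<Sum>K\<in>idx n. (z * \<zeta> x (map E K) - cop (box0 x) (\<zeta> x) (map E K)) * p (map E K)) = 0"
      proof -
        assume e: "cip (cop (box0 x) (\<zeta> x)) p = cip (\<zeta> x) (\<lambda>vs. z * p vs)"
        have "(\<Sum>K\<in>idx n. (z * \<zeta> x (map E K) - cop (box0 x) (\<zeta> x) (map E K)) * p (map E K))
          = cip (\<zeta> x) (\<lambda>vs. z * p vs) - cip (cop (box0 x) (\<zeta> x)) p"
          unfolding cip_def sum_subtractf[symmetric] by (intro sum.cong) (simp_all add: algebra_simps)
        then show ?thesis using e by simp
      qed
      moreover have "(z * \<zeta> x (map E K) - cop (box0 x) (\<zeta> x) (map E K)) * p (map E K) = complex_of_real ((cmod (p (map E K)))\<^sup>2)"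
        if K: "K \<in> idx n" for K
      proof (cases "wt K = k")
        case True
        then have "?r (map E K) = 0" using r K by (auto simp: cFil_iff Fil_iff complex_eq_iff)
        then have "z * \<zeta> x (map E K) - cop (box0 x) (\<zeta> x) (map E K) = cnj (p (map E K))"
          using fun_cong[OF e'[OF x], of "map E K"] by (simp add: \<eta>(2))
        then show ?thesis by (simp add: complex_norm_square mult.commute del: of_real_power)
      qed (simp add: pk K)
      ultimately have "complex_of_real (\<Sum>K\<in>idx n. (cmod (p (map E K)))\<^sup>2) = 0" by simp
      then have "(\<Sum>K\<in>idx n. (cmod (p (map E K)))\<^sup>2) = 0" by (simp only: of_real_eq_0_iff)
      then have "p (map E K) = 0" if "K \<in> idx n" for K using that by (simp add: sum_nonneg_eq_0_iff)
      then have "p = (\<lambda>_. 0)" by (intro cext_eqI[OF p cext_zero]) auto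
      then have "piece k (\<lambda>vs. Re (a vs)) = (\<lambda>_. 0)" "piece k (\<lambda>vs. Im (a vs)) = (\<lambda>_. 0)"
        by (auto simp: p_def cop_def complex_eq_iff fun_eq_iff)
      then show "a \<in> cFil M (Suc k) x" using a Fil_piece_eq_0 by (auto simp: cFil_iff)
    qed
  qed
  show ?thesis unfolding no_eigenvalue_def
  proof (intro ballI impI)
    fix a assume a: "a \<in> cext" and e: "(\<lambda>vs. z * a vs) = cop (box0 x) a"
    have "(\<lambda>vs. z * a vs - cop (box0 x) a vs) = (\<lambda>_. 0)" by (simp add: e[symmetric])
    then have "a \<in> cFil M k x" for k
      by (induction k) (use P x a in \<open>auto simp: cFil_zero intro: cFil_0\<close>)
    then show "a = (\<lambda>_. 0)" by (rule cFil_top)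
  qed
qed

end

subsection \<open>Solving equations with parameter in a frame\<close>

text \<open>Joint continuity is needed to keep a determinant away from 0 for nearby points and small
  parameters at the same time.\<close>

lemma smooth_hol_continuous: "f \<in> smooth_hol D S \<Longrightarrow> continuous_on (D \<times> S) (\<lambda>p. f (fst p) (snd p))"
proof (induction rule: smooth_hol.induct)
  case (smooth f)
  show ?case by (rule continuous_on_compose2[OF smooth_on_continuous_on[OF smooth]]) (auto intro!: continuous_intros)
next
  case (cong f g)
  then show ?case by (subst continuous_on_cong[OF refl, of _ _ "\<lambda>p. f (fst p) (snd p)"]) auto
qed (auto intro!: continuous_intros)

text \<open>A frame neighbourhood inside one chart, so that the coefficients of forms become
  functions on the open subset \<open>S\<close> of the model space.\<close>

locale frame_chart = frame_nbhd M W E n w + smooth_partial_inverse M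
  for M :: "('m::{t2_space, second_countable_topology}, 'e::euclidean_space) filtered_space"
    and W :: "'m set" and E :: "nat \<Rightarrow> 'm \<Rightarrow> 'e" and n :: nat and w :: "nat \<Rightarrow> nat" +
  fixes c :: "('m, 'e) chart"
  assumes c_atlas: "c \<in> atlas M" and W_chart: "W \<subseteq> fst c"
begin

abbreviation "S \<equiv> img c W"

lemma open_S: "open S"
  by (rule open_img[OF c_atlas open_W])

lemma inv_S: "y \<in> S \<Longrightarrow> chart_inv c y \<in> W" "y \<in> S \<Longrightarrow> chart_inv c y \<in> fst c" "y \<in> S \<Longrightarrow> snd c (chart_inv c y) = y"
  using chart_inv_in[OF c_atlas] by blast+

lemma in_S: "q \<in> W \<Longrightarrow> snd c q \<in> S" "q \<in> W \<Longrightarrow> chart_inv c (snd c q) = q"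
  using W_chart chart_inv_snd[OF c_atlas] by auto

lemma smooth_hol_real: "smf W f \<Longrightarrow> (\<lambda>z y. complex_of_real (f (chart_inv c y))) \<in> smooth_hol D S"
  by (rule smooth_hol.smooth)
    (rule smooth_on_compose[OF open_S open_UNIV subset_UNIV smooth_on_bounded_linear[OF bounded_linear_of_real] smfD[OF _ c_atlas]])

lemma smooth_hol_form: "\<omega> \<in> forms_on M W \<Longrightarrow> (\<lambda>z y. complex_of_real (\<omega> (chart_inv c y) (EK K (chart_inv c y)))) \<in> smooth_hol D S"
  by (rule smooth_hol_real) (rule smf_coeff[OF _ open_W order_refl order_refl])

definition coef :: "(complex \<Rightarrow> ('m, 'e) cform) \<Rightarrow> nat list \<Rightarrow> complex \<Rightarrow> 'e \<Rightarrow> complex" where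
  "coef \<zeta> K = (\<lambda>z y. \<zeta> z (chart_inv c y) (EK K (chart_inv c y)))"

text \<open>Families of complex forms over \<open>W\<close> with a parameter in \<open>D\<close>,
  tested on their frame coefficients. The class is closed under smooth fibrewise operators, under
  the exterior derivative and under fibrewise resolvents.\<close>

definition fam :: "complex set \<Rightarrow> (complex \<Rightarrow> ('m, 'e) cform) \<Rightarrow> bool" where
  "fam D \<zeta> \<longleftrightarrow> (\<forall>z\<in>D. \<forall>q. \<zeta> z q \<in> cext) \<and> (\<forall>z\<in>D. \<forall>q. q \<notin> W \<longrightarrow> \<zeta> z q = (\<lambda>_. 0)) \<and>
     (\<forall>K\<in>idx n. coef \<zeta> K \<in> smooth_hol D S)"

lemma fam_cext: "fam D \<zeta> \<Longrightarrow> z \<in> D \<Longrightarrow> \<zeta> z q \<in> cext"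
  by (simp add: fam_def)

lemma fam_expand:
  assumes q: "q \<in> W" and a: "a \<in> cext"
  shows "a vs = (\<Sum>K\<in>idx n. a (EK K q) * complex_of_real (eb K q vs))"
proof -
  interpret adapted_frame M q "\<lambda>a. E a q" n w by (rule frame[OF q])
  show ?thesis using cext_expand[OF a, of vs] by (simp add: cbas_def ebas_eb[OF q])
qed

text \<open>Coefficients on arbitrary lists are combinations of those on increasing lists with
  constant factors, since \<open>eb\<close> takes constant values on frame vectors.\<close>

lemma fam_coef:
  assumes z: "fam D \<zeta>" and J: "set J \<subseteq> {..<n}"
  shows "coef \<zeta> J \<in> smooth_hol D S"
proof -
  define e where "e K = (if length K = length J then
    Determinant.det (Matrix.mat (length K) (length K) (\<lambda>(i, j). if K ! i = J ! j then 1 else 0)) else 0 :: real)" for K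
  have "(\<lambda>z y. \<Sum>K\<in>idx n. coef \<zeta> K z y * complex_of_real (e K)) \<in> smooth_hol D S"
    using z by (intro smooth_hol_sum smooth_hol.mult smooth_hol_const) (auto simp: fam_def)
  then show ?thesis
  proof (rule smooth_hol.cong)
    fix z y assume zy: "z \<in> D" "y \<in> S"
    have "eb K (chart_inv c y) (EK J (chart_inv c y)) = e K" if "K \<in> idx n" for K
      unfolding e_def by (rule eb_frame[OF inv_S(1)[OF zy(2)] idx_set[OF that] J])
    then show "coef \<zeta> J z y = (\<Sum>K\<in>idx n. coef \<zeta> K z y * complex_of_real (e K))"
      unfolding coef_def using fam_expand[OF inv_S(1)[OF zy(2)] fam_cext[OF z zy(1)], where vs = "EK J (chart_inv c y)"] by simp
  qed
qed

lemma fam_CF: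
  assumes z: "fam D \<zeta>" and D: "z \<in> D"
  shows "\<zeta> z \<in> CF W"
proof -
  have sm: "smooth_on S (coef \<zeta> K z)" if "K \<in> idx n" for K
    by (rule smooth_hol_smooth_on[OF open_S fam_coef[OF z idx_set[OF that]] D])
  \<comment> \<open>\<open>L\<close> stands for the real and for the imaginary part, which are
    treated together.\<close>
  have L: "(\<lambda>q vs. L (\<zeta> z q vs)) \<in> forms_on M W" if L: "bounded_linear L" "L 0 = 0" "\<And>a :: 'e list \<Rightarrow> complex. a \<in> cext \<Longrightarrow> (\<lambda>vs. L (a vs)) \<in> ext_T" for L :: "complex \<Rightarrow> real"
  proof (rule forms_on_frame_idxI[OF open_W order_refl])
    show "(\<lambda>vs. L (\<zeta> z q vs)) \<in> ext_T" for q by (rule L(3)[OF fam_cext[OF z D]])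
    show "(\<lambda>vs. L (\<zeta> z q vs)) = (\<lambda>_. 0)" if "q \<notin> W" for q using z D that L(2) by (simp add: fam_def)
    show "smf W (\<lambda>q. L (\<zeta> z q (EK K q)))" if "K \<in> idx n" for K
      by (rule smf_one_chart[OF c_atlas open_W W_chart])
        (rule smooth_on_compose[OF open_S open_UNIV subset_UNIV smooth_on_bounded_linear[OF L(1)] sm[OF that, unfolded coef_def]])
  qed
  show ?thesis unfolding cforms_on_def
    using L[OF bounded_linear_Re] L[OF bounded_linear_Im] by (simp add: cext_def)
qed

lemma fam_const:
  assumes z: "\<zeta> \<in> CF W"
  shows "fam D (\<lambda>_. \<zeta>)"
  unfolding fam_def
proof (intro conjI ballI allI impI)
  fix K
  have f: "(\<lambda>x vs. Re (\<zeta> x vs)) \<in> forms_on M W" "(\<lambda>x vs. Im (\<zeta> x vs)) \<in> forms_on M W" using z by (auto simp: cforms_on_def)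
  show "coef (\<lambda>_. \<zeta>) K \<in> smooth_hol D S" unfolding coef_def
    by (rule smooth_hol.cong[OF smooth_hol.add[OF smooth_hol_form[OF f(1)] smooth_hol.mult[OF smooth_hol_const[of \<i>] smooth_hol_form[OF f(2)]]]])
      (simp add: complex_eq_iff)
qed (use z CF_cext CF_out in auto)

lemma fam_add: "fam D \<zeta> \<Longrightarrow> fam D \<xi> \<Longrightarrow> fam D (\<lambda>z q vs. \<zeta> z q vs + \<xi> z q vs)"
  and fam_diff: "fam D \<zeta> \<Longrightarrow> fam D \<xi> \<Longrightarrow> fam D (\<lambda>z q vs. \<zeta> z q vs - \<xi> z q vs)"
  and fam_param: "fam D \<zeta> \<Longrightarrow> fam D (\<lambda>z q vs. z * \<zeta> z q vs)"
  unfolding fam_def coef_def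
  by (auto intro: cext_add cext_diff cext_scale smooth_hol.add smooth_hol_diff smooth_hol.mult smooth_hol.param)

definition pw_op :: "('m \<Rightarrow> ('e list \<Rightarrow> real) \<Rightarrow> 'e list \<Rightarrow> real) \<Rightarrow> bool" where
  "pw_op A \<longleftrightarrow> (\<forall>q. lin_op (A q)) \<and> (\<forall>\<omega>\<in>forms_on M W. (\<lambda>q. A q (\<omega> q)) \<in> forms_on M W)"

lemma pw_op_lin: "pw_op A \<Longrightarrow> lin_op (A q)"
  by (simp add: pw_op_def)

lemma pw_op_coef: "pw_op A \<Longrightarrow> J \<in> idx n \<Longrightarrow>
    (\<lambda>z y. complex_of_real (A (chart_inv c y) (eb J (chart_inv c y)) (EK K (chart_inv c y)))) \<in> smooth_hol D S"
  by (rule smooth_hol_form[where \<omega> = "\<lambda>q. A q (eb J q)"]) (simp add: pw_op_def eb_forms_on idx_set)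

lemma fam_cop:
  assumes A: "pw_op A" and z: "fam D \<zeta>"
  shows "fam D (\<lambda>z q. cop (A q) (\<zeta> z q))"
  unfolding fam_def
proof (intro conjI ballI allI impI)
  show "cop (A q) (\<zeta> z q) \<in> cext" if "z \<in> D" for z q by (rule cop_in[OF pw_op_lin[OF A] fam_cext[OF z that]])
  show "cop (A q) (\<zeta> z q) = (\<lambda>_. 0)" if "z \<in> D" "q \<notin> W" for z q
    using z that cop_zero[OF pw_op_lin[OF A]] by (simp add: fam_def)
  fix K assume K: "K \<in> idx n"
  have "(\<lambda>z y. \<Sum>J\<in>idx n. coef \<zeta> J z y * complex_of_real (A (chart_inv c y) (eb J (chart_inv c y)) (EK K (chart_inv c y)))) \<in> smooth_hol D S"
    by (intro smooth_hol_sum smooth_hol.mult pw_op_coef[OF A] fam_coef[OF z] idx_set)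
  then show "coef (\<lambda>z q. cop (A q) (\<zeta> z q)) K \<in> smooth_hol D S"
  proof (rule smooth_hol.cong)
    fix z y assume zy: "z \<in> D" "y \<in> S"
    note q = inv_S(1)[OF zy(2)]
    interpret adapted_frame M "chart_inv c y" "\<lambda>a. E a (chart_inv c y)" n w by (rule frame[OF q])
    show "coef (\<lambda>z q. cop (A q) (\<zeta> z q)) K z y =
        (\<Sum>J\<in>idx n. coef \<zeta> J z y * complex_of_real (A (chart_inv c y) (eb J (chart_inv c y)) (EK K (chart_inv c y))))"
      unfolding coef_def using cop_matrix[OF pw_op_lin[OF A] fam_cext[OF z zy(1)]] by (simp add: ebas_eb[OF q])
  qed
qed

lemma pw_op_at: "pw_op (d0_at M)" "pw_op (t_at M)" "pw_op (h_at M)" "pw_op box0" "pw_op (aux_op C)"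
proof -
  have D: "d0 M \<omega> \<in> forms_on M W" and T: "d0_t M \<omega> \<in> forms_on M W" and H: "h \<omega> \<in> forms_on M W"
    if "\<omega> \<in> forms_on M W" for \<omega>
    using that d0_t_forms_on h_forms_on open_W by blast+
  show "pw_op (d0_at M)" "pw_op (t_at M)" "pw_op (h_at M)"
    using D T H lin_op_at by (auto simp: pw_op_def pointwise_ops[abs_def])
  have "(\<lambda>q. box0 q (\<omega> q)) = (\<lambda>x vs. d0 M (d0_t M \<omega>) x vs + d0_t M (d0 M \<omega>) x vs)" for \<omega>
    by (simp add: fun_eq_iff box0_def pointwise_ops)
  then show "pw_op box0" using D T open_W by (auto simp: pw_op_def lin_op_box0 intro!: forms_on_add)
  have "(\<lambda>q. aux_op C q (\<omega> q)) = (\<lambda>x vs. d0_t M (d0 M \<omega>) x vs + C * (\<omega> x vs - h (d0 M \<omega>) x vs))" for \<omega>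
    by (simp add: fun_eq_iff aux_op_def pointwise_ops)
  then show "pw_op (aux_op C)" using D T H open_W by (auto simp: pw_op_def lin_op_aux intro!: forms_on_add forms_on_scale forms_on_diff)
qed

section \<open>The exterior derivative in frame coefficients\<close>

definition \<tau> :: "nat \<Rightarrow> nat \<Rightarrow> nat \<Rightarrow> 'm \<Rightarrow> real" where
  "\<tau> a b e q = gm q (lie_bracket M (E a) (E b) q) (E e q)"

text \<open>The coframe takes constant values on the frame, so Cartan's formula expresses the
  components of the brackets of frame fields through the exterior derivative of the coframe.\<close>

lemma smf_\<tau>:
  assumes e: "e < n" and ab: "a < n" "b < n"
  shows "smf W (\<tau> a b e)"
proof -
  have eb: "eb [e] \<in> forms_on M W" using e by (intro eb_forms_on) auto
  have "\<tau> a b e q = - restr W (de_rham M (eb [e])) q (EK [a, b] q)" if q: "q \<in> W" for q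
  proof -
    have D: "Dm (\<lambda>p. eb [e] p [E i p]) q v = 0" if "i < n" for i v
    proof -
      have "Dm (\<lambda>p. eb [e] p [E i p]) q = Dm (\<lambda>_. if e = i then 1 else 0) q"
      proof (rule Dm_cong[OF open_W q])
        fix p assume p: "p \<in> W"
        interpret adapted_frame M p "\<lambda>a. E a p" n w by (rule frame[OF p])
        show "eb [e] p [E i p] = (if e = i then 1 else 0)" using g_frame[OF e that] by (simp add: eb_single[OF p])
      qed
      then show ?thesis by (simp add: Dm_const)
    qed
    have "nths [a, b] (- {0}) = [b]" "nths [a, b] (- {Suc 0}) = [a]" "nths [a, b] (- {0, Suc 0}) = []"
      by (simp_all add: nths_Cons)
    then have "de_rham M (eb [e]) q (EK [a, b] q) = - eb [e] q [lie_bracket M (E a) (E b) q]"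
      using de_rham_cartan[OF eb open_W q, of E "[a, b]", OF E_smooth] D ab by (simp add: altsum2_def)
    then show ?thesis using q metric_M(2)[of q "E e q"] by (simp add: \<tau>_def eb_single)
  qed
  moreover have "smf W (\<lambda>q. - restr W (de_rham M (eb [e])) q (EK [a, b] q))"
    by (rule smf_uminus, rule smf_coeff[OF de_rham_forms_on[OF eb open_W] open_W order_refl order_refl])
  ultimately show ?thesis by (subst smf_cong)
qed

lemma de_rham_frame:
  assumes w: "\<omega> \<in> forms_on M W" and q: "q \<in> W"
  shows "de_rham M \<omega> q (EK K q) =
    (\<Sum>k<length K. (-1) ^ k * Dm (\<lambda>p. \<omega> p (EK (nths K (- {k})) p)) q (E (K ! k) q))
    + (\<Sum>j<length K. \<Sum>i<j. (-1) ^ (i + j) * (\<Sum>e<n. \<tau> (K ! i) (K ! j) e q * \<omega> q (EK (e # nths K (- {i, j})) q)))"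
proof -
  interpret adapted_frame M q "\<lambda>a. E a q" n w by (rule frame[OF q])
  have "\<omega> q (lie_bracket M (E a) (E b) q # vs) = (\<Sum>e<n. \<tau> a b e q * \<omega> q (E e q # vs))" for a b vs
    using ext_T_expand_arg[OF forms_on_ext[OF w, of q], of "[]" "lie_bracket M (E a) (E b) q" vs]
    by (simp only: append_Nil \<tau>_def)
  then show ?thesis using de_rham_cartan[OF w open_W q, of E K, OF E_smooth] by (simp add: altsum2_def)
qed

text \<open>Derivatives now act on the coefficients, as functions on \<open>S\<close>, in the
  directions of the frame fields, and all other factors are smooth; this is what shows that
  \<open>fam\<close> is stable under \<open>d\<close>.\<close>

lemma cd_frame:
  assumes w: "\<xi> \<in> CF W" and y: "y \<in> S" and q: "q = chart_inv c y" and K: "set K \<subseteq> {..<n}"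
  shows "cd \<xi> q (EK K q) =
    (\<Sum>k<length K. (-1) ^ k * frechet_derivative (\<lambda>y. \<xi> (chart_inv c y) (EK (nths K (- {k})) (chart_inv c y))) (at y) (vf_rep M c (E (K ! k)) y))
    + (\<Sum>j<length K. \<Sum>i<j. (-1) ^ (i + j) * (\<Sum>e<n. complex_of_real (\<tau> (K ! i) (K ! j) e q) * \<xi> q (EK (e # nths K (- {i, j})) q)))"
proof -
  note qW = inv_S(1)[OF y, folded q]
  have D: "L (frechet_derivative (\<lambda>y. \<xi> (chart_inv c y) (EK J (chart_inv c y))) (at y) (vf_rep M c (E a) y))
      = Dm (\<lambda>p. L (\<xi> p (EK J p))) q (E a q)"
    if J: "set J \<subseteq> {..<n}" and L: "bounded_linear L" "(\<lambda>x vs. L (\<xi> x vs)) \<in> forms_on M W" for J a and L :: "complex \<Rightarrow> real"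
  proof -
    have "smooth_on S (coef (\<lambda>_. \<xi>) J 0)"
      by (rule smooth_hol_smooth_on[OF open_S fam_coef[OF fam_const[OF w] J] UNIV_I])
    then have "((\<lambda>y. \<xi> (chart_inv c y) (EK J (chart_inv c y))) has_derivative
        frechet_derivative (\<lambda>y. \<xi> (chart_inv c y) (EK J (chart_inv c y))) (at y)) (at y)"
      unfolding coef_def by (rule smooth_on_has_derivative[OF _ y])
    from frechet_derivative_eq[OF bounded_linear.has_derivative[OF L(1) this]]
    have "L (frechet_derivative (\<lambda>y. \<xi> (chart_inv c y) (EK J (chart_inv c y))) (at y) v)
      = frechet_derivative (\<lambda>y. L (\<xi> (chart_inv c y) (EK J (chart_inv c y)))) (at y) v" for v by simp
    also have "frechet_derivative (\<lambda>y. L (\<xi> (chart_inv c y) (EK J (chart_inv c y)))) (at y) v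
      = Dm (\<lambda>p. L (\<xi> p (EK J p))) q (tang_from M c q v)" for v
      using Dm_chart[OF smf_coeff[OF L(2) open_W order_refl order_refl] c_atlas _ qW, of J v] inv_S[OF y] q by simp
    also have "tang_from M c q (vf_rep M c (E a) y) = E a q"
      using vf_rep_tang_from[OF c_atlas, of y "E a"] y q by auto
    finally show ?thesis .
  qed
  have sub: "set (nths K I) \<subseteq> {..<n}" for I using K notin_set_nthsI by fastforce
  have f: "(\<lambda>x vs. Re (\<xi> x vs)) \<in> forms_on M W" "(\<lambda>x vs. Im (\<xi> x vs)) \<in> forms_on M W" using w by (auto simp: cforms_on_def)
  have sg: "Re ((-1) ^ k * a) = (-1) ^ k * Re a" "Im ((-1) ^ k * a) = (-1) ^ k * Im a" for k a
    by (cases "even k"; simp)+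
  show ?thesis
    unfolding complex_eq_iff cplx_def complex.sel de_rham_frame[OF f(1) qW] de_rham_frame[OF f(2) qW]
      plus_complex.sel Re_sum Im_sum sg D[OF sub bounded_linear_Re f(1)] D[OF sub bounded_linear_Im f(2)]
    by simp
qed

lemma fam_cd:
  assumes z: "fam D \<zeta>"
  shows "fam D (\<lambda>z. crestr W (cd (\<zeta> z)))"
  unfolding fam_def
proof (intro conjI ballI allI impI)
  show "crestr W (cd (\<zeta> z)) q \<in> cext" if "z \<in> D" for z q by (rule CF_cext[OF cd_CF[OF fam_CF[OF z that] open_W]])
  show "crestr W (cd (\<zeta> z)) q = (\<lambda>_. 0)" if "q \<notin> W" for z q using that by (simp add: crestr_def)
  fix K assume "K \<in> idx n"
  then have K: "set K \<subseteq> {..<n}" by (rule idx_set)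
  have sub: "set (nths K I) \<subseteq> {..<n}" for I using K notin_set_nthsI by fastforce
  have mem: "K ! i < n" if "i < length K" for i using K that nth_mem by blast
  have "(\<lambda>z y. (\<Sum>k<length K. (-1) ^ k * frechet_derivative (coef \<zeta> (nths K (- {k})) z) (at y) (vf_rep M c (E (K ! k)) y))
    + (\<Sum>j<length K. \<Sum>i<j. (-1) ^ (i + j) * (\<Sum>e<n. complex_of_real (\<tau> (K ! i) (K ! j) e (chart_inv c y)) * coef \<zeta> (e # nths K (- {i, j})) z y))) \<in> smooth_hol D S"
    by (intro smooth_hol.add smooth_hol_sum smooth_hol.mult smooth_hol_const smooth_hol_derivative_dir open_S fam_coef[OF z]
        smooth_hol_real smf_\<tau> smooth_vfD[OF E_smooth c_atlas]) (use sub mem in auto)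
  then show "coef (\<lambda>z. crestr W (cd (\<zeta> z))) K \<in> smooth_hol D S"
    by (rule smooth_hol.cong) (use cd_frame[OF fam_CF[OF z] _ refl K] inv_S in \<open>simp add: coef_def\<close>)
qed

section \<open>Solving equations by Cramer's rule and iteration on the weight\<close>

definition cm :: "nat \<Rightarrow> (nat \<Rightarrow> nat list) \<Rightarrow> ('m \<Rightarrow> ('e list \<Rightarrow> real) \<Rightarrow> 'e list \<Rightarrow> real) \<Rightarrow> complex \<Rightarrow> 'm \<Rightarrow> complex mat" where
  "cm m \<kappa> A z q = Matrix.mat m m (\<lambda>(i, j). (if i = j then z else 0) - complex_of_real (A q (eb (\<kappa> j) q) (EK (\<kappa> i) q)))"

lemma ex_enum: obtains m :: nat and \<kappa> where "bij_betw \<kappa> {..<m} (idx n)"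
  using ex_bij_betw_nat_finite[OF finite_idx[of n]] unfolding lessThan_atLeast0[symmetric] by blast

lemma cm_carrier: "cm m \<kappa> A z q \<in> carrier_mat m m"
  by (simp add: cm_def)

lemma cm_hol:
  assumes \<kappa>: "bij_betw \<kappa> {..<m} (idx n)" and A: "pw_op A" and ij: "i < m" "j < m"
  shows "(\<lambda>z y. cm m \<kappa> A z (chart_inv c y) $$ (i, j)) \<in> smooth_hol D S"
proof -
  have "\<kappa> j \<in> idx n" using \<kappa> ij by (auto simp: bij_betw_def)
  moreover have "(\<lambda>z y. if i = j then z else 0) \<in> smooth_hol D S"
    by (cases "i = j") (simp_all add: smooth_hol.param smooth_hol_const)
  ultimately show ?thesis using ij by (simp add: cm_def) (intro smooth_hol_diff pw_op_coef[OF A])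
qed

lemma cm_det:
  assumes \<kappa>: "bij_betw \<kappa> {..<m} (idx n)" and A: "pw_op A" and q: "q \<in> W"
  shows "Determinant.det (cm m \<kappa> A z q) \<noteq> 0 \<longleftrightarrow> no_eigenvalue (A q) z"
proof -
  interpret adapted_frame M q "\<lambda>a. E a q" n w by (rule frame[OF q])
  have "cm m \<kappa> A z q = char_matrix m \<kappa> (A q) z" by (simp add: cm_def char_matrix_def ebas_eb[OF q])
  then show ?thesis using char_matrix_det_iff[OF \<kappa> pw_op_lin[OF A]] by simp
qed

text \<open>Cramer's rule on every fibre, with the coefficients recognised as members of
  \<open>smooth_hol\<close>.\<close>

lemma solve_step:
  assumes A: "pw_op A" and ne: "\<And>z q. z \<in> D \<Longrightarrow> q \<in> W \<Longrightarrow> no_eigenvalue (A q) z" and \<rho>: "fam D \<rho>"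
  shows "\<exists>\<xi>. fam D \<xi> \<and> (\<forall>z\<in>D. \<forall>q\<in>W. (\<lambda>vs. z * \<xi> z q vs - cop (A q) (\<xi> z q) vs) = \<rho> z q)"
proof -
  obtain m \<kappa> where \<kappa>: "bij_betw \<kappa> {..<m::nat} (idx n)" by (rule ex_enum)
  define x where "x i z q = (\<Sum>j<m. adj_mat (cm m \<kappa> A z q) $$ (i, j) * \<rho> z q (EK (\<kappa> j) q)) * inverse (Determinant.det (cm m \<kappa> A z q))" for i z q
  define \<xi> where "\<xi> z q = (\<lambda>vs. \<Sum>i<m. x i z q * complex_of_real (eb (\<kappa> i) q vs))" for z q
  have at: "\<xi> z q \<in> cext \<and> (\<lambda>vs. z * \<xi> z q vs - cop (A q) (\<xi> z q) vs) = \<rho> z q \<and> (\<forall>i<m. \<xi> z q (EK (\<kappa> i) q) = x i z q)"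
    if z: "z \<in> D" and q: "q \<in> W" for z q
  proof -
    interpret adapted_frame M q "\<lambda>a. E a q" n w by (rule frame[OF q])
    have m: "char_matrix m \<kappa> (A q) z = cm m \<kappa> A z q" by (simp add: cm_def char_matrix_def ebas_eb[OF q])
    have \<xi>: "\<xi> z q = (\<lambda>vs. \<Sum>i<m. x i z q * cbas (\<kappa> i) vs)" by (simp add: \<xi>_def cbas_def ebas_eb[OF q])
    show ?thesis
      using resolvent_coeffs[OF \<kappa> pw_op_lin[OF A] ne[OF z q] fam_cext[OF \<rho> z], folded m]
        cext_of_coeffs(2)[OF \<kappa>] unfolding \<xi> m x_def by auto
  qed
  have "fam D \<xi>" unfolding fam_def
  proof (intro conjI ballI allI impI)
    show o: "\<xi> z q = (\<lambda>_. 0)" if "q \<notin> W" for z q using that by (simp add: \<xi>_def eb_def restr_def)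
    show "\<xi> z q \<in> cext" if "z \<in> D" for z q using at[OF that] o[of q z] cext_zero by (cases "q \<in> W") auto
    fix K assume "K \<in> idx n"
    then obtain i where i: "i < m" "K = \<kappa> i" using \<kappa> by (auto simp: bij_betw_def)
    have dn: "Determinant.det (cm m \<kappa> A z (chart_inv c y)) \<noteq> 0" if "z \<in> D" "y \<in> S" for z y
      using cm_det[OF \<kappa> A inv_S(1)[OF that(2)]] ne[OF that(1) inv_S(1)[OF that(2)]] by blast
    have "(\<lambda>z y. (\<Sum>j<m. adj_mat (cm m \<kappa> A z (chart_inv c y)) $$ (i, j) * coef \<rho> (\<kappa> j) z y) * inverse (Determinant.det (cm m \<kappa> A z (chart_inv c y)))) \<in> smooth_hol D S"
      using \<kappa> by (intro smooth_hol.mult smooth_hol_sum smooth_hol.inverse smooth_hol_adj[OF cm_carrier] smooth_hol_det[OF cm_carrier]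
        cm_hol[OF \<kappa> A] fam_coef[OF \<rho>] dn i(1) idx_set) (auto simp: bij_betw_def)
    then show "coef \<xi> K \<in> smooth_hol D S"
      by (rule smooth_hol.cong) (use at inv_S(1) i in \<open>simp add: coef_def x_def\<close>)
  qed
  then show ?thesis using at by blast
qed

text \<open>Neumann iteration for \<open>z - A - X\<close> with \<open>X\<close> raising weights:
  correcting \<open>\<zeta>\<close> by the fibrewise solution \<open>\<xi>\<close> for the current
  residual leaves the residual \<open>X \<xi>\<close>. The perturbation is kept abstract because it
  is \<open>Box - box0\<close> in one application and \<open>t (d - d0)\<close> in the
  other.\<close>

lemma solve:
  assumes A: "pw_op A" and graded: "A = box0 \<or> A = aux_op C"
    and ne: "\<And>z q. z \<in> D \<Longrightarrow> q \<in> W \<Longrightarrow> no_eigenvalue (A q) z"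
    and X_fam: "\<And>\<zeta>. fam D \<zeta> \<Longrightarrow> fam D (\<lambda>z. X (\<zeta> z))"
    and X_add: "\<And>\<zeta> \<xi> q vs. \<zeta> \<in> CF W \<Longrightarrow> \<xi> \<in> CF W \<Longrightarrow> q \<in> W \<Longrightarrow> X (\<lambda>q vs. \<zeta> q vs + \<xi> q vs) q vs = X \<zeta> q vs + X \<xi> q vs"
    and X_raise: "\<And>\<zeta> k q. \<zeta> \<in> CF W \<Longrightarrow> (\<And>p. p \<in> W \<Longrightarrow> \<zeta> p \<in> cFil M k p) \<Longrightarrow> q \<in> W \<Longrightarrow> X \<zeta> q \<in> cFil M (Suc k) q"
    and \<eta>: "fam D \<eta>"
  shows "\<exists>\<zeta>. fam D \<zeta> \<and> (\<forall>z\<in>D. \<forall>q\<in>W. \<forall>vs. z * \<zeta> z q vs - cop (A q) (\<zeta> z q) vs - X (\<zeta> z) q vs = \<eta> z q vs)"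
proof -
  let ?R = "\<lambda>\<zeta> z q vs. \<eta> z q vs - ((z * \<zeta> z q vs - cop (A q) (\<zeta> z q) vs) - X (\<zeta> z) q vs)"
  have "\<exists>\<zeta>. fam D \<zeta> \<and> (\<forall>z\<in>D. \<forall>q\<in>W. ?R \<zeta> z q \<in> cFil M k q)" for k
  proof (induction k)
    case 0
    have z: "fam D (\<lambda>_ _ _. 0)" by (rule fam_const) (simp add: cforms_on_def forms_on_zero)
    have "fam D (?R (\<lambda>_ _ _. 0))"
      by (rule fam_diff[OF \<eta> fam_diff[OF fam_diff[OF fam_param[OF z] fam_cop[OF A z]] X_fam[OF z]]])
    then show ?case using z fam_cext cFil_0 by blast
  next
    case (Suc k)
    then obtain \<zeta> where z: "fam D \<zeta>" and r: "\<And>z q. z \<in> D \<Longrightarrow> q \<in> W \<Longrightarrow> ?R \<zeta> z q \<in> cFil M k q" by blast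
    have "fam D (?R \<zeta>)"
      by (rule fam_diff[OF \<eta> fam_diff[OF fam_diff[OF fam_param[OF z] fam_cop[OF A z]] X_fam[OF z]]])
    from solve_step[OF A ne this] obtain \<xi> where x: "fam D \<xi>"
      and e: "\<And>z q. z \<in> D \<Longrightarrow> q \<in> W \<Longrightarrow> (\<lambda>vs. z * \<xi> z q vs - cop (A q) (\<xi> z q) vs) = ?R \<zeta> z q" by blast
    have xF: "\<xi> z q \<in> cFil M k q" if "z \<in> D" "q \<in> W" for z q
    proof (rule resolvent_Fil[where A = "A q"])
      show "A q = box0 q \<or> A q = aux_op C q" using graded by auto
      show "(\<lambda>vs. z * \<xi> z q vs - cop (A q) (\<xi> z q) vs) \<in> cFil M k q" unfolding e[OF that] by (rule r[OF that])
    qed (use that ne fam_cext[OF x] in auto)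
    have "?R (\<lambda>z q vs. \<zeta> z q vs + \<xi> z q vs) z q \<in> cFil M (Suc k) q" if D: "z \<in> D" "q \<in> W" for z q
    proof -
      have "?R (\<lambda>z q vs. \<zeta> z q vs + \<xi> z q vs) z q vs = X (\<xi> z) q vs" for vs
        using fun_cong[OF e[OF D], of vs] X_add[OF fam_CF[OF z D(1)] fam_CF[OF x D(1)] D(2), of vs]
          cop_add[OF pw_op_lin[OF A] fam_cext[OF z D(1)] fam_cext[OF x D(1)]]
        by (simp add: algebra_simps)
      then have "?R (\<lambda>z q vs. \<zeta> z q vs + \<xi> z q vs) z q = X (\<xi> z) q" by (rule ext)
      then show ?thesis using X_raise[OF fam_CF[OF x D(1)] xF[OF D(1)] D(2)] by simp
    qed
    then show ?case using fam_add[OF z x] by blast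
  qed
  then obtain \<zeta> where z: "fam D \<zeta>" and r: "\<And>z q. z \<in> D \<Longrightarrow> q \<in> W \<Longrightarrow> ?R \<zeta> z q \<in> cFil M top_weight q" by blast
  have "?R \<zeta> z q vs = 0" if "z \<in> D" "q \<in> W" for z q vs
    using fun_cong[OF cFil_top[OF r[OF that]], of vs] by simp
  then show ?thesis using z by (intro exI[of _ \<zeta>]) simp
qed

text \<open>The determinant is jointly continuous and nonzero at parameter 0 over \<open>q0\<close>,
  hence nonzero on a product neighbourhood.\<close>

lemma no_eigenvalue_near:
  assumes A: "pw_op A" and q0: "q0 \<in> W" and ne: "no_eigenvalue (A q0) 0"
  obtains V \<delta> where "open V" "q0 \<in> V" "V \<subseteq> W" "\<delta> > 0" "\<And>q z. q \<in> V \<Longrightarrow> cmod z \<le> \<delta> \<Longrightarrow> no_eigenvalue (A q) z"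
proof -
  obtain m \<kappa> where \<kappa>: "bij_betw \<kappa> {..<m::nat} (idx n)" by (rule ex_enum)
  let ?f = "\<lambda>p. Determinant.det (cm m \<kappa> A (fst p) (chart_inv c (snd p)))"
  have "continuous_on (UNIV \<times> S) ?f"
    by (rule smooth_hol_continuous[OF smooth_hol_det[OF cm_carrier cm_hol[OF \<kappa> A]]])
  then have "open ((UNIV \<times> S) \<inter> ?f -` (- {0}))"
    by (rule continuous_open_preimage) (auto intro: open_Times open_S)
  moreover have "(0, snd c q0) \<in> (UNIV \<times> S) \<inter> ?f -` (- {0})"
    using cm_det[OF \<kappa> A q0] ne in_S[OF q0] q0 W_chart by auto
  ultimately obtain P Q where PQ: "open P" "open Q" "0 \<in> P" "snd c q0 \<in> Q" "P \<times> Q \<subseteq> (UNIV \<times> S) \<inter> ?f -` (- {0})"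
    by (rule open_prod_elim) auto
  obtain \<delta> where \<delta>: "\<delta> > 0" "cball 0 \<delta> \<subseteq> P" using open_contains_cball PQ(1,3) by blast
  show thesis
  proof (rule that[of "W \<inter> (fst c \<inter> snd c -` Q)" \<delta>])
    have "open (fst c \<inter> snd c -` Q)"
      using chart_homeo[OF c_atlas] chart_open[OF c_atlas] PQ(2) by (intro continuous_open_preimage) (auto simp: homeomorphism_def)
    then show "open (W \<inter> (fst c \<inter> snd c -` Q))" using open_W by blast
    show "no_eigenvalue (A q) z" if "q \<in> W \<inter> (fst c \<inter> snd c -` Q)" "cmod z \<le> \<delta>" for q z
    proof -
      have "(z, snd c q) \<in> P \<times> Q" using that \<delta>(2) by auto
      then have "?f (z, snd c q) \<noteq> 0" using PQ(5) by blast
      then show ?thesis using cm_det[OF \<kappa> A] in_S that by auto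
    qed
  qed (use q0 W_chart PQ \<delta> in auto)
qed

end

subsection \<open>The spectral projection\<close>

context smooth_partial_inverse
begin

lemma frame_chart_at:
  assumes U: "open U" "x \<in> U"
  obtains W E n w c where "frame_chart M W E n w c" "x \<in> W" "W \<subseteq> U"
proof -
  obtain W E n w where W: "x \<in> W" "frame_nbhd M W E n w" by (rule frame_nbhd_at)
  interpret frame_nbhd M W E n w by (rule W(2))
  let ?V = "W \<inter> U \<inter> fst (chart_at M x)"
  have "frame_nbhd M ?V E n w"
  proof (rule frame_nbhd.intro[OF filtered_manifold_axioms frame_nbhd_axioms.intro])
    show "open ?V" using open_W U chart_open[OF chart_at(1)] by blast
    show "smooth_vf_on M ?V (E a)" for a by (rule E_smooth') blast
    show "adapted_frame M q (\<lambda>a. E a q) n w" if "q \<in> ?V" for q using frame that by blast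
  qed
  then have "frame_chart M ?V E n w (chart_at M x)"
    by (intro frame_chart.intro smooth_partial_inverse_axioms frame_chart_axioms.intro chart_at) blast+
  then show thesis by (rule that) (use W U chart_at in auto)
qed

lemma resolvent_unique:
  assumes U: "open U" and ne: "\<And>x. x \<in> U \<Longrightarrow> no_eigenvalue (box0 x) z"
    and s: "solves_resolvent M U z \<eta> \<zeta>" "solves_resolvent M U z \<eta> \<xi>"
  shows "\<zeta> = \<xi>"
proof -
  have zx: "\<zeta> \<in> CF U" "\<xi> \<in> CF U" using s by (auto simp: solves_resolvent_def)
  have "(\<lambda>x vs. (-1) * \<xi> x vs + \<zeta> x vs) = (\<lambda>x vs. 0)"
  proof (rule Box_resolvent_unique[OF U ne])
    show "(\<lambda>x vs. (-1) * \<xi> x vs + \<zeta> x vs) \<in> CF U" by (intro CF_add CF_scale U zx)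
    show "z * ((-1) * \<xi> x vs + \<zeta> x vs) - cplx (Box M) (\<lambda>x vs. (-1) * \<xi> x vs + \<zeta> x vs) x vs = 0" if "x \<in> U" for x vs
    proof -
      have "z * \<zeta> x vs - cplx (Box M) \<zeta> x vs = z * \<xi> x vs - cplx (Box M) \<xi> x vs"
        using s that by (simp add: solves_resolvent_def)
      then show ?thesis unfolding cBox_lincomb[OF zx(2,1) U that] by (simp add: algebra_simps)
    qed
  qed
  then show ?thesis by (auto simp: fun_eq_iff)
qed

text \<open>Since \<open>box0\<close> is singular at 0, invertibility on a full disc is first
  obtained for \<open>aux_op\<close>, by continuity, and then passed to \<open>box0\<close> on the
  punctured disc. Iteration on the weight gives solvability for \<open>Box\<close>.\<close>

lemma small_enough_near: "\<exists>U \<epsilon>. open U \<and> x \<in> U \<and> small_enough M U \<epsilon>"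
proof -
  obtain W E n w c where fc: "frame_chart M W E n w c" and x: "x \<in> W"
    by (rule frame_chart_at[OF open_UNIV UNIV_I])
  interpret W: frame_chart M W E n w c by (rule fc)
  \<comment> \<open>The constant 1 only has to differ from the parameter value 0.\<close>
  have "no_eigenvalue (aux_op 1 x) 0" by (rule aux_no_eigenvalue) auto
  then obtain V \<delta> where V: "open V" "x \<in> V" "V \<subseteq> W" "\<delta> > 0"
    and ne: "\<And>q z. q \<in> V \<Longrightarrow> cmod z \<le> \<delta> \<Longrightarrow> no_eigenvalue (aux_op 1 q) z"
    by (rule W.no_eigenvalue_near[OF W.pw_op_at(5) x]) (rule that)
  obtain U E' n' w' c' where fc': "frame_chart M U E' n' w' c'" and xU: "x \<in> U" and UV: "U \<subseteq> V"
    by (rule frame_chart_at[OF V(1,2)])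
  interpret U: frame_chart M U E' n' w' c' by (rule fc')
  note U = U.open_W
  have ne0: "no_eigenvalue (box0 q) z" if "q \<in> U" "0 < cmod z" "cmod z \<le> \<delta>" for q z
    using box0_no_eigenvalue[OF _ ne] that UV by auto
  have "\<exists>\<zeta>. solves_resolvent M U z \<eta> \<zeta>" if z: "0 < cmod z" "cmod z \<le> \<delta>" and \<eta>: "\<eta> \<in> CF U" for z \<eta>
  proof -
    let ?X = "\<lambda>\<zeta> q. if q \<in> U then (\<lambda>vs. cplx (Box M) \<zeta> q vs - cop (box0 q) (\<zeta> q) vs) else (\<lambda>_. 0)"
    \<comment> \<open>Solvability is a question for one parameter value at a time, so the parameter
      domain is the singleton of \<open>z\<close>.\<close>
    have X_fam: "U.fam {z} (\<lambda>z. ?X (\<zeta> z))" if f: "U.fam {z} \<zeta>" for \<zeta>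
    proof -
      have "U.fam {z} (\<lambda>z q vs. (crestr U (cd (\<lambda>q. cop (t_at M q) (\<zeta> z q))) q vs + cop (t_at M q) (crestr U (cd (\<zeta> z)) q) vs) - cop (box0 q) (\<zeta> z q) vs)"
        by (intro U.fam_diff U.fam_add U.fam_cd U.fam_cop[OF U.pw_op_at(2)] U.fam_cop[OF U.pw_op_at(4)] f)
      also have "(\<lambda>z q vs. (crestr U (cd (\<lambda>q. cop (t_at M q) (\<zeta> z q))) q vs + cop (t_at M q) (crestr U (cd (\<zeta> z)) q) vs) - cop (box0 q) (\<zeta> z q) vs)
        = (\<lambda>z q vs. (if q \<in> U then (\<lambda>vs. cplx (Box M) (\<zeta> z) q vs - cop (box0 q) (\<zeta> z q) vs) else (\<lambda>vs. - cop (box0 q) (\<zeta> z q) vs)) vs)"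
        by (intro ext) (auto simp: cBox_eq cplx_pointwise[abs_def] crestr_def cop_zero[OF lin_op_at(2)])
      finally show ?thesis
        using f cop_zero[OF lin_op_box0] unfolding U.fam_def U.coef_def
        by (auto simp: U.inv_S cong: if_cong elim!: smooth_hol.cong)
    qed
    have "\<exists>\<zeta>. U.fam {z} \<zeta> \<and> (\<forall>z\<in>{z}. \<forall>q\<in>U. \<forall>vs. z * \<zeta> z q vs - cop (box0 q) (\<zeta> z q) vs - ?X (\<zeta> z) q vs = \<eta> q vs)"
    proof (rule U.solve[OF U.pw_op_at(4) disjI1[OF refl] _ X_fam _ _ U.fam_const[OF \<eta>]])
      show "no_eigenvalue (box0 q) z'" if "z' \<in> {z}" "q \<in> U" for z' q using ne0 z that by simp
      show "?X (\<lambda>q vs. \<zeta> q vs + \<xi> q vs) q vs = ?X \<zeta> q vs + ?X \<xi> q vs" if "\<zeta> \<in> CF U" "\<xi> \<in> CF U" "q \<in> U" for \<zeta> \<xi> q vs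
        using cBox_lincomb[OF that(1,2) U that(3), of 1 vs] cop_add[OF lin_op_box0 CF_cext[OF that(1)] CF_cext[OF that(2)]] that(3) by simp
      show "?X \<zeta> q \<in> cFil M (Suc k) q" if "\<zeta> \<in> CF U" "\<And>p. p \<in> U \<Longrightarrow> \<zeta> p \<in> cFil M k p" "q \<in> U" for \<zeta> k q
        using cBox_raise[OF that(1) U that(3,2)] that(3) by simp
    qed
    then obtain \<zeta> where z: "U.fam {z} \<zeta>" and e: "\<And>q vs. q \<in> U \<Longrightarrow> z * \<zeta> z q vs - cop (box0 q) (\<zeta> z q) vs - ?X (\<zeta> z) q vs = \<eta> q vs" by auto
    have "solves_resolvent M U z \<eta> (\<zeta> z)" unfolding solves_resolvent_def
      using U.fam_CF[OF z] e by (auto simp: algebra_simps)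
    then show ?thesis by blast
  qed
  then have "small_enough M U \<delta>" unfolding small_enough_def
    using V(4) resolvent_unique[OF U ne0] by blast
  then show ?thesis using U xU by blast
qed

lemma h_range_local:
  assumes s: "s \<in> CF UNIV" and U: "open U"
  shows "crestr U (cplx h s) \<in> CF U"
proof -
  have "cplx h s \<in> CF UNIV" using s by (simp add: cforms_on_def h_UNIV)
  then show ?thesis by (rule CF_restr[OF _ subset_UNIV U])
qed

end

context frame_chart
begin

text \<open>The equation \<open>(z - t d) v = h s\<close> is replaced by
  \<open>(z - aux_op - t (d - d0)) v = h s\<close>, whose leading part is invertible also at
  \<open>z = 0\<close>. Then \<open>aux_range\<close> puts \<open>v\<close> into the image of
  \<open>h\<close>, where \<open>aux_op\<close> is \<open>t d0\<close>; so the original equation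
  holds, and \<open>t v = 0\<close> follows from \<open>t h = 0\<close>.\<close>

lemma solve_h_range:
  assumes ne: "\<And>z q. z \<in> D \<Longrightarrow> q \<in> W \<Longrightarrow> z \<noteq> 0 \<Longrightarrow> no_eigenvalue (box0 q) z"
    and C: "complex_of_real C \<notin> D" and s: "s \<in> CF UNIV"
  obtains v where "fam D v" "\<And>z q vs. z \<in> D \<Longrightarrow> q \<in> W \<Longrightarrow> z * v z q vs - cop (t_at M q) (cd (v z) q) vs = cplx h s q vs"
    "\<And>z. z \<in> D \<Longrightarrow> ct (v z) = (\<lambda>x vs. 0)"
proof -
  let ?r = "\<lambda>\<zeta> q vs. crestr W (cd \<zeta>) q vs - cop (d0_at M q) (\<zeta> q) vs"
  let ?X = "\<lambda>\<zeta> q. cop (t_at M q) (?r \<zeta> q)"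
  have dc: "crestr W (cd \<zeta>) q \<in> cext" if "\<zeta> \<in> CF W" for \<zeta> q by (rule CF_cext[OF cd_CF[OF that open_W]])
  have rc: "?r \<zeta> q \<in> cext" if "\<zeta> \<in> CF W" for \<zeta> q by (intro cext_diff dc[OF that] cop_at_in CF_cext[OF that])
  have "\<exists>v. fam D v \<and> (\<forall>z\<in>D. \<forall>q\<in>W. \<forall>vs. z * v z q vs - cop (aux_op C q) (v z q) vs - ?X (v z) q vs = crestr W (cplx h s) q vs)"
  proof (rule solve[OF pw_op_at(5) disjI2[OF refl] _ _ _ _ fam_const[OF h_range_local[OF s open_W]]])
    show "no_eigenvalue (aux_op C q) z" if "z \<in> D" "q \<in> W" for z q
      using aux_no_eigenvalue[of z C q] ne[OF that] that C by blast
    show "fam D (\<lambda>z. ?X (\<zeta> z))" if "fam D \<zeta>" for \<zeta>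
      by (intro fam_cop[OF pw_op_at(2)] fam_diff fam_cd fam_cop[OF pw_op_at(1)] that)
    show "?X (\<lambda>q vs. \<zeta> q vs + \<xi> q vs) q vs = ?X \<zeta> q vs + ?X \<xi> q vs" if z: "\<zeta> \<in> CF W" "\<xi> \<in> CF W" and q: "q \<in> W" for \<zeta> \<xi> q vs
    proof -
      have "?r (\<lambda>q vs. \<zeta> q vs + \<xi> q vs) q = (\<lambda>vs. ?r \<zeta> q vs + ?r \<xi> q vs)"
        using cd_lincomb[OF z open_W q, of 1] cop_add[OF lin_op_at(1) CF_cext[OF z(1)] CF_cext[OF z(2)]] q
        by (simp add: fun_eq_iff)
      then show ?thesis by (simp only: cop_add[OF lin_op_at(2) rc[OF z(1)] rc[OF z(2)]])
    qed
    show "?X \<zeta> q \<in> cFil M (Suc k) q" if z: "\<zeta> \<in> CF W" and k: "\<And>p. p \<in> W \<Longrightarrow> \<zeta> p \<in> cFil M k p" and q: "q \<in> W" for \<zeta> k q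
    proof -
      have f: "(\<lambda>x vs. Re (\<zeta> x vs)) \<in> forms_on M W" "(\<lambda>x vs. Im (\<zeta> x vs)) \<in> forms_on M W" using z by (auto simp: cforms_on_def)
      have kk: "(\<lambda>vs. Re (\<zeta> p vs)) \<in> Fil M k p" "(\<lambda>vs. Im (\<zeta> p vs)) \<in> Fil M k p" if "p \<in> W" for p
        using k[OF that] by (auto simp: cFil_iff)
      have "?r \<zeta> q \<in> cFil M (Suc k) q"
        using raise[OF f(1) open_W q kk(1)] raise[OF f(2) open_W q kk(2)] q by (simp add: cFil_iff cplx_def cop_def)
      then show ?thesis by (simp add: cFil_iff at_Fil)
    qed
  qed
  then obtain v where v: "fam D v" and e: "\<And>z q vs. z \<in> D \<Longrightarrow> q \<in> W \<Longrightarrow>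
    z * v z q vs - cop (aux_op C q) (v z q) vs - ?X (v z) q vs = crestr W (cplx h s) q vs" by blast
  have hD: "cop (h_at M q) (cop (d0_at M q) (v z q)) = v z q" if z: "z \<in> D" and q: "q \<in> W" for z q
  proof (rule aux_range)
    show "z \<noteq> complex_of_real C" using z C by blast
    show "v z q \<in> cext" by (rule fam_cext[OF v z])
    show "?r (v z) q \<in> cext" by (rule rc[OF fam_CF[OF v z]])
    show "s q \<in> cext" by (rule CF_cext[OF s])
    show "z * v z q vs - cop (aux_op C q) (v z q) vs - cop (t_at M q) (?r (v z) q) vs = cop (h_at M q) (s q) vs" for vs
      using e[OF z q, of vs] q by (simp add: cplx_pointwise)
  qed
  show thesis
  proof (rule that[OF v])
    fix z assume z: "z \<in> D"
    show "z * v z q vs - cop (t_at M q) (cd (v z) q) vs = cplx h s q vs" if q: "q \<in> W" for q vs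
    proof -
      have "cop (aux_op C q) (v z q) = cop (t_at M q) (cop (d0_at M q) (v z q))"
        unfolding cop_aux hD[OF z q] by simp
      moreover have "?X (v z) q = (\<lambda>vs. cop (t_at M q) (crestr W (cd (v z)) q) vs - cop (t_at M q) (cop (d0_at M q) (v z q)) vs)"
        by (rule cop_diff[OF lin_op_at(2) dc[OF fam_CF[OF v z]] cop_at_in(1)[OF fam_cext[OF v z]]])
      ultimately show ?thesis using e[OF z q, of vs] q by simp
    qed
    have "cop (t_at M q) (v z q) = (\<lambda>_. 0)" for q
    proof (cases "q \<in> W")
      case True
      have "cop (t_at M q) (v z q) = cop (t_at M q) (cop (h_at M q) (cop (d0_at M q) (v z q)))" by (simp only: hD[OF z True])
      then show ?thesis using cop_at(3)[OF cop_at_in(1)[OF fam_cext[OF v z]], of q q] by (simp only: cop_comp)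
    qed (use v z cop_zero[OF lin_op_at(2)] in \<open>simp add: fam_def\<close>)
    then show "ct (v z) = (\<lambda>x vs. 0)" by (simp add: fun_eq_iff cplx_pointwise)
  qed
qed

text \<open>Multiplied by \<open>z\<close>, the integrand becomes
  \<open>F(z) = a + z \<zeta>(z)\<close>, and Cauchy's formula at the centre returns
  \<open>F(0) = a\<close>: the regular part contributes nothing.\<close>

lemma fam_circle_integral:
  assumes g: "fam (cball 0 \<epsilon>) \<zeta>" and e: "\<epsilon> > 0" and q: "q \<in> W"
    and f: "\<And>z. cmod z = \<epsilon> \<Longrightarrow> f z = a / z + \<zeta> z q vs"
  shows "contour_integral (circlepath 0 \<epsilon>) f = 2 * of_real pi * \<i> * a"
proof -
  let ?F = "\<lambda>z. a + z * (\<Sum>K\<in>idx n. coef \<zeta> K z (snd c q) * complex_of_real (eb K q vs))"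
  note h = smooth_hol_holomorphic[OF fam_coef[OF g idx_set] in_S(1)[OF q]]
  have "continuous_on (cball 0 \<epsilon>) ?F" using h by (intro continuous_intros) auto
  moreover have "?F holomorphic_on ball 0 \<epsilon>"
    unfolding holomorphic_on_def
  proof (intro ballI field_differentiable_add field_differentiable_mult field_differentiable_const field_differentiable_ident field_differentiable_sum)
    show "(\<lambda>z. coef \<zeta> K z (snd c q)) field_differentiable at z within ball 0 \<epsilon>" if "z \<in> ball 0 \<epsilon>" "K \<in> idx n" for z K
      by (rule field_differentiable_at_within) (use h[OF that(2)] that(1) in auto)
  qed
  ultimately have "((\<lambda>u. ?F u / (u - 0)) has_contour_integral (2 * of_real pi * \<i> * ?F 0)) (circlepath 0 \<epsilon>)"
    by (rule Cauchy_integral_circlepath) (use e in simp)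
  then have "(f has_contour_integral (2 * of_real pi * \<i> * ?F 0)) (circlepath 0 \<epsilon>)"
  proof (rule has_contour_integral_eq)
    fix z assume "z \<in> path_image (circlepath 0 \<epsilon>)"
    then have z: "cmod z = \<epsilon>" using e by simp
    then have "z \<in> cball 0 \<epsilon>" "z \<noteq> 0" using e by auto
    then show "?F z / (z - 0) = f z"
      using f[OF z] fam_expand[OF q fam_cext[OF g], of z q vs] in_S(2)[OF q] by (simp add: coef_def field_simps)
  qed
  then show ?thesis by (simp add: contour_integral_unique)
qed

end

context smooth_partial_inverse
begin

text \<open>Here \<open>Box \<theta> = 0\<close>, \<open>Box v1 = t d v1\<close> because
  \<open>t v1 = 0\<close>, and \<open>Box (d v2) = d t d v2 = d (z v2 - u2)\<close> because
  \<open>d d = 0\<close>. Hence \<open>\<theta> / z + v1 + d v2\<close> solves the resolvent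
  equation on \<open>W\<close>.\<close>

lemma resolvent_formula:
  assumes fc: "frame_chart M W E n w c" and WU: "W \<subseteq> U" and U: "open U" and sm: "\<exists>!\<zeta>. solves_resolvent M U z (crestr U \<omega>) \<zeta>"
    and ne: "\<And>x. x \<in> W \<Longrightarrow> no_eigenvalue (box0 x) z" and z0: "z \<noteq> 0"
    and \<theta>: "\<theta> \<in> CF UNIV" "\<And>x vs. cplx (Box M) \<theta> x vs = 0"
    and v: "v1 \<in> CF W" "v2 \<in> CF W" "ct v1 = (\<lambda>x vs. 0)"
    and u: "u1 \<in> CF UNIV" "u2 \<in> CF UNIV"
    and e1: "\<And>q vs. q \<in> W \<Longrightarrow> z * v1 q vs - cop (t_at M q) (cd v1 q) vs = u1 q vs"
    and e2: "\<And>q vs. q \<in> W \<Longrightarrow> z * v2 q vs - cop (t_at M q) (cd v2 q) vs = u2 q vs"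
    and \<omega>: "\<And>q vs. \<omega> q vs = \<theta> q vs + u1 q vs + cd u2 q vs"
    and q: "q \<in> W"
  shows "resolvent M U z \<omega> q vs = \<theta> q vs / z + (v1 q vs + crestr W (cd v2) q vs)"
proof -
  interpret W: frame_chart M W E n w c by (rule fc)
  note W = W.open_W
  \<comment> \<open>Being a solution only depends on the right-hand side over \<open>U\<close>,
    whereas solvability is assumed for forms that vanish outside \<open>U\<close>.\<close>
  have s_eq: "solves_resolvent M U z \<omega> \<zeta> \<longleftrightarrow> solves_resolvent M U z (crestr U \<omega>) \<zeta>" for \<zeta>
    by (simp add: solves_resolvent_def)
  define \<zeta> where "\<zeta> = resolvent M U z \<omega>"
  have \<zeta>: "solves_resolvent M U z \<omega> \<zeta>"
    unfolding \<zeta>_def resolvent_def s_eq by (rule theI'[OF sm])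
  then have \<zeta>C: "\<zeta> \<in> CF U" by (simp add: solves_resolvent_def)
  let ?w = "crestr W (cd v2)" and ?th = "crestr W \<theta>"
  have wC: "?w \<in> CF W" by (rule cd_CF[OF v(2) W])
  have thC: "?th \<in> CF W" by (rule CF_restr[OF \<theta>(1) subset_UNIV W])
  have sC: "(\<lambda>q vs. 1 * v1 q vs + ?w q vs) \<in> CF W" using CF_add[OF W v(1) wC] by simp
  let ?\<xi> = "\<lambda>q vs. (1 / z) * ?th q vs + (1 * v1 q vs + ?w q vs)"
  \<comment> \<open>The candidate exists over \<open>W\<close> only. Since \<open>Box\<close> is
    local, the resolvent over \<open>U\<close> restricts to a solution on \<open>W\<close>, and
    uniqueness there identifies the two.\<close>
  have "crestr W \<zeta> = ?\<xi>"
  proof (rule resolvent_unique[OF W ne])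
    show "solves_resolvent M W z \<omega> (crestr W \<zeta>)" unfolding solves_resolvent_def
    proof (intro conjI ballI allI)
      show "crestr W \<zeta> \<in> CF W" by (rule CF_restr[OF \<zeta>C WU W])
      fix p vs assume p: "p \<in> W"
      have "cplx (Box M) (crestr W \<zeta>) p = cplx (Box M) \<zeta> p" by (rule cBox_restr[OF W p]) simp
      then show "z * crestr W \<zeta> p vs - cplx (Box M) (crestr W \<zeta>) p vs = \<omega> p vs"
        using \<zeta> p WU by (auto simp: solves_resolvent_def)
    qed
    show "solves_resolvent M W z \<omega> ?\<xi>" unfolding solves_resolvent_def
    proof (intro conjI ballI allI)
      show "?\<xi> \<in> CF W" by (rule CF_add[OF W CF_scale[OF W thC] sC])
      fix p vs assume p: "p \<in> W"
      have "cplx (Box M) ?th p = cplx (Box M) \<theta> p" by (rule cBox_restr[OF W p]) simp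
      then have B0: "cplx (Box M) ?th p vs = 0" by (simp add: \<theta>(2))
      have B1: "cplx (Box M) v1 p vs = z * v1 p vs - u1 p vs"
        unfolding cBox_eq v(3) cd_zero using e1[OF p, of vs] by (simp add: algebra_simps)
      have "ct ?w q = (\<lambda>vs. z * v2 q vs + (-1) * u2 q vs)" if "q \<in> W" for q
        using e2[OF that] that by (auto simp: fun_eq_iff cplx_pointwise algebra_simps)
      then have "cd (ct ?w) p = cd (\<lambda>q vs. z * v2 q vs + (-1) * crestr W u2 q vs) p" by (intro cd_cong[OF W p]) simp
      moreover have "cd (\<lambda>q vs. z * v2 q vs + (-1) * crestr W u2 q vs) p vs = z * cd v2 p vs + cd (\<lambda>q vs. (-1) * crestr W u2 q vs) p vs"
        by (rule cd_lincomb[OF v(2) CF_scale[OF W CF_restr[OF u(2) subset_UNIV W]] W p])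
      moreover have "cd (\<lambda>q vs. (-1) * crestr W u2 q vs) p = cd (\<lambda>q vs. (-1) * u2 q vs + 0) p" by (rule cd_cong[OF W p]) simp
      moreover have "cd (\<lambda>q vs. (-1) * u2 q vs + 0) p vs = (-1) * cd u2 p vs + cd (\<lambda>q vs. 0) p vs"
        by (rule cd_lincomb[OF u(2) _ open_UNIV UNIV_I]) (simp add: cforms_on_def forms_on_zero)
      ultimately have d2: "cd (ct ?w) p vs = z * cd v2 p vs - cd u2 p vs" by (simp add: cd_zero)
      have cw: "cd ?w p = cd (cd v2) p" by (rule cd_cong[OF W p]) simp
      have B2: "cplx (Box M) ?w p vs = z * cd v2 p vs - cd u2 p vs"
        unfolding cBox_eq d2 cw cd_cd[OF v(2) W p] cop_zero[OF lin_op_at(2)] by simp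
      show "z * ?\<xi> p vs - cplx (Box M) ?\<xi> p vs = \<omega> p vs"
        unfolding cBox_lincomb[OF thC sC W p] cBox_lincomb[OF v(1) wC W p] B0 B1 B2 \<omega>
        using z0 p by (simp add: algebra_simps)
    qed
  qed
  from fun_cong[OF fun_cong[OF this, of q], of vs] show ?thesis using q by (simp add: \<zeta>_def)
qed

lemma P_op_eq:
  assumes U: "open U" and sm: "small_enough M U \<epsilon>" and \<omega>: "\<omega> \<in> CF UNIV" and x: "x \<in> U"
  shows "P_op M U \<epsilon> \<omega> x vs = \<omega> x vs - cplx (Pi_op M) \<omega> x vs"
proof -
  have \<epsilon>: "\<epsilon> > 0" and ex: "\<And>z \<eta>. 0 < cmod z \<Longrightarrow> cmod z \<le> \<epsilon> \<Longrightarrow> \<eta> \<in> CF U \<Longrightarrow> \<exists>!\<zeta>. solves_resolvent M U z \<eta> \<zeta>"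
    using sm by (auto simp: small_enough_def)
  have ne: "no_eigenvalue (box0 q) z" if "0 < cmod z" "cmod z \<le> \<epsilon>" "q \<in> U" for z q
    by (rule small_enough_no_eigenvalue[OF U _ that(3)]) (use ex[OF that(1,2)] in blast)
  obtain W E n w c where fc: "frame_chart M W E n w c" and xW: "x \<in> W" and WU: "W \<subseteq> U"
    by (rule frame_chart_at[OF U x])
  interpret W: frame_chart M W E n w c by (rule fc)
  have f: "(\<lambda>x vs. Re (\<omega> x vs)) \<in> F" "(\<lambda>x vs. Im (\<omega> x vs)) \<in> F" using \<omega> by (auto simp: cforms_on_def)
  obtain r1 r2 where r: "r1 \<in> F" "r2 \<in> F" "Pi_op M (\<lambda>x vs. Re (\<omega> x vs)) = (\<lambda>x vs. h r1 x vs + d (h r2) x vs)"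
    using Pi_op_decompose[OF f(1)] by blast
  obtain i1 i2 where i: "i1 \<in> F" "i2 \<in> F" "Pi_op M (\<lambda>x vs. Im (\<omega> x vs)) = (\<lambda>x vs. h i1 x vs + d (h i2) x vs)"
    using Pi_op_decompose[OF f(2)] by blast
  \<comment> \<open>The decomposition of \<open>\<Pi>\<close> is available for real forms;
    \<open>s1\<close> and \<open>s2\<close> reassemble its data from the real and the imaginary
    part.\<close>
  define s1 where "s1 = (\<lambda>x vs. Complex (r1 x vs) (i1 x vs))"
  define s2 where "s2 = (\<lambda>x vs. Complex (r2 x vs) (i2 x vs))"
  have s: "s1 \<in> CF UNIV" "s2 \<in> CF UNIV" using r i by (simp_all add: s1_def s2_def cforms_on_def)
  have u: "cplx h s1 \<in> CF UNIV" "cplx h s2 \<in> CF UNIV" using s by (simp_all add: cforms_on_def h_UNIV)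
  define \<theta> where "\<theta> = (\<lambda>x vs. \<omega> x vs - cplx (Pi_op M) \<omega> x vs)"
  have \<theta>: "\<theta> \<in> CF UNIV"
    unfolding \<theta>_def by (rule CF_diff[OF open_UNIV \<omega>]) (simp add: cforms_on_def Pi_op_F f)
  have B: "cplx (Box M) \<theta> y us = 0" for y us
    using Box_I_minus_Pi[OF f(1)] Box_I_minus_Pi[OF f(2)] by (simp add: cplx_def \<theta>_def zero_complex.code)
  have \<omega>_eq: "\<omega> q us = \<theta> q us + cplx h s1 q us + cd (cplx h s2) q us" for q us
    by (simp add: \<theta>_def cplx_def r(3) i(3) s1_def s2_def complex_eq_iff)
  have neW: "no_eigenvalue (box0 q) z" if "z \<in> cball 0 \<epsilon>" "q \<in> W" "z \<noteq> 0" for z q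
    using ne that WU by auto
  \<comment> \<open>The constant in \<open>aux_op\<close> must avoid all parameters in the closed
    disc; \<open>\<epsilon> + 1\<close> does.\<close>
  have C: "complex_of_real (\<epsilon> + 1) \<notin> cball 0 \<epsilon>" using \<epsilon> by (simp add: dist_norm del: of_real_add)
  obtain v1 where v1: "W.fam (cball 0 \<epsilon>) v1"
    "\<And>z q vs. z \<in> cball 0 \<epsilon> \<Longrightarrow> q \<in> W \<Longrightarrow> z * v1 z q vs - cop (t_at M q) (cd (v1 z) q) vs = cplx h s1 q vs"
    "\<And>z. z \<in> cball 0 \<epsilon> \<Longrightarrow> ct (v1 z) = (\<lambda>x vs. 0)"
    by (rule W.solve_h_range[OF neW C s(1)]) (assumption | rule that)+
  obtain v2 where v2: "W.fam (cball 0 \<epsilon>) v2"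
    "\<And>z q vs. z \<in> cball 0 \<epsilon> \<Longrightarrow> q \<in> W \<Longrightarrow> z * v2 z q vs - cop (t_at M q) (cd (v2 z) q) vs = cplx h s2 q vs"
    "\<And>z. z \<in> cball 0 \<epsilon> \<Longrightarrow> ct (v2 z) = (\<lambda>x vs. 0)"
    by (rule W.solve_h_range[OF neW C s(2)]) (assumption | rule that)+
  have "contour_integral (circlepath 0 \<epsilon>) (\<lambda>z. resolvent M U z \<omega> x vs) = 2 * of_real pi * \<i> * \<theta> x vs"
  proof (rule W.fam_circle_integral[OF W.fam_add[OF v1(1) W.fam_cd[OF v2(1)]] \<epsilon> xW])
    fix z :: complex assume "cmod z = \<epsilon>"
    then have z: "0 < cmod z" "cmod z \<le> \<epsilon>" "z \<in> cball 0 \<epsilon>" "z \<noteq> 0" using \<epsilon> by auto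
    show "resolvent M U z \<omega> x vs = \<theta> x vs / z + (v1 z x vs + crestr W (cd (v2 z)) x vs)"
      by (rule resolvent_formula[OF fc WU U ex[OF z(1,2) CF_restr[OF \<omega> subset_UNIV U]] neW[OF z(3) _ z(4)] z(4) \<theta> B
        W.fam_CF[OF v1(1) z(3)] W.fam_CF[OF v2(1) z(3)] v1(3)[OF z(3)] u v1(2)[OF z(3)] v2(2)[OF z(3)] \<omega>_eq xW])
  qed
  then show ?thesis unfolding P_op_def by (simp add: \<theta>_def)
qed

end

text \<open>The first conjunct guarantees that the second one reaches a neighbourhood of every
  point.\<close>

theorem corollary4p11:
  fixes M :: "('m::{t2_space, second_countable_topology}, 'e::euclidean_space) filtered_space"
  assumes "filtered_riemannian_manifold M"
    and "\<And>\<omega>. \<omega> \<in> forms_on M UNIV \<Longrightarrow> d0_inv M \<omega> \<in> forms_on M UNIV"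
  shows "(\<forall>x. \<exists>U \<epsilon>. open U \<and> x \<in> U \<and> small_enough M U \<epsilon>) \<and>
         (\<forall>U \<epsilon>. open U \<and> small_enough M U \<epsilon> \<longrightarrow>
           (\<forall>\<omega>\<in>cforms_on M UNIV. \<forall>x\<in>U. \<forall>vs.
              P_op M U \<epsilon> \<omega> x vs = \<omega> x vs - cplx (Pi_op M) \<omega> x vs))"
proof -
  interpret smooth_partial_inverse M by unfold_locales (use assms in auto)
  show ?thesis using small_enough_near P_op_eq by blast
qed

end
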